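(* Let $X$ be a smooth $S$-scheme, $G$ a flat $S$-group scheme and $\mathcal{P}$ a connected $G$-gerbe on $X$, with a connection $\epsilon$ and a curving $(K,\kappa)$. Let $\coprod_i U_i$ be an open cover of $X$, and choose local objects $x_i\in\mathcal{P}_{U_i}$, arrows $\phi_{ij}:x_j\to x_i$ in $\mathcal{P}_{U_{ij}}$, arrows $\gamma_i:\epsilon\, p_1^*x_i\to p_0^*x_i$ and arrows $\delta_i:\kappa\, p_0^*x_i\to p_0^*x_i$. Let $(\lambda_{ij},g_{ijk},m_i,\gamma_{ij},B_i,\nu_i,\delta_{ij},\omega_i)$ be the associated local data defined in the context; in particular $\nu_i=d^1m_i-i(B_i)$, $\delta_{ij}=\lambda_{ij}(B_j)-B_i-d^1_{m_i}(-\gamma_{ij})$ and $\omega_i=d^2_{m_i}(B_i)$. Then the following equations between differential forms hold (written additively): \begin{enumerate} \item ${}^{\lambda_{ij}}m_j = m_i-\lambda_{ij}\,d\lambda_{ij}^{-1}-i(\gamma_{ij})$ on $U_{ij}$; \item $\gamma_{ij}+\lambda_{ij}(\gamma_{jk})-\lambda_{ij}\lambda_{jk}\lambda_{ik}^{-1}(\gamma_{ik}) = dg_{ijk}\,g_{ijk}^{-1}+[m_i,g_{ijk}]$ on $U_{ijk}$; \item ${}^{\lambda_{ij}}\nu_j=\nu_i-i(\delta_{ij})$ on $U_{ij}$; \item $\delta_{ij}+\lambda_{ij}(\delta_{jk})-\lambda_{ij}\lambda_{jk}\lambda_{ik}^{-1}(\delta_{ik})=[\nu_i,g_{ijk}]$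 on $U_{ijk}$; \item $d^3_{m_i}(\omega_i)=[\nu_i,B_i]$ on $U_i$; \item $d^2_{m_i}\nu_i+i(\omega_i)=0$ on $U_i$; \item $\lambda_{ij}(\omega_j)+[{}^{\lambda_{ij}}\nu_j,\gamma_{ij}]=\omega_i+d^2_{m_i}(\delta_{ij})$ on $U_{ij}$. \end{enumerate}
   Context: Throughout, $2$ and $3$ are invertible on $S$, and $\mathfrak{g}=\mathrm{Lie}(G)$. **Forms.** For an $S$-scheme $X$, $\Delta^n_{X/S}$ is the scheme of $(n+1)$-tuples $(x_0,\dots,x_n)$ of points of $X$ which are pairwise infinitesimally close to first order (each pair $(x_a,x_b)$ lies in the first-order neighbourhood of the diagonal). $p_a$ and $p_{ab}$ denote the projections to $X$ and to $\Delta^1_{X/S}$; a superscript or subscript $ab$ on an object denotes pullback by $p_{ab}$. For $F=G$ or $F=\mathrm{Aut}(G)$ (sheaf of local automorphisms of $G$), an $F$-valued $n$-form ($n\ge1$) on $X$ is a section of $F$ over $\Delta^n_{X/S}$ whose restriction to the degenerate subsimplex is $1$; for $X/S$ smooth this is the same as a relative $n$-form with values in the Lie algebra of $F$. Group multiplication of forms of the same degree corresponds to addition, and additive notation is used. A local automorphism of $G$ acts on $G$-valued forms by applying it to values. $i:G\to\mathrm{Aut}(G)$ is inner conjugation, $i(\gamma)(g)=\gamma g\gamma^{-1}$. Brackets: for $G$-valued forms (or $\mathrm{Aut}(G)$-valued forms) of degrees $m,n\geq 1$, $[\omega,\omega'](x_0,\dots,x_{m+n})$ is the commutator of $\omega(x_0,\dots,x_m)$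 and $\omega'(x_m,\dots,x_{m+n})$, where the commutator of $a,b$ is $aba^{-1}b^{-1}$ (classically the bracket of Lie-algebra-valued forms). For an $\mathrm{Aut}(G)$-valued $m$-form $u$ ($m\ge1$) and a $G$-valued $n$-form $g$ ($n\ge 0$, a $0$-form being a section of $G$), $[u,g](x_0,\dots,x_{m+n})=u(x_0,\dots,x_m)(g(x_m,\dots,x_{m+n}))\,g(x_m,\dots,x_{m+n})^{-1}$; for $\gamma$ a $G$-valued form one has $[i(\gamma),g]=[\gamma,g]$. Differentials: for an $\mathrm{Aut}(G)$-valued $1$-form $m$ and a $G$-valued form $\omega$, $d^1_m\omega(x_0,x_1,x_2)=\omega(x_0,x_1)\,m(x_0,x_1)(\omega(x_1,x_2))\,\omega(x_0,x_2)^{-1}$, classically $d\omega+\frac12[\omega,\omega]+[m,\omega]$; and for $n\ge2$, $d^n_m\omega=d\omega+[m,\omega]$ with $d$ the usual (linear) de Rham differential. For an $\mathrm{Aut}(G)$-valued $1$-form $m$, $d^1m(x,y,z)=m(x,y)m(y,z)m(z,x)$, classically $dm+\frac12[m,m]$; for an $\mathrm{Aut}(G)$-valued $2$-form $\nu$, $d^2_m\nu=d\nu+[m,\nu]$. For a section $g$ of $G$, $dg\,g^{-1}$ is the $1$-form $g(x_1)g(x_0)^{-1}$. For a section $u$ of $\mathrm{Aut}(G)$, $u\,du^{-1}$ is the $1$-form $u(x_0)u(x_1)^{-1}$, and ${}^{u}m=u\,m\,u^{-1}$ ($u$ evaluated at $x_0$) for an $\mathrm{Aut}(G)$-valued form $m$.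 **Gerbe.** A $G$-gerbe $\mathcal{P}$ on $X$ comes with, for each object $x\in\mathcal{P}_U$, an isomorphism $G_{|U}\simeq\mathrm{Aut}_{\mathcal{P}_U}(x)$, used to identify sections of $G$ with automorphisms of the chosen objects (and of their pullbacks). Connected means that any two objects of $\mathcal{P}_U$ are connected by an arrow in $\mathcal{P}_U$. Composition of arrows is written right to left. $\lambda_{ij}\in\Gamma(U_{ij},\mathrm{Aut}(G))$ is defined by $\phi_{ij}\,\gamma=\lambda_{ij}(\gamma)\,\phi_{ij}$ for all sections $\gamma$ of $G$, and $g_{ijk}\in\Gamma(U_{ijk},G)$ by $\phi_{ij}\phi_{jk}=g_{ijk}\phi_{ik}$. Consequently $\lambda_{ij}\lambda_{jk}=i(g_{ijk})\lambda_{ik}$ and $\lambda_{ij}(g_{jkl})g_{ijl}=g_{ijk}g_{ikl}$. **Connection.** A connection on $\mathcal{P}$ is an equivalence of stacks $\epsilon:p_1^*\mathcal{P}\to p_0^*\mathcal{P}$ over $\Delta^1_{X/S}$ together with a natural isomorphism between its restriction to the diagonal and $1_{\mathcal{P}}$. The arrows $\gamma_i:\epsilon\,p_1^*x_i\to p_0^*x_i$ over $\Delta^1_{U_i/S}$ are required to restrict to $1_{x_i}$ on the diagonal. The $\mathrm{Aut}(G)$-valued $1$-form $m_i$ on $U_i$ is defined by $\gamma_i\,\epsilon(g)=m_i(g)\,\gamma_i$ for sections $g$ of $p_1^*G$ (with $p_0^*G$, $p_1^*G$ canonically identified). The $G$-valued $1$-form $\gamma_{ij}$ on $U_{ij}$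 is defined by $\gamma_i\circ\epsilon(p_1^*\phi_{ij})=\gamma_{ij}\circ p_0^*\phi_{ij}\circ\gamma_j$. **Curving.** A curving of $(\mathcal{P},\epsilon)$ is a natural isomorphism $K:\epsilon_{01}\epsilon_{12}\Rightarrow\kappa\,\epsilon_{02}$ of functors $p_2^*\mathcal{P}\to p_0^*\mathcal{P}$ over $\Delta^2_{X/S}$, for some morphism $\kappa:p_0^*\mathcal{P}\to p_0^*\mathcal{P}$ (the fake curvature), trivialized on the degenerate subsimplex. The arrows $\delta_i:\kappa\,p_0^*x_i\to p_0^*x_i$ over $\Delta^2_{U_i/S}$ are required to restrict to the identity on the degenerate subsimplex. The $G$-valued $2$-form $B_i$ on $U_i$ is defined by $\gamma_i^{01}\circ\epsilon_{01}(\gamma_i^{12})=B_i\circ\delta_i\circ\kappa(\gamma_i^{02})\circ K(p_2^*x_i)$. *)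

theory Defs
  imports "HOL-Algebra.Module" "HOL-Algebra.Ideal" "HOL-Algebra.Bij"
    "HOL-Algebra.Free_Abelian_Groups"
begin

text \<open>
  Schemes are functors of points (Demazure--Gabriel): a functor on commutative rings is a scheme
  if it is a Zariski sheaf covered by affine open subfunctors. All test rings have their carrier
  in one type \<open>'r\<close>; when that type is infinite, the rings in it are, up to isomorphism, exactly
  those of cardinality at most that of \<open>'r\<close>, a class closed under quotients, localisations,
  pushouts and finitely generated algebras. It plays the role of the universe.

  A section over a scheme \<open>Y\<close> of a sheaf, or of a stack, is a family indexed by the affine points of
  \<open>Y\<close> and compatible with base change (Yoneda). So "over \<open>p\<^sub>a\<close>" means: evaluated at the \<open>a\<close>-th
  component of a tuple of points.
\<close>

section \<open>Rings and functors of points\<close>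

text \<open>Ring homomorphisms are extensional, so that equality of functions is equality of arrows.\<close>

definition rhom :: "'r ring \<Rightarrow> 'r ring \<Rightarrow> ('r \<Rightarrow> 'r) set" where
  "rhom R R' = ring_hom R R' \<inter> extensional (carrier R)"

definition rid :: "'r ring \<Rightarrow> 'r \<Rightarrow> 'r" where
  "rid R = (\<lambda>r\<in>carrier R. r)"

record ('r, 'x) pfunctor =
  pts :: "'r ring \<Rightarrow> 'x set"
  pull :: "'r ring \<Rightarrow> 'r ring \<Rightarrow> ('r \<Rightarrow> 'r) \<Rightarrow> 'x \<Rightarrow> 'x"

locale point_functor =
  fixes F :: "('r, 'x) pfunctor"
  assumes pull_closed: "\<lbrakk>cring R; cring R'; h \<in> rhom R R'; x \<in> pts F R\<rbrakk>
      \<Longrightarrow> pull F R R' h x \<in> pts F R'"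
    and pull_id: "\<lbrakk>cring R; x \<in> pts F R\<rbrakk> \<Longrightarrow> pull F R R (rid R) x = x"
    and pull_comp: "\<lbrakk>cring R; cring R'; cring R''; h \<in> rhom R R'; k \<in> rhom R' R''; x \<in> pts F R\<rbrakk>
      \<Longrightarrow> pull F R R'' (compose (carrier R) k h) x = pull F R' R'' k (pull F R R' h x)"

locale functor_morphism =
  fixes X :: "('r, 'x) pfunctor" and S :: "('r, 's) pfunctor" and p :: "'r ring \<Rightarrow> 'x \<Rightarrow> 's"
  assumes mor_closed: "\<lbrakk>cring R; x \<in> pts X R\<rbrakk> \<Longrightarrow> p R x \<in> pts S R"
    and mor_natural: "\<lbrakk>cring R; cring R'; h \<in> rhom R R'; x \<in> pts X R\<rbrakk>
      \<Longrightarrow> p R' (pull X R R' h x) = pull S R R' h (p R x)"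

definition subfunctor :: "('r, 'x) pfunctor \<Rightarrow> ('r ring \<Rightarrow> 'x set) \<Rightarrow> ('r, 'x) pfunctor" where
  "subfunctor X U = \<lparr>pts = U, pull = pull X\<rparr>"

definition is_localization :: "'r ring \<Rightarrow> 'r \<Rightarrow> 'r ring \<Rightarrow> ('r \<Rightarrow> 'r) \<Rightarrow> bool" where
  "is_localization R f R' h \<longleftrightarrow>
     cring R' \<and> f \<in> carrier R \<and> h \<in> rhom R R' \<and> h f \<in> Units R' \<and>
     (\<forall>y\<in>carrier R'. \<exists>a\<in>carrier R. \<exists>n::nat. y \<otimes>\<^bsub>R'\<^esub> (h f [^]\<^bsub>R'\<^esub> n) = h a) \<and>
     (\<forall>a\<in>carrier R. h a = \<zero>\<^bsub>R'\<^esub> \<longrightarrow> (\<exists>n::nat. (f [^]\<^bsub>R\<^esub> n) \<otimes>\<^bsub>R\<^esub> a = \<zero>\<^bsub>R\<^esub>))"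

text \<open>A covering of \<open>Spec R\<close> by finitely many basic open sets.\<close>

definition zariski_cover :: "'r ring \<Rightarrow> ('r ring \<times> ('r \<Rightarrow> 'r)) set \<Rightarrow> bool" where
  "zariski_cover R C \<longleftrightarrow> finite C \<and>
     (\<exists>f. (\<forall>c\<in>C. is_localization R (f c) (fst c) (snd c)) \<and> Idl\<^bsub>R\<^esub> (f ` C) = carrier R)"

text \<open>Compatibility on overlaps is tested on all rings under two members of the covering.\<close>

definition zariski_sheaf :: "('r, 'x) pfunctor \<Rightarrow> bool" where
  "zariski_sheaf F \<longleftrightarrow> (\<forall>R C s. cring R \<and> zariski_cover R C \<and>
     (\<forall>(R1, h1)\<in>C. s (R1, h1) \<in> pts F R1) \<and>
     (\<forall>(R1, h1)\<in>C. \<forall>(R2, h2)\<in>C. \<forall>T k1 k2. cring T \<and> k1 \<in> rhom R1 T \<and> k2 \<in> rhom R2 T \<and>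
        compose (carrier R) k1 h1 = compose (carrier R) k2 h2 \<longrightarrow>
        pull F R1 T k1 (s (R1, h1)) = pull F R2 T k2 (s (R2, h2)))
     \<longrightarrow> (\<exists>!x. x \<in> pts F R \<and> (\<forall>(R1, h1)\<in>C. pull F R R1 h1 x = s (R1, h1))))"

definition open_sub :: "('r, 'x) pfunctor \<Rightarrow> ('r ring \<Rightarrow> 'x set) \<Rightarrow> bool" where
  "open_sub F U \<longleftrightarrow> (\<forall>R. cring R \<longrightarrow> U R \<subseteq> pts F R) \<and>
     (\<forall>R x. cring R \<and> x \<in> pts F R \<longrightarrow>
       (\<exists>I. ideal I R \<and> (\<forall>R' h. cring R' \<and> h \<in> rhom R R' \<longrightarrow>
          (pull F R R' h x \<in> U R' \<longleftrightarrow> Idl\<^bsub>R'\<^esub> (h ` I) = carrier R'))))"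

definition open_cover :: "('r, 'x) pfunctor \<Rightarrow> ('i \<Rightarrow> 'r ring \<Rightarrow> 'x set) \<Rightarrow> bool" where
  "open_cover F U \<longleftrightarrow> (\<forall>i. open_sub F (U i)) \<and>
     (\<forall>R x. cring R \<and> x \<in> pts F R \<longrightarrow>
       (\<exists>C. zariski_cover R C \<and> (\<forall>(R1, h1)\<in>C. \<exists>i. pull F R R1 h1 x \<in> U i R1)))"

text \<open>The subfunctor of \<open>F\<close> represented by \<open>A\<close>, with \<open>v\<close> the candidate universal point.\<close>

definition orbit :: "('r, 'x) pfunctor \<Rightarrow> 'r ring \<Rightarrow> 'x \<Rightarrow> 'r ring \<Rightarrow> 'x set" where
  "orbit F A v R = (\<lambda>h. pull F A R h v) ` rhom A R"

definition affine_open :: "('r, 'x) pfunctor \<Rightarrow> 'r ring \<Rightarrow> 'x \<Rightarrow> bool" where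
  "affine_open F A v \<longleftrightarrow> cring A \<and> v \<in> pts F A \<and>
     (\<forall>R. cring R \<longrightarrow> inj_on (\<lambda>h. pull F A R h v) (rhom A R)) \<and> open_sub F (orbit F A v)"

definition scheme :: "('r, 'x) pfunctor \<Rightarrow> bool" where
  "scheme F \<longleftrightarrow> point_functor F \<and> zariski_sheaf F \<and>
     (\<forall>R x. cring R \<and> x \<in> pts F R \<longrightarrow>
       (\<exists>C. zariski_cover R C \<and>
         (\<forall>(R1, h1)\<in>C. \<exists>A v. affine_open F A v \<and> pull F R R1 h1 x \<in> orbit F A v R1)))"

definition invertible_on :: "nat \<Rightarrow> ('r, 's) pfunctor \<Rightarrow> bool" where
  "invertible_on n S \<longleftrightarrow>
     (\<forall>R s. cring R \<and> s \<in> pts S R \<longrightarrow> [n] \<cdot>\<^bsub>R\<^esub> \<one>\<^bsub>R\<^esub> \<in> Units R)"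


section \<open>Flat and smooth morphisms\<close>

text \<open>The relations defining \<open>M \<otimes>\<^sub>B A\<close> as a quotient of the free abelian group on \<open>M \<times> A\<close>.\<close>

definition tensor_relations ::
  "'r ring \<Rightarrow> ('r, 'm) module \<Rightarrow> 'r ring \<Rightarrow> ('r \<Rightarrow> 'r) \<Rightarrow> ('m \<times> 'r \<Rightarrow>\<^sub>0 int) set" where
  "tensor_relations B M A b =
     {frag_of (m \<oplus>\<^bsub>M\<^esub> m', a) - frag_of (m, a) - frag_of (m', a) | m m' a.
        m \<in> carrier M \<and> m' \<in> carrier M \<and> a \<in> carrier A} \<union>
     {frag_of (m, a \<oplus>\<^bsub>A\<^esub> a') - frag_of (m, a) - frag_of (m, a') | m a a'.
        m \<in> carrier M \<and> a \<in> carrier A \<and> a' \<in> carrier A} \<union>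
     {frag_of (c \<odot>\<^bsub>M\<^esub> m, a) - frag_of (m, b c \<otimes>\<^bsub>A\<^esub> a) | c m a.
        c \<in> carrier B \<and> m \<in> carrier M \<and> a \<in> carrier A}"

definition tensor_null ::
  "'r ring \<Rightarrow> ('r, 'm) module \<Rightarrow> 'r ring \<Rightarrow> ('r \<Rightarrow> 'r) \<Rightarrow> ('m \<times> 'r \<Rightarrow>\<^sub>0 int) set" where
  "tensor_null B M A b =
     generate (free_Abelian_group (carrier M \<times> carrier A)) (tensor_relations B M A b)"

text \<open>\<open>A\<close> is flat over \<open>B\<close> (via \<open>b\<close>): \<open>_ \<otimes>\<^sub>B A\<close> preserves injectivity of module homomorphisms.\<close>

definition flat_hom :: "'r ring \<Rightarrow> 'r ring \<Rightarrow> ('r \<Rightarrow> 'r) \<Rightarrow> bool" where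
  "flat_hom B A b \<longleftrightarrow> (\<forall>(M :: ('r, 'r) module) (N :: ('r, 'r) module) f.
     module B M \<and> module B N \<and>
     f \<in> carrier M \<rightarrow> carrier N \<and> inj_on f (carrier M) \<and>
     (\<forall>x\<in>carrier M. \<forall>y\<in>carrier M. f (x \<oplus>\<^bsub>M\<^esub> y) = f x \<oplus>\<^bsub>N\<^esub> f y) \<and>
     (\<forall>c\<in>carrier B. \<forall>x\<in>carrier M. f (c \<odot>\<^bsub>M\<^esub> x) = c \<odot>\<^bsub>N\<^esub> f x) \<longrightarrow>
     (\<forall>z\<in>carrier (free_Abelian_group (carrier M \<times> carrier A)).
        frag_extend (\<lambda>(m, a). frag_of (f m, a)) z \<in> tensor_null B N A b \<longrightarrow>
        z \<in> tensor_null B M A b))"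

definition flat_morphism ::
  "('r, 'x) pfunctor \<Rightarrow> ('r, 's) pfunctor \<Rightarrow> ('r ring \<Rightarrow> 'x \<Rightarrow> 's) \<Rightarrow> bool" where
  "flat_morphism X S p \<longleftrightarrow> (\<forall>A v B w b. affine_open X A v \<and> affine_open S B w \<and>
     b \<in> rhom B A \<and> pull S B A b w = p A v \<longrightarrow> flat_hom B A b)"

text \<open>A polynomial over \<open>B\<close> is a list of terms (coefficient, list of indices of its variables).\<close>

definition poly_val ::
  "'r ring \<Rightarrow> ('r \<Rightarrow> 'r) \<Rightarrow> 'r list \<Rightarrow> ('r \<times> nat list) list \<Rightarrow> 'r" where
  "poly_val A b ts P =
     foldr (\<lambda>(c, vs) acc. (b c \<otimes>\<^bsub>A\<^esub> foldr (\<lambda>v w. ts ! v \<otimes>\<^bsub>A\<^esub> w) vs \<one>\<^bsub>A\<^esub>) \<oplus>\<^bsub>A\<^esub> acc) P \<zero>\<^bsub>A\<^esub>"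

text \<open>\<open>A\<close> has the universal property of \<open>B[t\<^sub>1,\<dots>,t\<^sub>n]\<close> modulo the finitely many polynomials \<open>Ps\<close>.\<close>

definition finitely_presented_hom :: "'r ring \<Rightarrow> 'r ring \<Rightarrow> ('r \<Rightarrow> 'r) \<Rightarrow> bool" where
  "finitely_presented_hom B A b \<longleftrightarrow> (\<exists>as Ps.
     set as \<subseteq> carrier A \<and>
     (\<forall>P\<in>set Ps. \<forall>(c, vs)\<in>set P. c \<in> carrier B \<and> (\<forall>v\<in>set vs. v < length as)) \<and>
     (\<forall>P\<in>set Ps. poly_val A b as P = \<zero>\<^bsub>A\<^esub>) \<and>
     (\<forall>C c ts. cring C \<and> c \<in> rhom B C \<and> length ts = length as \<and> set ts \<subseteq> carrier C \<and>
        (\<forall>P\<in>set Ps. poly_val C c ts P = \<zero>\<^bsub>C\<^esub>) \<longrightarrow>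
        (\<exists>!k. k \<in> rhom A C \<and> compose (carrier B) k b = c \<and> map k as = ts)))"

definition locally_finitely_presented ::
  "('r, 'x) pfunctor \<Rightarrow> ('r, 's) pfunctor \<Rightarrow> ('r ring \<Rightarrow> 'x \<Rightarrow> 's) \<Rightarrow> bool" where
  "locally_finitely_presented X S p \<longleftrightarrow> (\<forall>A v B w b. affine_open X A v \<and> affine_open S B w \<and>
     b \<in> rhom B A \<and> pull S B A b w = p A v \<longrightarrow> finitely_presented_hom B A b)"

text \<open>First-order thickenings of affine schemes: surjections with kernel of square zero.\<close>

definition thickening :: "'r ring \<Rightarrow> 'r ring \<Rightarrow> ('r \<Rightarrow> 'r) \<Rightarrow> bool" where
  "thickening R R0 h \<longleftrightarrow> cring R \<and> cring R0 \<and> h \<in> rhom R R0 \<and> h ` carrier R = carrier R0 \<and>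
     (\<forall>a\<in>carrier R. \<forall>b\<in>carrier R. h a = \<zero>\<^bsub>R0\<^esub> \<and> h b = \<zero>\<^bsub>R0\<^esub> \<longrightarrow> a \<otimes>\<^bsub>R\<^esub> b = \<zero>\<^bsub>R\<^esub>)"

definition formally_smooth ::
  "('r, 'x) pfunctor \<Rightarrow> ('r, 's) pfunctor \<Rightarrow> ('r ring \<Rightarrow> 'x \<Rightarrow> 's) \<Rightarrow> bool" where
  "formally_smooth X S p \<longleftrightarrow> (\<forall>R R0 h x0 s. thickening R R0 h \<and> x0 \<in> pts X R0 \<and> s \<in> pts S R \<and>
     p R0 x0 = pull S R R0 h s \<longrightarrow> (\<exists>x\<in>pts X R. pull X R R0 h x = x0 \<and> p R x = s))"

definition smooth_morphism ::
  "('r, 'x) pfunctor \<Rightarrow> ('r, 's) pfunctor \<Rightarrow> ('r ring \<Rightarrow> 'x \<Rightarrow> 's) \<Rightarrow> bool" where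
  "smooth_morphism X S p \<longleftrightarrow> functor_morphism X S p \<and>
     locally_finitely_presented X S p \<and> formally_smooth X S p"


section \<open>Group schemes and the sheaf of automorphisms\<close>

record ('r, 's, 'f) gfunctor =
  grp :: "'r ring \<Rightarrow> 's \<Rightarrow> 'f monoid"
  res :: "'r ring \<Rightarrow> 'r ring \<Rightarrow> ('r \<Rightarrow> 'r) \<Rightarrow> 's \<Rightarrow> 'f \<Rightarrow> 'f"

locale group_functor =
  fixes S :: "('r, 's) pfunctor" and F :: "('r, 's, 'f) gfunctor"
  assumes grp_group: "\<lbrakk>cring R; s \<in> pts S R\<rbrakk> \<Longrightarrow> group (grp F R s)"
    and res_hom: "\<lbrakk>cring R; cring R'; h \<in> rhom R R'; s \<in> pts S R\<rbrakk>
      \<Longrightarrow> res F R R' h s \<in> hom (grp F R s) (grp F R' (pull S R R' h s))"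
    and res_id: "\<lbrakk>cring R; s \<in> pts S R; g \<in> carrier (grp F R s)\<rbrakk> \<Longrightarrow> res F R R (rid R) s g = g"
    and res_comp: "\<lbrakk>cring R; cring R'; cring R''; h \<in> rhom R R'; k \<in> rhom R' R'';
        s \<in> pts S R; g \<in> carrier (grp F R s)\<rbrakk>
      \<Longrightarrow> res F R R'' (compose (carrier R) k h) s g
          = res F R' R'' k (pull S R R' h s) (res F R R' h s g)"

text \<open>The underlying functor over \<open>S\<close>: its \<open>R\<close>-points are an \<open>R\<close>-point of \<open>S\<close> and a point above it.\<close>

definition total :: "('r, 's) pfunctor \<Rightarrow> ('r, 's, 'f) gfunctor \<Rightarrow> ('r, 's \<times> 'f) pfunctor" where
  "total S F = \<lparr>pts = \<lambda>R. {(s, g). s \<in> pts S R \<and> g \<in> carrier (grp F R s)},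
                pull = \<lambda>R R' h (s, g). (pull S R R' h s, res F R R' h s g)\<rparr>"

definition flat_group_scheme :: "('r, 's) pfunctor \<Rightarrow> ('r, 's, 'g) gfunctor \<Rightarrow> bool" where
  "flat_group_scheme S G \<longleftrightarrow> group_functor S G \<and> scheme (total S G) \<and>
     flat_morphism (total S G) S (\<lambda>R. fst)"

definition base_change ::
  "('r ring \<Rightarrow> 'x \<Rightarrow> 's) \<Rightarrow> ('r, 's, 'f) gfunctor \<Rightarrow> ('r, 'x, 'f) gfunctor" where
  "base_change p F = \<lparr>grp = \<lambda>R x. grp F R (p R x), res = \<lambda>R R' h x. res F R R' h (p R x)\<rparr>"

text \<open>A local automorphism over \<open>s \<in> S(R)\<close> is a compatible family of automorphisms of \<open>G(R')\<close>,
  indexed by the homomorphisms \<open>h : R \<rightarrow> R'\<close>; it takes the value \<open>undefined\<close> on other indices, so that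
  equality of functions is equality of automorphisms.\<close>

type_synonym ('r, 'g) local_aut = "'r ring \<Rightarrow> ('r \<Rightarrow> 'r) \<Rightarrow> 'g \<Rightarrow> 'g"

definition family :: "'r ring \<Rightarrow> ('r ring \<Rightarrow> ('r \<Rightarrow> 'r) \<Rightarrow> 'g \<Rightarrow> 'g) \<Rightarrow> ('r, 'g) local_aut" where
  "family R u = (\<lambda>R' h. if cring R' \<and> h \<in> rhom R R' then u R' h else undefined)"

definition Aut_carrier ::
  "('r, 's) pfunctor \<Rightarrow> ('r, 's, 'g) gfunctor \<Rightarrow> 'r ring \<Rightarrow> 's \<Rightarrow> ('r, 'g) local_aut set" where
  "Aut_carrier S G R s = {u. family R u = u \<and>
     (\<forall>R' h. cring R' \<and> h \<in> rhom R R' \<longrightarrow> u R' h \<in> auto (grp G R' (pull S R R' h s))) \<and>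
     (\<forall>R' R'' h k g. cring R' \<and> cring R'' \<and> h \<in> rhom R R' \<and> k \<in> rhom R' R'' \<and>
        g \<in> carrier (grp G R' (pull S R R' h s)) \<longrightarrow>
        u R'' (compose (carrier R) k h) (res G R' R'' k (pull S R R' h s) g)
        = res G R' R'' k (pull S R R' h s) (u R' h g))}"

definition Aut_sheaf ::
  "('r, 's) pfunctor \<Rightarrow> ('r, 's, 'g) gfunctor \<Rightarrow> ('r, 's, ('r, 'g) local_aut) gfunctor" where
  "Aut_sheaf S G = \<lparr>
     grp = \<lambda>R s. \<lparr>carrier = Aut_carrier S G R s,
       mult = \<lambda>u v. family R
         (\<lambda>R' h. compose (carrier (grp G R' (pull S R R' h s))) (u R' h) (v R' h)),
       one = family R (\<lambda>R' h. \<lambda>g\<in>carrier (grp G R' (pull S R R' h s)). g)\<rparr>,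
     res = \<lambda>R R' k s u. family R' (\<lambda>R'' h. u R'' (compose (carrier R) h k))\<rparr>"

definition inner_aut ::
  "('r, 's) pfunctor \<Rightarrow> ('r, 's, 'g) gfunctor \<Rightarrow> 'r ring \<Rightarrow> 's \<Rightarrow> 'g \<Rightarrow> ('r, 'g) local_aut" where
  "inner_aut S G R s \<gamma> = family R (\<lambda>R' h.
     let H = grp G R' (pull S R R' h s); c = res G R R' h s \<gamma>
     in (\<lambda>g\<in>carrier H. c \<otimes>\<^bsub>H\<^esub> g \<otimes>\<^bsub>H\<^esub> inv\<^bsub>H\<^esub> c))"


section \<open>Combinatorial differential forms\<close>

text \<open>Two points with the same image in \<open>S\<close> lie in the first-order neighbourhood \<open>V(J\<^sup>2)\<close> of the
  diagonal of \<open>X \<times>\<^sub>S X\<close> iff the pullback of the ideal \<open>J\<close> of the diagonal generates an ideal of square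
  zero, that is, iff they agree after restriction along a first-order thickening.\<close>

definition infinitesimally_close :: "('r, 'x) pfunctor \<Rightarrow> 'r ring \<Rightarrow> 'x \<Rightarrow> 'x \<Rightarrow> bool" where
  "infinitesimally_close X R x y \<longleftrightarrow>
     (\<exists>R0 h. thickening R R0 h \<and> pull X R R0 h x = pull X R R0 h y)"

text \<open>The scheme \<open>\<Delta>\<^sup>n\<^bsub>U/S\<^esub>\<close> for \<open>U\<close> open in \<open>X\<close>; a point is the list of its \<open>n + 1\<close> vertices.\<close>

definition simplices ::
  "('r, 'x) pfunctor \<Rightarrow> ('r ring \<Rightarrow> 'x \<Rightarrow> 's) \<Rightarrow> ('r ring \<Rightarrow> 'x set) \<Rightarrow> nat \<Rightarrow> ('r, 'x list) pfunctor"
  where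
  "simplices X p U n = \<lparr>
     pts = \<lambda>R. {xs. length xs = Suc n \<and> set xs \<subseteq> U R \<and>
       (\<forall>x\<in>set xs. \<forall>y\<in>set xs. p R x = p R y \<and> infinitesimally_close X R x y)},
     pull = \<lambda>R R' h. map (pull X R R' h)\<rparr>"

text \<open>The degenerate subsimplex is the union of the images of the degeneracy maps.\<close>

definition degenerate :: "'x list \<Rightarrow> bool" where
  "degenerate xs \<longleftrightarrow> (\<exists>i. Suc i < length xs \<and> xs ! i = xs ! Suc i)"

text \<open>Here and below \<open>F\<close> is a sheaf of groups on \<open>X\<close> obtained by base change from \<open>S\<close>. The vertices of a
  simplex have the same image in \<open>S\<close>, so the groups at its vertices coincide.\<close>

type_synonym ('r, 'x, 'f) fm = "'r ring \<Rightarrow> 'x list \<Rightarrow> 'f"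

definition is_form ::
  "('r, 'x) pfunctor \<Rightarrow> ('r ring \<Rightarrow> 'x \<Rightarrow> 's) \<Rightarrow> ('r, 'x, 'f) gfunctor \<Rightarrow> ('r ring \<Rightarrow> 'x set) \<Rightarrow> nat
    \<Rightarrow> ('r, 'x, 'f) fm \<Rightarrow> bool" where
  "is_form X p F U n \<omega> \<longleftrightarrow> (\<forall>R xs. cring R \<and> xs \<in> pts (simplices X p U n) R \<longrightarrow>
     \<omega> R xs \<in> carrier (grp F R (hd xs)) \<and>
     (\<forall>R' h. cring R' \<and> h \<in> rhom R R' \<longrightarrow>
        \<omega> R' (map (pull X R R' h) xs) = res F R R' h (hd xs) (\<omega> R xs)) \<and>
     (degenerate xs \<longrightarrow> \<omega> R xs = \<one>\<^bsub>grp F R (hd xs)\<^esub>))"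

definition eq_forms ::
  "('r, 'x) pfunctor \<Rightarrow> ('r ring \<Rightarrow> 'x \<Rightarrow> 's) \<Rightarrow> ('r, 'x, 'f) gfunctor \<Rightarrow> ('r ring \<Rightarrow> 'x set) \<Rightarrow> nat
    \<Rightarrow> ('r, 'x, 'f) fm \<Rightarrow> ('r, 'x, 'f) fm \<Rightarrow> bool" where
  "eq_forms X p F U n \<alpha> \<beta> \<longleftrightarrow> is_form X p F U n \<alpha> \<and> is_form X p F U n \<beta> \<and>
     (\<forall>R xs. cring R \<and> xs \<in> pts (simplices X p U n) R \<longrightarrow> \<alpha> R xs = \<beta> R xs)"

text \<open>A section over \<open>X\<close>, evaluated at the first vertex.\<close>

definition at0 :: "('r ring \<Rightarrow> 'x \<Rightarrow> 'f) \<Rightarrow> ('r, 'x, 'f) fm" where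
  "at0 s R xs = s R (hd xs)"

text \<open>Additive notation for the (pointwise) group structure.\<close>

definition fzero :: "('r, 'x, 'f) gfunctor \<Rightarrow> ('r, 'x, 'f) fm" where
  "fzero F R xs = \<one>\<^bsub>grp F R (hd xs)\<^esub>"

definition fadd ::
  "('r, 'x, 'f) fm \<Rightarrow> ('r, 'x, 'f) gfunctor \<Rightarrow> ('r, 'x, 'f) fm \<Rightarrow> ('r, 'x, 'f) fm"
    (\<open>(_ \<boxplus>\<^bsub>_\<^esub> _)\<close> [65, 0, 66] 65) where
  "(\<alpha> \<boxplus>\<^bsub>F\<^esub> \<beta>) R xs = \<alpha> R xs \<otimes>\<^bsub>grp F R (hd xs)\<^esub> \<beta> R xs"

definition fneg :: "('r, 'x, 'f) gfunctor \<Rightarrow> ('r, 'x, 'f) fm \<Rightarrow> ('r, 'x, 'f) fm" where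
  "fneg F \<alpha> R xs = inv\<^bsub>grp F R (hd xs)\<^esub> (\<alpha> R xs)"

definition fsub ::
  "('r, 'x, 'f) fm \<Rightarrow> ('r, 'x, 'f) gfunctor \<Rightarrow> ('r, 'x, 'f) fm \<Rightarrow> ('r, 'x, 'f) fm"
    (\<open>(_ \<boxminus>\<^bsub>_\<^esub> _)\<close> [65, 0, 66] 65) where
  "\<alpha> \<boxminus>\<^bsub>F\<^esub> \<beta> = \<alpha> \<boxplus>\<^bsub>F\<^esub> fneg F \<beta>"

text \<open>\<open>\<^bsup>u\<^esup>m = u m u\<^sup>-\<^sup>1\<close>.\<close>

definition conj_form ::
  "('r, 'x, 'f) gfunctor \<Rightarrow> ('r, 'x, 'f) fm \<Rightarrow> ('r, 'x, 'f) fm \<Rightarrow> ('r, 'x, 'f) fm" where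
  "conj_form F u m = u \<boxplus>\<^bsub>F\<^esub> m \<boxminus>\<^bsub>F\<^esub> u"

definition aut_app :: "'r ring \<Rightarrow> ('r, 'g) local_aut \<Rightarrow> 'g \<Rightarrow> 'g" where
  "aut_app R u g = u R (rid R) g"

definition act_form ::
  "('r, 'x, ('r, 'g) local_aut) fm \<Rightarrow> ('r, 'x, 'g) fm \<Rightarrow> ('r, 'x, 'g) fm" where
  "act_form u \<omega> R xs = aut_app R (u R xs) (\<omega> R xs)"

definition inner_form ::
  "('r, 's) pfunctor \<Rightarrow> ('r ring \<Rightarrow> 'x \<Rightarrow> 's) \<Rightarrow> ('r, 's, 'g) gfunctor
    \<Rightarrow> ('r, 'x, 'g) fm \<Rightarrow> ('r, 'x, ('r, 'g) local_aut) fm" where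
  "inner_form S p G \<omega> R xs = inner_aut S G R (p R (hd xs)) (\<omega> R xs)"

text \<open>The bracket of an \<open>m\<close>-form with a form of arbitrary degree: the commutator of the values at
  \<open>(x\<^sub>0,\<dots>,x\<^sub>m)\<close> and \<open>(x\<^sub>m,\<dots>,x\<^bsub>m+n\<^esub>)\<close>.\<close>

definition bracket ::
  "('r, 'x, 'f) gfunctor \<Rightarrow> nat \<Rightarrow> ('r, 'x, 'f) fm \<Rightarrow> ('r, 'x, 'f) fm \<Rightarrow> ('r, 'x, 'f) fm" where
  "bracket F m \<alpha> \<beta> R xs = (let H = grp F R (hd xs); a = \<alpha> R (take (Suc m) xs); b = \<beta> R (drop m xs)
     in a \<otimes>\<^bsub>H\<^esub> b \<otimes>\<^bsub>H\<^esub> inv\<^bsub>H\<^esub> a \<otimes>\<^bsub>H\<^esub> inv\<^bsub>H\<^esub> b)"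

text \<open>The bracket of an \<open>Aut(G)\<close>-valued \<open>m\<close>-form with a \<open>G\<close>-valued form. A section \<open>g\<close> of \<open>G\<close> is
  regarded as the \<open>0\<close>-form \<open>at0 g\<close>.\<close>

definition aut_bracket ::
  "('r, 'x, 'g) gfunctor \<Rightarrow> nat \<Rightarrow> ('r, 'x, ('r, 'g) local_aut) fm \<Rightarrow> ('r, 'x, 'g) fm
    \<Rightarrow> ('r, 'x, 'g) fm" where
  "aut_bracket G m u \<omega> R xs = (let H = grp G R (hd xs); g = \<omega> R (drop m xs)
     in aut_app R (u R (take (Suc m) xs)) g \<otimes>\<^bsub>H\<^esub> inv\<^bsub>H\<^esub> g)"

definition omit :: "nat \<Rightarrow> 'x list \<Rightarrow> 'x list" where
  "omit i xs = take i xs @ drop (Suc i) xs"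

text \<open>The de Rham differential in degrees \<open>n \<ge> 2\<close>. Under the identification of the classical form
  \<open>f dg\<^sub>1 \<and> \<dots> \<and> dg\<^sub>n\<close> with \<open>(x\<^sub>0,\<dots>,x\<^sub>n) \<mapsto> f(x\<^sub>0) (g\<^sub>1(x\<^sub>1) - g\<^sub>1(x\<^sub>0)) \<dots> (g\<^sub>n(x\<^sub>n) - g\<^sub>n(x\<^bsub>n-1\<^esub>))\<close>, the classical
  \<open>d\<close> is \<open>\<omega> \<mapsto> \<Sum>\<^sub>i (-1)\<^sup>i \<omega>(x\<^sub>0,\<dots>,\<widehat>x\<^sub>i,\<dots>,x\<^bsub>n+1\<^esub>)\<close>; this is checked for the additive group in
  \<open>de_rham_elementary\<close> below. Multiplication of forms being addition, this is an alternating
  product, and for \<open>n \<ge> 2\<close> its factors commute.\<close>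

definition alternating_factor ::
  "('r, 'x, 'f) gfunctor \<Rightarrow> ('r, 'x, 'f) fm \<Rightarrow> 'r ring \<Rightarrow> 'x list \<Rightarrow> nat \<Rightarrow> 'f" where
  "alternating_factor F \<omega> R xs i = (if even i then \<omega> R (omit i xs)
     else inv\<^bsub>grp F R (hd xs)\<^esub> (\<omega> R (omit i xs)))"

definition de_rham :: "('r, 'x, 'f) gfunctor \<Rightarrow> ('r, 'x, 'f) fm \<Rightarrow> ('r, 'x, 'f) fm" where
  "de_rham F \<omega> R xs = foldr (\<lambda>i acc. alternating_factor F \<omega> R xs i \<otimes>\<^bsub>grp F R (hd xs)\<^esub> acc)
     [0..<length xs] \<one>\<^bsub>grp F R (hd xs)\<^esub>"

text \<open>\<open>d\<^sup>1\<^sub>m \<omega>\<close> for a \<open>G\<close>-valued \<open>1\<close>-form \<open>\<omega>\<close>.\<close>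

definition d1_twisted ::
  "('r, 'x, 'g) gfunctor \<Rightarrow> ('r, 'x, ('r, 'g) local_aut) fm \<Rightarrow> ('r, 'x, 'g) fm
    \<Rightarrow> ('r, 'x, 'g) fm" where
  "d1_twisted G m \<omega> R xs = (let H = grp G R (hd xs); x0 = xs ! 0; x1 = xs ! 1; x2 = xs ! 2
     in \<omega> R [x0, x1] \<otimes>\<^bsub>H\<^esub> aut_app R (m R [x0, x1]) (\<omega> R [x1, x2]) \<otimes>\<^bsub>H\<^esub> inv\<^bsub>H\<^esub> (\<omega> R [x0, x2]))"

text \<open>\<open>d\<^sup>n\<^sub>m \<omega>\<close>, \<open>n \<ge> 2\<close>, for a \<open>G\<close>-valued \<open>n\<close>-form \<open>\<omega>\<close>.\<close>

definition d_twisted ::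
  "('r, 'x, 'g) gfunctor \<Rightarrow> ('r, 'x, ('r, 'g) local_aut) fm \<Rightarrow> ('r, 'x, 'g) fm
    \<Rightarrow> ('r, 'x, 'g) fm" where
  "d_twisted G m \<omega> = de_rham G \<omega> \<boxplus>\<^bsub>G\<^esub> aut_bracket G 1 m \<omega>"

text \<open>\<open>d\<^sup>1 m\<close> and \<open>d\<^sup>2\<^sub>m \<nu>\<close> for \<open>Aut(G)\<close>-valued forms \<open>m\<close> and \<open>\<nu>\<close>.\<close>

definition d1_aut :: "('r, 'x, 'f) gfunctor \<Rightarrow> ('r, 'x, 'f) fm \<Rightarrow> ('r, 'x, 'f) fm" where
  "d1_aut A m R xs = (let H = grp A R (hd xs); x0 = xs ! 0; x1 = xs ! 1; x2 = xs ! 2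
     in m R [x0, x1] \<otimes>\<^bsub>H\<^esub> m R [x1, x2] \<otimes>\<^bsub>H\<^esub> m R [x2, x0])"

definition d2_aut ::
  "('r, 'x, 'f) gfunctor \<Rightarrow> ('r, 'x, 'f) fm \<Rightarrow> ('r, 'x, 'f) fm \<Rightarrow> ('r, 'x, 'f) fm" where
  "d2_aut A m \<nu> = de_rham A \<nu> \<boxplus>\<^bsub>A\<^esub> bracket A 1 m \<nu>"

text \<open>\<open>dg g\<^sup>-\<^sup>1\<close> and \<open>u du\<^sup>-\<^sup>1\<close> for sections \<open>g\<close> of \<open>G\<close> and \<open>u\<close> of \<open>Aut(G)\<close>.\<close>

definition dg_ginv :: "('r, 'x, 'f) gfunctor \<Rightarrow> ('r ring \<Rightarrow> 'x \<Rightarrow> 'f) \<Rightarrow> ('r, 'x, 'f) fm" where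
  "dg_ginv F g R xs = g R (xs ! 1) \<otimes>\<^bsub>grp F R (hd xs)\<^esub> inv\<^bsub>grp F R (hd xs)\<^esub> (g R (xs ! 0))"

definition u_duinv :: "('r, 'x, 'f) gfunctor \<Rightarrow> ('r ring \<Rightarrow> 'x \<Rightarrow> 'f) \<Rightarrow> ('r, 'x, 'f) fm" where
  "u_duinv F u R xs = u R (xs ! 0) \<otimes>\<^bsub>grp F R (hd xs)\<^esub> inv\<^bsub>grp F R (hd xs)\<^esub> (u R (xs ! 1))"


section \<open>Stacks and gerbes\<close>

text \<open>A category over the category of affine schemes over \<open>X\<close>: an object lies over a ring \<open>brg\<close> and a
  point \<open>bpt\<close> of \<open>X\<close> with values in it, an arrow over the homomorphism \<open>bhom\<close> from the ring of its
  target to that of its source. The composite \<open>cmp f g\<close> is ``first \<open>g\<close>, then \<open>f\<close>''.\<close>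

record ('r, 'x, 'o, 'a) fcat =
  obs :: "'o set"
  ars :: "'a set"
  src :: "'a \<Rightarrow> 'o"
  tgt :: "'a \<Rightarrow> 'o"
  idn :: "'o \<Rightarrow> 'a"
  cmp :: "'a \<Rightarrow> 'a \<Rightarrow> 'a"
  brg :: "'o \<Rightarrow> 'r ring"
  bpt :: "'o \<Rightarrow> 'x"
  bhom :: "'a \<Rightarrow> 'r \<Rightarrow> 'r"

locale fibred_in_groupoids =
  fixes X :: "('r, 'x) pfunctor" and P :: "('r, 'x, 'o, 'a) fcat"
  assumes obj_base: "a \<in> obs P \<Longrightarrow> cring (brg P a) \<and> bpt P a \<in> pts X (brg P a)"
    and src_tgt: "f \<in> ars P \<Longrightarrow> src P f \<in> obs P \<and> tgt P f \<in> obs P"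
    and arr_base: "f \<in> ars P \<Longrightarrow> bhom P f \<in> rhom (brg P (tgt P f)) (brg P (src P f)) \<and>
      pull X (brg P (tgt P f)) (brg P (src P f)) (bhom P f) (bpt P (tgt P f)) = bpt P (src P f)"
    and idn: "a \<in> obs P \<Longrightarrow> idn P a \<in> ars P \<and> src P (idn P a) = a \<and> tgt P (idn P a) = a \<and>
      bhom P (idn P a) = rid (brg P a)"
    and cmp: "\<lbrakk>f \<in> ars P; g \<in> ars P; src P f = tgt P g\<rbrakk> \<Longrightarrow>
      cmp P f g \<in> ars P \<and> src P (cmp P f g) = src P g \<and> tgt P (cmp P f g) = tgt P f \<and>
      bhom P (cmp P f g) = compose (carrier (brg P (tgt P f))) (bhom P g) (bhom P f)"
    and cmp_assoc: "\<lbrakk>f \<in> ars P; g \<in> ars P; e \<in> ars P; src P f = tgt P g; src P g = tgt P e\<rbrakk> \<Longrightarrow>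
      cmp P (cmp P f g) e = cmp P f (cmp P g e)"
    and cmp_idn: "f \<in> ars P \<Longrightarrow> cmp P f (idn P (src P f)) = f \<and> cmp P (idn P (tgt P f)) f = f"
    and lift: "\<lbrakk>a \<in> obs P; cring R'; h \<in> rhom (brg P a) R'\<rbrakk> \<Longrightarrow>
      \<exists>f\<in>ars P. tgt P f = a \<and> brg P (src P f) = R' \<and> bhom P f = h"
    and cartesian: "\<lbrakk>f \<in> ars P; g \<in> ars P; tgt P f = tgt P g;
        k \<in> rhom (brg P (src P f)) (brg P (src P g));
        bhom P g = compose (carrier (brg P (tgt P f))) k (bhom P f)\<rbrakk> \<Longrightarrow>
      \<exists>!e. e \<in> ars P \<and> src P e = src P g \<and> tgt P e = src P f \<and> bhom P e = k \<and> cmp P f e = g"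

text \<open>The arrows from \<open>a\<close> to \<open>b\<close> in a fibre category.\<close>

definition fib :: "('r, 'x, 'o, 'a) fcat \<Rightarrow> 'o \<Rightarrow> 'o \<Rightarrow> 'a set" where
  "fib P a b = {f \<in> ars P. src P f = a \<and> tgt P f = b \<and> brg P a = brg P b \<and>
     bhom P f = rid (brg P b)}"

definition aut_group :: "('r, 'x, 'o, 'a) fcat \<Rightarrow> 'o \<Rightarrow> 'a monoid" where
  "aut_group P a = \<lparr>carrier = fib P a a, mult = cmp P, one = idn P a\<rparr>"

text \<open>Objects and arrows of \<open>P\<close> over a functor \<open>Y\<close> above \<open>X\<close> (via \<open>\<pi>\<close>), not necessarily affine:
  cartesian sections of \<open>P\<close> over the category of points of \<open>Y\<close>, and their morphisms.\<close>

record ('r, 'y, 'o, 'a) csect =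
  sob :: "'r ring \<Rightarrow> 'y \<Rightarrow> 'o"
  sar :: "'r ring \<Rightarrow> 'r ring \<Rightarrow> ('r \<Rightarrow> 'r) \<Rightarrow> 'y \<Rightarrow> 'a"

definition is_object ::
  "('r, 'x, 'o, 'a) fcat \<Rightarrow> ('r, 'y) pfunctor \<Rightarrow> ('r ring \<Rightarrow> 'y \<Rightarrow> 'x) \<Rightarrow> ('r, 'y, 'o, 'a) csect
    \<Rightarrow> bool" where
  "is_object P Y \<pi> s \<longleftrightarrow>
     (\<forall>R y. cring R \<and> y \<in> pts Y R \<longrightarrow>
        sob s R y \<in> obs P \<and> brg P (sob s R y) = R \<and> bpt P (sob s R y) = \<pi> R y \<and>
        sar s R R (rid R) y = idn P (sob s R y)) \<and>
     (\<forall>R R' h y. cring R \<and> cring R' \<and> h \<in> rhom R R' \<and> y \<in> pts Y R \<longrightarrow>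
        sar s R R' h y \<in> ars P \<and> src P (sar s R R' h y) = sob s R' (pull Y R R' h y) \<and>
        tgt P (sar s R R' h y) = sob s R y \<and> bhom P (sar s R R' h y) = h) \<and>
     (\<forall>R R' R'' h k y. cring R \<and> cring R' \<and> cring R'' \<and> h \<in> rhom R R' \<and> k \<in> rhom R' R'' \<and>
        y \<in> pts Y R \<longrightarrow>
        sar s R R'' (compose (carrier R) k h) y
        = cmp P (sar s R R' h y) (sar s R' R'' k (pull Y R R' h y)))"

definition is_arrow ::
  "('r, 'x, 'o, 'a) fcat \<Rightarrow> ('r, 'y) pfunctor \<Rightarrow> ('r, 'y, 'o, 'a) csect \<Rightarrow> ('r, 'y, 'o, 'a) csect
    \<Rightarrow> ('r ring \<Rightarrow> 'y \<Rightarrow> 'a) \<Rightarrow> bool" where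
  "is_arrow P Y s t f \<longleftrightarrow>
     (\<forall>R y. cring R \<and> y \<in> pts Y R \<longrightarrow> f R y \<in> fib P (sob s R y) (sob t R y)) \<and>
     (\<forall>R R' h y. cring R \<and> cring R' \<and> h \<in> rhom R R' \<and> y \<in> pts Y R \<longrightarrow>
        cmp P (f R y) (sar s R R' h y) = cmp P (sar t R R' h y) (f R' (pull Y R R' h y)))"

text \<open>\<open>Spec R\<close> as a functor, and the sieve on it generated by a covering.\<close>

definition spec :: "'r ring \<Rightarrow> ('r, 'r \<Rightarrow> 'r) pfunctor" where
  "spec R = \<lparr>pts = rhom R, pull = \<lambda>R' R'' k h. compose (carrier R) k h\<rparr>"

definition sieve :: "'r ring \<Rightarrow> ('r ring \<times> ('r \<Rightarrow> 'r)) set \<Rightarrow> ('r, 'r \<Rightarrow> 'r) pfunctor" where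
  "sieve R C = subfunctor (spec R)
     (\<lambda>R'. {compose (carrier R) k h1 | R1 h1 k. (R1, h1) \<in> C \<and> k \<in> rhom R1 R'})"

text \<open>Giraud's definition: restriction of cartesian sections from \<open>Spec R\<close> to a covering sieve is an
  equivalence of categories.\<close>

definition stack :: "('r, 'x) pfunctor \<Rightarrow> ('r, 'x, 'o, 'a) fcat \<Rightarrow> bool" where
  "stack X P \<longleftrightarrow> fibred_in_groupoids X P \<and>
     (\<forall>R x C. cring R \<and> x \<in> pts X R \<and> zariski_cover R C \<longrightarrow>
       (let \<pi> = (\<lambda>R' h. pull X R R' h x) in
        (\<forall>s t f. is_object P (spec R) \<pi> s \<and> is_object P (spec R) \<pi> t \<and> is_arrow P (sieve R C) s t f
          \<longrightarrow> (\<exists>f'. is_arrow P (spec R) s t f' \<and>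
                (\<forall>R'. cring R' \<longrightarrow> (\<forall>h\<in>pts (sieve R C) R'. f' R' h = f R' h)) \<and>
                (\<forall>f''. is_arrow P (spec R) s t f'' \<and>
                   (\<forall>R'. cring R' \<longrightarrow> (\<forall>h\<in>pts (sieve R C) R'. f'' R' h = f R' h))
                   \<longrightarrow> (\<forall>R'. cring R' \<longrightarrow> (\<forall>h\<in>rhom R R'. f'' R' h = f' R' h))))) \<and>
        (\<forall>s. is_object P (sieve R C) \<pi> s \<longrightarrow>
          (\<exists>t f. is_object P (spec R) \<pi> t \<and> is_arrow P (sieve R C) t s f))))"

definition gerbe :: "('r, 'x) pfunctor \<Rightarrow> ('r, 'x, 'o, 'a) fcat \<Rightarrow> bool" where
  "gerbe X P \<longleftrightarrow> stack X P \<and>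
     (\<forall>R x. cring R \<and> x \<in> pts X R \<longrightarrow>
       (\<exists>C. zariski_cover R C \<and>
         (\<forall>(R1, h1)\<in>C. \<exists>a\<in>obs P. brg P a = R1 \<and> bpt P a = pull X R R1 h1 x))) \<and>
     (\<forall>a\<in>obs P. \<forall>b\<in>obs P. brg P a = brg P b \<and> bpt P a = bpt P b \<longrightarrow>
       (\<exists>C. zariski_cover (brg P a) C \<and>
         (\<forall>(R1, h1)\<in>C. \<exists>f\<in>ars P. \<exists>g\<in>ars P. tgt P f = a \<and> tgt P g = b \<and>
            bhom P f = h1 \<and> bhom P g = h1 \<and> brg P (src P f) = R1 \<and> brg P (src P g) = R1 \<and>
            fib P (src P f) (src P g) \<noteq> {})))"

text \<open>An isomorphism of sheaves of groups between \<open>G\<close> and the automorphisms of an object over \<open>Y\<close>.\<close>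

definition is_band ::
  "('r, 'x, 'o, 'a) fcat \<Rightarrow> ('r, 'x, 'g) gfunctor \<Rightarrow> ('r, 'x) pfunctor \<Rightarrow> ('r, 'x, 'o, 'a) csect
    \<Rightarrow> ('r ring \<Rightarrow> 'x \<Rightarrow> 'g \<Rightarrow> 'a) \<Rightarrow> bool" where
  "is_band P G Y s \<theta> \<longleftrightarrow>
     (\<forall>R y. cring R \<and> y \<in> pts Y R \<longrightarrow> \<theta> R y \<in> iso (grp G R y) (aut_group P (sob s R y))) \<and>
     (\<forall>R R' h y g. cring R \<and> cring R' \<and> h \<in> rhom R R' \<and> y \<in> pts Y R \<and> g \<in> carrier (grp G R y) \<longrightarrow>
        cmp P (\<theta> R y g) (sar s R R' h y)
        = cmp P (sar s R R' h y) (\<theta> R' (pull Y R R' h y) (res G R R' h y g)))"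

definition G_gerbe ::
  "('r, 'x) pfunctor \<Rightarrow> ('r, 'x, 'g) gfunctor \<Rightarrow> ('r, 'x, 'o, 'a) fcat
    \<Rightarrow> (('r ring \<Rightarrow> 'x set) \<Rightarrow> ('r, 'x, 'o, 'a) csect \<Rightarrow> 'r ring \<Rightarrow> 'x \<Rightarrow> 'g \<Rightarrow> 'a) \<Rightarrow> bool" where
  "G_gerbe X G P \<theta> \<longleftrightarrow> gerbe X P \<and>
     (\<forall>U s. open_sub X U \<and> is_object P (subfunctor X U) (\<lambda>R x. x) s \<longrightarrow>
        is_band P G (subfunctor X U) s (\<theta> U s))"

definition connected_gerbe :: "('r, 'x) pfunctor \<Rightarrow> ('r, 'x, 'o, 'a) fcat \<Rightarrow> bool" where
  "connected_gerbe X P \<longleftrightarrow> (\<forall>U s t. open_sub X U \<and>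
     is_object P (subfunctor X U) (\<lambda>R x. x) s \<and> is_object P (subfunctor X U) (\<lambda>R x. x) t \<longrightarrow>
     (\<exists>f. is_arrow P (subfunctor X U) s t f))"


section \<open>Connections and curvings\<close>

text \<open>A morphism of stacks \<open>p\<^sub>a\<^sup>*P \<rightarrow> p\<^sub>b\<^sup>*P\<close> over \<open>\<Delta>\<^sup>n\<^bsub>X/S\<^esub>\<close>. An object of \<open>p\<^sub>a\<^sup>*P\<close> over a simplex
  \<open>xs\<close> is an object of \<open>P\<close> over \<open>xs ! a\<close>; an arrow of \<open>p\<^sub>a\<^sup>*P\<close> is an arrow \<open>f\<close> of \<open>P\<close> together with a simplex
  over its target.\<close>

record ('x, 'o, 'a) fmor =
  fob :: "'x list \<Rightarrow> 'o \<Rightarrow> 'o"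
  far :: "'x list \<Rightarrow> 'a \<Rightarrow> 'a"

definition over :: "('r, 'x, 'o, 'a) fcat \<Rightarrow> ('r, 'x list) pfunctor \<Rightarrow> nat \<Rightarrow> 'x list \<Rightarrow> 'o \<Rightarrow> bool"
  where
  "over P D a xs ob \<longleftrightarrow> ob \<in> obs P \<and> xs \<in> pts D (brg P ob) \<and> bpt P ob = xs ! a"

abbreviation pull_along ::
  "('r, 'x, 'o, 'a) fcat \<Rightarrow> ('r, 'x list) pfunctor \<Rightarrow> 'a \<Rightarrow> 'x list \<Rightarrow> 'x list" where
  "pull_along P D f xs \<equiv> pull D (brg P (tgt P f)) (brg P (src P f)) (bhom P f) xs"

locale stack_morphism =
  fixes P :: "('r, 'x, 'o, 'a) fcat" and D :: "('r, 'x list) pfunctor" and a b :: nat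
    and F :: "('x, 'o, 'a) fmor"
  assumes fob: "over P D a xs ob \<Longrightarrow> over P D b xs (fob F xs ob) \<and> brg P (fob F xs ob) = brg P ob"
    and far: "\<lbrakk>f \<in> ars P; over P D a xs (tgt P f)\<rbrakk> \<Longrightarrow> far F xs f \<in> ars P \<and>
      src P (far F xs f) = fob F (pull_along P D f xs) (src P f) \<and>
      tgt P (far F xs f) = fob F xs (tgt P f) \<and> bhom P (far F xs f) = bhom P f"
    and far_idn: "over P D a xs ob \<Longrightarrow> far F xs (idn P ob) = idn P (fob F xs ob)"
    and far_cmp: "\<lbrakk>f \<in> ars P; g \<in> ars P; src P f = tgt P g; over P D a xs (tgt P f)\<rbrakk> \<Longrightarrow>
      far F xs (cmp P f g) = cmp P (far F xs f) (far F (pull_along P D f xs) g)"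

text \<open>A morphism of stacks is an equivalence iff it is one on each fibre.\<close>

definition stack_equivalence ::
  "('r, 'x, 'o, 'a) fcat \<Rightarrow> ('r, 'x list) pfunctor \<Rightarrow> nat \<Rightarrow> nat \<Rightarrow> ('x, 'o, 'a) fmor \<Rightarrow> bool" where
  "stack_equivalence P D a b F \<longleftrightarrow> stack_morphism P D a b F \<and>
     (\<forall>xs c c'. over P D a xs c \<and> over P D a xs c' \<and> brg P c = brg P c' \<longrightarrow>
        bij_betw (far F xs) (fib P c c') (fib P (fob F xs c) (fob F xs c'))) \<and>
     (\<forall>xs e. over P D b xs e \<longrightarrow>
        (\<exists>c. over P D a xs c \<and> brg P c = brg P e \<and> fib P (fob F xs c) e \<noteq> {}))"

text \<open>A connection \<open>\<epsilon>\<close> with the isomorphism \<open>\<eta>\<close> from its restriction to the diagonal to the identity.\<close>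

locale connection =
  fixes X :: "('r, 'x) pfunctor" and p :: "'r ring \<Rightarrow> 'x \<Rightarrow> 's" and P :: "('r, 'x, 'o, 'a) fcat"
    and \<epsilon> :: "('x, 'o, 'a) fmor" and \<eta> :: "'o \<Rightarrow> 'a"
  assumes equivalence: "stack_equivalence P (simplices X p (pts X) 1) 1 0 \<epsilon>"
    and \<eta>_component: "ob \<in> obs P \<Longrightarrow> \<eta> ob \<in> fib P (fob \<epsilon> [bpt P ob, bpt P ob] ob) ob"
    and \<eta>_natural: "f \<in> ars P \<Longrightarrow>
      cmp P (\<eta> (tgt P f)) (far \<epsilon> [bpt P (tgt P f), bpt P (tgt P f)] f) = cmp P f (\<eta> (src P f))"

text \<open>A curving \<open>(K, \<kappa>)\<close>. On the degenerate subsimplex it is trivialized by \<open>\<zeta> : \<kappa> \<Rightarrow> 1\<close>, in such a way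
  that \<open>K\<close> becomes the isomorphism \<open>\<epsilon>\<^sub>0\<^sub>1 \<epsilon>\<^sub>1\<^sub>2 \<Rightarrow> \<epsilon>\<^sub>0\<^sub>2\<close> given by \<open>\<eta>\<close>.\<close>

locale curving =
  fixes X :: "('r, 'x) pfunctor" and p :: "'r ring \<Rightarrow> 'x \<Rightarrow> 's" and P :: "('r, 'x, 'o, 'a) fcat"
    and \<epsilon> :: "('x, 'o, 'a) fmor" and \<eta> :: "'o \<Rightarrow> 'a"
    and \<kappa> :: "('x, 'o, 'a) fmor" and K \<zeta> :: "'x list \<Rightarrow> 'o \<Rightarrow> 'a"
  assumes fake_curvature: "stack_morphism P (simplices X p (pts X) 2) 0 0 \<kappa>"
    and K_component: "over P (simplices X p (pts X) 2) 2 [x0, x1, x2] ob \<Longrightarrow>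
      K [x0, x1, x2] ob \<in> fib P (fob \<epsilon> [x0, x1] (fob \<epsilon> [x1, x2] ob))
                                (fob \<kappa> [x0, x1, x2] (fob \<epsilon> [x0, x2] ob))"
    and K_natural: "\<lbrakk>f \<in> ars P; over P (simplices X p (pts X) 2) 2 [x0, x1, x2] (tgt P f)\<rbrakk> \<Longrightarrow>
      cmp P (K [x0, x1, x2] (tgt P f)) (far \<epsilon> [x0, x1] (far \<epsilon> [x1, x2] f))
      = cmp P (far \<kappa> [x0, x1, x2] (far \<epsilon> [x0, x2] f))
              (K (pull_along P (simplices X p (pts X) 2) f [x0, x1, x2]) (src P f))"
    and \<zeta>_component: "\<lbrakk>over P (simplices X p (pts X) 2) 0 xs ob; degenerate xs\<rbrakk> \<Longrightarrow> \<zeta> xs ob \<in> fib P (fob \<kappa> xs ob) ob"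
    and \<zeta>_natural: "\<lbrakk>f \<in> ars P; over P (simplices X p (pts X) 2) 0 xs (tgt P f); degenerate xs\<rbrakk> \<Longrightarrow>
      cmp P (\<zeta> xs (tgt P f)) (far \<kappa> xs f) = cmp P f (\<zeta> (pull_along P (simplices X p (pts X) 2) f xs) (src P f))"
    and K_degenerate_01: "over P (simplices X p (pts X) 2) 2 [x, x, y] ob \<Longrightarrow>
      cmp P (\<zeta> [x, x, y] (fob \<epsilon> [x, y] ob)) (K [x, x, y] ob) = \<eta> (fob \<epsilon> [x, y] ob)"
    and K_degenerate_12: "over P (simplices X p (pts X) 2) 2 [x, y, y] ob \<Longrightarrow>
      cmp P (\<zeta> [x, y, y] (fob \<epsilon> [x, y] ob)) (K [x, y, y] ob) = far \<epsilon> [x, y] (\<eta> ob)"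


section \<open>Local data\<close>

text \<open>The object \<open>p\<^sub>a\<^sup>*s\<close> over a scheme of simplices, and the image of an object over such a scheme under
  a morphism of stacks.\<close>

definition proj_pull :: "nat \<Rightarrow> ('r, 'x, 'o, 'a) csect \<Rightarrow> ('r, 'x list, 'o, 'a) csect" where
  "proj_pull a s = \<lparr>sob = \<lambda>R xs. sob s R (xs ! a), sar = \<lambda>R R' h xs. sar s R R' h (xs ! a)\<rparr>"

definition image_obj ::
  "('x, 'o, 'a) fmor \<Rightarrow> ('r, 'x list, 'o, 'a) csect \<Rightarrow> ('r, 'x list, 'o, 'a) csect" where
  "image_obj F s = \<lparr>sob = \<lambda>R xs. fob F xs (sob s R xs),
                    sar = \<lambda>R R' h xs. far F xs (sar s R R' h xs)\<rparr>"

text \<open>\<open>\<phi>\<^sub>i\<^sub>j \<gamma> = \<lambda>\<^sub>i\<^sub>j(\<gamma>) \<phi>\<^sub>i\<^sub>j\<close>. A section \<open>\<gamma>\<close> of \<open>G\<close> is regarded as an automorphism of \<open>x\<^sub>j\<close>, resp.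
  \<open>x\<^sub>i\<close>, by means of \<open>\<theta>j\<close>, resp. \<open>\<theta>i\<close>.\<close>

definition lambda_of ::
  "('r, 'x) pfunctor \<Rightarrow> ('r, 'x, 'g) gfunctor \<Rightarrow> ('r, 'x, ('r, 'g) local_aut) gfunctor
    \<Rightarrow> ('r, 'x, 'o, 'a) fcat \<Rightarrow> ('r ring \<Rightarrow> 'x \<Rightarrow> 'g \<Rightarrow> 'a) \<Rightarrow> ('r ring \<Rightarrow> 'x \<Rightarrow> 'g \<Rightarrow> 'a)
    \<Rightarrow> ('r ring \<Rightarrow> 'x \<Rightarrow> 'a) \<Rightarrow> 'r ring \<Rightarrow> 'x \<Rightarrow> ('r, 'g) local_aut" where
  "lambda_of X G A P \<theta>i \<theta>j \<phi>ij R x = (THE u. u \<in> carrier (grp A R x) \<and>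
     (\<forall>R' h. cring R' \<and> h \<in> rhom R R' \<longrightarrow> (let y = pull X R R' h x in
        \<forall>g\<in>carrier (grp G R' y).
          cmp P (\<phi>ij R' y) (\<theta>j R' y g) = cmp P (\<theta>i R' y (u R' h g)) (\<phi>ij R' y))))"

text \<open>\<open>\<phi>\<^sub>i\<^sub>j \<phi>\<^sub>j\<^sub>k = g\<^sub>i\<^sub>j\<^sub>k \<phi>\<^sub>i\<^sub>k\<close>.\<close>

definition cocycle_of ::
  "('r, 'x, 'g) gfunctor \<Rightarrow> ('r, 'x, 'o, 'a) fcat \<Rightarrow> ('r ring \<Rightarrow> 'x \<Rightarrow> 'g \<Rightarrow> 'a)
    \<Rightarrow> ('r ring \<Rightarrow> 'x \<Rightarrow> 'a) \<Rightarrow> ('r ring \<Rightarrow> 'x \<Rightarrow> 'a) \<Rightarrow> ('r ring \<Rightarrow> 'x \<Rightarrow> 'a)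
    \<Rightarrow> 'r ring \<Rightarrow> 'x \<Rightarrow> 'g" where
  "cocycle_of G P \<theta>i \<phi>ij \<phi>jk \<phi>ik R x = (THE g. g \<in> carrier (grp G R x) \<and>
     cmp P (\<phi>ij R x) (\<phi>jk R x) = cmp P (\<theta>i R x g) (\<phi>ik R x))"

text \<open>\<open>\<gamma>\<^sub>i \<epsilon>(g) = m\<^sub>i(g) \<gamma>\<^sub>i\<close>.\<close>

definition m_of ::
  "('r, 'x) pfunctor \<Rightarrow> ('r, 'x, 'g) gfunctor \<Rightarrow> ('r, 'x, ('r, 'g) local_aut) gfunctor
    \<Rightarrow> ('r, 'x, 'o, 'a) fcat \<Rightarrow> ('x, 'o, 'a) fmor \<Rightarrow> ('r ring \<Rightarrow> 'x \<Rightarrow> 'g \<Rightarrow> 'a)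
    \<Rightarrow> ('r ring \<Rightarrow> 'x list \<Rightarrow> 'a) \<Rightarrow> ('r, 'x, ('r, 'g) local_aut) fm" where
  "m_of X G A P \<epsilon> \<theta>i \<gamma>i R xs = (THE u. u \<in> carrier (grp A R (hd xs)) \<and>
     (\<forall>R' h. cring R' \<and> h \<in> rhom R R' \<longrightarrow> (let ys = map (pull X R R' h) xs in
        \<forall>g\<in>carrier (grp G R' (ys ! 1)).
          cmp P (\<gamma>i R' ys) (far \<epsilon> ys (\<theta>i R' (ys ! 1) g))
          = cmp P (\<theta>i R' (ys ! 0) (u R' h g)) (\<gamma>i R' ys))))"

text \<open>\<open>\<gamma>\<^sub>i \<epsilon>(p\<^sub>1\<^sup>*\<phi>\<^sub>i\<^sub>j) = \<gamma>\<^sub>i\<^sub>j p\<^sub>0\<^sup>*\<phi>\<^sub>i\<^sub>j \<gamma>\<^sub>j\<close>.\<close>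

definition gamma_of ::
  "('r, 'x, 'g) gfunctor \<Rightarrow> ('r, 'x, 'o, 'a) fcat \<Rightarrow> ('x, 'o, 'a) fmor
    \<Rightarrow> ('r ring \<Rightarrow> 'x \<Rightarrow> 'g \<Rightarrow> 'a) \<Rightarrow> ('r ring \<Rightarrow> 'x \<Rightarrow> 'a) \<Rightarrow> ('r ring \<Rightarrow> 'x list \<Rightarrow> 'a)
    \<Rightarrow> ('r ring \<Rightarrow> 'x list \<Rightarrow> 'a) \<Rightarrow> ('r, 'x, 'g) fm" where
  "gamma_of G P \<epsilon> \<theta>i \<phi>ij \<gamma>i \<gamma>j R xs = (THE g. g \<in> carrier (grp G R (hd xs)) \<and>
     cmp P (\<gamma>i R xs) (far \<epsilon> xs (\<phi>ij R (xs ! 1)))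
     = cmp P (\<theta>i R (xs ! 0) g) (cmp P (\<phi>ij R (xs ! 0)) (\<gamma>j R xs)))"

text \<open>\<open>\<gamma>\<^sub>i\<^bsup>01\<^esup> \<epsilon>\<^sub>0\<^sub>1(\<gamma>\<^sub>i\<^bsup>12\<^esup>) = B\<^sub>i \<delta>\<^sub>i \<kappa>(\<gamma>\<^sub>i\<^bsup>02\<^esup>) K(p\<^sub>2\<^sup>*x\<^sub>i)\<close>.\<close>

definition B_of ::
  "('r, 'x, 'g) gfunctor \<Rightarrow> ('r, 'x, 'o, 'a) fcat \<Rightarrow> ('x, 'o, 'a) fmor \<Rightarrow> ('x, 'o, 'a) fmor
    \<Rightarrow> ('x list \<Rightarrow> 'o \<Rightarrow> 'a) \<Rightarrow> ('r ring \<Rightarrow> 'x \<Rightarrow> 'g \<Rightarrow> 'a) \<Rightarrow> ('r, 'x, 'o, 'a) csect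
    \<Rightarrow> ('r ring \<Rightarrow> 'x list \<Rightarrow> 'a) \<Rightarrow> ('r ring \<Rightarrow> 'x list \<Rightarrow> 'a) \<Rightarrow> ('r, 'x, 'g) fm" where
  "B_of G P \<epsilon> \<kappa> K \<theta>i xi \<gamma>i \<delta>i R xs = (let x0 = xs ! 0; x1 = xs ! 1; x2 = xs ! 2 in
     THE g. g \<in> carrier (grp G R x0) \<and>
       cmp P (\<gamma>i R [x0, x1]) (far \<epsilon> [x0, x1] (\<gamma>i R [x1, x2]))
       = cmp P (\<theta>i R x0 g) (cmp P (\<delta>i R xs)
           (cmp P (far \<kappa> xs (\<gamma>i R [x0, x2])) (K xs (sob xi R x2)))))"


section \<open>The de Rham differential of an elementary form\<close>

text \<open>Scalar forms are forms with values in the additive group. \<open>elementary f gs\<close> is the form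
  corresponding to \<open>f dg\<^sub>1 \<and> \<dots> \<and> dg\<^sub>n\<close>, where \<open>gs\<close> lists \<open>g\<^sub>n, \<dots>, g\<^sub>1\<close> and values are taken in a fixed ring.\<close>

fun elementary :: "('r, 'm) ring_scheme \<Rightarrow> ('x \<Rightarrow> 'r) \<Rightarrow> ('x \<Rightarrow> 'r) list \<Rightarrow> 'x list \<Rightarrow> 'r" where
  "elementary R f [] xs = f (xs ! 0)"
| "elementary R f (g # gs) xs = elementary R f gs (take (Suc (length gs)) xs) \<otimes>\<^bsub>R\<^esub>
     (g (xs ! Suc (length gs)) \<ominus>\<^bsub>R\<^esub> g (xs ! length gs))"

lemma (in abelian_group) foldr_add_Suc:
  assumes "\<And>i. i < Suc k \<Longrightarrow> t i \<in> carrier G"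
  shows "foldr (\<lambda>i acc. t i \<oplus> acc) [0..<Suc k] \<zero> = foldr (\<lambda>i acc. t i \<oplus> acc) [0..<k] \<zero> \<oplus> t k"
    and "foldr (\<lambda>i acc. t i \<oplus> acc) [0..<k] \<zero> \<in> carrier G"
proof -
  have *: "foldr (\<lambda>i acc. t i \<oplus> acc) l z = foldr (\<lambda>i acc. t i \<oplus> acc) l \<zero> \<oplus> z \<and>
      foldr (\<lambda>i acc. t i \<oplus> acc) l \<zero> \<in> carrier G"
    if "set l \<subseteq> {..<Suc k}" "z \<in> carrier G" for l z
    using that by (induction l) (auto simp: assms a_assoc)
  show "foldr (\<lambda>i acc. t i \<oplus> acc) [0..<Suc k] \<zero>
      = foldr (\<lambda>i acc. t i \<oplus> acc) [0..<k] \<zero> \<oplus> t k"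
    using *[of "[0..<k]" "t k \<oplus> \<zero>"] assms[of k] by (simp add: atLeast0LessThan lessThan_subset_iff)
  show "foldr (\<lambda>i acc. t i \<oplus> acc) [0..<k] \<zero> \<in> carrier G"
    using *[of "[0..<k]" \<zero>] by (simp add: atLeast0LessThan lessThan_subset_iff)
qed

lemma (in cring) elementary_closed:
  assumes "\<And>y. f y \<in> carrier R" "\<And>g y. g \<in> set gs \<Longrightarrow> g y \<in> carrier R"
  shows "elementary R f gs xs \<in> carrier R"
  using assms(2) by (induction gs arbitrary: xs) (auto simp: assms(1))

lemma (in cring) foldr_add_mult:
  assumes "\<And>i. i < k \<Longrightarrow> t i \<in> carrier R" "c \<in> carrier R"
  shows "foldr (\<lambda>i acc. (t i \<otimes> c) \<oplus> acc) [0..<k] \<zero> = foldr (\<lambda>i acc. t i \<oplus> acc) [0..<k] \<zero> \<otimes> c"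
  using assms(1)
proof (induction k)
  case (Suc k)
  have "foldr (\<lambda>i acc. (t i \<otimes> c) \<oplus> acc) [0..<Suc k] \<zero>
      = foldr (\<lambda>i acc. (t i \<otimes> c) \<oplus> acc) [0..<k] \<zero> \<oplus> t k \<otimes> c"
    by (rule foldr_add_Suc) (simp add: Suc.prems assms(2))
  moreover have "foldr (\<lambda>i acc. t i \<oplus> acc) [0..<Suc k] \<zero>
      = foldr (\<lambda>i acc. t i \<oplus> acc) [0..<k] \<zero> \<oplus> t k"
    by (rule foldr_add_Suc) (simp add: Suc.prems)
  moreover have "foldr (\<lambda>i acc. t i \<oplus> acc) [0..<k] \<zero> \<in> carrier R"
    by (rule foldr_add_Suc(2)) (simp add: Suc.prems)
  ultimately show ?case
    using Suc.prems[of k] Suc.IH Suc.prems assms(2) by (simp add: l_distr)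
qed (simp add: assms(2))

lemma de_rham_elementary:
  fixes R :: "'r ring" (structure) and F :: "('r, 'x, 'r) gfunctor"
  assumes "cring R" and F: "\<And>y. grp F R y = add_monoid R"
    and f: "\<And>y. f y \<in> carrier R" and gs: "\<And>g y. g \<in> set gs \<Longrightarrow> g y \<in> carrier R"
    and "length xs = length gs + 2"
  shows "de_rham F (\<lambda>_. elementary R f gs) R xs = elementary R (\<lambda>_. \<one>) (gs @ [f]) xs"
proof -
  interpret cring R by fact
  have minus: "inv\<^bsub>\<lparr>carrier = carrier R, mult = (\<oplus>), one = \<zero>\<rparr>\<^esub> y = \<ominus> y" for y by (simp add: a_inv_def)
  show ?thesis using gs assms(5)
  proof (induction gs arbitrary: xs)
    case Nil
    then obtain x0 x1 where xs: "xs = [x0, x1]"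
      by (auto simp: numeral_2_eq_2 length_Suc_conv)
    show ?case
      using f by (simp add: xs de_rham_def alternating_factor_def omit_def F upt_rec
          minus minus_eq)
  next
    case (Cons g gs)
    define n where "n = length gs"
    define e where "e = elementary R f gs"
    define ys where "ys = take (Suc (Suc n)) xs"
    define t where "t = (\<lambda>i. if even i then e (omit i ys) else \<ominus> e (omit i ys))"
    define t' where "t' = (\<lambda>i. if even i then elementary R f (g # gs) (omit i xs)
        else \<ominus> elementary R f (g # gs) (omit i xs))"
    let ?S = "\<lambda>t k. foldr (\<lambda>i acc. t i \<oplus> acc) [0..<k] \<zero>"
    have len: "length xs = Suc (Suc (Suc n))" "length ys = Suc (Suc n)"
      using Cons.prems(2) by (simp_all add: n_def ys_def)
    have e: "e zs \<in> carrier R" for zs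
      unfolding e_def by (rule elementary_closed) (use f Cons.prems in auto)
    have g: "g y \<in> carrier R" for y using Cons.prems(1) by simp
    have t: "t i \<in> carrier R" for i using e by (simp add: t_def)
    have t': "t' i \<in> carrier R" for i
      unfolding t'_def using elementary_closed[of f "g # gs"] f Cons.prems(1) by simp
    have unf: "elementary R f (g # gs) zs = e (take (Suc n) zs) \<otimes> (g (zs ! Suc n) \<ominus> g (zs ! n))" for zs
      by (simp add: e_def n_def)
    note elementary.simps [simp del]
    define a b c where "a = g (xs ! (Suc (Suc n)))" and "b = g (xs ! (Suc n))" and "c = g (xs ! n)"
    have abc: "a \<in> carrier R" "b \<in> carrier R" "c \<in> carrier R"
      using g by (simp_all add: a_def b_def c_def)
    have low: "t' i = t i \<otimes> (a \<ominus> b)" if "i < Suc n" for i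
    proof -
      have 1: "take (Suc n) (omit i xs) = omit i ys"
        using that len by (auto simp: omit_def ys_def take_drop min_def)
      have 2: "omit i xs ! Suc n = xs ! (Suc (Suc n))" "omit i xs ! n = xs ! (Suc n)"
        using that len by (auto simp: omit_def nth_append)
      show ?thesis
        using e abc g by (simp add: t'_def t_def unf 1 2 a_def b_def c_def l_minus)
    qed
    have o1: "elementary R f (g # gs) (omit (Suc n) xs) = e (omit (Suc n) ys) \<otimes> (a \<ominus> c)"
    proof -
      have 1: "take (Suc n) (omit (Suc n) xs) = omit (Suc n) ys"
        using len by (auto simp: omit_def ys_def)
      have 2: "omit (Suc n) xs ! Suc n = xs ! (Suc (Suc n))" "omit (Suc n) xs ! n = xs ! n"
        using len by (auto simp: omit_def nth_append)
      show ?thesis by (simp add: unf 1 2 a_def b_def c_def)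
    qed
    have o2: "elementary R f (g # gs) (omit (Suc (Suc n)) xs) = e (omit (Suc n) ys) \<otimes> (b \<ominus> c)"
    proof -
      have 1: "take (Suc n) (omit (Suc (Suc n)) xs) = omit (Suc n) ys"
        using len by (auto simp: omit_def ys_def)
      have 2: "omit (Suc (Suc n)) xs ! Suc n = xs ! (Suc n)" "omit (Suc (Suc n)) xs ! n = xs ! n"
        using len by (auto simp: omit_def nth_append)
      show ?thesis by (simp add: unf 1 2 a_def b_def c_def)
    qed
    have high: "t' (Suc n) \<oplus> t' (Suc (Suc n)) = t (Suc n) \<otimes> (a \<ominus> b)"
    proof -
      let ?e = "e (omit (Suc n) ys)"
      note simps = t'_def t_def o1 o2 e abc
      show ?thesis
      proof (cases "even n")
        case True
        have "\<ominus> (?e \<otimes> (a \<ominus> c)) \<oplus> ?e \<otimes> (b \<ominus> c) = \<ominus> ?e \<otimes> (a \<ominus> b)"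
          using e[of "omit (Suc n) ys"] abc by algebra
        then show ?thesis using True by (simp add: simps)
      next
        case False
        have "?e \<otimes> (a \<ominus> c) \<oplus> \<ominus> (?e \<otimes> (b \<ominus> c)) = ?e \<otimes> (a \<ominus> b)"
          using e[of "omit (Suc n) ys"] abc by algebra
        then show ?thesis using False by (simp add: simps)
      qed
    qed
    have St: "?S t k \<in> carrier R" "?S t' k \<in> carrier R" for k
      by (rule foldr_add_Suc(2), simp add: t t')+
    have "de_rham F (\<lambda>_. elementary R f (g # gs)) R xs = ?S t' (Suc (Suc (Suc n)))"
      by (simp add: de_rham_def alternating_factor_def F t'_def len minus del: upt_Suc cong: if_cong)
    also have "?S t' (Suc (Suc (Suc n))) = ?S t' (Suc n) \<oplus> (t' (Suc n) \<oplus> t' (Suc (Suc n)))"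
      using foldr_add_Suc(1)[of "Suc (Suc n)" t'] foldr_add_Suc(1)[of "Suc n" t'] t' St
      by (simp only: a_assoc)
    also have "?S t' (Suc n) = ?S (\<lambda>i. t i \<otimes> (a \<ominus> b)) (Suc n)"
      by (rule foldr_cong) (auto simp: low simp del: upt_Suc)
    also have "\<dots> = ?S t (Suc n) \<otimes> (a \<ominus> b)"
      by (rule foldr_add_mult) (use t abc in auto)
    also have "?S t (Suc n) \<otimes> (a \<ominus> b) \<oplus> (t' (Suc n) \<oplus> t' (Suc (Suc n)))
        = (?S t (Suc n) \<oplus> t (Suc n)) \<otimes> (a \<ominus> b)"
      using high t abc St by (simp add: l_distr del: upt_Suc)
    also have "?S t (Suc n) \<oplus> t (Suc n) = ?S t (Suc (Suc n))"
      using foldr_add_Suc(1)[of "Suc n" t] t by (simp del: upt_Suc)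
    also have "\<dots> = de_rham F (\<lambda>_. e) R ys"
      by (simp add: de_rham_def alternating_factor_def F t_def len minus
          del: upt_Suc cong: if_cong)
    also have "\<dots> = elementary R (\<lambda>_. \<one>) (gs @ [f]) ys"
      unfolding e_def by (rule Cons.IH) (use Cons.prems len in \<open>auto simp: n_def\<close>)
    finally show ?case
      by (simp add: elementary.simps a_def b_def c_def ys_def n_def)
  qed
qed

end

theory Submission
  imports Defs "HOL-Algebra.Weak_Morphisms"
begin

text \<open>The points of \<open>G\<close> over an affine infinitesimal simplex that are congruent to \<open>1\<close> modulo powers of
 its nilpotent ideal filter the group of points. A \<open>k\<close>-form takes its values in the \<open>k\<close>-th
 step; commutators, and differences \<open>u(g) g\<inverse>\<close> with an automorphism congruent to the identity, add
 degrees. So every identity between forms is a computation with products of finitely many elements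
 of a filtered group, most of which commute, and one compares exponents. Both sides of an equation
 between local data are moreover sections describing the same composite of arrows of the gerbe, which
 determines the section. The Bianchi identities need in addition \<open>[B, B] = 0\<close>, which is where
 \<open>2\<close> has to be invertible.\<close>

\<comment> \<open>No coordinates on \<open>G\<close> near its unit are chosen, so no Taylor
  expansion can show that a \<open>k\<close>-form has degree \<open>k\<close>: a form is only known
  to be \<open>1\<close> on degenerate simplices. The substitute is to replace a vertex by a pair of
  neighbouring vertices over R x_{R/J} R. One projection is then degenerate, and a section is
  determined by its two projections. This determination is proved inside affine opens, hence the
  detour through simplices lying in one affine open, from which equalities of forms descend along
  Zariski coverings. The ideal of an n-simplex has vanishing (n+1)-st power; this is the origin of
  the bounds on \<open>c\<close> in the group calculus. Signs come from transposing vertices: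
  reversing a simplex exchanges the two factors of a bracket, which makes [B, B] symmetric and
  exchanges [B, \<gamma>] with [\<gamma>, B] in the transformation law of \<omega>. The relations
  between the local data enter this calculus through three identities only, on vertices and edges:
  one for a pair of indices, two for a triple.\<close>
syntax "_index" :: "logic => index" ("\<^sub>_" [1000] 1000)

notation mult (infixl "**\<index>" 70)

abbreviation "cmps R k h == compose (carrier R) k h"

section \<open>Rings\<close>

lemma rhom_ring_hom: "h : rhom R R' ==> h : ring_hom R R'"
 by (simp add: rhom_def)

lemma rhom_cring: "cring R ==> cring R' ==> h : rhom R R' ==> ring_hom_cring R R' h"
 by (simp add: rhom_def ring_hom_cring_def ring_hom_cring_axioms_def)

lemma rhom_closed: "h : rhom R R' ==> r : carrier R ==> h r : carrier R'"
 by (meson rhom_ring_hom ring_hom_closed)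

lemma rhom_zero: "cring R ==> cring R' ==> h : rhom R R' ==> h \<zero>\<^sub>R = \<zero>\<^sub>R'"
 using ring_hom_zero rhom_ring_hom by (metis cring.axioms(1))

lemma rhom_one: "h : rhom R R' ==> h \<one>\<^sub>R = \<one>\<^sub>R'"
 by (simp add: rhom_ring_hom ring_hom_one)

lemma rhom_mult: "h : rhom R R' ==> a : carrier R ==> b : carrier R ==>
  h (a **\<^sub>R b) = h a **\<^sub>R' h b"
 by (simp add: rhom_ring_hom ring_hom_mult)

lemma rhom_minus: "cring R ==> cring R' ==> h : rhom R R' ==> a : carrier R ==> b : carrier R ==>
  h (a \<ominus>\<^sub>R b) = h a \<ominus>\<^sub>R' h b"
proof -
 assume *: "cring R" "cring R'" "h : rhom R R'" and ab: "a : carrier R" "b : carrier R"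
 interpret ring_hom_cring R R' h by (rule rhom_cring[OF *])
 show ?thesis using ab by (simp add: R.minus_eq S.minus_eq)
qed

lemma compose_app: "r : carrier R ==> cmps R k h r = k (h r)"
 by (simp add: compose_def)

lemma rid_rhom: "cring R ==> rid R : rhom R R"
 unfolding rid_def rhom_def ring_hom_def
 by (auto simp: cring_def ring.ring_simprules)

lemma rid_app: "r : carrier R ==> rid R r = r"
 by (simp add: rid_def)

lemma compose_rid: "h : rhom R R' ==> cmps R (rid R') h = h"
 "h : rhom R R' ==> cmps R h (rid R) = h"
 using rhom_closed[of h R R']
 by (auto simp: rid_def rhom_def compose_def extensional_def fun_eq_iff)

lemma rhom_eqI: "f : rhom R R' ==> g : rhom R R' ==> (!!r. r : carrier R ==> f r = g r) ==> f = g"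
 by (auto simp: rhom_def intro: extensionalityI)

lemma restrict_rhom: "cring R ==> h : ring_hom R R' ==> restrict h (carrier R) : rhom R R'"
 unfolding rhom_def ring_hom_def by (auto simp: cring_def ring.ring_simprules)

lemma compose_assoc_rhom: "h : rhom R R' ==>
  cmps R l (cmps R k h) = cmps R (cmps R' l k) h"
 using rhom_closed[of h R R'] by (auto simp: compose_def fun_eq_iff)

lemma (in cring) eq_of_diff_zero:
 assumes "a : carrier R" "b : carrier R" "a \<ominus> b = \<zero>" shows "a = b"
proof -
 have "a = (a \<ominus> b) \<oplus> b" using assms(1,2) by algebra
 then show ?thesis using assms by simp
qed

lemma rhom_comp:
 assumes "cring R" "h : rhom R R'" "k : rhom R' R''"
 shows "cmps R k h : rhom R R''"
 using restrict_rhom[OF assms(1) ring_hom_trans[OF rhom_ring_hom rhom_ring_hom, OF assms(2,3)]]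
 by (simp add: compose_def comp_def)

text \<open>Quotients and fibre products are first built on cosets or on pairs. An injection of
  their carrier into the type of test rings turns them into rings at which points can be
  evaluated.\<close>

lemma image_ring_iso_cring:
 assumes "cring Q" "inj_on f (carrier Q)"
 shows "cring (image_ring f Q)" and "f : ring_iso Q (image_ring f Q)"
proof -
 interpret cring Q by fact
 show *: "f : ring_iso Q (image_ring f Q)" by (rule inj_imp_image_ring_iso[OF assms(2)])
 show "cring (image_ring f Q)"
  using ring_iso_imp_img_cring[OF *] by (simp add: image_ring_def image_group_def monoid.defs)
qed

text \<open>A quotient is known only as a surjection \<open>q\<close>, so the factorisation is
  defined through a set-theoretic section of \<open>q\<close>; the kernel condition makes its choice
  immaterial.\<close>

lemma factor_through:
 assumes "cring R" "cring Q" "cring Q'" and q: "q : rhom R Q" "q ` carrier R = carrier Q"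
  and f: "f : rhom R Q'" and ker: "!!r. r : carrier R ==> q r = \<zero>\<^sub>Q ==> f r = \<zero>\<^sub>Q'"
 obtains k where "k : rhom Q Q'" "f = cmps R k q"
proof -
 interpret q: ring_hom_cring R Q q by (rule rhom_cring) fact+
 interpret f: ring_hom_cring R Q' f by (rule rhom_cring) fact+
 have eq: "f a = f b" if "a : carrier R" "b : carrier R" "q a = q b" for a b
 proof -
  have "q (a \<ominus>\<^sub>R b) = \<zero>\<^sub>Q" using that by (simp add: q.R.minus_eq q.S.r_neg)
  then have "f (a \<ominus>\<^sub>R b) = \<zero>\<^sub>Q'" using ker that by simp
  then have "f a \<ominus>\<^sub>Q' f b = \<zero>\<^sub>Q'"
   by (rule trans[OF sym[OF rhom_minus[OF assms(1,3) f that(1,2)]]])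
  then show ?thesis using that f.S.eq_of_diff_zero by simp
 qed
 define s where "s = inv_into (carrier R) q"
 have s: "s y : carrier R" "q (s y) = y" if "y : carrier Q" for y
  using that q(2) by (auto simp: s_def inv_into_into f_inv_into_f)
 define k where "k = (\<lambda>y\<in>carrier Q. f (s y))"
 have kq: "k (q a) = f a" if "a : carrier R" for a
  using that s[of "q a"] by (auto simp: k_def intro: eq)
 have k: "k : rhom Q Q'"
 proof -
  have "k : ring_hom Q Q'"
  proof (rule ring_hom_memI)
   fix y assume "y : carrier Q" then show "k y : carrier Q'" by (simp add: k_def s)
  next
   fix y z assume yz: "y : carrier Q" "z : carrier Q"
   have "k (y **\<^sub>Q z) = k (q (s y **\<^sub>R s z))" using yz by (simp add: s)
   also have "... = k y **\<^sub>Q' k z" using yz by (subst kq) (simp_all add: s k_def)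
   finally show "k (y **\<^sub>Q z) = k y **\<^sub>Q' k z" .
   have "k (y \<oplus>\<^sub>Q z) = k (q (s y \<oplus>\<^sub>R s z))" using yz by (simp add: s)
   also have "... = k y \<oplus>\<^sub>Q' k z" using yz by (subst kq) (simp_all add: s k_def)
   finally show "k (y \<oplus>\<^sub>Q z) = k y \<oplus>\<^sub>Q' k z" .
  next
   show "k \<one>\<^sub>Q = \<one>\<^sub>Q'" using kq[of "\<one>\<^sub>R"] by simp
  qed
  then show ?thesis by (simp add: rhom_def k_def)
 qed
 show thesis
 proof (rule that[OF k])
  show "f = cmps R k q"
   by (rule rhom_eqI[OF f rhom_comp[OF assms(1) q(1) k]]) (simp add: compose_app kq)
 qed
qed

text \<open>The elements of \<open>R Quot I\<close> are cosets, hence of the wrong type. Choosing an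
  element of each coset is injective because distinct cosets are disjoint, and transports the
  quotient to a ring of the required type.\<close>

lemma ex_quotient:
 fixes R :: "'r ring" (structure)
 assumes R: "cring R" and I: "ideal I R"
 obtains Q :: "'r ring" and q where "cring Q" "q : rhom R Q" "q ` carrier R = carrier Q"
  "!!r. r : carrier R ==> q r = \<zero>\<^sub>Q \<longleftrightarrow> r : I"
proof -
 interpret cring R by fact
 interpret I: ideal I R by fact
 define F where "F = R Quot I"
 have F: "cring F" unfolding F_def by (rule I.quotient_is_cring[OF R])
 have car: "carrier F = (%a. I +> a) ` carrier R"
  by (auto simp: F_def FactRing_def A_RCOSETS_def')
 define c where "c C = (SOME x. x : C)" for C :: "'r set"
 have c: "c C : C" if C: "C : carrier F" for C
 proof -
  obtain a where a: "a : carrier R" "C = I +> a" using C by (auto simp: car)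
  have "a : C" using I.a_rcos_self[OF a(1)] a(2) by simp
  then show ?thesis unfolding c_def by (rule someI)
 qed
 have inj: "inj_on c (carrier F)"
 proof (rule inj_onI)
  fix C D assume C: "C : carrier F" "D : carrier F" and eq: "c C = c D"
  obtain a b where ab: "a : carrier R" "b : carrier R" "C = I +> a" "D = I +> b"
   using C car by auto
  have "c C : I +> a" "c C : I +> b" using C(1,2)[THEN c] ab eq by auto
  then show "C = D"
   using ab a_repr_independence[OF _ _ I.a_subgroup] by metis
 qed
 define Q where "Q = image_ring c F"
 have Q: "cring Q" and iso: "c : ring_iso F Q"
  unfolding Q_def by (rule image_ring_iso_cring[OF F inj])+
 have h0: "(+>) I : ring_hom R F" unfolding F_def by (rule I.rcos_ring_hom)
 define q where "q = restrict (%a. c (I +> a)) (carrier R)"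
 have "(%a. c (I +> a)) : ring_hom R Q"
  using ring_hom_trans[OF h0, of c Q] iso by (simp add: ring_iso_def comp_def)
 then have q: "q : rhom R Q" unfolding q_def by (rule restrict_rhom[OF R])
 show thesis
 proof (rule that[OF Q q])
  show "q ` carrier R = carrier Q"
   using iso car by (auto simp: q_def ring_iso_def bij_betw_def)
 next
  fix r assume r: "r : carrier R"
  have "\<zero>\<^sub>Q = c \<zero>\<^sub>F" by (simp add: Q_def image_ring_zero)
  moreover have "\<zero>\<^sub>F : carrier F" "I +> r : carrier F"
   using cring.cring_simprules(2)[OF F] r by (auto simp: car)
  ultimately have "q r = \<zero>\<^sub>Q \<longleftrightarrow> I +> r = \<zero>\<^sub>F"
   using r inj_on_eq_iff[OF inj] by (simp add: q_def)
  also have "... \<longleftrightarrow> r : I"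
   using r I.a_rcos_const I.rcos_const_imp_mem by (auto simp: F_def FactRing_def)
  finally show "q r = \<zero>\<^sub>Q \<longleftrightarrow> r : I" .
 qed
qed

text \<open>\<open>T = R \<times>\<^bsub>R/J\<^esub> R\<close>, the ring of pairs congruent modulo \<open>J\<close>.\<close>

locale fibre_square =
 fixes R :: "'r ring" (structure) and J :: "'r set" and T :: "'r ring" and p1 p2 :: "'r => 'r"
 assumes R: "cring R" and T: "cring T" and J: "ideal J R"
  and p1: "p1 : rhom T R" and p2: "p2 : rhom T R"
  and diff: "t : carrier T ==> p2 t \<ominus> p1 t : J"
  and ex: "a : carrier R ==> b : carrier R ==> b \<ominus> a : J ==>
   EX t:carrier T. p1 t = a & p2 t = b"
  and inj: "t : carrier T ==> t' : carrier T ==> p1 t = p1 t' ==> p2 t = p2 t' ==> t = t'"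
begin

sublocale p1: ring_hom_cring T R p1 by (rule rhom_cring[OF T R p1])
sublocale p2: ring_hom_cring T R p2 by (rule rhom_cring[OF T R p2])
sublocale J: ideal J R by (rule J)

text \<open>Universal property of the fibre product. As \<open>T\<close> is given only by axioms,
  the map is chosen pointwise; joint injectivity of the projections makes it a homomorphism.\<close>

lemma pair:
 assumes Q: "cring Q" and f: "f : rhom Q R" and g: "g : rhom Q R"
  and fg: "!!q. q : carrier Q ==> g q \<ominus> f q : J"
 obtains k where "k : rhom Q T" "cmps Q p1 k = f" "cmps Q p2 k = g"
proof -
 have "ALL q:carrier Q. EX t:carrier T. p1 t = f q & p2 t = g q"
  using ex fg rhom_closed[OF f] rhom_closed[OF g] by blast
 then obtain k0 where k0: "ALL q:carrier Q. k0 q : carrier T & p1 (k0 q) = f q & p2 (k0 q) = g q"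
  by metis
 interpret f: ring_hom_cring Q R f by (rule rhom_cring[OF Q R f])
 interpret g: ring_hom_cring Q R g by (rule rhom_cring[OF Q R g])
 have "k0 : ring_hom Q T"
 proof (rule ring_hom_memI)
  fix x y assume xy: "x : carrier Q" "y : carrier Q"
  show "k0 (x **\<^sub>Q y) = k0 x **\<^sub>T k0 y" by (rule inj) (simp_all add: k0 xy)
  show "k0 (x \<oplus>\<^sub>Q y) = k0 x \<oplus>\<^sub>T k0 y" by (rule inj) (simp_all add: k0 xy)
 next
  show "k0 \<one>\<^sub>Q = \<one>\<^sub>T" by (rule inj) (simp_all add: k0)
 qed (simp add: k0)
 then have k: "restrict k0 (carrier Q) : rhom Q T" by (rule restrict_rhom[OF Q])
 show thesis
 proof (rule that[OF k])
  show "cmps Q p1 (restrict k0 (carrier Q)) = f"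
   by (rule rhom_eqI[OF rhom_comp[OF Q k p1] f]) (simp add: compose_app k0)
  show "cmps Q p2 (restrict k0 (carrier Q)) = g"
   by (rule rhom_eqI[OF rhom_comp[OF Q k p2] g]) (simp add: compose_app k0)
 qed
qed

definition diag :: "'r => 'r" where
 "diag = (SOME k. k : rhom R T & cmps R p1 k = rid R & cmps R p2 k = rid R)"

lemma diag: "diag : rhom R T" "cmps R p1 diag = rid R" "cmps R p2 diag = rid R"
proof -
 obtain k where "k : rhom R T" "cmps R p1 k = rid R" "cmps R p2 k = rid R"
  by (rule pair[OF R rid_rhom[OF R] rid_rhom[OF R]])
   (auto simp: rid_app p1.S.minus_eq p1.S.r_neg)
 then have "EX k. k : rhom R T & cmps R p1 k = rid R & cmps R p2 k = rid R"
  by blast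
 from someI_ex[OF this]
 show "diag : rhom R T" "cmps R p1 diag = rid R" "cmps R p2 diag = rid R"
  unfolding diag_def by auto
qed

sublocale diag: ring_hom_cring R T diag by (rule rhom_cring[OF R T diag(1)])

lemma p_diag: "r : carrier R ==> p1 (diag r) = r" "r : carrier R ==> p2 (diag r) = r"
 using fun_cong[OF diag(2), of r] fun_cong[OF diag(3), of r] by (simp_all add: compose_app rid_app)

lemma p_surj: "p1 ` carrier T = carrier R" "p2 ` carrier T = carrier R"
proof -
 have "r = p1 (diag r)" "r = p2 (diag r)" "diag r : carrier T" if "r : carrier R" for r
  using that by (simp_all add: p_diag)
 then show "p1 ` carrier T = carrier R" "p2 ` carrier T = carrier R"
  using p1.hom_closed p2.hom_closed by blast+
qed

lemma ker_ideal: "ideal {t : carrier T. p1 t = \<zero>} T" "ideal {t : carrier T. p2 t = \<zero>} T"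
 using p1.ring.kernel_is_ideal p2.ring.kernel_is_ideal
 unfolding a_kernel_def kernel_def by simp_all

lemma ker_Int: "Idl \<^sub>T {t : carrier T. p1 t = \<zero>} Int Idl \<^sub>T {t : carrier T. p2 t = \<zero>} = {\<zero>\<^sub>T}"
proof -
 have "Idl \<^sub>T {t : carrier T. p1 t = \<zero>} = {t : carrier T. p1 t = \<zero>}"
  "Idl \<^sub>T {t : carrier T. p2 t = \<zero>} = {t : carrier T. p2 t = \<zero>}"
  by (rule subset_antisym[OF p1.R.genideal_minimal[OF _ subset_refl] p1.R.genideal_self];
   (rule ker_ideal | blast))+
 then show ?thesis using inj[of _ "\<zero>\<^sub>T"] by auto
qed

text \<open>Differences of the two projections lie in \<open>J\<close> and are killed by
  \<open>K\<close>, so the projections agree on the whole ideal generated by the diagonal copy of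
  \<open>K\<close>. An element of it with first projection \<open>0\<close> is therefore
  \<open>0\<close>.\<close>

lemma ker_Int_diag:
 assumes K: "K <= carrier R" and KJ: "!!k j. k : K ==> j : J ==> k ** j = \<zero>"
 shows "Idl \<^sub>T {t : carrier T. p1 t = \<zero>} Int Idl \<^sub>T (diag ` K) = {\<zero>\<^sub>T}"
proof -
 have 1: "Idl \<^sub>T {t : carrier T. p1 t = \<zero>} <= {t : carrier T. p1 t = \<zero>}"
  using p1.R.genideal_minimal[OF ker_ideal(1)] by blast
 \<comment> \<open>Equality of the projections alone is not stable under multiplication by
   \<open>T\<close>; the annihilation clause makes this set an ideal.\<close>
 let ?D = "{t : carrier T. p1 t = p2 t & (ALL j:J. p1 t ** j = \<zero>)}"
 have 3: "p2 t ** p2 x = p2 t ** p1 x" if "t : carrier T" "x : carrier T"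
  "ALL j:J. p2 t ** j = \<zero>" for t x
 proof -
  have "p2 t ** (p2 x \<ominus> p1 x) = \<zero>" using that diff by blast
  then have "p2 t ** p2 x \<oplus> \<ominus> (p2 t ** p1 x) = \<zero>"
   using that by (simp add: p1.S.minus_eq p1.S.r_distr p1.S.r_minus)
  then show ?thesis using that p1.S.eq_of_diff_zero by (simp add: p1.S.minus_eq)
 qed
 have "ideal ?D T"
 proof (rule idealI)
  show "ring T" by (rule p1.R.ring_axioms)
  show "subgroup ?D (add_monoid T)"
   by (rule p1.R.add.subgroupI)
    (auto simp: p1.S.l_distr p1.S.l_minus simp flip: a_inv_def intro!: exI[of _ "\<zero>\<^sub>T"])
  fix a x assume a: "a : ?D" and x: "x : carrier T"
  have a1: "a : carrier T" "p1 a = p2 a" "ALL j:J. p2 a ** j = \<zero>" using a by auto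
  have "p2 a ** p2 x = p2 a ** p1 x" by (rule 3[OF a1(1) x a1(3)])
  moreover have "p1 x ** p2 a ** j = \<zero>" if "j : J" for j
   using a1 x that by (simp add: p1.S.m_assoc)
  ultimately show "x **\<^sub>T a : ?D" "a **\<^sub>T x : ?D"
   using x a1 by (auto simp: p1.S.m_comm[of "p1 x"] p1.S.m_comm[of "p2 x"])
 qed
 then have "Idl \<^sub>T (diag ` K) <= ?D"
  by (rule p1.R.genideal_minimal) (use K KJ in "auto simp: p_diag")
 then have x0: "x = \<zero>\<^sub>T" if "x : Idl \<^sub>T {t : carrier T. p1 t = \<zero>} Int Idl \<^sub>T (diag ` K)" for x
 proof -
  have "x : carrier T" "p1 x = \<zero>" "p1 x = p2 x"
   using \<open>Idl \<^sub>T (diag ` K) <= ?D\<close> 1 that by blast+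
  then show ?thesis using inj[of x "\<zero>\<^sub>T"] by simp
 qed
 moreover have "ideal (Idl \<^sub>T {t : carrier T. p1 t = \<zero>}) T"
  by (rule p1.R.genideal_ideal) auto
 moreover have "ideal (Idl \<^sub>T (diag ` K)) T"
  by (rule p1.R.genideal_ideal) (use K in auto)
 ultimately have "\<zero>\<^sub>T : Idl \<^sub>T {t : carrier T. p1 t = \<zero>} Int Idl \<^sub>T (diag ` K)"
  by (simp add: additive_subgroup.zero_closed[OF ideal.axioms(1)])
 then show ?thesis by (intro subset_antisym subsetI singletonI) (simp_all only: x0 singleton_iff)
qed

end

text \<open>Pairs have to be encoded again as elements of the type of test rings; an infinite type
  is in bijection with its square.\<close>

lemma ex_fibre_square:
 fixes R :: "'r ring" (structure)
 assumes inf: "infinite (UNIV :: 'r set)" and R: "cring R" and J: "ideal J R"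
 obtains T p1 p2 where "fibre_square R J T p1 p2"
proof -
 interpret cring R by fact
 interpret J: ideal J R by fact
 define P where "P = \<lparr>carrier = {(a, b). a : carrier R & b : carrier R & b \<ominus> a : J},
  mult = %(a, b) (c, d). (a ** c, b ** d), one = (\<one>, \<one>), ring.zero = (\<zero>, \<zero>),
  ring.add = %(a, b) (c, d). (a \<oplus> c, b \<oplus> d)\<rparr>"
 have sum: "b \<oplus> d \<ominus> (a \<oplus> c) : J" if "a : carrier R" "b : carrier R" "c : carrier R" "d : carrier R"
  "b \<ominus> a : J" "d \<ominus> c : J" for a b c d
 proof -
  have "b \<oplus> d \<ominus> (a \<oplus> c) = (b \<ominus> a) \<oplus> (d \<ominus> c)" using that by algebra
  then show ?thesis using that by simp
 qed
 have prod: "b ** d \<ominus> (a ** c) : J" if "a : carrier R" "b : carrier R" "c : carrier R" "d : carrier R"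
  "b \<ominus> a : J" "d \<ominus> c : J" for a b c d
 proof -
  have "b ** d \<ominus> (a ** c) = (b \<ominus> a) ** d \<oplus> a ** (d \<ominus> c)" using that by algebra
  then show ?thesis using that by (simp add: J.I_l_closed J.I_r_closed)
 qed
 have neg: "\<ominus> b \<ominus> (\<ominus> a) : J" if "a : carrier R" "b : carrier R" "b \<ominus> a : J" for a b
 proof -
  have "\<ominus> b \<ominus> (\<ominus> a) = \<ominus> (b \<ominus> a)" using that by algebra
  then show ?thesis using that by simp
 qed
 have same: "\<zero> \<ominus> \<zero> : J" "\<one> \<ominus> \<one> : J" by (simp_all add: minus_eq r_neg)
 have P: "cring P"
 proof (rule cringI)
  show "abelian_group P"
  proof (rule abelian_groupI)
   fix x assume "x : carrier P"
   then obtain a b where x: "x = (a, b)" "a : carrier R" "b : carrier R" "b \<ominus> a : J"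
    by (auto simp: P_def)
   then show "EX y:carrier P. y \<oplus>\<^sub>P x = \<zero>\<^sub>P"
    by (intro bexI[of _ "(\<ominus> a, \<ominus> b)"]) (auto simp: P_def l_neg neg)
  qed (auto simp: P_def sum a_ac same)
  show "Group.comm_monoid P"
   by unfold_locales (auto simp: P_def prod m_ac same)
 qed (auto simp: P_def l_distr)
 obtain e :: "'r \<times> 'r => 'r" where e: "inj e"
 proof -
  have "|UNIV \<times> UNIV :: ('r \<times> 'r) set| =o |UNIV :: 'r set|"
   by (rule card_of_Times_same_infinite[OF inf])
  then have "|UNIV \<times> UNIV :: ('r \<times> 'r) set| \<le>o |UNIV :: 'r set|"
   by (rule ordIso_imp_ordLeq)
  then show thesis using that by (auto simp: card_of_ordLeq[symmetric])
 qed
 define T where "T = image_ring e P"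
 have inj: "inj_on e (carrier P)" by (rule inj_on_subset[OF e subset_UNIV])
 have T: "cring T" and iso: "e : ring_iso P T"
  unfolding T_def by (rule image_ring_iso_cring[OF P inj])+
 define d where "d = inv_into (carrier P) e"
 have d: "d (e x) = x" if "x : carrier P" for x using inj that by (simp add: d_def)
 have carT: "carrier T = e ` carrier P" by (simp add: T_def image_ring_carrier)
 have dh: "d : ring_hom T P"
  using ring_iso_set_sym[OF _ iso] P by (simp add: ring_iso_def d_def cring_def)
 have "fst : ring_hom P R" "snd : ring_hom P R"
  by (rule ring_hom_memI; auto simp: P_def)+
 then have "fst \<circ> d : ring_hom T R" "snd \<circ> d : ring_hom T R"
  by (auto intro: ring_hom_trans[OF dh])
 then have p: "restrict (fst \<circ> d) (carrier T) : rhom T R" "restrict (snd \<circ> d) (carrier T) : rhom T R"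
  by (auto intro: restrict_rhom[OF T])
 have "fibre_square R J T (restrict (fst \<circ> d) (carrier T)) (restrict (snd \<circ> d) (carrier T))"
 proof (rule fibre_square.intro[OF R T J p])
  fix t assume "t : carrier T"
  then show "restrict (snd \<circ> d) (carrier T) t \<ominus> restrict (fst \<circ> d) (carrier T) t : J"
   by (auto simp: carT d) (auto simp: P_def)
 next
  fix a b assume "a : carrier R" "b : carrier R" "b \<ominus> a : J"
  then have "(a, b) : carrier P" by (simp add: P_def)
  then show "EX t:carrier T. restrict (fst \<circ> d) (carrier T) t = a & restrict (snd \<circ> d) (carrier T) t = b"
   by (intro bexI[of _ "e (a, b)"]) (auto simp: carT d)
 next
  fix t t' assume "t : carrier T" "t' : carrier T"
   "restrict (fst \<circ> d) (carrier T) t = restrict (fst \<circ> d) (carrier T) t'"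
   "restrict (snd \<circ> d) (carrier T) t = restrict (snd \<circ> d) (carrier T) t'"
  then show "t = t'" by (auto simp: carT d prod_eq_iff)
 qed
 then show thesis by (rule that)
qed

text \<open>Only the set of \<open>k\<close>-fold products, not the ideal power. A homomorphism
  kills one exactly when it kills the other, and congruences are tested by homomorphisms.\<close>

primrec pw :: "'r ring => 'r set => nat => 'r set" where
 "pw R J 0 = {\<one>\<^sub>R}"
| "pw R J (Suc k) = {j **\<^sub>R w | j w. j : J & w : pw R J k}"

lemma pw_carrier: "cring R ==> J <= carrier R ==> pw R J k <= carrier R"
 by (induction k) (auto simp: cring.cring_simprules subset_iff)

lemma pw_image:
 assumes "h : rhom R R'" "cring R" "J <= carrier R"
 shows "pw R' (h ` J) k = h ` pw R J k"
proof (induction k)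
 case 0 show ?case using assms(1) by (simp add: rhom_one)
next
 case (Suc k)
 have "h (j **\<^sub>R w) = h j **\<^sub>R' h w" if "j : J" "w : pw R J k" for j w
  using that assms pw_carrier[OF assms(2,3)] by (intro rhom_mult) auto
 then show ?case unfolding pw.simps Suc.IH by (auto 0 4 intro!: rev_image_eqI)
qed

lemma pw_add:
 assumes "cring R" "J <= carrier R" "v : pw R J j" "w : pw R J k"
 shows "v **\<^sub>R w : pw R J (j + k)"
 using assms(3)
proof (induction j arbitrary: v)
 case 0
 have "w : carrier R" using assms(4) pw_carrier[OF assms(1,2)] by blast
 then show ?case using 0 assms(1,4) by (simp add: cring.cring_simprules(12))
next
 case (Suc j)
 then obtain i v' where v: "v = i **\<^sub>R v'" "i : J" "v' : pw R J j" by auto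
 have "v **\<^sub>R w = i **\<^sub>R (v' **\<^sub>R w)"
  using v assms pw_carrier[OF assms(1,2)] by (auto simp: cring.cring_simprules subset_iff)
 then show ?case using Suc.IH[OF v(3)] v by auto
qed

lemma pw_zero_mono:
 assumes R: "cring R" and J: "J <= carrier R" "pw R J j <= {\<zero>\<^sub>R}" and "j <= k"
 shows "pw R J k <= {\<zero>\<^sub>R}"
 using \<open>j <= k\<close>
proof (induction rule: dec_induct)
 case (step n)
 interpret cring R by fact
 show ?case
 proof
  fix v assume "v : pw R J (Suc n)"
  then obtain j w where "v = j **\<^sub>R w" "j : J" "w : pw R J n" by auto
  then show "v : {\<zero>\<^sub>R}" using step.IH J(1) by (auto dest!: subsetD)
 qed
qed (rule J)

text \<open>Products of \<open>c\<close> elements of \<open>J^k\<close> are products of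
  \<open>k * c >= c\<close> elements of \<open>J\<close>.\<close>

lemma pw_pw_zero:
 assumes R: "cring R" and J: "J <= carrier R" "pw R J c <= {\<zero>\<^sub>R}" and "0 < k"
 shows "pw R (pw R J k) c <= {\<zero>\<^sub>R}"
proof -
 have "pw R (pw R J k) n <= pw R J (k * n)" for n
 proof (induction n)
  case (Suc n)
  then show ?case using pw_add[OF R J(1)] by fastforce
 qed simp
 moreover have "pw R J (k * c) <= {\<zero>\<^sub>R}"
  by (rule pw_zero_mono[OF R J]) (use \<open>0 < k\<close> in simp)
 ultimately show ?thesis by blast
qed

text \<open>A nonzero product has at most one factor from \<open>L\<close>, as \<open>L\<close> has
  square zero; so at least \<open>c\<close> of \<open>Suc c\<close> factors come from
  \<open>J\<close>.\<close>

lemma pw_Un_zero: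
 fixes R :: "'r ring" (structure)
 assumes R: "cring R" and J: "J <= carrier R" "pw R J c <= {\<zero>\<^sub>R}"
  and L: "L <= carrier R" "pw R L 2 <= {\<zero>\<^sub>R}"
 shows "pw R (J \<union> L) (Suc c) <= {\<zero>\<^sub>R}"
proof -
 interpret cring R by fact
 have L2: "l ** l' = \<zero>" if "l : L" "l' : L" for l l'
  using L that by (force simp: numeral_2_eq_2)
 have pJ: "pw R J n <= carrier R" for n by (rule pw_carrier[OF R J(1)])
 have "w : pw R J n | w = \<zero> | (EX l:L. EX n' w'. n = Suc n' & w' : pw R J n' & w = l ** w')"
  if "w : pw R (J \<union> L) n" for w n
  using that
 proof (induction n arbitrary: w)
  case (Suc n)
  then obtain i v where w: "w = i ** v" "i : J \<union> L" "v : pw R (J \<union> L) n" by auto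
  consider "v : pw R J n" | "v = \<zero>" | l n' w' where "l : L" "n = Suc n'" "w' : pw R J n'" "v = l ** w'"
   using Suc.IH[OF w(3)] by blast
  then show ?case
  proof cases
   case 1 then show ?thesis using w by auto
  next
   case 2 then show ?thesis using w J(1) L(1) by auto
  next
   case 3
   have car: "i : carrier R" "l : carrier R" "w' : carrier R" using w J(1) L(1) 3 pJ by auto
   have 4: "w = l ** (i ** w')" using w 3 car by (simp add: m_lcomm)
   show ?thesis
   proof (cases "i : J")
    case True
    then have "i ** w' : pw R J n" using 3 by auto
    then show ?thesis using 4 3(1) by blast
   next
    case False
    then have "l ** i = \<zero>" using w(2) L2 3 by auto
    then have "w = \<zero>" using 4 car by (simp flip: m_assoc)
    then show ?thesis by simp
   qed
  qed
 qed simp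
 note * = this
 have Sc: "pw R J (Suc c) <= {\<zero>}" by (rule pw_zero_mono[OF R J]) simp
 show ?thesis
 proof
  fix w assume "w : pw R (J \<union> L) (Suc c)"
  from *[OF this] show "w : {\<zero>}"
  proof (elim disjE bexE exE conjE)
   fix l n w' assume "l : L" "Suc c = Suc n" "w' : pw R J n" "w = l ** w'"
   then show "w : {\<zero>}" using J(2) L(1) by (auto dest!: subsetD)
  qed (use Sc in auto)
 qed
qed

text \<open>\<open>i\<close> differs from \<open>1\<close> by a nilpotent element and is thus a
  unit. Instead of summing a geometric series, a descending induction puts
  \<open>pw R J (c - d)\<close> into \<open>L\<close>, ending with \<open>pw R J 0\<close>, which
  consists of \<open>1\<close>.\<close>

lemma one_mem_of_nilpotent:
 fixes R :: "'r ring" (structure)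
 assumes R: "cring R" and L: "ideal L R" and J: "J <= carrier R" "pw R J c <= {\<zero>\<^sub>R}"
  and i: "i : L" "\<one>\<^sub>R \<ominus>\<^sub>R i : Idl \<^sub>R J"
 shows "\<one>\<^sub>R : L"
proof -
 interpret cring R by fact
 interpret L: ideal L R by fact
 have "pw R J (c - d) <= L" for d
 proof (induction d)
  case 0 then show ?case using J(2) L.zero_closed by auto
 next
  case (Suc d)
  show ?case
  proof (cases "d < c")
   case False then show ?thesis using Suc by simp
  next
   case True
   show ?thesis
   proof
    fix w assume w: "w : pw R J (c - Suc d)"
    have wc: "w : carrier R" using w pw_carrier[OF R J(1)] by blast
    have "ideal {x : carrier R. x ** w : L} R"
    proof (rule idealI[OF ring_axioms])
     show "subgroup {x : carrier R. x ** w : L} (add_monoid R)"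
      by (rule add.subgroupI)
       (use wc in "auto simp: l_distr l_minus simp flip: a_inv_def intro!: exI[of _ \<zero>]")
    next
     fix a x assume a: "a : {x : carrier R. x ** w : L}" and x: "x : carrier R"
     have "x ** a ** w = x ** (a ** w)" using a x wc by (simp add: m_assoc)
     then have 1: "x ** a ** w : L" using a x by (simp add: L.I_l_closed)
     then show "x ** a : {x : carrier R. x ** w : L}" using a x by simp
     show "a ** x : {x : carrier R. x ** w : L}" using a x 1 by (simp add: m_comm)
    qed
    moreover have "J <= {x : carrier R. x ** w : L}"
    proof
     fix j assume j: "j : J"
     have "j ** w : pw R J (Suc (c - Suc d))" using j w by auto
     also have "Suc (c - Suc d) = c - d" using True by simp
     finally show "j : {x : carrier R. x ** w : L}" using Suc j J by auto
    qed
    ultimately have "(\<one> \<ominus> i) ** w : L" using genideal_minimal i(2) by blast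
    moreover have "i ** w : L" using i(1) wc by (simp add: L.I_r_closed)
    moreover have "w = (\<one> \<ominus> i) ** w \<oplus> i ** w"
    proof -
     have "i : carrier R" by (rule L.Icarr[OF i(1)])
     then show ?thesis using wc by algebra
    qed
    ultimately show "w : L" by (metis L.a_closed)
   qed
  qed
 qed
 from this[of c] show ?thesis by simp
qed

section \<open>Congruence of points modulo an ideal\<close>

text \<open>Equality over R/(K), phrased by all homomorphisms that kill \<open>K\<close>. This needs
  no choice of a quotient and is visibly stable under base change.\<close>

definition agree_mod :: "('r, 'x) pfunctor => 'r ring => 'r set => 'x => 'x => bool" where
 "agree_mod F R K x y \<longleftrightarrow> (ALL Q q. cring Q & q : rhom R Q & (ALL k:K. q k = \<zero>\<^sub>Q) -->
   pull F R Q q x = pull F R Q q y)"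

lemma agree_modD: "agree_mod F R K x y ==> cring Q ==> q : rhom R Q ==> (!!k. k : K ==> q k = \<zero>\<^sub>Q) ==>
  pull F R Q q x = pull F R Q q y"
 unfolding agree_mod_def by blast

lemma agree_mod_refl: "agree_mod F R K x x"
 by (simp add: agree_mod_def)

lemma agree_mod_sym: "agree_mod F R K x y ==> agree_mod F R K y x"
 by (simp add: agree_mod_def)

lemma agree_mod_trans: "agree_mod F R K x y ==> agree_mod F R K y z ==> agree_mod F R K x z"
 unfolding agree_mod_def by metis

lemma agree_mod_mono: "agree_mod F R K x y ==> K <= K' ==> agree_mod F R K' x y"
 unfolding agree_mod_def by blast

lemma zariski_coverD:
 "zariski_cover R C ==> (R1, h1) : C ==> cring R1 & h1 : rhom R R1"
 by (force simp: zariski_cover_def is_localization_def)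

lemma open_subD: "open_sub F U ==> cring R ==> x : pts F R ==> EX I. ideal I R &
  (ALL R' h. cring R' & h : rhom R R' --> (pull F R R' h x : U R' \<longleftrightarrow> Idl \<^sub>R' (h ` I) = carrier R'))"
 by (simp add: open_sub_def)

section \<open>Base change of congruences and of open subfunctors\<close>

context point_functor
begin

lemma agree_mod_pull:
 assumes R: "cring R" "cring R0" "h : rhom R R0" and K: "K <= carrier R"
  and xy: "x : pts F R" "y : pts F R" and a: "agree_mod F R K x y"
 shows "agree_mod F R0 (h ` K) (pull F R R0 h x) (pull F R R0 h y)"
 unfolding agree_mod_def
proof (intro allI impI, elim conjE)
 fix Q q assume Q: "cring Q" "q : rhom R0 Q" "ALL k:h ` K. q k = \<zero>\<^sub>Q"
 have "pull F R Q (cmps R q h) x = pull F R Q (cmps R q h) y"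
  by (rule agree_modD[OF a Q(1) rhom_comp[OF R(1,3) Q(2)]]) (use Q K in "auto simp: compose_def")
 then show "pull F R0 Q q (pull F R R0 h x) = pull F R0 Q q (pull F R R0 h y)"
  by (simp add: pull_comp[OF R(1,2) Q(1) R(3) Q(2)] xy)
qed

lemma agree_mod_eq:
 assumes R: "cring R" and K: "K <= {\<zero>\<^sub>R}" and xy: "x : pts F R" "y : pts F R"
  and a: "agree_mod F R K x y"
 shows "x = y"
proof -
 have "pull F R R (rid R) x = pull F R R (rid R) y"
  by (rule agree_modD[OF a R rid_rhom[OF R]])
   (use K R in "auto simp: rid_def cring.cring_simprules(2)")
 then show ?thesis by (simp add: pull_id[OF R] xy)
qed

text \<open>Every homomorphism killing the kernel of \<open>q\<close> factors through
  \<open>q\<close>, so the single equality over \<open>Q\<close> suffices.\<close>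

lemma agree_mod_surj:
 assumes R: "cring R" "cring Q" "q : rhom R Q" "q ` carrier R = carrier Q"
  and xy: "x : pts F R" "y : pts F R" and eq: "pull F R Q q x = pull F R Q q y"
 shows "agree_mod F R {r : carrier R. q r = \<zero>\<^sub>Q} x y"
 unfolding agree_mod_def
proof (intro allI impI, elim conjE)
 fix Q' f assume Q: "cring Q'" "f : rhom R Q'" "ALL k:{r : carrier R. q r = \<zero>\<^sub>Q}. f k = \<zero>\<^sub>Q'"
 obtain k where k: "k : rhom Q Q'" "f = cmps R k q"
  by (rule factor_through[OF R(1,2) Q(1) R(3,4) Q(2)]) (use Q(3) in blast)+
 show "pull F R Q' f x = pull F R Q' f y"
  by (simp add: k(2) pull_comp[OF R(1,2) Q(1) R(3) k(1)] xy eq)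
qed

lemma sheaf_eqI:
 assumes sh: "zariski_sheaf F" and R: "cring R" and C: "zariski_cover R C"
  and xy: "x : pts F R" "y : pts F R"
  and eq: "!!R1 h1. (R1, h1) : C ==> pull F R R1 h1 x = pull F R R1 h1 y"
 shows "x = y"
proof -
 define s where "s = (%(R1, h1). pull F R R1 h1 x)"
 have "EX! z. z : pts F R & (ALL (R1, h1):C. pull F R R1 h1 z = s (R1, h1))"
 proof (rule sh[unfolded zariski_sheaf_def, rule_format], intro conjI ballI allI impI; (clarify)?)
  fix R1 h1 assume "(R1, h1) : C"
  then show "s (R1, h1) : pts F R1"
   using zariski_coverD[OF C] pull_closed[OF R _ _ xy(1)] by (simp add: s_def)
 next
  fix R1 h1 R2 h2 T k1 k2
  assume c: "(R1, h1) : C" "(R2, h2) : C" and T: "cring T" "k1 : rhom R1 T" "k2 : rhom R2 T"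
   and e: "cmps R k1 h1 = cmps R k2 h2"
  show "pull F R1 T k1 (s (R1, h1)) = pull F R2 T k2 (s (R2, h2))"
   using pull_comp[OF R _ T(1) _ T(2) xy(1), of h1] pull_comp[OF R _ T(1) _ T(3) xy(1), of h2]
    zariski_coverD[OF C c(1)] zariski_coverD[OF C c(2)] e by (simp add: s_def)
 qed (fact R C)+
 then obtain z where z: "!!w. w : pts F R & (ALL (R1, h1):C. pull F R R1 h1 w = s (R1, h1)) ==> w = z"
  unfolding Ex1_def by blast
 have "x = z" by (rule z) (auto simp: s_def xy)
 moreover have "y = z" by (rule z) (auto simp: s_def eq xy)
 ultimately show ?thesis by simp
qed

lemma open_sub_pull:
 assumes U: "open_sub F U" and R: "cring R" "cring R'" "h : rhom R R'" and x: "x : U R"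
 shows "pull F R R' h x : U R'"
proof -
 have xp: "x : pts F R" using U R(1) x unfolding open_sub_def by blast
 obtain I where I: "ideal I R" "!!R' h. cring R' ==> h : rhom R R' ==>
   pull F R R' h x : U R' \<longleftrightarrow> Idl \<^sub>R' (h ` I) = carrier R'"
  using open_subD[OF U R(1) xp] by metis
 interpret R: cring R by fact
 interpret R': cring R' by fact
 interpret I: ideal I R by fact
 have "Idl \<^sub>R (rid R ` I) = carrier R"
  using I(2)[OF R(1) rid_rhom[OF R(1)]] x xp by (simp add: pull_id[OF R(1)])
 moreover have "rid R ` I = I" using I.Icarr by (auto simp: rid_def image_iff)
 moreover have "Idl \<^sub>R I <= I" by (rule R.genideal_minimal[OF I(1)]) simp
 ultimately have "\<one>\<^sub>R : I" by auto
 then have "\<one>\<^sub>R' : h ` I" using rhom_one[OF R(3)] by (metis image_eqI)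
 moreover have sub: "h ` I <= carrier R'" using I.Icarr rhom_closed[OF R(3)] by blast
 ultimately have "\<one>\<^sub>R' : Idl \<^sub>R' (h ` I)" using R'.genideal_self by blast
 then have "Idl \<^sub>R' (h ` I) = carrier R'"
  by (rule ideal.one_imp_carrier[OF R'.genideal_ideal[OF sub]])
 then show ?thesis using I(2)[OF R(2,3)] by simp
qed

text \<open>The image of \<open>I\<close> under a surjection is already an ideal, so generating the
  unit ideal means containing \<open>1\<close>. Membership over quotients is thereby reduced to a
  single element of \<open>I\<close>.\<close>

lemma open_sub_witness:
 assumes U: "open_sub F U" and R: "cring R" and y: "y : pts F R"
 obtains I where "ideal I R" "\<one>\<^sub>R : I ==> y : U R"
  "!!Q q. cring Q ==> q : rhom R Q ==> q ` carrier R = carrier Q ==> pull F R Q q y : U Q ==>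
   EX i:I. q i = \<one>\<^sub>Q"
proof -
 obtain I where I: "ideal I R" "!!R' h. cring R' ==> h : rhom R R' ==>
   pull F R R' h y : U R' \<longleftrightarrow> Idl \<^sub>R' (h ` I) = carrier R'"
  using open_subD[OF U R y] by metis
 interpret R: cring R by fact
 interpret I: ideal I R by fact
 show thesis
 proof (rule that[OF I(1)])
  assume "\<one>\<^sub>R : I"
  then have "I = carrier R" by (rule I.one_imp_carrier)
  moreover have "rid R ` carrier R = carrier R" by (auto simp: rid_def image_iff)
  moreover have "Idl \<^sub>R (carrier R) = carrier R"
   using R.genideal_self[of "carrier R"] R.genideal_ideal[of "carrier R"]
   by (meson ideal.Icarr subsetI subset_antisym subset_refl)
  ultimately show "y : U R" using I(2)[OF R rid_rhom[OF R]] y by (simp add: pull_id[OF R])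
 next
  fix Q q assume Q: "cring Q" "q : rhom R Q" "q ` carrier R = carrier Q" "pull F R Q q y : U Q"
  interpret q: ring_hom_cring R Q q by (rule rhom_cring[OF R Q(1,2)])
  have "ideal (q ` I) Q"
  proof (rule idealI)
   show "ring Q" by (rule q.S.ring_axioms)
   show "subgroup (q ` I) (add_monoid Q)"
   proof (rule q.S.add.subgroupI)
    show "q ` I <= carrier Q" using I.Icarr by auto
    show "q ` I ~= {}" using I(1) additive_subgroup.zero_closed[OF ideal.axioms(1)] by blast
   next
    fix a assume "a : q ` I"
    then obtain i where i: "i : I" "a = q i" by auto
    have "\<ominus>\<^sub>Q a = q (\<ominus>\<^sub>R i)" using i I.Icarr by simp
    also have "... : q ` I" by (rule imageI) (rule I.a_inv_closed[OF i(1)])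
    finally show "\<ominus>\<^sub>Q a : q ` I" .
   next
    fix a b assume "a : q ` I" "b : q ` I"
    then obtain i j where i: "i : I" "a = q i" "j : I" "b = q j" by auto
    have "a \<oplus>\<^sub>Q b = q (i \<oplus>\<^sub>R j)" using i I.Icarr by simp
    also have "... : q ` I" by (rule imageI) (rule I.a_closed[OF i(1,3)])
    finally show "a \<oplus>\<^sub>Q b : q ` I" .
   qed
  next
   fix a y assume "a : q ` I" "y : carrier Q"
   then obtain i r where i: "i : I" "a = q i" "r : carrier R" "y = q r" unfolding Q(3)[symmetric] by auto
   have "y **\<^sub>Q a = q (r **\<^sub>R i)" "a **\<^sub>Q y = q (i **\<^sub>R r)"
    using i I.Icarr by simp_all
   then show "y **\<^sub>Q a : q ` I" "a **\<^sub>Q y : q ` I"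
    using imageI[OF I.I_l_closed[OF i(1,3)], of q] imageI[OF I.I_r_closed[OF i(1,3)], of q] by metis+
  qed
  then have "Idl \<^sub>Q (q ` I) <= q ` I" by (rule q.S.genideal_minimal) simp
  moreover have "Idl \<^sub>Q (q ` I) = carrier Q" using I(2)[OF Q(1,2)] Q(4) by simp
  ultimately have "\<one>\<^sub>Q : q ` I" by auto
  then show "EX i:I. q i = \<one>\<^sub>Q" by auto
 qed
qed

text \<open>Over R/(K) the two points coincide, so \<open>y\<close> lies in \<open>U\<close> there;
  lifting the witness of this fact gives \<open>i\<close>.\<close>

lemma open_sub_agree:
 assumes U: "open_sub F U" and R: "cring R" and K: "K <= carrier R"
  and x: "x : U R" and I: "ideal I R"
  and w: "!!Q q. cring Q ==> q : rhom R Q ==> q ` carrier R = carrier Q ==> pull F R Q q y : U Q ==>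
   EX i:I. q i = \<one>\<^sub>Q"
  and a: "agree_mod F R K x y"
 shows "EX i:I. \<one>\<^sub>R \<ominus>\<^sub>R i : Idl \<^sub>R K"
proof -
 interpret R: cring R by fact
 interpret I: ideal I R by fact
 obtain Q q where Q: "cring Q" "q : rhom R Q" "q ` carrier R = carrier Q"
  "!!r. r : carrier R ==> q r = \<zero>\<^sub>Q \<longleftrightarrow> r : Idl \<^sub>R K"
  using ex_quotient[OF R R.genideal_ideal[OF K]] by blast
 have "pull F R Q q x = pull F R Q q y"
  by (rule agree_modD[OF a Q(1,2)]) (use Q(4) K R.genideal_self[OF K] in blast)
 then have "pull F R Q q y : U Q" using open_sub_pull[OF U R Q(1,2) x] by simp
 then obtain i where i: "i : I" "q i = \<one>\<^sub>Q" using w[OF Q(1,2,3)] by blast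
 have ic: "i : carrier R" by (rule I.Icarr[OF i(1)])
 interpret Q: cring Q by fact
 have "q (\<one>\<^sub>R \<ominus>\<^sub>R i) = \<zero>\<^sub>Q"
  using rhom_minus[OF R Q(1,2) R.one_closed ic] i(2) rhom_one[OF Q(2)]
  by (simp add: Q.minus_eq Q.r_neg)
 then show ?thesis using Q(4)[of "\<one>\<^sub>R \<ominus>\<^sub>R i"] i(1) ic by auto
qed

text \<open>Membership in an open subfunctor is not affected by nilpotents: the witness
  \<open>i\<close> is congruent to \<open>1\<close> modulo a nilpotent ideal.\<close>

lemma open_sub_nilpotent:
 assumes U: "open_sub F U" and R: "cring R" and K: "K <= carrier R" "pw R K c <= {\<zero>\<^sub>R}"
  and x: "x : U R" and y: "y : pts F R" and a: "agree_mod F R K x y"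
 shows "y : U R"
proof -
 obtain I where I: "ideal I R" "\<one>\<^sub>R : I ==> y : U R"
  "!!Q q. cring Q ==> q : rhom R Q ==> q ` carrier R = carrier Q ==> pull F R Q q y : U Q ==>
   EX i:I. q i = \<one>\<^sub>Q"
  by (rule open_sub_witness[OF U R y]) blast
 have "EX i:I. \<one>\<^sub>R \<ominus>\<^sub>R i : Idl \<^sub>R K"
  by (rule open_sub_agree[OF U R K(1) x I(1) I(3) a])
 then show ?thesis using one_mem_of_nilpotent[OF R I(1) K] I(2) by blast
qed

text \<open>The two projections embed Spec R as closed subschemes that cover Spec T. With witnesses
  \<open>i\<close> and \<open>j\<close> for the two, \<open>1 - i\<close> and \<open>1 - j\<close>
  have product zero, and expanding this product puts \<open>1\<close> into \<open>I\<close>.\<close>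

lemma open_sub_fibre_square:
 assumes U: "open_sub F U" and sq: "fibre_square R J T p1 p2" and z: "z : pts F T"
  and p: "pull F T R p1 z : U R" "pull F T R p2 z : U R"
 shows "z : U T"
proof -
 interpret sq: fibre_square R J T p1 p2 by fact
 obtain I where I: "ideal I T" "\<one>\<^sub>T : I ==> z : U T"
  "!!Q q. cring Q ==> q : rhom T Q ==> q ` carrier T = carrier Q ==> pull F T Q q z : U Q ==>
   EX i:I. q i = \<one>\<^sub>Q"
  by (rule open_sub_witness[OF U sq.T z]) blast
 interpret I: ideal I T by fact
 obtain i where i: "i : I" "p1 i = \<one>\<^sub>R" using I(3)[OF sq.R sq.p1 sq.p_surj(1) p(1)] by blast
 obtain j where j: "j : I" "p2 j = \<one>\<^sub>R" using I(3)[OF sq.R sq.p2 sq.p_surj(2) p(2)] by blast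
 have car: "i : carrier T" "j : carrier T" using i j I.Icarr by auto
 have "(\<one>\<^sub>T \<ominus>\<^sub>T i) **\<^sub>T (\<one>\<^sub>T \<ominus>\<^sub>T j) = \<zero>\<^sub>T"
 proof (rule sq.inj)
  have "p1 (\<one>\<^sub>T \<ominus>\<^sub>T i) = \<zero>\<^sub>R" "p2 (\<one>\<^sub>T \<ominus>\<^sub>T j) = \<zero>\<^sub>R"
   using car i j by (simp_all add: sq.p1.R.minus_eq sq.p1.S.r_neg)
  then show "p1 ((\<one>\<^sub>T \<ominus>\<^sub>T i) **\<^sub>T (\<one>\<^sub>T \<ominus>\<^sub>T j)) = p1 \<zero>\<^sub>T"
   "p2 ((\<one>\<^sub>T \<ominus>\<^sub>T i) **\<^sub>T (\<one>\<^sub>T \<ominus>\<^sub>T j)) = p2 \<zero>\<^sub>T"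
   using car by simp_all
 qed (use car in simp_all)
 moreover have "\<one>\<^sub>T = (\<one>\<^sub>T \<ominus>\<^sub>T i) **\<^sub>T (\<one>\<^sub>T \<ominus>\<^sub>T j) \<oplus>\<^sub>T (i \<oplus>\<^sub>T (\<one>\<^sub>T \<ominus>\<^sub>T i) **\<^sub>T j)"
  using car by algebra
 moreover have "i \<oplus>\<^sub>T (\<one>\<^sub>T \<ominus>\<^sub>T i) **\<^sub>T j : I"
  using i(1) j(1) car by (intro I.a_closed I.I_l_closed) auto
 ultimately have "\<one>\<^sub>T : I" using car
  by (metis sq.p1.R.add.l_one I.Icarr)
 then show ?thesis by (rule I(2))
qed

end

section \<open>Points in an affine open\<close>

locale affine = point_functor F for F :: "('r, 'x) pfunctor" +
 fixes A :: "'r ring" and v :: 'x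
 assumes affine_open: "affine_open F A v"
begin

lemma A: "cring A" and v: "v : pts F A" and orbit_open: "open_sub F (orbit F A v)"
 using affine_open unfolding affine_open_def by auto

lemma rep_inj: "cring R ==> a : rhom A R ==> b : rhom A R ==> pull F A R a v = pull F A R b v ==> a = b"
 using affine_open unfolding affine_open_def inj_on_def by blast

lemma orbitE:
 assumes "x : orbit F A v R" obtains a where "a : rhom A R" "x = pull F A R a v"
 using assms unfolding orbit_def by blast

lemma orbitI: "a : rhom A R ==> pull F A R a v : orbit F A v R"
 unfolding orbit_def by blast

lemma orbit_pts: "cring R ==> x : orbit F A v R ==> x : pts F R"
 using pull_closed[OF A _ _ v] by (auto elim: orbitE)

lemma orbit_pull: "cring R ==> cring R' ==> h : rhom R R' ==> x : orbit F A v R ==>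
  pull F R R' h x : orbit F A v R'"
 by (rule open_sub_pull[OF orbit_open])

lemma rep_diff:
 assumes R: "cring R" and K: "K <= carrier R" and a: "a : rhom A R" and b: "b : rhom A R"
  and ag: "agree_mod F R K (pull F A R a v) (pull F A R b v)" and f: "f : carrier A"
 shows "b f \<ominus>\<^sub>R a f : Idl \<^sub>R K"
proof -
 interpret R: cring R by fact
 obtain Q q where Q: "cring Q" "q : rhom R Q" "q ` carrier R = carrier Q"
  "!!r. r : carrier R ==> q r = \<zero>\<^sub>Q \<longleftrightarrow> r : Idl \<^sub>R K"
  using ex_quotient[OF R R.genideal_ideal[OF K]] by blast
 interpret Q: cring Q by fact
 have "pull F R Q q (pull F A R a v) = pull F R Q q (pull F A R b v)"
  by (rule agree_modD[OF ag Q(1,2)]) (use Q(4) K R.genideal_self[OF K] in blast)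
 then have "cmps A q a = cmps A q b"
  by (intro rep_inj[OF Q(1)] rhom_comp[OF A _ Q(2)] a b)
   (simp add: pull_comp[OF A R Q(1) _ Q(2) v] a b)
 then have "q (a f) = q (b f)" using f by (metis compose_app)
 then have "q (b f \<ominus>\<^sub>R a f) = \<zero>\<^sub>Q"
  using rhom_minus[OF R Q(1,2)] rhom_closed[OF a f] rhom_closed[OF b f] rhom_closed[OF Q(2)]
  by (simp add: Q.minus_eq Q.r_neg)
 then show ?thesis using Q(4) rhom_closed[OF a f] rhom_closed[OF b f] by simp
qed

lemma rep_agree:
 assumes R: "cring R" and a: "a : rhom A R" and b: "b : rhom A R"
  and d: "!!f. f : carrier A ==> b f \<ominus>\<^sub>R a f : K"
 shows "agree_mod F R K (pull F A R a v) (pull F A R b v)"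
 unfolding agree_mod_def
proof (intro allI impI, elim conjE)
 fix Q q assume Q: "cring Q" "q : rhom R Q" "ALL k:K. q k = \<zero>\<^sub>Q"
 interpret Q: cring Q by fact
 have "cmps A q a = cmps A q b"
 proof (rule rhom_eqI[OF rhom_comp[OF A a Q(2)] rhom_comp[OF A b Q(2)]])
  fix f assume f: "f : carrier A"
  have "q (b f \<ominus>\<^sub>R a f) = \<zero>\<^sub>Q" using d[OF f] Q(3) by blast
  then have "q (b f) \<ominus>\<^sub>Q q (a f) = \<zero>\<^sub>Q"
   using rhom_minus[OF R Q(1,2) rhom_closed[OF b f] rhom_closed[OF a f]] by simp
  then have "q (b f) = q (a f)"
   by (rule Q.eq_of_diff_zero[rotated 2]) (intro rhom_closed[OF Q(2)] rhom_closed[OF a f] rhom_closed[OF b f])+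
  then show "cmps A q a f = cmps A q b f" using f by (simp add: compose_app)
 qed
 then show "pull F R Q q (pull F A R a v) = pull F R Q q (pull F A R b v)"
  by (simp flip: pull_comp[OF A R Q(1) _ Q(2) v] add: a b)
qed

text \<open>Only \<open>x\<close> is known to lie in the affine open. The product
  \<open>(1 - i) (1 - j)\<close> of the two defects lies in both ideals and so vanishes, which
  brings \<open>y\<close> into the same affine open; there the coordinates of \<open>x\<close> and
  \<open>y\<close> differ by elements of both ideals.\<close>

lemma agree_mod_inj:
 fixes R :: "'r ring" (structure)
 assumes R: "cring R" and K: "K1 <= carrier R" "K2 <= carrier R"
  "Idl K1 Int Idl K2 = {\<zero>}"
  and x: "x : orbit F A v R" and y: "y : pts F R"
  and a1: "agree_mod F R K1 x y" and a2: "agree_mod F R K2 x y"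
 shows "x = y"
proof -
 interpret R: cring R by fact
 interpret K1: ideal "Idl K1" R by (rule R.genideal_ideal[OF K(1)])
 interpret K2: ideal "Idl K2" R by (rule R.genideal_ideal[OF K(2)])
 obtain I where I: "ideal I R" "\<one> : I ==> y : orbit F A v R"
  "!!Q q. cring Q ==> q : rhom R Q ==> q ` carrier R = carrier Q ==> pull F R Q q y : orbit F A v Q ==>
   EX i:I. q i = \<one>\<^sub>Q"
  by (rule open_sub_witness[OF orbit_open R y]) blast
 interpret I: ideal I R by fact
 obtain i where i: "i : I" "\<one> \<ominus> i : Idl K1"
  using open_sub_agree[OF orbit_open R K(1) x I(1) I(3) a1] by blast
 obtain j where j: "j : I" "\<one> \<ominus> j : Idl K2"
  using open_sub_agree[OF orbit_open R K(2) x I(1) I(3) a2] by blast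
 have car: "i : carrier R" "j : carrier R" using i j I.Icarr by auto
 have "(\<one> \<ominus> i) ** (\<one> \<ominus> j) : Idl K1 Int Idl K2"
  using i(2) j(2) car by (intro IntI K1.I_r_closed K2.I_l_closed) auto
 then have "(\<one> \<ominus> i) ** (\<one> \<ominus> j) = \<zero>" using K(3) by blast
 moreover have "\<one> = (\<one> \<ominus> i) ** (\<one> \<ominus> j) \<oplus> (i \<oplus> (\<one> \<ominus> i) ** j)"
  using car by algebra
 moreover have "i \<oplus> (\<one> \<ominus> i) ** j : I"
  using i(1) j(1) car by (intro I.a_closed I.I_l_closed) auto
 ultimately have "\<one> : I" using car by (metis R.add.l_one I.Icarr)
 then have "y : orbit F A v R" by (rule I(2))
 then obtain b where b: "b : rhom A R" "y = pull F A R b v" by (rule orbitE)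
 obtain a where a: "a : rhom A R" "x = pull F A R a v" using x by (rule orbitE)
 have "a = b"
 proof (rule rhom_eqI[OF a(1) b(1)])
  fix f assume f: "f : carrier A"
  have "b f \<ominus> a f : Idl K1 Int Idl K2"
   using rep_diff[OF R K(1) a(1) b(1) _ f] rep_diff[OF R K(2) a(1) b(1) _ f] a1 a2 a(2) b(2) by blast
  then have "b f \<ominus> a f = \<zero>" using K(3) by blast
  then show "a f = b f"
   using R.eq_of_diff_zero[OF rhom_closed[OF b(1) f] rhom_closed[OF a(1) f]] by simp
 qed
 then show ?thesis using a b by simp
qed

lemma fibre_square_inj:
 assumes sq: "fibre_square R J T p1 p2" and z: "z : orbit F A v T" and w: "w : pts F T"
  and eq: "pull F T R p1 z = pull F T R p1 w" "pull F T R p2 z = pull F T R p2 w"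
 shows "z = w"
proof -
 interpret sq: fibre_square R J T p1 p2 by fact
 have zp: "z : pts F T" by (rule orbit_pts[OF sq.T z])
 show ?thesis
  by (rule agree_mod_inj[OF sq.T _ _ sq.ker_Int z w
     agree_mod_surj[OF sq.T sq.R sq.p1 sq.p_surj(1) zp w eq(1)]
     agree_mod_surj[OF sq.T sq.R sq.p2 sq.p_surj(2) zp w eq(2)]]) auto
qed

text \<open>In an affine open both points are homomorphisms from \<open>A\<close>, congruent modulo
  \<open>K\<close>, hence one homomorphism into the fibre product.\<close>

lemma glue:
 assumes sq: "fibre_square R (Idl \<^sub>R K) T p1 p2" and K: "K <= carrier R"
  and x: "x : orbit F A v R" and y: "y : orbit F A v R" and ag: "agree_mod F R K x y"
 obtains z where "z : orbit F A v T" "pull F T R p1 z = x" "pull F T R p2 z = y"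
proof -
 interpret sq: fibre_square R "Idl \<^sub>R K" T p1 p2 by fact
 obtain a where a: "a : rhom A R" "x = pull F A R a v" using x by (rule orbitE)
 obtain b where b: "b : rhom A R" "y = pull F A R b v" using y by (rule orbitE)
 obtain k where k: "k : rhom A T" "cmps A p1 k = a" "cmps A p2 k = b"
  by (rule sq.pair[OF A a(1) b(1)]) (use rep_diff[OF sq.R K a(1) b(1)] ag a(2) b(2) in blast)+
 show thesis
  by (rule that[OF orbitI[OF k(1)]])
   (simp_all add: a b flip: pull_comp[OF A sq.T sq.R k(1) sq.p1 v]
    pull_comp[OF A sq.T sq.R k(1) sq.p2 v] k(2,3))
qed

end

section \<open>The sheaf of automorphisms\<close>

abbreviation (input) "Aut_grp S G R s == grp (Aut_sheaf S G) R s"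

lemma Aut_sheaf_simps:
 "carrier (grp (Aut_sheaf S G) R s) = Aut_carrier S G R s"
 "u **\<^sub>(grp (Aut_sheaf S G) R s) w = family R
     (%R' h. compose (carrier (grp G R' (pull S R R' h s))) (u R' h) (w R' h))"
 "\<one>\<^sub>(grp (Aut_sheaf S G) R s) = family R (%R' h. \<lambda>g\<in>carrier (grp G R' (pull S R R' h s)). g)"
 "res (Aut_sheaf S G) R R' k s u = family R' (%R'' h. u R'' (cmps R h k))"
 by (simp_all add: Aut_sheaf_def)

lemma family_app: "cring R' ==> h : rhom R R' ==> family R u R' h = u R' h"
 by (simp add: family_def)

lemma family_family: "family R (family R u) = family R u"
 by (auto simp: family_def fun_eq_iff)

lemma Aut_carrierD:
 assumes "u : Aut_carrier S G R s"
 shows "family R u = u"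
  and "cring R' ==> h : rhom R R' ==> u R' h : auto (grp G R' (pull S R R' h s))"
  and "cring R' ==> cring R'' ==> h : rhom R R' ==> k : rhom R' R'' ==>
   g : carrier (grp G R' (pull S R R' h s)) ==>
   u R'' (cmps R k h) (res G R' R'' k (pull S R R' h s) g)
    = res G R' R'' k (pull S R R' h s) (u R' h g)"
 using assms unfolding Aut_carrier_def by blast+

lemma Aut_carrierI:
 assumes "family R u = u"
  and "!!R' h. cring R' ==> h : rhom R R' ==> u R' h : auto (grp G R' (pull S R R' h s))"
  and "!!R' R'' h k g. cring R' ==> cring R'' ==> h : rhom R R' ==> k : rhom R' R'' ==>
   g : carrier (grp G R' (pull S R R' h s)) ==>
   u R'' (cmps R k h) (res G R' R'' k (pull S R R' h s) g)
    = res G R' R'' k (pull S R R' h s) (u R' h g)"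
 shows "u : Aut_carrier S G R s"
 using assms unfolding Aut_carrier_def by blast

lemma autoD:
 assumes "f : auto H"
 shows "f : hom H H" "bij_betw f (carrier H) (carrier H)" "f : extensional (carrier H)"
  "x : carrier H ==> f x : carrier H"
 using assms by (auto simp: auto_def Bij_def hom_def)

lemma Aut_eqI:
 assumes u: "u : Aut_carrier S G R s" and w: "w : Aut_carrier S G R s"
  and eq: "!!R' h g. cring R' ==> h : rhom R R' ==> g : carrier (grp G R' (pull S R R' h s)) ==>
   u R' h g = w R' h g"
 shows "u = w"
proof -
 have "family R u R' h = family R w R' h" for R' h
 proof (cases "cring R' & h : rhom R R'")
  case True
  then have "u R' h = w R' h"
   using autoD(3)[OF Aut_carrierD(2)[OF u]] autoD(3)[OF Aut_carrierD(2)[OF w]] eq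
   by (intro extensionalityI[of _ "carrier (grp G R' (pull S R R' h s))"]) auto
  then show ?thesis by (simp add: family_def)
 qed (auto simp: family_def)
 then have "family R u = family R w" by (simp add: fun_eq_iff)
 then show ?thesis using Aut_carrierD(1)[OF u] Aut_carrierD(1)[OF w] by simp
qed

locale group_over = group_functor S G + S: point_functor S
 for S :: "('r, 's) pfunctor" and G :: "('r, 's, 'g) gfunctor"
begin

lemma res_closed: "[|cring R; cring R'; h : rhom R R'; s : pts S R; g : carrier (grp G R s)|]
  ==> res G R R' h s g : carrier (grp G R' (pull S R R' h s))"
 by (rule hom_in_carrier[OF res_hom])

lemma res_mult: "[|cring R; cring R'; h : rhom R R'; s : pts S R; g : carrier (grp G R s);
  g' : carrier (grp G R s)|] ==>
  res G R R' h s (g **\<^sub>(grp G R s) g') = res G R R' h s g **\<^sub>(grp G R' (pull S R R' h s)) res G R R' h s g'"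
 by (rule hom_mult[OF res_hom])

lemma res_group_hom:
 assumes "cring R" "cring R'" "h : rhom R R'" "s : pts S R"
 shows "group_hom (grp G R s) (grp G R' (pull S R R' h s)) (res G R R' h s)"
 using assms by (simp add: group_hom_def group_hom_axioms_def grp_group res_hom S.pull_closed)

lemma res_one: "[|cring R; cring R'; h : rhom R R'; s : pts S R|] ==>
  res G R R' h s \<one>\<^sub>(grp G R s) = \<one>\<^sub>(grp G R' (pull S R R' h s))"
 by (rule group_hom.hom_one[OF res_group_hom])

lemma res_inv: "[|cring R; cring R'; h : rhom R R'; s : pts S R; g : carrier (grp G R s)|] ==>
  res G R R' h s (inv \<^sub>(grp G R s) g) = inv \<^sub>(grp G R' (pull S R R' h s)) (res G R R' h s g)"
 by (rule group_hom.hom_inv[OF res_group_hom])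

subsection \<open>Sections congruent to the identity\<close>

text \<open>The kernel of restriction to R/(K), again tested by all homomorphisms that kill
  \<open>K\<close>.\<close>

definition congr :: "'r ring => 's => 'r set => 'g set" where
 "congr R s K = {g : carrier (grp G R s). ALL Q q. cring Q & q : rhom R Q & (ALL k:K. q k = \<zero>\<^sub>Q) -->
   res G R Q q s g = \<one>\<^sub>(grp G Q (pull S R Q q s))}"

lemma congrD: "g : congr R s K ==> g : carrier (grp G R s)"
 "g : congr R s K ==> cring Q ==> q : rhom R Q ==> (!!k. k : K ==> q k = \<zero>\<^sub>Q) ==>
   res G R Q q s g = \<one>\<^sub>(grp G Q (pull S R Q q s))"
 unfolding congr_def by blast+

lemma congrI: "g : carrier (grp G R s) ==>
 (!!Q q. cring Q ==> q : rhom R Q ==> (!!k. k : K ==> q k = \<zero>\<^sub>Q) ==>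
   res G R Q q s g = \<one>\<^sub>(grp G Q (pull S R Q q s))) ==> g : congr R s K"
 unfolding congr_def by blast

lemma congr_normal:
 assumes R: "cring R" and s: "s : pts S R"
 shows "congr R s K \<lhd> grp G R s"
proof -
 let ?H = "grp G R s"
 interpret H: group ?H by (rule grp_group[OF R s])
 have Q: "group (grp G Q (pull S R Q q s))" if "cring Q" "q : rhom R Q" for Q q
  using that by (intro grp_group S.pull_closed R s)
 have "subgroup (congr R s K) (grp G R s)"
 proof (rule H.subgroupI)
  show "congr R s K <= carrier (grp G R s)" by (auto dest: congrD(1))
  have "\<one>\<^sub>?H : congr R s K" by (rule congrI) (simp_all add: res_one R s)
  then show "congr R s K ~= {}" by blast
 next
  fix a assume a: "a : congr R s K"
  show "inv \<^sub>?H a : congr R s K"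
   using congrD[OF a] by (intro congrI) (simp_all add: res_inv R s Q group.is_monoid monoid.inv_one)
 next
  fix a b assume a: "a : congr R s K" and b: "b : congr R s K"
  show "a **\<^sub>?H b : congr R s K"
   using congrD[OF a] congrD[OF b] Q by (intro congrI) (simp_all add: res_mult R s monoid.l_one group.is_monoid)
 qed
 moreover have "x **\<^sub>?H a **\<^sub>?H inv \<^sub>?H x : congr R s K"
  if x: "x : carrier (grp G R s)" and a: "a : congr R s K" for x a
  using congrD[OF a] x Q
  by (intro congrI) (simp_all add: res_mult res_inv res_closed R s group.r_inv monoid.r_one group.is_monoid)
 ultimately show ?thesis by (simp add: H.normal_inv_iff)
qed

text \<open>The hypothesis expresses, by test homomorphisms, that \<open>K\<close> lies in the ideal
  generated by \<open>K'\<close>.\<close>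

lemma congr_mono:
 assumes "!!Q q k. cring Q ==> q : rhom R Q ==> (!!k'. k' : K' ==> q k' = \<zero>\<^sub>Q) ==> k : K ==> q k = \<zero>\<^sub>Q"
 shows "congr R s K <= congr R s K'"
proof
 fix g assume g: "g : congr R s K"
 show "g : congr R s K'"
  by (rule congrI[OF congrD(1)[OF g] congrD(2)[OF g]]) (use assms in blast)+
qed

lemma congr_trivial:
 assumes R: "cring R" and s: "s : pts S R" and K: "K <= {\<zero>\<^sub>R}" and g: "g : congr R s K"
 shows "g = \<one>\<^sub>(grp G R s)"
proof -
 have "res G R R (rid R) s g = \<one>\<^sub>(grp G R (pull S R R (rid R) s))"
  by (rule congrD(2)[OF g R rid_rhom[OF R]]) (use K R in "auto simp: rid_def cring.cring_simprules(2)")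
 then show ?thesis using res_id[OF R s congrD(1)[OF g]] S.pull_id[OF R s] by simp
qed

lemma congr_res:
 assumes R: "cring R" "cring R'" "h : rhom R R'" and s: "s : pts S R" and K: "K <= carrier R"
  and g: "g : congr R s K"
 shows "res G R R' h s g : congr R' (pull S R R' h s) (h ` K)"
proof (rule congrI)
 show "res G R R' h s g : carrier (grp G R' (pull S R R' h s))"
  by (rule res_closed[OF R s congrD(1)[OF g]])
 fix Q q assume Q: "cring Q" "q : rhom R' Q" "!!k. k : h ` K ==> q k = \<zero>\<^sub>Q"
 have "res G R Q (cmps R q h) s g = \<one>\<^sub>(grp G Q (pull S R Q (cmps R q h) s))"
  by (rule congrD(2)[OF g Q(1) rhom_comp[OF R(1,3) Q(2)]]) (use K Q(3) in "auto simp: compose_def")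
 then show "res G R' Q q (pull S R R' h s) (res G R R' h s g)
   = \<one>\<^sub>(grp G Q (pull S R' Q q (pull S R R' h s)))"
  by (simp add: res_comp[OF R(1,2) Q(1) R(3) Q(2) s congrD(1)[OF g]] S.pull_comp[OF R(1,2) Q(1) R(3) Q(2) s])
qed

lemma congr_surj:
 assumes R: "cring R" "cring Q" "q : rhom R Q" "q ` carrier R = carrier Q" and s: "s : pts S R"
  and g: "g : carrier (grp G R s)" and eq: "res G R Q q s g = \<one>\<^sub>(grp G Q (pull S R Q q s))"
 shows "g : congr R s {r : carrier R. q r = \<zero>\<^sub>Q}"
proof (rule congrI[OF g])
 fix Q' f assume Q: "cring Q'" "f : rhom R Q'" "!!k. k : {r : carrier R. q r = \<zero>\<^sub>Q} ==> f k = \<zero>\<^sub>Q'"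
 obtain k where k: "k : rhom Q Q'" "f = cmps R k q"
  by (rule factor_through[OF R(1,2) Q(1) R(3,4) Q(2)]) (use Q(3) in blast)+
 have s': "pull S R Q q s : pts S Q" by (rule S.pull_closed[OF R(1-3) s])
 show "res G R Q' f s g = \<one>\<^sub>(grp G Q' (pull S R Q' f s))"
  by (simp add: k(2) res_comp[OF R(1,2) Q(1) R(3) k(1) s g] S.pull_comp[OF R(1,2) Q(1) R(3) k(1) s]
    eq res_one[OF R(2) Q(1) k(1) s'])
qed

lemma eq_iff_quotient:
 assumes R: "cring R" and s: "s : pts S R" and g: "g : carrier (grp G R s)" "g' : carrier (grp G R s)"
 shows "g = g' \<longleftrightarrow> g **\<^sub>(grp G R s) inv \<^sub>(grp G R s) g' = \<one>\<^sub>(grp G R s)"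
proof -
 let ?H = "grp G R s"
 interpret group ?H by (rule grp_group[OF R s])
 show ?thesis
 proof
  assume "g **\<^sub>?H inv \<^sub>?H g' = \<one>\<^sub>?H"
  then have "g **\<^sub>?H inv \<^sub>?H g' **\<^sub>?H g' = g'" using g by simp
  then show "g = g'" using g by (simp add: m_assoc)
 qed (simp add: g)
qed

end

section \<open>Group structure and base change of the automorphism sheaf\<close>

context group_over
begin

lemma auto_closed:
 assumes "u : Aut_carrier S G R s" "cring R'" "h : rhom R R'" "g : carrier (grp G R' (pull S R R' h s))"
 shows "u R' h g : carrier (grp G R' (pull S R R' h s))"
 by (rule autoD(4)[OF Aut_carrierD(2)[OF assms(1-3)] assms(4)])

lemma Aut_mult_closed:
 assumes R: "cring R" and s: "s : pts S R"
  and u: "u : Aut_carrier S G R s" and w: "w : Aut_carrier S G R s"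
 shows "u **\<^sub>(Aut_grp S G R s) w : Aut_carrier S G R s"
 unfolding Aut_sheaf_simps
proof (rule Aut_carrierI, goal_cases)
 case 1 show ?case by (rule family_family)
next
 case (2 R' h)
 interpret group "grp G R' (pull S R R' h s)" by (intro grp_group S.pull_closed R s 2)
 have "compose (carrier (grp G R' (pull S R R' h s))) (u R' h) (w R' h) : auto (grp G R' (pull S R R' h s))"
  using Aut_carrierD(2)[OF u 2] Aut_carrierD(2)[OF w 2] hom_compose
  by (auto simp: auto_def compose_Bij)
 then show ?case by (simp add: family_app 2)
next
 case (3 R' R'' h k g)
 let ?s = "pull S R R' h s"
 have kh: "cmps R k h : rhom R R''" by (rule rhom_comp[OF R 3(3,4)])
 have s': "pull S R R'' (cmps R k h) s = pull S R' R'' k ?s"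
  by (rule S.pull_comp[OF R 3(1-4) s])
 have "res G R' R'' k ?s g : carrier (grp G R'' (pull S R' R'' k ?s))"
  by (rule res_closed[OF 3(1,2,4) _ 3(5)]) (rule S.pull_closed[OF R 3(1,3) s])
 moreover have "w R' h g : carrier (grp G R' ?s)" by (rule auto_closed[OF w 3(1,3,5)])
 ultimately show ?case
  using Aut_carrierD(3)[OF u 3(1-4)] Aut_carrierD(3)[OF w 3(1-5)] 3
  by (simp add: family_app[OF 3(2) kh] family_app[OF 3(1,3)] compose_app s')
qed

lemma Aut_mult_app:
 assumes "cring R'" "h : rhom R R'" "g : carrier (grp G R' (pull S R R' h s))"
 shows "(u **\<^sub>(Aut_grp S G R s) w) R' h g = u R' h (w R' h g)"
 using assms by (simp add: Aut_sheaf_simps family_app compose_def)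

lemma Aut_one_app:
 assumes "cring R'" "h : rhom R R'" "g : carrier (grp G R' (pull S R R' h s))"
 shows "\<one>\<^sub>(Aut_grp S G R s) R' h g = g"
 using assms by (simp add: Aut_sheaf_simps family_app)

lemma Aut_one_closed:
 assumes R: "cring R" and s: "s : pts S R"
 shows "\<one>\<^sub>(Aut_grp S G R s) : Aut_carrier S G R s"
 unfolding Aut_sheaf_simps
proof (rule Aut_carrierI, goal_cases)
 case 1 show ?case by (rule family_family)
next
 case (2 R' h)
 interpret group "grp G R' (pull S R R' h s)" by (intro grp_group S.pull_closed R s 2)
 show ?case unfolding family_app[OF 2] by (rule id_in_auto)
next
 case (3 R' R'' h k g)
 let ?s = "pull S R R' h s"
 have kh: "cmps R k h : rhom R R''" by (rule rhom_comp[OF R 3(3,4)])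
 have "res G R' R'' k ?s g : carrier (grp G R'' (pull S R' R'' k ?s))"
  by (rule res_closed[OF 3(1,2,4) _ 3(5)]) (rule S.pull_closed[OF R 3(1,3) s])
 then show ?case using 3 by (simp add: family_app[OF 3(2) kh] family_app[OF 3(1,3)] S.pull_comp[OF R 3(1-4) s])
qed

lemma Aut_inv_ex:
 assumes R: "cring R" and s: "s : pts S R" and u: "u : Aut_carrier S G R s"
 shows "EX w:Aut_carrier S G R s. w **\<^sub>(Aut_grp S G R s) u = \<one>\<^sub>(Aut_grp S G R s)"
proof -
 define C where "C R' h = carrier (grp G R' (pull S R R' h s))" for R' h
 define w where "w = family R (%R' h. restrict (inv_into (C R' h) (u R' h)) (C R' h))"
 have w_app: "w R' h = restrict (inv_into (C R' h) (u R' h)) (C R' h)" if "cring R'" "h : rhom R R'" for R' h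
  unfolding w_def by (rule family_app[OF that])
 have bij: "bij_betw (u R' h) (C R' h) (C R' h)" if "cring R'" "h : rhom R R'" for R' h
  unfolding C_def by (rule autoD(2)[OF Aut_carrierD(2)[OF u that]])
 have wu: "w R' h (u R' h g) = g" "u R' h g : C R' h" if "cring R'" "h : rhom R R'" "g : C R' h" for R' h g
  using bij[OF that(1,2)] that by (auto simp: w_app bij_betw_def inv_into_f_f)
 have uw: "u R' h (w R' h g) = g" "w R' h g : C R' h" if "cring R'" "h : rhom R R'" "g : C R' h" for R' h g
  using bij[OF that(1,2)] that by (auto simp: w_app bij_betw_def f_inv_into_f inv_into_into)
 have w: "w : Aut_carrier S G R s"
 proof (rule Aut_carrierI, goal_cases)
  case 1 show ?case by (simp add: w_def family_family)
 next
  case (2 R' h)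
  have "group (grp G R' (pull S R R' h s))" by (intro grp_group S.pull_closed R s 2)
  then have "m_inv (BijGroup (C R' h)) (u R' h) : auto (grp G R' (pull S R R' h s))"
   unfolding C_def using group.subgroup_auto Aut_carrierD(2)[OF u 2] by (metis subgroup.m_inv_closed)
  moreover have "m_inv (BijGroup (C R' h)) (u R' h) = w R' h"
   using Aut_carrierD(2)[OF u 2] by (simp add: inv_BijGroup w_app 2 auto_def C_def)
  ultimately show ?case by simp
 next
  case (3 R' R'' h k g)
  let ?s = "pull S R R' h s" and ?kh = "cmps R k h"
  have kh: "?kh : rhom R R''" by (rule rhom_comp[OF R 3(3,4)])
  have g: "g : C R' h" using 3 by (simp add: C_def)
  have w1: "w R' h g : C R' h" "u R' h (w R' h g) = g" using uw[OF 3(1,3) g] by auto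
  have "res G R' R'' k ?s (w R' h g) : C R'' ?kh"
   using res_closed[OF 3(1,2,4) S.pull_closed[OF R 3(1,3) s]] w1
   by (simp add: C_def S.pull_comp[OF R 3(1-4) s])
  then have "w R'' ?kh (u R'' ?kh (res G R' R'' k ?s (w R' h g))) = res G R' R'' k ?s (w R' h g)"
   by (rule wu(1)[OF 3(2) kh])
  moreover have "u R'' ?kh (res G R' R'' k ?s (w R' h g)) = res G R' R'' k ?s g"
   using Aut_carrierD(3)[OF u 3(1-4), of "w R' h g"] w1 by (simp add: C_def)
  ultimately show ?case by simp
 qed
 have "w **\<^sub>(Aut_grp S G R s) u = \<one>\<^sub>(Aut_grp S G R s)"
  by (rule Aut_eqI[OF Aut_mult_closed[OF R s w u] Aut_one_closed[OF R s]])
   (use wu(1) in "simp add: Aut_mult_app Aut_one_app C_def")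
 then show ?thesis using w by blast
qed

lemma Aut_group:
 assumes R: "cring R" and s: "s : pts S R"
 shows "group (Aut_grp S G R s)"
proof (rule groupI, unfold Aut_sheaf_simps(1))
 fix u w t assume u: "u : Aut_carrier S G R s" and w: "w : Aut_carrier S G R s" and t: "t : Aut_carrier S G R s"
 show "u **\<^sub>(Aut_grp S G R s) w **\<^sub>(Aut_grp S G R s) t = u **\<^sub>(Aut_grp S G R s) (w **\<^sub>(Aut_grp S G R s) t)"
  using u w t by (intro Aut_eqI[of _ S G R s] Aut_mult_closed R s) (simp_all add: Aut_mult_app auto_closed[OF t])
next
 fix u assume u: "u : Aut_carrier S G R s"
 show "\<one>\<^sub>(Aut_grp S G R s) **\<^sub>(Aut_grp S G R s) u = u"
  by (rule Aut_eqI[of _ S G R s]) (simp_all add: Aut_mult_closed Aut_one_closed R s u Aut_mult_app Aut_one_app auto_closed[OF u])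
qed (auto simp: Aut_sheaf_simps(1) Aut_mult_closed Aut_one_closed Aut_inv_ex R s)

lemma Aut_res_closed:
 assumes R: "cring R" "cring R'" "k : rhom R R'" and s: "s : pts S R" and u: "u : Aut_carrier S G R s"
 shows "res (Aut_sheaf S G) R R' k s u : Aut_carrier S G R' (pull S R R' k s)"
 unfolding Aut_sheaf_simps
proof (rule Aut_carrierI, goal_cases)
 case 1 show ?case by (rule family_family)
next
 case (2 Q h)
 show ?case using Aut_carrierD(2)[OF u 2(1) rhom_comp[OF R(1,3) 2(2)]]
  by (simp add: family_app 2 S.pull_comp[OF R(1,2) 2(1) R(3) 2(2) s])
next
 case (3 Q Q' h l g)
 have lh: "cmps R' l h : rhom R' Q'" by (rule rhom_comp[OF R(2) 3(3,4)])
 have "u Q' (cmps R l (cmps R h k))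
   (res G Q Q' l (pull S R Q (cmps R h k) s) g)
  = res G Q Q' l (pull S R Q (cmps R h k) s) (u Q (cmps R h k) g)"
  by (rule Aut_carrierD(3)[OF u 3(1,2) rhom_comp[OF R(1,3) 3(3)] 3(4)])
   (use 3(5) in "simp add: S.pull_comp[OF R(1,2) 3(1) R(3) 3(3) s]")
 then show ?case using 3
  by (simp add: family_app[OF 3(2) lh] family_app[OF 3(1,3)] S.pull_comp[OF R(1,2) 3(1) R(3) 3(3) s] compose_assoc_rhom[OF R(3)])
qed

lemma Aut_res_app:
 assumes "cring R''" "h : rhom R' R''"
 shows "res (Aut_sheaf S G) R R' k s u R'' h = u R'' (cmps R h k)"
 using assms by (simp add: Aut_sheaf_simps family_app)

text \<open>Lets congruences and forms with values in \<open>G\<close> and in its automorphism sheaf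
  share one development.\<close>

lemma Aut_group_over: "group_over S (Aut_sheaf S G)"
proof (rule group_over.intro[OF group_functor.intro S.point_functor_axioms], goal_cases)
 case (1 R s) then show ?case by (rule Aut_group)
next
 case (2 R R' h s)
 have s': "pull S R R' h s : pts S R'" by (rule S.pull_closed[OF 2])
 show ?case
 proof (rule homI, unfold Aut_sheaf_simps(1))
  fix u w assume u: "u : Aut_carrier S G R s" and w: "w : Aut_carrier S G R s"
  show "res (Aut_sheaf S G) R R' h s u : Aut_carrier S G R' (pull S R R' h s)"
   by (rule Aut_res_closed[OF 2 u])
  show "res (Aut_sheaf S G) R R' h s (u **\<^sub>(Aut_grp S G R s) w) = res (Aut_sheaf S G) R R' h s u
    **\<^sub>(Aut_grp S G R' (pull S R R' h s)) res (Aut_sheaf S G) R R' h s w"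
   by (rule Aut_eqI[OF Aut_res_closed[OF 2 Aut_mult_closed[OF 2(1,4) u w]]
      Aut_mult_closed[OF 2(2) s' Aut_res_closed[OF 2 u] Aut_res_closed[OF 2 w]]])
    (simp add: Aut_res_app Aut_mult_app rhom_comp[OF 2(1,3)] S.pull_comp[OF 2(1,2) _ 2(3) _ 2(4)])
 qed
next
 case (3 R s u)
 then have u: "u : Aut_carrier S G R s" by (simp add: Aut_sheaf_simps(1))
 have "family R (%R'' h. u R'' (cmps R h (rid R))) = family R u"
  by (auto simp: family_def fun_eq_iff compose_rid)
 then show ?case by (simp add: Aut_sheaf_simps Aut_carrierD(1)[OF u])
next
 case (4 R R' R'' h k s u)
 have "cmps R l (cmps R k h) = cmps R (cmps R' l k) h"
  for l :: "'r => 'r"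
  by (rule compose_assoc_rhom[OF 4(4)])
 then show ?case unfolding Aut_sheaf_simps(4)
  using rhom_comp[OF 4(2,5)] by (intro ext) (simp add: family_def)
qed

end

section \<open>Action on sections and inner conjugation\<close>

locale aut_over = group_over S G
 for S :: "('r, 's) pfunctor" and G :: "('r, 's, 'g) gfunctor"
begin

sublocale Aut: group_over S "Aut_sheaf S G" by (rule Aut_group_over)

abbreviation "AG R s == Aut_grp S G R s"
abbreviation "AC R s == carrier (Aut_grp S G R s)"
abbreviation "GC R s == carrier (grp G R s)"
abbreviation "inn R s g == inner_aut S G R s g"
abbreviation "ract R R' h s == res (Aut_sheaf S G) R R' h s"

lemma res_aut_app:
 assumes "cring R'" "h : rhom R R'"
 shows "aut_app R' (ract R R' h s u) g = u R' h g"
 using assms by (simp add: aut_app_def Aut_res_app rid_rhom compose_rid(1))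

text \<open>\<open>aut_app\<close> sees only the component of an automorphism at the identity
  homomorphism, so all base changes have to be compared.\<close>

lemma Aut_eqI_app:
 assumes "u : AC R s" "w : AC R s"
  and "!!R' h g. cring R' ==> h : rhom R R' ==> g : GC R' (pull S R R' h s) ==>
   aut_app R' (ract R R' h s u) g = aut_app R' (ract R R' h s w) g"
 shows "u = w"
 using assms by (intro Aut_eqI[of u S G R s w]) (simp_all add: Aut_sheaf_simps(1) res_aut_app)

lemma aut_app_closed:
 assumes "cring R" "s : pts S R" "u : AC R s" "g : GC R s"
 shows "aut_app R u g : GC R s"
 using auto_closed[of u R s R "rid R" g] assms
 by (simp add: aut_app_def Aut_sheaf_simps(1) rid_rhom S.pull_id)

lemma aut_app_mult:
 assumes "cring R" "s : pts S R" "u : AC R s" "g : GC R s" "g' : GC R s"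
 shows "aut_app R u (g **\<^sub>(grp G R s) g') = aut_app R u g **\<^sub>(grp G R s) aut_app R u g'"
 using autoD(1)[OF Aut_carrierD(2), of u S G R s R "rid R"] assms
 by (simp add: aut_app_def Aut_sheaf_simps(1) rid_rhom S.pull_id hom_mult)

lemma aut_app_natural:
 assumes "cring R" "cring R'" "h : rhom R R'" "s : pts S R" "u : AC R s" "g : GC R s"
 shows "res G R R' h s (aut_app R u g) = aut_app R' (ract R R' h s u) (res G R R' h s g)"
 using Aut_carrierD(3)[of u S G R s R R' "rid R" h g] assms
 by (simp add: res_aut_app Aut_sheaf_simps(1) rid_rhom S.pull_id compose_rid(2))
  (simp add: aut_app_def)

lemma aut_app_comp:
 assumes "cring R" "s : pts S R" "g : GC R s"
 shows "aut_app R (u **\<^sub>(AG R s) w) g = aut_app R u (aut_app R w g)"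
 using assms by (simp add: aut_app_def Aut_mult_app rid_rhom S.pull_id)

lemma aut_app_one:
 assumes "cring R" "s : pts S R" "g : GC R s"
 shows "aut_app R \<one>\<^sub>(AG R s) g = g"
 using assms by (simp add: aut_app_def Aut_one_app rid_rhom S.pull_id)

lemma inner_closed:
 assumes R: "cring R" and s: "s : pts S R" and c: "c : GC R s"
 shows "inn R s c : AC R s"
 unfolding Aut_sheaf_simps(1) inner_aut_def Let_def
proof (rule Aut_carrierI, goal_cases)
 case 1 show ?case by (rule family_family)
next
 case (2 R' h)
 interpret H: group "grp G R' (pull S R R' h s)" by (intro grp_group S.pull_closed R s 2)
 let ?H = "grp G R' (pull S R R' h s)" and ?c = "res G R R' h s c"
 have c': "?c : carrier ?H" by (rule res_closed[OF R 2 s c])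
 let ?f = "\<lambda>g\<in>carrier ?H. ?c **\<^sub>?H g **\<^sub>?H inv \<^sub>?H ?c"
 have cancel: "inv \<^sub>?H ?c **\<^sub>?H (?c **\<^sub>?H x) = x" "?c **\<^sub>?H (inv \<^sub>?H ?c **\<^sub>?H x) = x" if "x : carrier ?H" for x
  using that c' by (simp_all flip: H.m_assoc)
 have "?f : hom ?H ?H" by (rule homI) (simp_all add: c' cancel H.m_assoc)
 moreover have "bij_betw ?f (carrier ?H) (carrier ?H)"
  by (rule bij_betw_byWitness[where f' = "%g. inv \<^sub>?H ?c **\<^sub>?H g **\<^sub>?H ?c"])
   (auto simp: c' cancel H.m_assoc)
 ultimately have "?f : auto ?H" by (simp add: auto_def Bij_def)
 then show ?case unfolding family_app[OF 2] .
next
 case (3 R' R'' h k g)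
 let ?s = "pull S R R' h s"
 have kh: "cmps R k h : rhom R R''" by (rule rhom_comp[OF R 3(3,4)])
 have s1: "?s : pts S R'" by (rule S.pull_closed[OF R 3(1,3) s])
 have s': "pull S R R'' (cmps R k h) s = pull S R' R'' k ?s"
  by (rule S.pull_comp[OF R 3(1-4) s])
 interpret H: group "grp G R' ?s" by (rule grp_group[OF 3(1) s1])
 have c': "res G R R' h s c : GC R' ?s" by (rule res_closed[OF R 3(1,3) s c])
 show ?case
  using c' 3(5) by (simp add: family_app[OF 3(2) kh] family_app[OF 3(1,3)] s' res_comp[OF R 3(1-4) s c] res_closed[OF 3(1,2,4) s1]
    res_mult[OF 3(1,2,4) s1] res_inv[OF 3(1,2,4) s1])
qed

lemma inner_app:
 assumes R: "cring R" "cring R'" "h : rhom R R'"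
  and g: "g : GC R' (pull S R R' h s)"
 shows "inn R s c R' h g = res G R R' h s c **\<^sub>(grp G R' (pull S R R' h s)) g
  **\<^sub>(grp G R' (pull S R R' h s)) inv \<^sub>(grp G R' (pull S R R' h s)) res G R R' h s c"
 using g by (simp add: inner_aut_def Let_def family_app R)

lemma inner_aut_app:
 assumes "cring R" "s : pts S R" "c : GC R s" "g : GC R s"
 shows "aut_app R (inn R s c) g = c **\<^sub>(grp G R s) g **\<^sub>(grp G R s) inv \<^sub>(grp G R s) c"
 using inner_app[OF assms(1,1) rid_rhom[OF assms(1)], of g s c] assms
 by (simp add: aut_app_def S.pull_id res_id)

lemma inner_res:
 assumes R: "cring R" "cring R'" "h : rhom R R'" and s: "s : pts S R" and c: "c : GC R s"
 shows "ract R R' h s (inn R s c) = inn R' (pull S R R' h s) (res G R R' h s c)"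
proof (rule Aut_eqI[of _ S G R' "pull S R R' h s"])
 note c' = res_closed[OF R s c] and s' = S.pull_closed[OF R s]
 show "ract R R' h s (inn R s c) : Aut_carrier S G R' (pull S R R' h s)"
  using Aut_res_closed[OF R s] inner_closed[OF R(1) s c] by (simp add: Aut_sheaf_simps(1))
 show "inn R' (pull S R R' h s) (res G R R' h s c) : Aut_carrier S G R' (pull S R R' h s)"
  using inner_closed[OF R(2) s' c'] by (simp add: Aut_sheaf_simps(1))
 fix Q k g assume Q: "cring Q" "k : rhom R' Q" "g : GC Q (pull S R' Q k (pull S R R' h s))"
 have kh: "cmps R k h : rhom R Q" by (rule rhom_comp[OF R(1,3) Q(2)])
 show "ract R R' h s (inn R s c) Q k g = inn R' (pull S R R' h s) (res G R R' h s c) Q k g"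
  using Q(3) by (simp add: Aut_res_app[OF Q(1,2)] inner_app[OF R(1) Q(1) kh] inner_app[OF R(2) Q(1,2)]
    S.pull_comp[OF R(1,2) Q(1) R(3) Q(2) s] res_comp[OF R(1,2) Q(1) R(3) Q(2) s c])
qed

lemma inner_mult:
 assumes R: "cring R" and s: "s : pts S R" and c: "c : GC R s" "c' : GC R s"
 shows "inn R s (c **\<^sub>(grp G R s) c') = inn R s c **\<^sub>(AG R s) inn R s c'"
proof -
 interpret H: group "grp G R s" by (rule grp_group[OF R s])
 interpret A: group "AG R s" by (rule Aut_group[OF R s])
 show ?thesis
 proof (rule Aut_eqI_app)
  fix Q q g assume Q: "cring Q" "q : rhom R Q" "g : GC Q (pull S R Q q s)"
  note s' = S.pull_closed[OF R Q(1,2) s]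
  interpret HQ: group "grp G Q (pull S R Q q s)" by (rule grp_group[OF Q(1) s'])
  have c': "res G R Q q s c : GC Q (pull S R Q q s)" "res G R Q q s c' : GC Q (pull S R Q q s)"
   by (rule res_closed[OF R Q(1,2) s], rule c)+
  show "aut_app Q (ract R Q q s (inn R s (c **\<^sub>(grp G R s) c'))) g
    = aut_app Q (ract R Q q s (inn R s c **\<^sub>(AG R s) inn R s c')) g"
   using Q(3) c c' by (simp add: inner_res R Q(1,2) s inner_closed Aut.res_mult aut_app_comp s' inner_aut_app
     res_mult HQ.inv_mult_group HQ.m_assoc)
 qed (use c in "simp_all add: inner_closed R s")
qed

lemma aut_app_inv:
 assumes R: "cring R" and s: "s : pts S R" and u: "u : AC R s" and g: "g : GC R s"
 shows "aut_app R u (inv \<^sub>(grp G R s) g) = inv \<^sub>(grp G R s) (aut_app R u g)"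
proof -
 interpret group_hom "grp G R s" "grp G R s" "aut_app R u"
  by (simp add: group_hom_def group_hom_axioms_def grp_group R s hom_def aut_app_closed u aut_app_mult)
 show ?thesis using g by simp
qed

lemma inner_conj:
 assumes R: "cring R" and s: "s : pts S R" and u: "u : AC R s" and c: "c : GC R s"
 shows "u **\<^sub>(AG R s) inn R s c = inn R s (aut_app R u c) **\<^sub>(AG R s) u"
proof -
 interpret A: group "AG R s" by (rule Aut_group[OF R s])
 have uc: "aut_app R u c : GC R s" by (rule aut_app_closed[OF R s u c])
 show ?thesis
 proof (rule Aut_eqI_app)
  fix Q q g assume Q: "cring Q" "q : rhom R Q" "g : GC Q (pull S R Q q s)"
  note s' = S.pull_closed[OF R Q(1,2) s]
  interpret HQ: group "grp G Q (pull S R Q q s)" by (rule grp_group[OF Q(1) s'])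
  have u': "ract R Q q s u : AC Q (pull S R Q q s)"
   by (rule Aut.res_closed[OF R Q(1,2) s u])
  have c': "res G R Q q s c : GC Q (pull S R Q q s)" by (rule res_closed[OF R Q(1,2) s c])
  show "aut_app Q (ract R Q q s (u **\<^sub>(AG R s) inn R s c)) g
    = aut_app Q (ract R Q q s (inn R s (aut_app R u c) **\<^sub>(AG R s) u)) g"
   using Q(3) u u' c c' uc by (simp add: inner_res R Q(1,2) s inner_closed Aut.res_mult aut_app_comp s' inner_aut_app
     aut_app_mult aut_app_inv aut_app_natural aut_app_closed)
 qed (use u c uc in "simp_all add: inner_closed R s")
qed

lemma aut_app_hom_one:
 assumes R: "cring R" and s: "s : pts S R" and u: "u : AC R s"
 shows "aut_app R u \<one>\<^sub>(grp G R s) = \<one>\<^sub>(grp G R s)"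
proof -
 interpret H: group "grp G R s" by (rule grp_group[OF R s])
 show ?thesis using aut_app_inv[OF assms H.one_closed] aut_app_mult[OF assms H.one_closed H.one_closed]
  aut_app_closed[OF assms H.one_closed] by (simp add: H.r_cancel_one')
qed

lemma inner_one: assumes "cring R" "s : pts S R" shows "inn R s \<one>\<^sub>(grp G R s) = \<one>\<^sub>(AG R s)"
proof -
 interpret H: group "grp G R s" by (rule grp_group[OF assms])
 interpret A: group "AG R s" by (rule Aut_group[OF assms])
 show ?thesis using inner_mult[OF assms H.one_closed H.one_closed] inner_closed[OF assms H.one_closed]
  by (simp add: A.r_cancel_one')
qed

end

lemma Idl_annihilates:
 fixes R (structure)
 assumes R: "cring R" and J: "J <= carrier R" and k: "k : carrier R"
  and kJ: "!!j. j : J ==> k ** j = \<zero>" and j: "j : Idl J"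
 shows "k ** j = \<zero>"
proof -
 interpret cring R by fact
 have "ideal {x : carrier R. k ** x = \<zero>} R"
 proof (rule idealI[OF ring_axioms])
  show "subgroup {x : carrier R. k ** x = \<zero>} (add_monoid R)"
   by (rule add.subgroupI) (use k in \<open>auto simp: r_distr r_minus intro!: exI[of _ "\<zero>"]\<close>)
 next
  fix a x assume a: "a : {x : carrier R. k ** x = \<zero>}" and x: "x : carrier R"
  have "k ** (a ** x) = \<zero>" using a x k by (simp flip: m_assoc)
  then show "x ** a : {x : carrier R. k ** x = \<zero>}"
   "a ** x : {x : carrier R. k ** x = \<zero>}"
   using a x by (simp_all add: m_comm)
 qed
 then have "Idl J <= {x : carrier R. k ** x = \<zero>}"
  by (rule genideal_minimal) (use J kJ in blast)
 then show ?thesis using j by blast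
qed

lemma pw_image_zero:
 assumes "cring R" "cring R'" "h : rhom R R'" "J <= carrier R" "pw R J c <= {\<zero>\<^sub>R}"
 shows "pw R' (h ` J) c <= {\<zero>\<^sub>R'}"
 using assms rhom_zero[OF assms(1-3)] by (auto simp: pw_image[OF assms(3,1,4)] dest!: subsetD)

lemma image_annihilates:
 assumes "cring R" "cring R'" "h : rhom R R'" "I <= carrier R" "J <= carrier R"
  and "!!i j. i : I ==> j : J ==> h (i **\<^sub>R j) = \<zero>\<^sub>R'"
  and "i : h ` I" "j : h ` J"
 shows "i **\<^sub>R' j = \<zero>\<^sub>R'"
proof -
 obtain i' j' where ij: "i' : I" "i = h i'" "j' : J" "j = h j'" using assms(7,8) by blast
 have "h (i' **\<^sub>R j') = h i' **\<^sub>R' h j'" by (rule rhom_mult[OF assms(3)]) (use ij assms(4,5) in auto)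
 then show ?thesis using assms(6)[OF ij(1,3)] ij by simp
qed

lemma (in point_functor) pull_pull_id:
 assumes "cring R" "cring T" "h : rhom R T" "k : rhom T R" "cmps R k h = rid R" "x : pts F R"
 shows "pull F T R k (pull F R T h x) = x"
 by (simp flip: pull_comp[OF assms(1,2,1,3,4,6)] add: assms(5) pull_id[OF assms(1,6)])

section \<open>Sections of a group scheme near the unit\<close>

locale group_scheme = aut_over S G
 for S :: "('r, 's) pfunctor" and G :: "('r, 's, 'g) gfunctor" +
 assumes infinite_universe: "infinite (UNIV :: 'r set)"
  and S: "scheme S" and total: "scheme (total S G)"
begin

sublocale tot: point_functor "total S G" using total by (simp add: scheme_def)

lemma total_simps:
 "(s, g) : pts (total S G) R \<longleftrightarrow> s : pts S R & g : GC R s"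
 "pull (total S G) R R' h (s, g) = (pull S R R' h s, res G R R' h s g)"
 by (simp_all add: total_def)

text \<open>Sections congruent to \<open>1\<close> are compared inside an affine open of the total
  space around the unit section, and their base points inside an affine open of \<open>S\<close>;
  both have to exist at the given point.\<close>

definition good :: "'r ring => 's => bool" where
 "good R s \<longleftrightarrow> (EX A v. affine_open S A v & s : orbit S A v R) &
   (EX A v. affine_open (total S G) A v & (s, \<one>\<^sub>(grp G R s)) : orbit (total S G) A v R)"

lemma good_pts: "cring R ==> good R s ==> s : pts S R"
proof -
 assume R: "cring R" and "good R s"
 then obtain A v where A: "affine_open S A v" "s : orbit S A v R" unfolding good_def by blast
 interpret A: affine S A v by unfold_locales (rule A)
 show ?thesis by (rule A.orbit_pts[OF R A(2)])
qed

lemma good_pull: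
 assumes R: "cring R" "cring R'" "h : rhom R R'" and g: "good R s"
 shows "good R' (pull S R R' h s)"
proof -
 have s: "s : pts S R" by (rule good_pts[OF R(1) g])
 obtain A v where A: "affine_open S A v" "s : orbit S A v R" using g unfolding good_def by blast
 obtain A' v' where A': "affine_open (total S G) A' v'" "(s, \<one>\<^sub>(grp G R s)) : orbit (total S G) A' v' R"
  using g unfolding good_def by blast
 interpret A: affine S A v by unfold_locales (rule A)
 interpret A': affine "total S G" A' v' by unfold_locales (rule A')
 have "(pull S R R' h s, \<one>\<^sub>(grp G R' (pull S R R' h s))) : orbit (total S G) A' v' R'"
  using A'.orbit_pull[OF R A'(2)] by (simp add: total_simps res_one[OF R s])
 then show ?thesis unfolding good_def
  using A(1) A'(1) A.orbit_pull[OF R A(2)] by blast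
qed

lemma eq_local:
 assumes R: "cring R" and s: "s : pts S R" and g: "g : GC R s" "g' : GC R s"
  and C: "zariski_cover R C"
  and eq: "!!R' h. (R', h) : C ==> res G R R' h s g = res G R R' h s g'"
 shows "g = g'"
proof -
 have "(s, g) = (s, g')"
  by (rule tot.sheaf_eqI[OF _ R C]) (use total s g eq in "auto simp: scheme_def total_simps")
 then show ?thesis by simp
qed

text \<open>Two successive coverings: the first moves the base point into an affine open of
  \<open>S\<close>, the second moves the unit section over it into an affine open of the total
  space.\<close>

lemma eq_good:
 assumes R: "cring R" and s: "s : pts S R" and g: "g : GC R s" "g' : GC R s"
  and eq: "!!R' h. cring R' ==> h : rhom R R' ==> good R' (pull S R R' h s) ==>
   res G R R' h s g = res G R R' h s g'"
 shows "g = g'"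
proof -
 obtain C where C: "zariski_cover R C" "!!R1 h1. (R1, h1) : C ==>
   EX A v. affine_open S A v & pull S R R1 h1 s : orbit S A v R1"
  using S R s unfolding scheme_def by blast
 show ?thesis
 proof (rule eq_local[OF R s g C(1)])
  fix R1 h1 assume 1: "(R1, h1) : C"
  have R1: "cring R1" "h1 : rhom R R1" using zariski_coverD[OF C(1) 1] by auto
  let ?s = "pull S R R1 h1 s"
  have s1: "?s : pts S R1" by (rule S.pull_closed[OF R R1 s])
  have one: "(?s, \<one>\<^sub>(grp G R1 ?s)) : pts (total S G) R1"
   using grp_group[OF R1(1) s1] by (simp add: total_simps s1 group.is_monoid monoid.one_closed)
  obtain C' where C': "zariski_cover R1 C'" "!!R2 h2. (R2, h2) : C' ==>
    EX A v. affine_open (total S G) A v & pull (total S G) R1 R2 h2 (?s, \<one>\<^sub>(grp G R1 ?s)) : orbit (total S G) A v R2"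
   using total R1(1) one unfolding scheme_def by blast
  show "res G R R1 h1 s g = res G R R1 h1 s g'"
  proof (rule eq_local[OF R1(1) s1 res_closed[OF R R1 s g(1)] res_closed[OF R R1 s g(2)] C'(1)])
   fix R2 h2 assume 2: "(R2, h2) : C'"
   have R2: "cring R2" "h2 : rhom R1 R2" using zariski_coverD[OF C'(1) 2] by auto
   have s2: "pull S R R2 (cmps R h2 h1) s = pull S R1 R2 h2 ?s"
    by (rule S.pull_comp[OF R R1(1) R2(1) R1(2) R2(2) s])
   have "EX A v. affine_open S A v & pull S R1 R2 h2 ?s : orbit S A v R2"
   proof -
    obtain A v where A: "affine_open S A v" "?s : orbit S A v R1" using C(2)[OF 1] by blast
    interpret A: affine S A v by unfold_locales (rule A)
    show ?thesis using A(1) A.orbit_pull[OF R1(1) R2 A(2)] by blast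
   qed
   then have "good R2 (pull S R R2 (cmps R h2 h1) s)"
    using C'(2)[OF 2] by (simp add: good_def s2 total_simps res_one[OF R1(1) R2 s1])
   from eq[OF R2(1) rhom_comp[OF R R1(2) R2(2)] this]
   show "res G R1 R2 h2 ?s (res G R R1 h1 s g) = res G R1 R2 h2 ?s (res G R R1 h1 s g')"
    by (simp add: res_comp[OF R R1(1) R2(1) R1(2) R2(2) s] g)
  qed
 qed
qed

lemma agree_mod_congr:
 assumes "g : congr R s K" "cring R" "s : pts S R"
 shows "agree_mod (total S G) R K (s, \<one>\<^sub>(grp G R s)) (s, g)"
 unfolding agree_mod_def using assms congrD(2)[OF assms(1)] by (simp add: total_simps res_one)

lemma congr_inj:
 assumes R: "cring R" and s: "good R s" and K: "K1 <= carrier R" "K2 <= carrier R"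
  "Idl \<^sub>R K1 Int Idl \<^sub>R K2 = {\<zero>\<^sub>R}"
  and g: "g : congr R s K1" "g : congr R s K2"
 shows "g = \<one>\<^sub>(grp G R s)"
proof -
 note sp = good_pts[OF R s]
 obtain A v where A: "affine_open (total S G) A v" "(s, \<one>\<^sub>(grp G R s)) : orbit (total S G) A v R"
  using s unfolding good_def by blast
 interpret A: affine "total S G" A v by unfold_locales (rule A)
 have "(s, \<one>\<^sub>(grp G R s)) = (s, g)"
  by (rule A.agree_mod_inj[OF R K A(2) _ agree_mod_congr[OF g(1) R sp] agree_mod_congr[OF g(2) R sp]])
   (simp add: total_simps sp congrD(1)[OF g(1)])
 then show ?thesis by simp
qed

lemma congr_inj_fibre_square:
 assumes sq: "fibre_square R J T p1 p2" and s: "good T s" and g: "g : GC T s"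
  and p1: "res G T R p1 s g = \<one>\<^sub>(grp G R (pull S T R p1 s))"
  and p2: "res G T R p2 s g = \<one>\<^sub>(grp G R (pull S T R p2 s))"
 shows "g = \<one>\<^sub>(grp G T s)"
proof -
 interpret sq: fibre_square R J T p1 p2 by fact
 note sp = good_pts[OF sq.T s]
 show ?thesis
  by (rule congr_inj[OF sq.T s _ _ sq.ker_Int congr_surj[OF sq.T sq.R sq.p1 sq.p_surj(1) sp g p1]
     congr_surj[OF sq.T sq.R sq.p2 sq.p_surj(2) sp g p2]]) auto
qed

text \<open>\<open>g\<close> is congruent to \<open>1\<close> modulo a nilpotent ideal, so it lies
  in the affine open around the unit section, where the pair \<open>(1, g)\<close> can be glued to a
  point over \<open>T\<close>.\<close>

lemma lift:
 assumes sq: "fibre_square R (Idl \<^sub>R J) T p1 p2" and s: "good R s"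
  and J: "J <= carrier R" "pw R J c <= {\<zero>\<^sub>R}" and g: "g : congr R s J"
 defines "t == pull S R T (fibre_square.diag R T p1 p2) s"
 obtains g' where "g' : GC T t" "res G T R p1 t g' = \<one>\<^sub>(grp G R s)" "res G T R p2 t g' = g"
proof -
 interpret sq: fibre_square R "Idl \<^sub>R J" T p1 p2 by fact
 note sp = good_pts[OF sq.R s]
 have t: "pull S T R p1 t = s" "pull S T R p2 t = s"
  unfolding t_def by (rule S.pull_pull_id[OF sq.R sq.T sq.diag(1) _ _ sp], rule sq.p1 sq.p2, rule sq.diag)+
 obtain A v where A: "affine_open S A v" "s : orbit S A v R" using s unfolding good_def by blast
 obtain A' v' where A': "affine_open (total S G) A' v'" "(s, \<one>\<^sub>(grp G R s)) : orbit (total S G) A' v' R"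
  using s unfolding good_def by blast
 interpret A: affine S A v by unfold_locales (rule A)
 interpret A': affine "total S G" A' v' by unfold_locales (rule A')
 have sg: "(s, g) : pts (total S G) R" by (simp add: total_simps sp congrD(1)[OF g])
 note ag = agree_mod_congr[OF g sq.R sp]
 have "(s, g) : orbit (total S G) A' v' R"
  by (rule tot.open_sub_nilpotent[OF A'.orbit_open sq.R J A'(2) sg ag])
 then obtain z where z: "z : orbit (total S G) A' v' T"
  "pull (total S G) T R p1 z = (s, \<one>\<^sub>(grp G R s))" "pull (total S G) T R p2 z = (s, g)"
  by (rule A'.glue[OF sq J(1) A'(2) _ ag])
 obtain t' g' where z': "z = (t', g')" by (cases z)
 have tg: "t' : pts S T" "g' : GC T t'"
  using A'.orbit_pts[OF sq.T z(1)] by (simp_all add: z' total_simps)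
 \<comment> \<open>Gluing takes place in the total space and yields some base point
   \<open>t'\<close>; it equals the constant one since both projections agree, in an affine open of
   \<open>S\<close>.\<close>
 have "t = t'"
  by (rule A.fibre_square_inj[OF sq _ tg(1)])
   (use t z z' A.orbit_pull[OF sq.R sq.T sq.diag(1) A(2)] in "auto simp: total_simps t_def")
 then show thesis using that[of g'] tg z z' by (simp add: total_simps)
qed

text \<open>The key estimate. The pair \<open>(1, g)\<close> is a point over \<open>R \<times>\<^bsub>R/J\<^esub> R\<close>; it and its image by \<open>u\<close> agree
 modulo the kernel of the first projection and modulo the diagonal copy of \<open>I\<close>, which meet in \<open>0\<close>.\<close>

lemma act_trivial:
 assumes R: "cring R" and s: "good R s" and I: "I <= carrier R" and J: "J <= carrier R" "pw R J c <= {\<zero>\<^sub>R}"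
  and IJ: "!!i j. i : I ==> j : J ==> i **\<^sub>R j = \<zero>\<^sub>R"
  and u: "u : Aut.congr R s I" and g: "g : congr R s J"
 shows "aut_app R u g = g"
proof -
 interpret R: cring R by fact
 obtain T p1 p2 where sq: "fibre_square R (Idl \<^sub>R J) T p1 p2"
  by (rule ex_fibre_square[OF infinite_universe R R.genideal_ideal[OF J(1)]])
 interpret sq: fibre_square R "Idl \<^sub>R J" T p1 p2 by fact
 note sp = good_pts[OF R s] and dg = sq.diag(1)
 define t where "t = pull S R T sq.diag s"
 have t: "pull S T R p1 t = s" "pull S T R p2 t = s"
  unfolding t_def by (rule S.pull_pull_id[OF sq.R sq.T sq.diag(1) _ _ sp], rule sq.p1 sq.p2, rule sq.diag)+
 have tp: "t : pts S T" unfolding t_def by (rule S.pull_closed[OF R sq.T dg sp])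
 have tg: "good T t" unfolding t_def by (rule good_pull[OF R sq.T dg s])
 obtain g' where g': "g' : GC T t" "res G T R p1 t g' = \<one>\<^sub>(grp G R s)" "res G T R p2 t g' = g"
  unfolding t_def by (rule lift[OF sq s J g])
 note uc = Aut.congrD(1)[OF u]
 define u' where "u' = ract R T sq.diag s u"
 have u': "u' : AC T t"
  unfolding u'_def t_def by (rule Aut.res_closed[OF R sq.T dg sp uc])
 have u'p: "ract T R p1 t u' = u" "ract T R p2 t u' = u"
  unfolding u'_def t_def
  by (simp_all flip: Aut.res_comp[OF R sq.T R dg sq.p1 sp uc] Aut.res_comp[OF R sq.T R dg sq.p2 sp uc]
    add: sq.diag Aut.res_id[OF R sp uc])
 interpret HT: group "grp G T t" by (rule grp_group[OF sq.T tp])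
 interpret H: group "grp G R s" by (rule grp_group[OF R sp])
 have ug': "aut_app T u' g' : GC T t" by (rule aut_app_closed[OF sq.T tp u' g'(1)])
 define e where "e = aut_app T u' g' **\<^sub>(grp G T t) inv \<^sub>(grp G T t) g'"
 have e: "e : GC T t" using ug' g'(1) by (simp add: e_def)
 have "e : congr T t {x : carrier T. p1 x = \<zero>\<^sub>R}"
  by (rule congr_surj[OF sq.T R sq.p1 sq.p_surj(1) tp e])
   (simp add: e_def res_mult[OF sq.T R sq.p1 tp] res_inv[OF sq.T R sq.p1 tp] ug' g'
    aut_app_natural[OF sq.T R sq.p1 tp u'] u'p t aut_app_hom_one[OF R sp uc])
 note e1 = this
 have e2: "e : congr T t (sq.diag ` I)"
 proof (rule congrI[OF e])
  fix Q q assume Q: "cring Q" "q : rhom T Q" "!!k. k : sq.diag ` I ==> q k = \<zero>\<^sub>Q"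
  have qd: "cmps R q sq.diag : rhom R Q" by (rule rhom_comp[OF R dg Q(2)])
  have st: "pull S R Q (cmps R q sq.diag) s = pull S T Q q t"
   unfolding t_def by (rule S.pull_comp[OF R sq.T Q(1) dg Q(2) sp])
  have "ract T Q q t u' = ract R Q (cmps R q sq.diag) s u"
   unfolding u'_def t_def by (rule Aut.res_comp[OF R sq.T Q(1) dg Q(2) sp uc, symmetric])
  also have "... = \<one>\<^sub>(AG Q (pull S R Q (cmps R q sq.diag) s))"
   by (rule Aut.congrD(2)[OF u Q(1) qd]) (use I Q(3) in "auto simp: compose_app subset_iff")
  finally have one: "ract T Q q t u' = \<one>\<^sub>(AG Q (pull S T Q q t))" by (simp add: st)
  note tq = S.pull_closed[OF sq.T Q(1,2) tp]
  interpret HQ: group "grp G Q (pull S T Q q t)" by (rule grp_group[OF Q(1) tq])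
  show "res G T Q q t e = \<one>\<^sub>(grp G Q (pull S T Q q t))"
   using res_closed[OF sq.T Q(1,2) tp g'(1)]
   by (simp add: e_def res_mult[OF sq.T Q(1,2) tp] res_inv[OF sq.T Q(1,2) tp] ug' g'(1)
    aut_app_natural[OF sq.T Q(1,2) tp u'] one aut_app_one[OF Q(1) tq])
 qed
 have e3: "Idl \<^sub>T {t : carrier T. p1 t = \<zero>\<^sub>R} Int Idl \<^sub>T (sq.diag ` I) = {\<zero>\<^sub>T}"
  by (rule sq.ker_Int_diag[OF I Idl_annihilates[OF R J(1)]]) (use I IJ in auto)
 have e4: "sq.diag ` I <= carrier T" using I rhom_closed[OF dg] by blast
 have "e = \<one>\<^sub>(grp G T t)" by (rule congr_inj[OF sq.T tg _ e4 e3 e1 e2]) auto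
 \<comment> \<open>The second projection carries this equation over \<open>T\<close> to the claim
   over \<open>R\<close>.\<close>
 then have "aut_app T u' g' = g'" using eq_iff_quotient[OF sq.T tp ug' g'(1)] by (simp add: e_def)
 then have "res G T R p2 t (aut_app T u' g') = g" using g' by simp
 then show ?thesis by (simp add: aut_app_natural[OF sq.T R sq.p2 tp u' g'(1)] u'p g')
qed

lemma act_congr_self:
 assumes R: "cring R" and s: "s : pts S R" and u: "u : Aut.congr R s I" and g: "g : GC R s"
 shows "aut_app R u g **\<^sub>(grp G R s) inv \<^sub>(grp G R s) g : congr R s I"
proof (rule congrI)
 interpret H: group "grp G R s" by (rule grp_group[OF R s])
 note uc = Aut.congrD(1)[OF u] note ug = aut_app_closed[OF R s uc g]
 show "aut_app R u g **\<^sub>(grp G R s) inv \<^sub>(grp G R s) g : GC R s" using ug g by simp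
 fix Q q assume Q: "cring Q" "q : rhom R Q" "!!k. k : I ==> q k = \<zero>\<^sub>Q"
 note sq = S.pull_closed[OF R Q(1,2) s]
 interpret HQ: group "grp G Q (pull S R Q q s)" by (rule grp_group[OF Q(1) sq])
 show "res G R Q q s (aut_app R u g **\<^sub>(grp G R s) inv \<^sub>(grp G R s) g) = \<one>\<^sub>(grp G Q (pull S R Q q s))"
  using res_closed[OF R Q(1,2) s g] Aut.congrD(2)[OF u Q]
  by (simp add: res_mult[OF R Q(1,2) s] res_inv[OF R Q(1,2) s] ug g
    aut_app_natural[OF R Q(1,2) s uc] aut_app_one[OF Q(1) sq])
qed

lemma inner_congr:
 assumes R: "cring R" and s: "s : pts S R" and c: "c : congr R s I"
 shows "inn R s c : Aut.congr R s I"
proof (rule Aut.congrI[OF inner_closed[OF R s congrD(1)[OF c]]])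
 fix Q q assume Q: "cring Q" "q : rhom R Q" "!!k. k : I ==> q k = \<zero>\<^sub>Q"
 note sq = S.pull_closed[OF R Q(1,2) s]
 have "ract R Q q s (inn R s c) = inn Q (pull S R Q q s) \<one>\<^sub>(grp G Q (pull S R Q q s))"
  by (simp add: inner_res[OF R Q(1,2) s congrD(1)[OF c]] congrD(2)[OF c Q])
 then show "ract R Q q s (inn R s c) = \<one>\<^sub>(AG Q (pull S R Q q s))" by (simp add: inner_one[OF Q(1) sq])
qed

text \<open>Over a test ring that kills \<open>K\<close> the images of \<open>I\<close> and
  \<open>J\<close> annihilate each other, and \<open>act_trivial\<close> applies. This turns a
  vanishing statement into additivity of degrees.\<close>

lemma act_congr:
 assumes R: "cring R" and s: "good R s" and I: "I <= carrier R" and J: "J <= carrier R" "pw R J c <= {\<zero>\<^sub>R}"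
  and IJ: "!!i j. i : I ==> j : J ==> i **\<^sub>R j : K"
  and u: "u : Aut.congr R s I" and g: "g : congr R s J"
 shows "aut_app R u g **\<^sub>(grp G R s) inv \<^sub>(grp G R s) g : congr R s K"
proof (rule congrI)
 note sp = good_pts[OF R s]
 interpret H: group "grp G R s" by (rule grp_group[OF R sp])
 note uc = Aut.congrD(1)[OF u] note gc = congrD(1)[OF g] note ug = aut_app_closed[OF R sp uc gc]
 show "aut_app R u g **\<^sub>(grp G R s) inv \<^sub>(grp G R s) g : GC R s" using ug gc by simp
 fix Q q assume Q: "cring Q" "q : rhom R Q" "!!k. k : K ==> q k = \<zero>\<^sub>Q"
 note sq = S.pull_closed[OF R Q(1,2) sp]
 interpret HQ: group "grp G Q (pull S R Q q s)" by (rule grp_group[OF Q(1) sq])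
 have "aut_app Q (ract R Q q s u) (res G R Q q s g) = res G R Q q s g"
  by (rule act_trivial[OF Q(1) good_pull[OF R Q(1,2) s] _ _ pw_image_zero[OF R Q(1,2) J]
     image_annihilates[OF R Q(1,2) I J(1)] Aut.congr_res[OF R Q(1,2) sp I u]
     congr_res[OF R Q(1,2) sp J(1) g]])
   (use IJ Q(3) I J(1) rhom_closed[OF Q(2)] in blast)+
 then show "res G R Q q s (aut_app R u g **\<^sub>(grp G R s) inv \<^sub>(grp G R s) g) = \<one>\<^sub>(grp G Q (pull S R Q q s))"
  using res_closed[OF R Q(1,2) sp gc]
  by (simp add: res_mult[OF R Q(1,2) sp] res_inv[OF R Q(1,2) sp] ug gc aut_app_natural[OF R Q(1,2) sp uc])
qed

text \<open>Write \<open>u(g) = k g\<close> and \<open>w(g) = h g\<close>, with \<open>k\<close>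
  congruent to \<open>1\<close> modulo \<open>I\<close> and \<open>h\<close> modulo
  \<open>J\<close>. By \<open>act_trivial\<close>, \<open>u\<close> fixes \<open>h\<close> and
  \<open>w\<close> fixes \<open>k\<close>; so everything reduces to
  \<open>h k = k h\<close>.\<close>

lemma Aut_commute:
 assumes R: "cring R" and s: "good R s" and I: "I <= carrier R" "pw R I c <= {\<zero>\<^sub>R}"
  and J: "J <= carrier R" "pw R J d <= {\<zero>\<^sub>R}"
  and IJ: "!!i j. i : I ==> j : J ==> i **\<^sub>R j = \<zero>\<^sub>R"
  and u: "u : Aut.congr R s I" and w: "w : Aut.congr R s J" and g: "g : GC R s"
 shows "aut_app R u (aut_app R w g) = aut_app R w (aut_app R u g)"
proof -
 let ?H = "grp G R s"
 interpret R: cring R by fact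
 note sp = good_pts[OF R s]
 interpret H: group "grp G R s" by (rule grp_group[OF R sp])
 note uc = Aut.congrD(1)[OF u] note wc = Aut.congrD(1)[OF w]
 note ug = aut_app_closed[OF R sp uc g] note wg = aut_app_closed[OF R sp wc g]
 have JI: "j **\<^sub>R i = \<zero>\<^sub>R" if "j : J" "i : I" for i j
  using IJ that I(1) J(1) by (metis R.m_comm subsetD)
 define k where "k = aut_app R u g **\<^sub>?H inv \<^sub>?H g"
 define h where "h = aut_app R w g **\<^sub>?H inv \<^sub>?H g"
 have k: "k : congr R s I" unfolding k_def by (rule act_congr_self[OF R sp u g])
 have h: "h : congr R s J" unfolding h_def by (rule act_congr_self[OF R sp w g])
 note kc = congrD(1)[OF k] note hc = congrD(1)[OF h]
 have kg: "aut_app R u g = k **\<^sub>?H g" and hg: "aut_app R w g = h **\<^sub>?H g"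
  using ug wg g by (simp_all add: k_def h_def H.m_assoc)
 have uh: "aut_app R u h = h" by (rule act_trivial[OF R s I(1) J IJ u h])
 have wk: "aut_app R w k = k" by (rule act_trivial[OF R s J(1) I JI w k])
 \<comment> \<open>Conjugation by \<open>h\<close> is congruent to the identity modulo
   \<open>J\<close>, so the same estimate makes \<open>h\<close> and \<open>k\<close>
   commute.\<close>
 have "aut_app R (inn R s h) k = k"
  by (rule act_trivial[OF R s J(1) I JI inner_congr[OF R sp h] k])
 then have "h **\<^sub>?H k **\<^sub>?H inv \<^sub>?H h = k" by (simp add: inner_aut_app[OF R sp hc kc])
 then have "h **\<^sub>?H k = k **\<^sub>?H h" using hc kc by (simp add: H.inv_solve_right')
 then have "h **\<^sub>?H (k **\<^sub>?H g) = k **\<^sub>?H (h **\<^sub>?H g)" using hc kc g by (simp flip: H.m_assoc)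
 then show ?thesis using uh wk
  by (simp add: kg hg aut_app_mult[OF R sp uc hc g] aut_app_mult[OF R sp wc kc g])
qed

text \<open>After base change along a homomorphism killing \<open>K\<close>, the ideals of
  \<open>u\<close> and \<open>w\<close> annihilate each other and \<open>Aut_commute\<close> holds
  over every further base change.\<close>

lemma Aut_commutator:
 assumes R: "cring R" and s: "good R s" and I: "I <= carrier R" "pw R I c <= {\<zero>\<^sub>R}"
  and J: "J <= carrier R" "pw R J d <= {\<zero>\<^sub>R}"
  and IJ: "!!i j. i : I ==> j : J ==> i **\<^sub>R j : K"
  and u: "u : Aut.congr R s I" and w: "w : Aut.congr R s J"
 shows "u **\<^sub>(AG R s) w **\<^sub>(AG R s) inv \<^sub>(AG R s) u **\<^sub>(AG R s) inv \<^sub>(AG R s) w : Aut.congr R s K"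
proof (rule Aut.congrI)
 let ?H = "AG R s"
 note sp = good_pts[OF R s]
 interpret H: group ?H by (rule Aut.grp_group[OF R sp])
 note uc = Aut.congrD(1)[OF u] note wc = Aut.congrD(1)[OF w]
 show "u **\<^sub>?H w **\<^sub>?H inv \<^sub>?H u **\<^sub>?H inv \<^sub>?H w : AC R s"
  using uc wc by simp
 fix Q q assume Q: "cring Q" "q : rhom R Q" "!!k. k : K ==> q k = \<zero>\<^sub>Q"
 note sq = S.pull_closed[OF R Q(1,2) sp]
 interpret HQ: group "AG Q (pull S R Q q s)" by (rule Aut.grp_group[OF Q(1) sq])
 let ?u = "ract R Q q s u" and ?w = "ract R Q q s w" and ?A = "AG Q (pull S R Q q s)"
 have u': "?u : carrier ?A" and w': "?w : carrier ?A"
  by (rule Aut.res_closed[OF R Q(1,2) sp], rule uc wc)+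
 have "?u **\<^sub>?A ?w = ?w **\<^sub>?A ?u"
 proof (rule Aut_eqI_app)
  fix R' h g assume R': "cring R'" "h : rhom Q R'" "g : GC R' (pull S Q R' h (pull S R Q q s))"
  note s' = S.pull_closed[OF Q(1) R'(1,2) sq]
  define k where "k = cmps R h q"
  have k: "k : rhom R R'" unfolding k_def by (rule rhom_comp[OF R Q(2) R'(2)])
  have e: "pull S Q R' h (pull S R Q q s) = pull S R R' k s"
   "ract Q R' h (pull S R Q q s) ?u = ract R R' k s u" "ract Q R' h (pull S R Q q s) ?w = ract R R' k s w"
   unfolding k_def by (simp_all add: S.pull_comp[OF R Q(1) R'(1) Q(2) R'(2) sp]
     Aut.res_comp[OF R Q(1) R'(1) Q(2) R'(2) sp] uc wc)
  have kz: "k (i **\<^sub>R j) = \<zero>\<^sub>R'" if "i : I" "j : J" for i j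
  proof -
   have "i **\<^sub>R j : carrier R"
    using that I(1) J(1) by (simp add: R cring.cring_simprules(5) subset_iff)
   then show ?thesis using IJ[OF that] Q(3) rhom_zero[OF Q(1) R'(1,2)] by (simp add: k_def compose_app)
  qed
  have "aut_app R' (ract R R' k s u) (aut_app R' (ract R R' k s w) g)
    = aut_app R' (ract R R' k s w) (aut_app R' (ract R R' k s u) g)"
   by (rule Aut_commute[OF R'(1) good_pull[OF R R'(1) k s] _ pw_image_zero[OF R R'(1) k I]
      _ pw_image_zero[OF R R'(1) k J] image_annihilates[OF R R'(1) k I(1) J(1) kz]
      Aut.congr_res[OF R R'(1) k sp I(1) u] Aut.congr_res[OF R R'(1) k sp J(1) w]])
    (use R'(3) e(1) I(1) J(1) rhom_closed[OF k] in auto)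
  then show "aut_app R' (ract Q R' h (pull S R Q q s) (?u **\<^sub>?A ?w)) g
    = aut_app R' (ract Q R' h (pull S R Q q s) (?w **\<^sub>?A ?u)) g"
   by (simp add: Aut.res_mult[OF Q(1) R'(1,2) sq] u' w' aut_app_comp[OF R'(1) s' R'(3)])
    (simp add: e)
 qed (use u' w' in auto)
 then show "ract R Q q s (u **\<^sub>?H w **\<^sub>?H inv \<^sub>?H u **\<^sub>?H inv \<^sub>?H w) = \<one>\<^sub>?A"
  using u' w' by (simp add: Aut.res_mult[OF R Q(1,2) sp] Aut.res_inv[OF R Q(1,2) sp] uc wc HQ.m_assoc)
qed

end

section \<open>Scaling of tangent directions and division by two\<close>

lemma (in cring) diff_self: "a : carrier R ==> a \<ominus> a = \<zero>"
 by (simp add: minus_eq r_neg)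

text \<open>Scaling the difference of a pair by \<open>c\<close> is multiplicative because products
  of two differences vanish.\<close>

lemma (in fibre_square) scale:
 assumes J2: "!!i j. i : J ==> j : J ==> i ** j = \<zero>" and c: "c : carrier R"
 obtains ps where "ps : rhom T T" "!!t. t : carrier T ==> p1 (ps t) = p1 t"
  "!!t. t : carrier T ==> p2 (ps t) = p1 t \<oplus> c ** (p2 t \<ominus> p1 t)"
proof -
 interpret Rc: cring R by (rule R)
 interpret Tc: cring T by (rule T)
 note p1c = rhom_closed[OF p1] and p2c = rhom_closed[OF p2]
 define g0 where "g0 t = p1 t \<oplus> c ** (p2 t \<ominus> p1 t)" for t
 have "g0 : ring_hom T R"
 proof (rule ring_hom_memI)
  fix t assume "t : carrier T" then show "g0 t : carrier R" using c p1c p2c by (simp add: g0_def)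
 next
  fix t t' assume t: "t : carrier T" "t' : carrier T"
  define a b a' b' where ab: "a = p1 t" "b = p2 t" "a' = p1 t'" "b' = p2 t'"
  have car: "a : carrier R" "b : carrier R" "a' : carrier R" "b' : carrier R"
   using t p1c p2c by (simp_all add: ab)
  have 0: "(b \<ominus> a) ** (b' \<ominus> a') = \<zero>" using J2 diff t by (simp add: ab)
  have "g0 (t **\<^sub>T t') = a ** a' \<oplus> c ** (b ** b' \<ominus> a ** a')"
   unfolding g0_def ab by (simp only: rhom_mult[OF p1 t] rhom_mult[OF p2 t])
  also have "... = a ** a' \<oplus> c ** (a ** (b' \<ominus> a') \<oplus> (b \<ominus> a) ** a' \<oplus> (b \<ominus> a) ** (b' \<ominus> a'))"
   using car c by algebra
  \<comment> \<open>A zero multiple of the product of the differences is first dropped and then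
    inserted with factor \<open>c^2\<close>, which completes the product of the two images.\<close>
  also have "... = a ** a' \<oplus> c ** (a ** (b' \<ominus> a') \<oplus> (b \<ominus> a) ** a') \<oplus> c ** c ** ((b \<ominus> a) ** (b' \<ominus> a'))"
   unfolding 0 using car c by algebra
  also have "... = (a \<oplus> c ** (b \<ominus> a)) ** (a' \<oplus> c ** (b' \<ominus> a'))"
  proof -
   have "a ** a' \<oplus> c ** (a ** y \<oplus> x ** a') \<oplus> c ** c ** (x ** y)
     = (a \<oplus> c ** x) ** (a' \<oplus> c ** y)"
    if "x : carrier R" "y : carrier R" for x y
    using that car(1,3) c by algebra
   then show ?thesis using car by simp
  qed
  finally show "g0 (t **\<^sub>T t') = g0 t ** g0 t'" by (simp add: g0_def ab)
  have "g0 (t \<oplus>\<^sub>T t') = a \<oplus> a' \<oplus> c ** (b \<oplus> b' \<ominus> (a \<oplus> a'))"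
   unfolding g0_def ab
   by (simp only: ring_hom_add[OF rhom_ring_hom[OF p1] t] ring_hom_add[OF rhom_ring_hom[OF p2] t])
  also have "... = (a \<oplus> c ** (b \<ominus> a)) \<oplus> (a' \<oplus> c ** (b' \<ominus> a'))"
   using car c by algebra
  finally show "g0 (t \<oplus>\<^sub>T t') = g0 t \<oplus> g0 t'" by (simp add: g0_def ab)
 next
  have "\<one> \<oplus> c ** (\<one> \<ominus> \<one>) = \<one>" using c by algebra
  then show "g0 \<one>\<^sub>T = \<one>" by (simp only: g0_def rhom_one[OF p1] rhom_one[OF p2])
 qed
 then have g: "restrict g0 (carrier T) : rhom T R" by (rule restrict_rhom[OF T])
 have d: "restrict g0 (carrier T) t \<ominus> p1 t : J" if t: "t : carrier T" for t
 proof -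
  have "g0 t \<ominus> p1 t = c ** (p2 t \<ominus> p1 t)"
   using p1c[OF t] p2c[OF t] c unfolding g0_def by algebra
  then show ?thesis using t J.I_l_closed[OF diff[OF t] c] by simp
 qed
 obtain ps where psi: "ps : rhom T T" "cmps T p1 ps = p1"
  "cmps T p2 ps = restrict g0 (carrier T)"
  by (rule pair[OF T p1 g d])
 show thesis
 proof (rule that[OF psi(1)])
  fix t assume t: "t : carrier T"
  show "p1 (ps t) = p1 t" using fun_cong[OF psi(2), of t] t by (simp add: compose_app)
  show "p2 (ps t) = p1 t \<oplus> c ** (p2 t \<ominus> p1 t)"
   using fun_cong[OF psi(3), of t] t by (simp add: compose_app g0_def)
 qed
qed

context group_scheme
begin

lemma res_res:
 assumes "cring R" "cring R'" "cring R''" "h : rhom R R'" "k : rhom R' R''" "s : pts S R" "g : GC R s"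
  and "cmps R k h = l" "s' = pull S R R' h s"
 shows "res G R' R'' k s' (res G R R' h s g) = res G R R'' l s g"
 using assms res_comp by metis

text \<open>With \<open>T' = T \<times>\<^sub>R T\<close>, the ring of triples \<open>(a, b, c)\<close> congruent modulo \<open>J\<close>, the point \<open>g = (1, h)\<close>
 satisfies \<open>(1, h, 1) (1, 1, h) = (1, h, h)\<close>; applying \<open>(a, b, c) \<mapsto> (a, b + c - a)\<close> shows that squaring
 is induced by \<open>(a, b) \<mapsto> (a, a + 2 (b - a))\<close>.\<close>

lemma square_eq_scale:
 fixes R :: "'r ring" (structure)
 assumes sq: "fibre_square R J T p1 p2" and s: "good R s"
  and J2: "!!i j. i : J ==> j : J ==> i ** j = \<zero>"
  and t: "t = pull S R T (fibre_square.diag R T p1 p2) s"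
  and g: "g : GC T t" "res G T R p1 t g = \<one>\<^sub>(grp G R s)"
  and psi: "ps : rhom T T" "!!x. x : carrier T ==> p1 (ps x) = p1 x"
  "!!x. x : carrier T ==> p2 (ps x) = p2 x \<oplus> (p2 x \<ominus> p1 x)"
 shows "g **\<^sub>(grp G T t) g = res G T T ps t g"
proof -
 interpret sq: fibre_square R J T p1 p2 by fact
 interpret Rc: cring R by (rule sq.R)
 interpret Tc: cring T by (rule sq.T)
 let ?d = sq.diag
 note R = sq.R and T = sq.T and p1 = sq.p1 and p2 = sq.p2 and d = sq.diag(1)
 note sp = good_pts[OF R s]
 \<comment> \<open>Modulo this kernel \<open>T\<close> becomes \<open>R\<close>, so the next fibre
   square is T x_R T, whose elements are triples \<open>(a, b, c)\<close> with projections
   \<open>(a, b)\<close> and \<open>(a, c)\<close>.\<close>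
 define K where "K = {x : carrier T. p1 x = \<zero>}"
 have K: "ideal K T" unfolding K_def by (rule sq.ker_ideal)
 obtain T' P1 P2 where sq': "fibre_square T K T' P1 P2"
  by (rule ex_fibre_square[OF infinite_universe T K])
 interpret sq': fibre_square T K T' P1 P2 by fact
 interpret T'c: cring T' by (rule sq'.T)
 let ?D = sq'.diag
 note T' = sq'.T and P1 = sq'.p1 and P2 = sq'.p2 and D = sq'.diag(1)
 note p1c = rhom_closed[OF p1] and p2c = rhom_closed[OF p2] and P1c = rhom_closed[OF P1]
  and P2c = rhom_closed[OF P2] and dc = rhom_closed[OF d] and Dc = rhom_closed[OF D]
 have tp: "t : pts S T" unfolding t by (rule S.pull_closed[OF R T d sp])
 have dp: "cmps T ?d p1 : rhom T T" by (rule rhom_comp[OF T p1 d])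
 note ridT = rid_rhom[OF T]
 have K1: "cmps T ?d p1 x \<ominus>\<^sub>T rid T x : K" "rid T x \<ominus>\<^sub>T cmps T ?d p1 x : K"
  if x: "x : carrier T" for x
 proof -
  note c = p1c[OF x] note e = dc[OF c]
  have "p1 (?d (p1 x) \<ominus>\<^sub>T x) = \<zero>" "p1 (x \<ominus>\<^sub>T ?d (p1 x)) = \<zero>"
   by (simp_all only: rhom_minus[OF T R p1 e x] rhom_minus[OF T R p1 x e] sq.p_diag(1)[OF c] cring.diff_self[OF R c])
  then show "cmps T ?d p1 x \<ominus>\<^sub>T rid T x : K" "rid T x \<ominus>\<^sub>T cmps T ?d p1 x : K"
   using sq.p1.R.minus_closed[OF e x] sq.p1.R.minus_closed[OF x e]
   unfolding K_def compose_app[OF x] rid_app[OF x] by blast+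
 qed
 \<comment> \<open>In terms of triples, \<open>al\<close>, \<open>be\<close> and \<open>?D\<close>
   send \<open>(a, b)\<close> to \<open>(a, b, a)\<close>, \<open>(a, a, b)\<close> and
   \<open>(a, b, b)\<close>.\<close>
 obtain al where alpha: "al : rhom T T'" "cmps T P1 al = rid T"
  "cmps T P2 al = cmps T ?d p1"
  by (rule sq'.pair[OF T ridT dp K1(1)])
 obtain be where beta: "be : rhom T T'" "cmps T P1 be = cmps T ?d p1"
  "cmps T P2 be = rid T"
  by (rule sq'.pair[OF T dp ridT K1(2)])
 note ac = rhom_closed[OF alpha(1)] and bc = rhom_closed[OF beta(1)]
 have a_app: "P1 (al x) = x" "P2 (al x) = ?d (p1 x)" if "x : carrier T" for x
  using fun_cong[OF alpha(2), of x] fun_cong[OF alpha(3), of x] that by (simp_all add: compose_app rid_app)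
 have b_app: "P1 (be x) = ?d (p1 x)" "P2 (be x) = x" if "x : carrier T" for x
  using fun_cong[OF beta(2), of x] fun_cong[OF beta(3), of x] that by (simp_all add: compose_app rid_app)
 have pp: "p1 (P2 x) = p1 (P1 x)" if x: "x : carrier T'" for x
 proof -
  have "p1 (P2 x \<ominus>\<^sub>T P1 x) = \<zero>" using sq'.diff[OF x] unfolding K_def by blast
  then have "p1 (P2 x) \<ominus> p1 (P1 x) = \<zero>" by (simp only: rhom_minus[OF T R p1 P2c[OF x] P1c[OF x]])
  then show ?thesis by (rule cring.eq_of_diff_zero[OF R p1c[OF P2c[OF x]] p1c[OF P1c[OF x]]])
 qed
 define q0 where "q0 x = p2 (P1 x) \<oplus> (p2 (P2 x) \<ominus> p1 (P1 x))" for x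
 have "q0 : ring_hom T' R"
 proof (rule ring_hom_memI)
  fix x assume x: "x : carrier T'"
  show "q0 x : carrier R" using p1c[OF P1c[OF x]] p2c[OF P1c[OF x]] p2c[OF P2c[OF x]] by (simp add: q0_def)
 next
  fix x x' assume x: "x : carrier T'" "x' : carrier T'"
  define a b c a' b' c' where ab: "a = p1 (P1 x)" "b = p2 (P1 x)" "c = p2 (P2 x)"
   "a' = p1 (P1 x')" "b' = p2 (P1 x')" "c' = p2 (P2 x')"
  have car: "a : carrier R" "b : carrier R" "c : carrier R" "a' : carrier R" "b' : carrier R" "c' : carrier R"
   using x p1c p2c P1c P2c by (simp_all add: ab)
  have J: "b \<ominus> a : J" "c \<ominus> a : J" "b' \<ominus> a' : J" "c' \<ominus> a' : J"
   using sq.diff[OF P1c[OF x(1)]] sq.diff[OF P1c[OF x(2)]] sq.diff[OF P2c[OF x(1)]] sq.diff[OF P2c[OF x(2)]]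
   by (simp_all add: ab pp x)
  \<comment> \<open>These vanishing cross terms are exactly what multiplicativity of
    \<open>q0\<close> lacks.\<close>
  have 0: "(b \<ominus> a) ** (c' \<ominus> a') = \<zero>" "(c \<ominus> a) ** (b' \<ominus> a') = \<zero>"
   using J J2 by auto
  have "q0 (x **\<^sub>T' x') = b ** b' \<oplus> (c ** c' \<ominus> a ** a')"
   unfolding q0_def ab
   by (simp only: rhom_mult[OF P1 x] rhom_mult[OF P2 x] rhom_mult[OF p1 x(1,2)[THEN P1c]]
     rhom_mult[OF p2 x(1,2)[THEN P1c]] rhom_mult[OF p2 x(1,2)[THEN P2c]])
  also have "... = b ** b' \<oplus> (c ** c' \<ominus> a ** a') \<oplus> (b \<ominus> a) ** (c' \<ominus> a') \<oplus> (c \<ominus> a) ** (b' \<ominus> a')"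
   unfolding 0 using car by algebra
  also have "... = (b \<oplus> (c \<ominus> a)) ** (b' \<oplus> (c' \<ominus> a'))"
   using car by algebra
  finally show "q0 (x **\<^sub>T' x') = q0 x ** q0 x'" by (simp only: q0_def ab)
  have "q0 (x \<oplus>\<^sub>T' x') = b \<oplus> b' \<oplus> (c \<oplus> c' \<ominus> (a \<oplus> a'))"
   unfolding q0_def ab
   by (simp only: ring_hom_add[OF rhom_ring_hom[OF P1] x] ring_hom_add[OF rhom_ring_hom[OF P2] x]
     ring_hom_add[OF rhom_ring_hom[OF p1] x(1,2)[THEN P1c]]
     ring_hom_add[OF rhom_ring_hom[OF p2] x(1,2)[THEN P1c]]
     ring_hom_add[OF rhom_ring_hom[OF p2] x(1,2)[THEN P2c]])
  also have "... = (b \<oplus> (c \<ominus> a)) \<oplus> (b' \<oplus> (c' \<ominus> a'))"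
   using car by algebra
  finally show "q0 (x \<oplus>\<^sub>T' x') = q0 x \<oplus> q0 x'" by (simp only: q0_def ab)
 next
  have "\<one> \<oplus> (\<one> \<ominus> \<one>) = \<one>" by algebra
  then show "q0 \<one>\<^sub>T' = \<one>"
   by (simp only: q0_def rhom_one[OF p1] rhom_one[OF p2] rhom_one[OF P1] rhom_one[OF P2])
 qed
 then have q: "restrict q0 (carrier T') : rhom T' R" by (rule restrict_rhom[OF T'])
 have qd: "restrict q0 (carrier T') x \<ominus> cmps T' p1 P1 x : J" if x: "x : carrier T'" for x
 proof -
  have c: "p1 (P1 x) : carrier R" "p2 (P1 x) : carrier R" "p2 (P2 x) : carrier R"
   using x P1c P2c p1c p2c by auto
  have "q0 x \<ominus> p1 (P1 x) = (p2 (P1 x) \<ominus> p1 (P1 x)) \<oplus> (p2 (P2 x) \<ominus> p1 (P1 x))"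
   using c unfolding q0_def by algebra
  also have "... : J"
   using sq.diff[OF P1c[OF x]] sq.diff[OF P2c[OF x]] by (intro sq.J.a_closed) (simp_all add: pp x)
  finally show ?thesis using x by (simp add: compose_app)
 qed
 obtain sg where sigma: "sg : rhom T' T" "cmps T' p1 sg = cmps T' p1 P1"
  "cmps T' p2 sg = restrict q0 (carrier T')"
  by (rule sq.pair[OF T' rhom_comp[OF T' P1 p1] q qd])
 note sc = rhom_closed[OF sigma(1)]
 have s_app: "p1 (sg x) = p1 (P1 x)" "p2 (sg x) = q0 x" if "x : carrier T'" for x
  using fun_cong[OF sigma(2), of x] fun_cong[OF sigma(3), of x] that by (simp_all add: compose_app)
 have sa: "cmps T sg al = rid T"
 proof (rule rhom_eqI[OF rhom_comp[OF T alpha(1) sigma(1)] ridT])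
  fix x assume x: "x : carrier T"
  note c = p1c[OF x] p2c[OF x]
  have "p2 x \<oplus> (p1 x \<ominus> p1 x) = p2 x" using c by algebra
  then have "sg (al x) = x"
   by (intro sq.inj[OF sc[OF ac[OF x]] x]) (simp_all add: s_app ac x a_app q0_def sq.p_diag c)
  then show "cmps T sg al x = rid T x" by (simp add: compose_app rid_app x)
 qed
 have sb: "cmps T sg be = rid T"
 proof (rule rhom_eqI[OF rhom_comp[OF T beta(1) sigma(1)] ridT])
  fix x assume x: "x : carrier T"
  note c = p1c[OF x] p2c[OF x]
  have "p1 x \<oplus> (p2 x \<ominus> p1 x) = p2 x" using c by algebra
  then have "sg (be x) = x"
   by (intro sq.inj[OF sc[OF bc[OF x]] x]) (simp_all add: s_app bc x b_app q0_def sq.p_diag c)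
  then show "cmps T sg be x = rid T x" by (simp add: compose_app rid_app x)
 qed
 have sD: "cmps T sg ?D = ps"
 proof (rule rhom_eqI[OF rhom_comp[OF T D sigma(1)] psi(1)])
  fix x assume x: "x : carrier T"
  have "sg (?D x) = ps x"
   by (intro sq.inj[OF sc[OF Dc[OF x]] rhom_closed[OF psi(1) x]]) (simp_all add: s_app Dc x q0_def sq'.p_diag psi)
  then show "cmps T sg ?D x = ps x" by (simp add: compose_app x)
 qed
 define t' where "t' = pull S T T' ?D t"
 have base: "pull S T T' al t = t'" "pull S T T' be t = t'"
 proof -
  have "al (?d x) = ?D (?d x)" "be (?d x) = ?D (?d x)" if x: "x : carrier R" for x
  proof -
   note e = dc[OF x]
   show "al (?d x) = ?D (?d x)"
    by (rule sq'.inj[OF ac[OF e] Dc[OF e]]) (simp_all only: a_app[OF e] sq'.p_diag[OF e] sq.p_diag[OF x])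
   show "be (?d x) = ?D (?d x)"
    by (rule sq'.inj[OF bc[OF e] Dc[OF e]]) (simp_all only: b_app[OF e] sq'.p_diag[OF e] sq.p_diag[OF x])
  qed
  then have "cmps R al ?d = cmps R ?D ?d" "cmps R be ?d = cmps R ?D ?d"
   by (simp_all add: compose_def cong: restrict_cong)
  then show "pull S T T' al t = t'" "pull S T T' be t = t'"
   unfolding t'_def t
   by (simp_all flip: S.pull_comp[OF R T T' d alpha(1) sp] S.pull_comp[OF R T T' d beta(1) sp]
     S.pull_comp[OF R T T' d D sp])
 qed
 have t'p: "t' : pts S T'" unfolding t'_def by (rule S.pull_closed[OF T T' D tp])
 have base': "pull S T' T P1 t' = t" "pull S T' T P2 t' = t"
  unfolding t'_def by (rule S.pull_pull_id[OF T T' D _ _ tp], rule P1 P2, rule sq'.diag)+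
 have bases: "pull S T' T sg t' = t"
  unfolding base(1)[symmetric] by (rule S.pull_pull_id[OF T T' alpha(1) sigma(1) sa tp])
 have gt: "good T t" unfolding t by (rule good_pull[OF R T d s])
 have gt': "good T' t'" unfolding t'_def by (rule good_pull[OF T T' D gt])
 define x y z where "x = res G T T' al t g" and "y = res G T T' be t g" and "z = res G T T' ?D t g"
 have xyz: "x : GC T' t'" "y : GC T' t'" "z : GC T' t'"
  using res_closed[OF T T' alpha(1) tp g(1)] res_closed[OF T T' beta(1) tp g(1)] res_closed[OF T T' D tp g(1)]
  by (simp_all add: x_def y_def z_def base t'_def)
 interpret HT: group "grp G T t" by (rule grp_group[OF T tp])
 interpret HT': group "grp G T' t'" by (rule grp_group[OF T' t'p])
 have tR: "pull S T R p1 t = s" unfolding t by (rule S.pull_pull_id[OF R T d p1 sq.diag(2) sp])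
 have one: "res G T T (cmps T ?d p1) t g = \<one>\<^sub>(grp G T t)"
  using res_comp[OF T R T p1 d tp g(1)] res_one[OF R T d sp] by (simp only: tR g(2) t[symmetric])
 have rx: "res G T' T P1 t' x = g" "res G T' T P2 t' x = \<one>\<^sub>(grp G T t)" "res G T' T sg t' x = g"
  unfolding x_def
  using res_res[OF T T' T alpha(1) P1 tp g(1) alpha(2)] res_res[OF T T' T alpha(1) P2 tp g(1) alpha(3)]
   res_res[OF T T' T alpha(1) sigma(1) tp g(1) sa]
  by (simp_all add: base one res_id[OF T tp g(1)])
 have ry: "res G T' T P1 t' y = \<one>\<^sub>(grp G T t)" "res G T' T P2 t' y = g" "res G T' T sg t' y = g"
  unfolding y_def
  using res_res[OF T T' T beta(1) P1 tp g(1) beta(2)] res_res[OF T T' T beta(1) P2 tp g(1) beta(3)]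
   res_res[OF T T' T beta(1) sigma(1) tp g(1) sb]
  by (simp_all add: base one res_id[OF T tp g(1)])
 have rz: "res G T' T P1 t' z = g" "res G T' T P2 t' z = g" "res G T' T sg t' z = res G T T ps t g"
  unfolding z_def
  using res_res[OF T T' T D P1 tp g(1) sq'.diag(2)] res_res[OF T T' T D P2 tp g(1) sq'.diag(3)]
   res_res[OF T T' T D sigma(1) tp g(1) sD]
  by (simp_all add: t'_def res_id[OF T tp g(1)])
 \<comment> \<open>Under each projection one of \<open>x\<close> and \<open>y\<close> becomes
   \<open>1\<close>, while the other and \<open>z\<close> become \<open>g\<close>.\<close>
 have "x **\<^sub>(grp G T' t') y **\<^sub>(grp G T' t') inv \<^sub>(grp G T' t') z = \<one>\<^sub>(grp G T' t')"
  by (rule congr_inj_fibre_square[OF sq' gt'])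
   (use xyz g(1) in "simp_all add: res_mult[OF T' T P1 t'p] res_mult[OF T' T P2 t'p]
    res_inv[OF T' T P1 t'p] res_inv[OF T' T P2 t'p] rx ry rz base'")
 then have "x **\<^sub>(grp G T' t') y = z"
  using eq_iff_quotient[OF T' t'p _ xyz(3)] xyz by simp
 then have "res G T' T sg t' (x **\<^sub>(grp G T' t') y) = res G T T ps t g" using rz(3) by simp
 then show ?thesis using res_mult[OF T' T sigma(1) t'p xyz(1,2)] by (simp add: rx ry bases)
qed

text \<open>Squaring is the pullback along scaling by \<open>2\<close>, and scaling by the inverse
  of \<open>2\<close> undoes that pullback.\<close>

lemma no_two_torsion:
 fixes R :: "'r ring" (structure)
 assumes sq: "fibre_square R J T p1 p2" and s: "good R s"
  and J2: "!!i j. i : J ==> j : J ==> i ** j = \<zero>"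
  and two: "\<one> \<oplus> \<one> : Units R"
  and t: "t = pull S R T (fibre_square.diag R T p1 p2) s"
  and g: "g : GC T t" "res G T R p1 t g = \<one>\<^sub>(grp G R s)" "g **\<^sub>(grp G T t) g = \<one>\<^sub>(grp G T t)"
 shows "g = \<one>\<^sub>(grp G T t)"
proof -
 interpret sq: fibre_square R J T p1 p2 by fact
 interpret Rc: cring R by (rule sq.R)
 note R = sq.R and T = sq.T
 note sp = good_pts[OF R s]
 have tp: "t : pts S T" unfolding t by (rule S.pull_closed[OF R T sq.diag(1) sp])
 let ?two = "\<one> \<oplus> \<one>" and ?half = "inv (\<one> \<oplus> \<one>)"
 have half: "?half : carrier R" "?half ** ?two = \<one>" using two by simp_all
 obtain ps where psi: "ps : rhom T T" "!!x. x : carrier T ==> p1 (ps x) = p1 x"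
  "!!x. x : carrier T ==> p2 (ps x) = p1 x \<oplus> ?two ** (p2 x \<ominus> p1 x)"
  by (rule sq.scale[OF J2, of ?two]) auto
 obtain \<chi> where chi: "\<chi> : rhom T T" "!!x. x : carrier T ==> p1 (\<chi> x) = p1 x"
  "!!x. x : carrier T ==> p2 (\<chi> x) = p1 x \<oplus> ?half ** (p2 x \<ominus> p1 x)"
  by (rule sq.scale[OF J2 half(1)]) auto
 have psi2: "p2 (ps x) = p2 x \<oplus> (p2 x \<ominus> p1 x)" if x: "x : carrier T" for x
 proof -
  note c = rhom_closed[OF sq.p1 x] rhom_closed[OF sq.p2 x]
  show ?thesis unfolding psi(3)[OF x] using c by algebra
 qed
 have "cmps T \<chi> ps = rid T"
 proof (rule rhom_eqI[OF rhom_comp[OF T psi(1) chi(1)] rid_rhom[OF T]])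
  fix x assume x: "x : carrier T"
  note c = rhom_closed[OF sq.p1 x] rhom_closed[OF sq.p2 x] rhom_closed[OF psi(1) x]
  have "\<chi> (ps x) = x"
  proof (rule sq.inj[OF rhom_closed[OF chi(1) c(3)] x])
   show "p1 (\<chi> (ps x)) = p1 x" by (simp add: chi(2)[OF c(3)] psi(2)[OF x])
   define a b where ab: "a = p1 x" "b = p2 x"
   have car: "a : carrier R" "b : carrier R" using c by (simp_all add: ab)
   have "p2 (\<chi> (ps x)) = a \<oplus> ?half ** (a \<oplus> ?two ** (b \<ominus> a) \<ominus> a)"
    unfolding chi(3)[OF c(3)] psi(2,3)[OF x] ab ..
   also have "... = a \<oplus> (?half ** ?two) ** (b \<ominus> a)"
   proof -
    have "a \<oplus> h ** (a \<oplus> w ** (b \<ominus> a) \<ominus> a) = a \<oplus> (h ** w) ** (b \<ominus> a)"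
     if "h : carrier R" "w : carrier R" for h w
     using that car by algebra
    from this[OF half(1), of ?two] show ?thesis by simp
   qed
   also have "... = b" unfolding half(2) using car by algebra
   finally show "p2 (\<chi> (ps x)) = p2 x" by (simp add: ab)
  qed
  then show "cmps T \<chi> ps x = rid T x" by (simp add: compose_app rid_app x)
 qed
 have tpsi: "pull S T T ps t = t"
 proof -
  have "cmps R ps sq.diag = sq.diag"
  proof (rule rhom_eqI[OF rhom_comp[OF R sq.diag(1) psi(1)] sq.diag(1)])
   fix x assume x: "x : carrier R"
   note dx = rhom_closed[OF sq.diag(1) x]
   have "x \<oplus> (x \<ominus> x) = x" using x by algebra
   then have "ps (sq.diag x) = sq.diag x"
    by (intro sq.inj[OF rhom_closed[OF psi(1) dx] dx]) (simp_all only: psi(2)[OF dx] psi2[OF dx] sq.p_diag[OF x])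
   then show "cmps R ps sq.diag x = sq.diag x" by (simp add: compose_app x)
  qed
  then show ?thesis unfolding t by (simp flip: S.pull_comp[OF R T T sq.diag(1) psi(1) sp])
 qed
 have "res G T T ps t g = \<one>\<^sub>(grp G T t)"
  using square_eq_scale[OF sq s J2 t g(1,2) psi(1,2) psi2] g(3) by simp
 then have "res G T T \<chi> t (res G T T ps t g) = \<one>\<^sub>(grp G T (pull S T T \<chi> t))"
  by (simp add: res_one[OF T T chi(1) tp])
 moreover have "pull S T T \<chi> t = t"
  using S.pull_comp[OF T T T psi(1) chi(1) tp] \<open>cmps T \<chi> ps = rid T\<close>
  by (simp add: tpsi S.pull_id[OF T tp])
 moreover have "res G T T \<chi> t (res G T T ps t g) = g"
  using res_res[OF T T T psi(1) chi(1) tp g(1) \<open>cmps T \<chi> ps = rid T\<close> tpsi[symmetric]]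
  by (simp add: res_id[OF T tp g(1)])
 ultimately show ?thesis by simp
qed

end

section \<open>Differential forms\<close>

lemma Idl_square_zero:
 assumes R: "cring R" and J: "J <= carrier R" "!!i j. i : J ==> j : J ==> i **\<^sub>R j = \<zero>\<^sub>R"
  and ij: "i : Idl \<^sub>R J" "j : Idl \<^sub>R J"
 shows "i **\<^sub>R j = \<zero>\<^sub>R"
proof -
 interpret Rc: cring R by fact
 have i: "i : carrier R" by (rule ideal.Icarr[OF Rc.genideal_ideal[OF J(1)] ij(1)])
 show ?thesis
 proof (rule Idl_annihilates[OF R J(1) i _ ij(2)])
  fix k assume k: "k : J"
  have kc: "k : carrier R" using k J(1) by blast
  have "k **\<^sub>R i = \<zero>\<^sub>R" by (rule Idl_annihilates[OF R J(1) kc J(2)[OF k] ij(1)])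
  then show "i **\<^sub>R k = \<zero>\<^sub>R" using Rc.m_comm[OF i kc] by simp
 qed
qed

lemma base_change_simps [simp]:
 "grp (base_change p F) R x = grp F R (p R x)"
 "res (base_change p F) R R' h x = res F R R' h (p R x)"
 by (simp_all add: base_change_def)

abbreviation "spx X p U n R == pts (simplices X p U n) R"

lemma spx_iff:
 "xs : spx X p U n R \<longleftrightarrow> length xs = Suc n & set xs <= U R &
   (ALL x:set xs. ALL y:set xs. p R x = p R y & infinitesimally_close X R x y)"
 by (simp add: simplices_def)

lemma spxD:
 assumes "xs : spx X p U n R"
 shows "length xs = Suc n" "set xs <= U R" "x : set xs ==> y : set xs ==> p R x = p R y"
  "x : set xs ==> y : set xs ==> infinitesimally_close X R x y" "xs ~= []" "hd xs : set xs"
proof -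
 note * = assms[unfolded spx_iff]
 show l: "length xs = Suc n" and "set xs <= U R" using * by simp_all
 show "x : set xs ==> y : set xs ==> p R x = p R y"
  "x : set xs ==> y : set xs ==> infinitesimally_close X R x y" using * by blast+
 show "xs ~= []" using l by force
 then show "hd xs : set xs" by (rule hd_in_set)
qed

lemma spxI:
 assumes "length xs = Suc n" "set xs <= U R" "!!x y. x : set xs ==> y : set xs ==> p R x = p R y"
  "!!x y. x : set xs ==> y : set xs ==> infinitesimally_close X R x y"
 shows "xs : spx X p U n R"
 using assms unfolding spx_iff by blast

lemma spx_subset:
 assumes xs: "xs : spx X p U n R" and ys: "set ys <= set xs" "length ys = Suc k"
 shows "ys : spx X p U k R"
proof (rule spxI[OF ys(2)])
 show "set ys <= U R" using ys(1) spxD(2)[OF xs] by (rule subset_trans)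
qed (use spxD(3,4)[OF xs] ys(1) in blast)+

lemma spx_mono:
 "xs : spx X p U n R ==> set xs <= V R ==> xs : spx X p V n R"
 unfolding spx_iff by blast

lemma spx_pull: "pull (simplices X p U n) R R' h = map (pull X R R' h)"
 by (simp add: simplices_def)

section \<open>Infinitesimal simplices\<close>

locale form_space = group_scheme S G
 for S :: "('r, 's) pfunctor" and G :: "('r, 's, 'g) gfunctor" +
 fixes X :: "('r, 'x) pfunctor" and p :: "'r ring => 'x => 's"
 assumes X: "scheme X" and p: "functor_morphism X S p"
begin

sublocale X: point_functor X using X by (simp add: scheme_def)
sublocale p: functor_morphism X S p by (rule p)

text \<open>The calculus of forms uses openness through these closure properties; unlike the
  description of \<open>open_sub\<close> by ideals, they pass to intersections without
  computation.\<close>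

definition stable_open :: "('r ring => 'x set) => bool" where
 "stable_open U \<longleftrightarrow> (ALL R. cring R --> U R <= pts X R) &
   (ALL R R' h x. cring R & cring R' & h : rhom R R' & x : U R --> pull X R R' h x : U R') &
   (ALL R J T p1 p2 z. fibre_square R J T p1 p2 & z : pts X T & pull X T R p1 z : U R &
    pull X T R p2 z : U R --> z : U T)"

lemma stable_openD:
 assumes "stable_open U"
 shows "cring R ==> x : U R ==> x : pts X R"
  and "cring R ==> cring R' ==> h : rhom R R' ==> x : U R ==> pull X R R' h x : U R'"
  and "fibre_square R J T p1 p2 ==> z : pts X T ==> pull X T R p1 z : U R ==>
    pull X T R p2 z : U R ==> z : U T"
 using conjunct1[OF assms[unfolded stable_open_def]] apply blast
 using conjunct1[OF conjunct2[OF assms[unfolded stable_open_def]]] apply blast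
 using conjunct2[OF conjunct2[OF assms[unfolded stable_open_def]]] apply blast
 done

lemma open_sub_stable:
 assumes "open_sub X U" shows "stable_open U"
 unfolding stable_open_def
proof (intro conjI allI impI)
 show "U R <= pts X R" if "cring R" for R using assms that unfolding open_sub_def by blast
next
 fix R R' h x assume "cring R & cring R' & h : rhom R R' & x : U R"
 then show "pull X R R' h x : U R'" using X.open_sub_pull[OF assms] by blast
next
 fix R J T p1 p2 z
 assume "fibre_square R J T p1 p2 & z : pts X T & pull X T R p1 z : U R & pull X T R p2 z : U R"
 then show "z : U T" using X.open_sub_fibre_square[OF assms] by blast
qed

lemma stable_open_Int:
 assumes U: "stable_open U" and V: "stable_open V" shows "stable_open (%R. U R Int V R)"
 unfolding stable_open_def
proof (intro conjI allI impI)
 show "U R Int V R <= pts X R" if "cring R" for R using stable_openD(1)[OF U that] by blast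
next
 fix R R' h x assume "cring R & cring R' & h : rhom R R' & x : U R Int V R"
 then show "pull X R R' h x : U R' Int V R'" using stable_openD(2)[OF U] stable_openD(2)[OF V] by simp
next
 fix R J T p1 p2 z
 assume "fibre_square R J T p1 p2 & z : pts X T & pull X T R p1 z : U R Int V R & pull X T R p2 z : U R Int V R"
 then show "z : U T Int V T" using stable_openD(3)[OF U] stable_openD(3)[OF V] by blast
qed

text \<open>From a thickening one takes its kernel; conversely, the ideal generated by
  \<open>J\<close> still has square zero, and its quotient is a thickening.\<close>

lemma close_iff:
 assumes R: "cring R" and x: "x : pts X R" and y: "y : pts X R"
 shows "infinitesimally_close X R x y \<longleftrightarrow>
  (EX J<=carrier R. (ALL i:J. ALL j:J. i **\<^sub>R j = \<zero>\<^sub>R) & agree_mod X R J x y)"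
proof
 assume "infinitesimally_close X R x y"
 then obtain R0 h where h: "thickening R R0 h" "pull X R R0 h x = pull X R R0 h y"
  unfolding infinitesimally_close_def by blast
 then have t: "cring R0" "h : rhom R R0" "h ` carrier R = carrier R0"
  "!!a b. a : carrier R ==> b : carrier R ==> h a = \<zero>\<^sub>R0 ==> h b = \<zero>\<^sub>R0 ==> a **\<^sub>R b = \<zero>\<^sub>R"
  unfolding thickening_def by blast+
 show "EX J<=carrier R. (ALL i:J. ALL j:J. i **\<^sub>R j = \<zero>\<^sub>R) & agree_mod X R J x y"
  by (rule exI[of _ "{r : carrier R. h r = \<zero>\<^sub>R0}"])
   (use t(4) X.agree_mod_surj[OF R t(1-3) x y h(2)] in blast)
next
 assume "EX J<=carrier R. (ALL i:J. ALL j:J. i **\<^sub>R j = \<zero>\<^sub>R) & agree_mod X R J x y"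
 then obtain J where J: "J <= carrier R" "!!i j. i : J ==> j : J ==> i **\<^sub>R j = \<zero>\<^sub>R" "agree_mod X R J x y"
  by blast
 interpret Rc: cring R by fact
 obtain Q q where Q: "cring Q" "q : rhom R Q" "q ` carrier R = carrier Q"
  "!!r. r : carrier R ==> q r = \<zero>\<^sub>Q \<longleftrightarrow> r : Idl \<^sub>R J"
  using ex_quotient[OF R Rc.genideal_ideal[OF J(1)]] by blast
 have "thickening R Q q" unfolding thickening_def using R Q Idl_square_zero[OF R J(1,2)] by blast
 moreover have "pull X R Q q x = pull X R Q q y"
  by (rule agree_modD[OF J(3) Q(1,2)]) (use Q(4) J(1) Rc.genideal_self[OF J(1)] in blast)
 ultimately show "infinitesimally_close X R x y" unfolding infinitesimally_close_def by blast
qed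

lemma close_pull:
 assumes R: "cring R" "cring R'" "h : rhom R R'" and x: "x : pts X R" and y: "y : pts X R"
  and c: "infinitesimally_close X R x y"
 shows "infinitesimally_close X R' (pull X R R' h x) (pull X R R' h y)"
proof -
 obtain J where J: "J <= carrier R" "!!i j. i : J ==> j : J ==> i **\<^sub>R j = \<zero>\<^sub>R" "agree_mod X R J x y"
  using c unfolding close_iff[OF R(1) x y] by blast
 have "h ` J <= carrier R'" using J(1) rhom_closed[OF R(3)] by blast
 moreover have "i **\<^sub>R' j = \<zero>\<^sub>R'" if "i : h ` J" "j : h ` J" for i j
  by (rule image_annihilates[OF R J(1,1) _ that]) (simp add: J(2) rhom_zero[OF R])
 ultimately show ?thesis
  unfolding close_iff[OF R(2) X.pull_closed[OF R x] X.pull_closed[OF R y]]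
  using X.agree_mod_pull[OF R J(1) x y J(3)] by blast
qed

lemma simplex_pull:
 assumes U: "stable_open U" and R: "cring R" "cring R'" "h : rhom R R'"
  and xs: "xs : spx X p U n R"
 shows "map (pull X R R' h) xs : spx X p U n R'"
proof (rule spxI)
 note xsD = spxD[OF xs]
 have UR: "x : pts X R" if "x : set xs" for x using that xsD(2) stable_openD(1)[OF U R(1)] by blast
 show "length (map (pull X R R' h) xs) = Suc n" using xsD(1) by simp
 show "set (map (pull X R R' h) xs) <= U R'" using xsD(2) stable_openD(2)[OF U R] by auto
 fix x y assume "x : set (map (pull X R R' h) xs)" "y : set (map (pull X R R' h) xs)"
 then obtain x' y' where x': "x' : set xs" "x = pull X R R' h x'" and y': "y' : set xs" "y = pull X R R' h y'"
  by auto
 show "p R' x = p R' y"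
  using xsD(3)[OF x'(1) y'(1)] p.mor_natural[OF R UR[OF x'(1)]] p.mor_natural[OF R UR[OF y'(1)]]
  by (simp add: x'(2) y'(2))
 show "infinitesimally_close X R' x y"
  unfolding x'(2) y'(2) by (rule close_pull[OF R UR[OF x'(1)] UR[OF y'(1)] xsD(4)[OF x'(1) y'(1)]])
qed

lemma spx_base:
 assumes U: "stable_open U" and R: "cring R" and xs: "xs : spx X p U n R"
 shows "p R (hd xs) : pts S R" "hd xs : pts X R"
  "cring R' ==> h : rhom R R' ==> p R' (pull X R R' h (hd xs)) = pull S R R' h (p R (hd xs))"
  "cring R' ==> h : rhom R R' ==> hd (map (pull X R R' h) xs) = pull X R R' h (hd xs)"
proof -
 note xsD = spxD[OF xs]
 show x: "hd xs : pts X R" using stable_openD(1)[OF U R] xsD(2,6) by blast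
 show "p R (hd xs) : pts S R" by (rule p.mor_closed[OF R x])
 show "cring R' ==> h : rhom R R' ==> p R' (pull X R R' h (hd xs)) = pull S R R' h (p R (hd xs))"
  by (rule p.mor_natural[OF R _ _ x])
 show "cring R' ==> h : rhom R R' ==> hd (map (pull X R R' h) xs) = pull X R R' h (hd xs)"
  using xsD(5) by (simp add: hd_map)
qed

text \<open>The simplices on which fibre squares can be used: all vertices lie in a single affine
  open and the base point is \<open>good\<close>.\<close>

definition aff_spx :: "('r ring => 'x set) => nat => 'r ring => 'x list => bool" where
 "aff_spx U n R xs \<longleftrightarrow> cring R & xs : spx X p U n R & good R (p R (hd xs)) &
   (EX A v. affine_open X A v & set xs <= orbit X A v R)"

text \<open>It suffices to place the first vertex: the others agree with it modulo square-zero
  ideals, which open subfunctors do not detect.\<close>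

lemma aff_spxI:
 assumes U: "stable_open U" and R: "cring R" and xs: "xs : spx X p U n R"
  and g: "good R (p R (hd xs))" and A: "affine_open X A v" "hd xs : orbit X A v R"
 shows "aff_spx U n R xs"
proof -
 note xsD = spxD[OF xs]
 interpret A: affine X A v by unfold_locales (rule A)
 have "y : orbit X A v R" if y: "y : set xs" for y
 proof -
  have yp: "y : pts X R" using y xsD(2) stable_openD(1)[OF U R] by blast
  obtain J where J: "J <= carrier R" "!!i j. i : J ==> j : J ==> i **\<^sub>R j = \<zero>\<^sub>R" "agree_mod X R J (hd xs) y"
   using xsD(4)[OF xsD(6) y] unfolding close_iff[OF R spx_base(2)[OF U R xs] yp] by blast
  interpret Rc: cring R by (rule R)
  have "i **\<^sub>R (j **\<^sub>R \<one>\<^sub>R) = \<zero>\<^sub>R" if "i : J" "j : J" for i j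
   using J(2)[OF that] Rc.r_one[of j] J(1) that(2) by auto
  then have "pw R J 2 <= {\<zero>\<^sub>R}" by (auto simp: numeral_2_eq_2)
  then show ?thesis by (rule X.open_sub_nilpotent[OF A.orbit_open R J(1) _ A(2) yp J(3)])
 qed
 then show ?thesis unfolding aff_spx_def using R xs g A(1) by blast
qed

lemma aff_spxD:
 assumes "aff_spx U n R xs"
 shows "cring R" "xs : spx X p U n R" "good R (p R (hd xs))"
 using assms unfolding aff_spx_def by blast+

lemma aff_spx_subset:
 assumes "aff_spx U n R xs" "set ys <= set xs" "length ys = Suc k"
 shows "aff_spx U k R ys"
proof -
 have ys: "ys : spx X p U k R"
  by (rule spx_subset[OF aff_spxD(2)[OF assms(1)] assms(2,3)])
 moreover have "p R (hd ys) = p R (hd xs)"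
  using spxD[OF aff_spxD(2)[OF assms(1)]] spxD(6)[OF ys] assms(2) by blast
 ultimately show ?thesis using assms(1,2) unfolding aff_spx_def by auto
qed

lemma aff_spx_pull:
 assumes U: "stable_open U" and R': "cring R'" "h : rhom R R'" and xs: "aff_spx U n R xs"
 shows "aff_spx U n R' (map (pull X R R' h) xs)"
proof -
 note xsD = aff_spxD[OF xs]
 obtain A v where A: "affine_open X A v" "set xs <= orbit X A v R"
  using xs unfolding aff_spx_def by blast
 interpret A: affine X A v by unfold_locales (rule A)
 note b = spx_base[OF U xsD(1,2)]
 have "good R' (p R' (hd (map (pull X R R' h) xs)))"
  using good_pull[OF xsD(1) R' xsD(3)] by (simp add: b(3,4) R')
 moreover have "set (map (pull X R R' h) xs) <= orbit X A v R'"
  using A(2) A.orbit_pull[OF xsD(1) R'] by auto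
 ultimately show ?thesis
  using simplex_pull[OF U xsD(1) R' xsD(2)] R'(1) A(1) unfolding aff_spx_def by blast
qed

text \<open>The base points agree because an affine open of \<open>S\<close> is determined by both
  projections. For closeness, the differences of the coordinates of two vertices are sent by each
  projection into a square-zero ideal, and \<open>T\<close> embeds by its projections.\<close>

lemma fibre_square_spx:
 assumes U: "stable_open U" and sq: "fibre_square R J T p1 p2" and A: "affine_open X A v"
  and zs: "set zs <= orbit X A v T"
  and z1: "map (pull X T R p1) zs : spx X p U n R"
  and z2: "map (pull X T R p2) zs : spx X p U n R"
  and s: "good R s" and ps: "!!z. z : set zs ==> p R (pull X T R p1 z) = s & p R (pull X T R p2 z) = s"
 shows "zs : spx X p U n T"
  "z : set zs ==> p T z = pull S R T (fibre_square.diag R T p1 p2) s"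
proof -
 interpret sq: fibre_square R J T p1 p2 by fact
 interpret A: affine X A v by unfold_locales (rule A)
 note R = sq.R and T = sq.T and p1 = sq.p1 and p2 = sq.p2 and d = sq.diag(1)
 note sp = good_pts[OF R s]
 obtain B w where B: "affine_open S B w" "s : orbit S B w R" using s unfolding good_def by blast
 interpret B: affine S B w by unfold_locales (rule B)
 have zp: "z : pts X T" if "z : set zs" for z using A.orbit_pts[OF T] zs that by blast
 show pz: "p T z = pull S R T sq.diag s" if z: "z : set zs" for z
 proof (rule B.fibre_square_inj[OF sq, symmetric])
  show "pull S R T sq.diag s : orbit S B w T" by (rule B.orbit_pull[OF R T d B(2)])
  show "p T z : pts S T" by (rule p.mor_closed[OF T zp[OF z]])
  show "pull S T R p1 (pull S R T sq.diag s) = pull S T R p1 (p T z)"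
   using ps[OF z] by (simp add: S.pull_pull_id[OF R T d p1 sq.diag(2) sp] p.mor_natural[OF T R p1 zp[OF z], symmetric])
  show "pull S T R p2 (pull S R T sq.diag s) = pull S T R p2 (p T z)"
   using ps[OF z] by (simp add: S.pull_pull_id[OF R T d p2 sq.diag(3) sp] p.mor_natural[OF T R p2 zp[OF z], symmetric])
 qed
 show "zs : spx X p U n T"
 proof (rule spxI)
  show "length zs = Suc n" using spxD(1)[OF z1] by simp
  show "set zs <= U T"
  proof
   fix z assume z: "z : set zs"
   show "z : U T"
    by (rule stable_openD(3)[OF U sq zp[OF z]]) (use spxD(2)[OF z1] spxD(2)[OF z2] z in auto)
  qed
  fix x y assume x: "x : set zs" and y: "y : set zs"
  show "p T x = p T y" using pz x y by simp
  have cl: "infinitesimally_close X R (pull X T R p1 x) (pull X T R p1 y)"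
   "infinitesimally_close X R (pull X T R p2 x) (pull X T R p2 y)"
   using spxD(4)[OF z1] spxD(4)[OF z2] x y by simp_all
  obtain J1 where J1: "J1 <= carrier R" "!!i j. i : J1 ==> j : J1 ==> i **\<^sub>R j = \<zero>\<^sub>R"
    "agree_mod X R J1 (pull X T R p1 x) (pull X T R p1 y)"
   using iffD1[OF close_iff[OF R X.pull_closed[OF T R p1 zp[OF x]] X.pull_closed[OF T R p1 zp[OF y]]] cl(1)]
   by blast
  obtain J2 where J2: "J2 <= carrier R" "!!i j. i : J2 ==> j : J2 ==> i **\<^sub>R j = \<zero>\<^sub>R"
    "agree_mod X R J2 (pull X T R p2 x) (pull X T R p2 y)"
   using iffD1[OF close_iff[OF R X.pull_closed[OF T R p2 zp[OF x]] X.pull_closed[OF T R p2 zp[OF y]]] cl(2)]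
   by blast
  obtain a where a: "a : rhom A T" "x = pull X A T a v" using zs x by (blast elim: A.orbitE)
  obtain b where b: "b : rhom A T" "y = pull X A T b v" using zs y by (blast elim: A.orbitE)
  define I where "I = {b f \<ominus>\<^sub>T a f | f. f : carrier A}"
  interpret Tc: cring T by (rule T)
  have I1: "q i : Idl \<^sub>R J'" if q: "q : rhom T R" and J': "J' <= carrier R"
   and ag: "agree_mod X R J' (pull X T R q x) (pull X T R q y)" and i: "i : I" for q J' i
  proof -
   obtain f where f: "f : carrier A" "i = b f \<ominus>\<^sub>T a f" using i unfolding I_def by blast
   have "cmps A q b f \<ominus>\<^sub>R cmps A q a f : Idl \<^sub>R J'"
    by (rule A.rep_diff[OF R J' rhom_comp[OF A.A a(1) q] rhom_comp[OF A.A b(1) q] _ f(1)])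
     (use ag in "simp add: a(2) b(2) X.pull_comp[OF A.A T R a(1) q A.v] X.pull_comp[OF A.A T R b(1) q A.v]")
   then show ?thesis
    using rhom_minus[OF T R q rhom_closed[OF b(1) f(1)] rhom_closed[OF a(1) f(1)]] f by (simp add: compose_app)
  qed
  have Ic: "I <= carrier T" unfolding I_def using rhom_closed[OF a(1)] rhom_closed[OF b(1)] by auto
  have "i **\<^sub>T j = \<zero>\<^sub>T" if "i : I" "j : I" for i j
  proof (rule sq.inj)
   have ij: "i : carrier T" "j : carrier T" using that Ic by auto
   show "i **\<^sub>T j : carrier T" "\<zero>\<^sub>T : carrier T" using ij by simp_all
   show "p1 (i **\<^sub>T j) = p1 \<zero>\<^sub>T"
    using Idl_square_zero[OF R J1(1,2) I1[OF p1 J1(1,3) that(1)] I1[OF p1 J1(1,3) that(2)]]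
    by (simp only: rhom_mult[OF p1 ij] rhom_zero[OF T R p1])
   show "p2 (i **\<^sub>T j) = p2 \<zero>\<^sub>T"
    using Idl_square_zero[OF R J2(1,2) I1[OF p2 J2(1,3) that(1)] I1[OF p2 J2(1,3) that(2)]]
    by (simp only: rhom_mult[OF p2 ij] rhom_zero[OF T R p2])
  qed
  moreover have "agree_mod X T I x y"
   unfolding a(2) b(2) by (rule A.rep_agree[OF T a(1) b(1)]) (auto simp: I_def)
  ultimately show "infinitesimally_close X T x y"
   unfolding close_iff[OF T zp[OF x] zp[OF y]] using Ic by blast
 qed
qed

text \<open>A family of maps \<open>G \<rightarrow> G\<close>, natural in a simplex. It stands for a \<open>G\<close>-valued form \<open>\<omega>\<close>, with
 \<open>\<Phi> g = \<omega>\<close>, or for an \<open>Aut(G)\<close>-valued form \<open>u\<close>, with \<open>\<Phi> g = u(g) g\<^sup>-\<^sup>1\<close>.\<close>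

definition natural_op :: "('r ring => 'x set) => nat => ('r ring => 'x list => 'g => 'g) => bool" where
 "natural_op U n Ph \<longleftrightarrow> (ALL R xs g. cring R & xs : spx X p U n R &
   g : GC R (p R (hd xs)) --> Ph R xs g : GC R (p R (hd xs)) &
   (ALL R' h. cring R' & h : rhom R R' -->
    Ph R' (map (pull X R R' h) xs) (res G R R' h (p R (hd xs)) g) = res G R R' h (p R (hd xs)) (Ph R xs g)))"

lemma natural_opD:
 assumes "natural_op U n Ph" "cring R" "xs : spx X p U n R" "g : GC R (p R (hd xs))"
 shows "Ph R xs g : GC R (p R (hd xs))"
  and "cring R' ==> h : rhom R R' ==> Ph R' (map (pull X R R' h) xs) (res G R R' h (p R (hd xs)) g)
   = res G R R' h (p R (hd xs)) (Ph R xs g)"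
 using assms unfolding natural_op_def by blast+

text \<open>The simplex over \<open>R \<times>\<^bsub>R/J\<^esub> R\<close> whose \<open>j\<close>-th vertex is the pair \<open>(x\<^sub>i, x\<^sub>j)\<close>.\<close>

lemma vertex_pair:
 assumes U: "stable_open U" and xsa: "aff_spx U n R xs" and J: "J <= carrier R"
  and sq: "fibre_square R (Idl \<^sub>R J) T p1 p2"
  and i: "i <= n" and j: "j <= n" and ag: "agree_mod X R J (xs ! i) (xs ! j)"
 obtains zs where "aff_spx U n T zs" "map (pull X T R p1) zs = xs[j := xs ! i]"
  "map (pull X T R p2) zs = xs" "p T (hd zs) = pull S R T (fibre_square.diag R T p1 p2) (p R (hd xs))"
  "!!k. k ~= j ==> k <= n ==> zs ! k = pull X R T (fibre_square.diag R T p1 p2) (xs ! k)"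
proof -
 interpret sq: fibre_square R "Idl \<^sub>R J" T p1 p2 by fact
 note xs = aff_spxD[OF xsa] note xsD = spxD[OF xs(2)]
 note R = xs(1) and T = sq.T and p1 = sq.p1 and p2 = sq.p2 and d = sq.diag(1)
 define s where "s = p R (hd xs)"
 have s: "good R s" using xs(3) by (simp add: s_def)
 note sp = good_pts[OF R s]
 obtain A v where A: "affine_open X A v" "set xs <= orbit X A v R"
  using xsa unfolding aff_spx_def by blast
 interpret A: affine X A v by unfold_locales (rule A)
 have lt: "i < length xs" "j < length xs" using i j xsD(1) by auto
 have mem: "xs ! i : set xs" "xs ! j : set xs" using lt by auto
 obtain z where z: "z : orbit X A v T" "pull X T R p1 z = xs ! i" "pull X T R p2 z = xs ! j"
  by (rule A.glue[OF sq J, of "xs ! i" "xs ! j"]) (use A(2) mem ag in auto)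
 define ds where "ds = map (pull X R T sq.diag) xs"
 define zs where "zs = ds[j := z]"
 have xp: "x : pts X R" if "x : set xs" for x using that xsD(2) stable_openD(1)[OF U R] by blast
 have dz: "z' : orbit X A v T" if "z' : set ds" for z'
  using that A(2) A.orbit_pull[OF R T d] by (auto simp: ds_def)
 have zs_orb: "set zs <= orbit X A v T"
  unfolding zs_def using set_update_subset_insert[of ds j z] dz z(1) by blast
 have pd: "map (pull X T R p1) ds = xs" "map (pull X T R p2) ds = xs"
  unfolding ds_def using xp
  by (auto simp: X.pull_pull_id[OF R T d p1 sq.diag(2)] X.pull_pull_id[OF R T d p2 sq.diag(3)] intro!: map_idI)
 have z1: "map (pull X T R p1) zs = xs[j := xs ! i]" unfolding zs_def by (simp add: map_update pd z)
 have z2: "map (pull X T R p2) zs = xs" unfolding zs_def by (simp add: map_update pd z)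
 have s1: "set (xs[j := xs ! i]) <= set xs"
  using set_update_subset_insert[of xs j "xs ! i"] mem(1) by blast
 have sub1: "map (pull X T R p1) zs : spx X p U n R"
  unfolding z1 by (rule spx_subset[OF xs(2) s1]) (simp add: xsD(1))
 have ps: "p R (pull X T R p1 z') = s & p R (pull X T R p2 z') = s" if "z' : set zs" for z'
 proof -
  have "pull X T R p1 z' : set (map (pull X T R p1) zs)" "pull X T R p2 z' : set (map (pull X T R p2) zs)"
   using that by auto
  then show ?thesis unfolding z1 z2 s_def using s1 xsD(3,6) by blast
 qed
 note fs = fibre_square_spx[OF U sq A(1) zs_orb sub1 _ s ps]
 have zs: "zs : spx X p U n T" by (rule fs(1)) (simp_all add: z2 xs(2))
 have pt: "p T (hd zs) = pull S R T sq.diag s" by (rule fs(2)) (simp_all add: z2 xs(2) spxD(6)[OF zs])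
 show thesis
 proof (rule that[OF _ z1 z2])
  show "aff_spx U n T zs"
   unfolding aff_spx_def using T zs good_pull[OF R T d s] pt A(1) zs_orb by auto
  show "p T (hd zs) = pull S R T sq.diag (p R (hd xs))" using pt by (simp add: s_def)
  show "zs ! k = pull X R T sq.diag (xs ! k)" if "k ~= j" "k <= n" for k
   unfolding zs_def using that xsD(1) by (simp add: ds_def)
 qed
qed

text \<open>An infinitesimal operation which is trivial whenever two of \<open>l\<close> consecutive pairs of vertices
 coincide is trivial modulo the product of the ideals of these pairs. In the inductive step the vertex
 \<open>y\<close> is replaced by the point \<open>(x, y)\<close> over \<open>R \<times>\<^bsub>R/J\<^esub> R\<close>, where \<open>x\<close> is the vertex before it.\<close>

lemma vanishing:
 assumes U: "stable_open U" and nat: "natural_op U n Ph"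
  and deg: "!!R xs g i. cring R ==> xs : spx X p U n R ==> g : GC R (p R (hd xs)) ==>
   a <= i ==> i < a + l ==> xs ! i = xs ! Suc i ==> Ph R xs g = \<one>\<^sub>(grp G R (p R (hd xs)))"
  and "0 < l" "a + l <= n"
  and "aff_spx U n R xs" "g : GC R (p R (hd xs))" "J <= carrier R"
  and "!!i. a <= i ==> i < a + l ==> agree_mod X R J (xs ! i) (xs ! Suc i)"
  and "pw R J l <= {\<zero>\<^sub>R}"
 shows "Ph R xs g = \<one>\<^sub>(grp G R (p R (hd xs)))"
 using \<open>0 < l\<close> deg assms(5-)
proof (induction l arbitrary: R xs g J rule: nat_induct_non_zero)
 case 1
 note xs = aff_spxD[OF 1(3)] note xsD = spxD[OF xs(2)]
 interpret Rc: cring R by (rule xs(1))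
 \<comment> \<open>For \<open>l = 1\<close> nilpotency means that \<open>J\<close> is zero, so
   congruent vertices are equal and the degeneracy hypothesis applies.\<close>
 have J: "J <= {\<zero>\<^sub>R}"
 proof
  fix j assume j: "j : J"
  then have "j **\<^sub>R \<one>\<^sub>R = \<zero>\<^sub>R" using 1(7) by auto
  then show "j : {\<zero>\<^sub>R}" using j 1(5) by auto
 qed
 have pts: "xs ! a : pts X R" "xs ! Suc a : pts X R"
  using 1(2) xsD(1,2) stable_openD(1)[OF U xs(1)] by (auto simp: subset_iff)
 have "xs ! a = xs ! Suc a"
  by (rule X.agree_mod_eq[OF xs(1) J pts]) (rule 1(6); simp)
 then show ?case by (intro 1(1)[OF xs(1,2) 1(4), of a]) auto
next
 case (Suc l)
 note IH = Suc.IH and l = Suc.hyps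
 note deg = Suc.prems(1) and n = Suc.prems(2) and g = Suc.prems(4) and J = Suc.prems(5)
  and ag = Suc.prems(6) and pwJ = Suc.prems(7)
 note xs = aff_spxD[OF Suc.prems(3)] note xsD = spxD[OF xs(2)]
 note R = xs(1)
 define s where "s = p R (hd xs)"
 have s: "good R s" using xs(3) by (simp add: s_def)
 note sp = good_pts[OF R s]
 interpret Rc: cring R by (rule R)
 obtain T p1 p2 where sq: "fibre_square R (Idl \<^sub>R J) T p1 p2"
  by (rule ex_fibre_square[OF infinite_universe R Rc.genideal_ideal[OF J]])
 interpret sq: fibre_square R "Idl \<^sub>R J" T p1 p2 by fact
 note T = sq.T and p1 = sq.p1 and p2 = sq.p2 and d = sq.diag(1)
 \<comment> \<open>The vertex to be varied: the second one of the last pair. The first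
   \<open>l\<close> pairs do not contain it.\<close>
 let ?b = "Suc (a + l)"
 have lt: "?b < length xs" "a + l < length xs" using n xsD(1) by auto
 have mem: "xs ! (a + l) : set xs" "xs ! ?b : set xs" using lt by auto
 have xp: "x : pts X R" if "x : set xs" for x using that xsD(2) stable_openD(1)[OF U R] by blast
 obtain zs where zsT: "aff_spx U n T zs" and z1: "map (pull X T R p1) zs = xs[?b := xs ! (a + l)]"
  and z2: "map (pull X T R p2) zs = xs" and pt0: "p T (hd zs) = pull S R T sq.diag (p R (hd xs))"
  and zsb: "!!k. k ~= ?b ==> k <= n ==> zs ! k = pull X R T sq.diag (xs ! k)"
  by (rule vertex_pair[OF U Suc.prems(3) J sq, of "a + l" ?b]) (use n ag[of "a + l"] in auto)
 note zs = aff_spxD(2)[OF zsT]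
 define t where "t = pull S R T sq.diag s"
 have pt: "p T (hd zs) = t" by (simp add: t_def pt0 s_def)
 have t: "good T t" unfolding t_def by (rule good_pull[OF R T d s])
 note tp = good_pts[OF T t]
 define g' where "g' = res G R T sq.diag s g"
 have gs: "g : GC R s" using g by (simp add: s_def)
 have g': "g' : GC T (p T (hd zs))"
  unfolding g'_def pt t_def by (rule res_closed[OF R T d sp gs])
 define h where "h = Ph T zs g'"
 have h: "h : GC T t" using natural_opD(1)[OF nat T zs g'] by (simp add: h_def pt)
 have zl: "length zs = Suc n" by (rule spxD(1)[OF zs])
 have res_h: "res G T Q q t h = Ph Q (map (pull X T Q q) zs) (res G T Q q t g')"
  "res G T Q q t g' : carrier (grp G Q (p Q (hd (map (pull X T Q q) zs))))"
  "p Q (hd (map (pull X T Q q) zs)) = pull S T Q q t"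
  if Q: "cring Q" "q : rhom T Q" for Q q
  using natural_opD(2)[OF nat T zs g' Q] spx_base(3,4)[OF U T zs Q] res_closed[OF T Q tp] g'
  by (simp_all add: h_def pt)
 \<comment> \<open>After the first projection the last pair of vertices coincides.\<close>
 have h1: "h : congr T t {x : carrier T. p1 x = \<zero>\<^sub>R}"
 proof (rule congrI[OF h])
  fix Q q assume Q: "cring Q" "q : rhom T Q" "!!k. k : {x : carrier T. p1 x = \<zero>\<^sub>R} ==> q k = \<zero>\<^sub>Q"
  have zm: "zs ! (a + l) : set zs" "zs ! ?b : set zs" using lt zl xsD(1) by auto
  have zp: "zs ! (a + l) : pts X T" "zs ! ?b : pts X T"
   using zm spxD(2)[OF zs] stable_openD(1)[OF U T] by auto
  have "pull X T R p1 (zs ! (a + l)) = map (pull X T R p1) zs ! (a + l)"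
   "pull X T R p1 (zs ! ?b) = map (pull X T R p1) zs ! ?b" using lt zl xsD(1) by simp_all
  then have "pull X T R p1 (zs ! (a + l)) = pull X T R p1 (zs ! ?b)" unfolding z1 using lt by simp
  then have "agree_mod X T {x : carrier T. p1 x = \<zero>\<^sub>R} (zs ! (a + l)) (zs ! ?b)"
   by (rule X.agree_mod_surj[OF T R p1 sq.p_surj(1) zp])
  then have "pull X T Q q (zs ! (a + l)) = pull X T Q q (zs ! ?b)" by (rule agree_modD[OF _ Q])
  then have "map (pull X T Q q) zs ! (a + l) = map (pull X T Q q) zs ! Suc (a + l)"
   using lt zl xsD(1) by simp
  then show "res G T Q q t h = \<one>\<^sub>(grp G Q (pull S T Q q t))"
   using deg[OF Q(1) simplex_pull[OF U T Q(1,2) zs] res_h(2)[OF Q(1,2)], of "a + l"] res_h(1,3)[OF Q(1,2)] by simp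
 qed
 \<comment> \<open>Once the diagonal copy of \<open>J^l\<close> is killed, the induction hypothesis
   covers the first \<open>l\<close> pairs, where \<open>zs\<close> is the constant simplex.\<close>
 have h2: "h : congr T t (sq.diag ` pw R J l)"
 proof (rule congrI[OF h])
  fix Q q assume Q: "cring Q" "q : rhom T Q" "!!k. k : sq.diag ` pw R J l ==> q k = \<zero>\<^sub>Q"
  define k where "k = cmps R q sq.diag"
  have k: "k : rhom R Q" unfolding k_def by (rule rhom_comp[OF R d Q(2)])
  have "Ph Q (map (pull X T Q q) zs) (res G T Q q t g') = \<one>\<^sub>(grp G Q (p Q (hd (map (pull X T Q q) zs))))"
  proof (rule IH)
   show "a + l <= n" using n by simp
   show "aff_spx U n Q (map (pull X T Q q) zs)" by (rule aff_spx_pull[OF U Q(1,2) zsT])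
   show "res G T Q q t g' : carrier (grp G Q (p Q (hd (map (pull X T Q q) zs))))" by (rule res_h(2)[OF Q(1,2)])
   show "k ` J <= carrier Q" using J rhom_closed[OF k] by blast
   show "pw Q (k ` J) l <= {\<zero>\<^sub>Q}"
    unfolding pw_image[OF k R J] using Q(3) pw_carrier[OF R J] by (auto simp: k_def compose_app subset_iff)
   fix i assume i: "a <= i" "i < a + l"
   have "xs ! i : set xs" "xs ! Suc i : set xs" using i lt by auto
   note ip = this(1,2)[THEN xp]
   have "map (pull X T Q q) zs ! i = pull X R Q k (xs ! i)"
    "map (pull X T Q q) zs ! Suc i = pull X R Q k (xs ! Suc i)"
    unfolding k_def using i lt zl xsD(1) ip
    by (simp_all add: zsb X.pull_comp[OF R T Q(1) d Q(2)])
   moreover have "agree_mod X R J (xs ! i) (xs ! Suc i)" using ag i by simp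
   ultimately show "agree_mod X Q (k ` J) (map (pull X T Q q) zs ! i) (map (pull X T Q q) zs ! Suc i)"
    using X.agree_mod_pull[OF R Q(1) k J ip] by simp
  qed (use deg in auto)
  then show "res G T Q q t h = \<one>\<^sub>(grp G Q (pull S T Q q t))" using res_h(1,3)[OF Q(1,2)] by simp
 qed
 have pwc: "pw R J l <= carrier R" by (rule pw_carrier[OF R J])
 \<comment> \<open>\<open>J^l\<close> annihilates \<open>J\<close> by the nilpotency hypothesis,
   which makes the two ideals of \<open>T\<close> meet in zero.\<close>
 have kj: "k **\<^sub>R j = \<zero>\<^sub>R" if k: "k : pw R J l" and j: "j : J" for k j
 proof -
  have "k **\<^sub>R j = j **\<^sub>R k" using k j pwc J by (intro Rc.m_comm) auto
  also have "... : pw R J (Suc l)" using k j by auto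
  finally show ?thesis using pwJ by blast
 qed
 have e3: "Idl \<^sub>T {x : carrier T. p1 x = \<zero>\<^sub>R} Int Idl \<^sub>T (sq.diag ` pw R J l) = {\<zero>\<^sub>T}"
  by (rule sq.ker_Int_diag[OF pwc Idl_annihilates[OF R J]]) (use pwc kj in auto)
 have e4: "sq.diag ` pw R J l <= carrier T" using pwc rhom_closed[OF d] by blast
 have h_one: "h = \<one>\<^sub>(grp G T t)" by (rule congr_inj[OF T t _ e4 e3 h1 h2]) auto
 have t2: "pull S T R p2 t = s" unfolding t_def by (rule S.pull_pull_id[OF R T d p2 sq.diag(3) sp])
 have "res G T R p2 t g' = g"
  unfolding g'_def using res_res[OF R T R d p2 sp gs sq.diag(3) t_def] by (simp add: res_id[OF R sp gs])
 then have "Ph R xs g = res G T R p2 t h" using res_h(1)[OF R p2] by (simp add: z2)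
 then show ?case using h_one by (simp add: res_one[OF T R p2 tp] t2 s_def)
qed

end

lemma omit_append:
 "omit (length pre) (pre @ x # post) = pre @ post"
 "omit (Suc (length pre)) (pre @ x # y # post) = pre @ x # post"
 "omit (Suc (Suc (length pre))) (pre @ x # y # z # post) = pre @ x # y # post"
 by (simp_all add: omit_def)

lemma omit_facts:
 assumes "i < length xs"
 shows "length (omit i xs) = length xs - 1" "set (omit i xs) <= set xs"
  "map f (omit i xs) = omit i (map f xs)"
  "k < i ==> omit i xs ! k = xs ! k" "i <= k ==> Suc k < length xs ==> omit i xs ! k = xs ! Suc k"
 using assms set_take_subset[of i xs] set_drop_subset[of "Suc i" xs]
 by (auto simp: omit_def take_map drop_map nth_append min_def)

lemma omit_eq:
 assumes "Suc i < length xs" "xs ! i = xs ! Suc i"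
 shows "omit i xs = omit (Suc i) xs"
proof (rule nth_equalityI)
 show "length (omit i xs) = length (omit (Suc i) xs)" using assms(1) by (simp add: omit_facts(1))
 fix k assume "k < length (omit i xs)"
 then have k: "Suc k < length xs" using assms(1) by (simp add: omit_facts(1))
 consider "k < i" | "k = i" | "Suc i <= k" by linarith
 then show "omit i xs ! k = omit (Suc i) xs ! k"
  using k assms by cases (simp_all add: omit_facts(4,5))
qed

lemma degenerate_map: "degenerate xs ==> degenerate (map f xs)"
 unfolding degenerate_def by auto

lemma degenerateI: "Suc i < length xs ==> xs ! i = xs ! Suc i ==> degenerate xs"
 unfolding degenerate_def by blast

section \<open>The degree of a form\<close>

context form_space
begin

abbreviation "bp R xs == p R (hd xs)"

text \<open>Vertices are added one at a time, each joined to the previous ones by a square-zero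
  ideal that raises the exponent by one; a single vertex needs the empty set. Hence the exponent is
  the number of vertices.\<close>

lemma simplex_ideal:
 assumes U: "stable_open U" and R: "cring R" and xs: "xs : spx X p U n R"
 obtains J where "J <= carrier R" "pw R J (Suc n) <= {\<zero>\<^sub>R}"
  "!!x y. x : set xs ==> y : set xs ==> agree_mod X R J x y"
proof -
 note xsD = spxD[OF xs]
 interpret Rc: cring R by (rule R)
 have xp: "x : pts X R" if "x : set xs" for x using that xsD(2) stable_openD(1)[OF U R] by blast
 have "set ys <= set xs --> (EX J<=carrier R. pw R J (length ys) <= {\<zero>\<^sub>R} &
   (ALL x:set ys. ALL y:set ys. agree_mod X R J x y))" if "ys ~= []" for ys
  using that
 proof (induction ys rule: list_nonempty_induct)
  case (single x)
  show ?case by (rule impI, rule exI[of _ "{}"]) (simp add: agree_mod_refl)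
 next
  case (cons x ys)
  show ?case
  proof
   assume sub: "set (x # ys) <= set xs"
   then obtain J where J: "J <= carrier R" "pw R J (length ys) <= {\<zero>\<^sub>R}"
    "!!x y. x : set ys ==> y : set ys ==> agree_mod X R J x y" using cons.IH by auto
   have h: "hd ys : set ys" using cons.hyps by simp
   then have m: "x : set xs" "hd ys : set xs" using sub by auto
   obtain L where L: "L <= carrier R" "!!i j. i : L ==> j : L ==> i **\<^sub>R j = \<zero>\<^sub>R"
    "agree_mod X R L x (hd ys)"
    using iffD1[OF close_iff[OF R m(1,2)[THEN xp]] xsD(4)[OF m]] by blast
   have "i **\<^sub>R (j **\<^sub>R \<one>\<^sub>R) = \<zero>\<^sub>R" if "i : L" "j : L" for i j
    using L(2)[OF that] Rc.r_one[of j] L(1) that(2) by auto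
   then have L2: "pw R L 2 <= {\<zero>\<^sub>R}" by (auto simp: numeral_2_eq_2)
   have xh: "agree_mod X R (J \<union> L) x (hd ys)" by (rule agree_mod_mono[OF L(3)]) simp
   have ag: "agree_mod X R (J \<union> L) y y'" if "y : set ys" "y' : set ys" for y y'
    by (rule agree_mod_mono[OF J(3)[OF that]]) simp
   have xy: "agree_mod X R (J \<union> L) x y" if "y : set ys" for y
    by (rule agree_mod_trans[OF xh ag[OF h that]])
   have "ALL y:set (x # ys). ALL y':set (x # ys). agree_mod X R (J \<union> L) y y'"
    using ag xy agree_mod_sym[OF xy] agree_mod_refl by auto
   moreover have "pw R (J \<union> L) (length (x # ys)) <= {\<zero>\<^sub>R}"
    using pw_Un_zero[OF R J(1,2) L(1) L2] by simp
   ultimately show "EX J<=carrier R. pw R J (length (x # ys)) <= {\<zero>\<^sub>R} &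
     (ALL y:set (x # ys). ALL y':set (x # ys). agree_mod X R J y y')"
    using J(1) L(1) by (intro exI[of _ "J \<union> L"]) auto
  qed
 qed
 from this[OF xsD(5)] show thesis using that xsD(1) by auto
qed

text \<open>Forms without the degeneracy condition. Sections, and values on selected faces of a
  larger simplex, need not be trivial on its degenerate subsimplex.\<close>

definition natural_form :: "('r, 's, 'f) gfunctor => ('r ring => 'x set) => nat => ('r, 'x, 'f) fm => bool" where
 "natural_form F U n ww \<longleftrightarrow> (ALL R xs. cring R & xs : spx X p U n R -->
   ww R xs : carrier (grp F R (bp R xs)) &
   (ALL R' h. cring R' & h : rhom R R' -->
    ww R' (map (pull X R R' h) xs) = res F R R' h (bp R xs) (ww R xs)))"

lemma natural_formD:
 assumes "natural_form F U n ww" "cring R" "xs : spx X p U n R"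
 shows "ww R xs : carrier (grp F R (bp R xs))"
  and "cring R' ==> h : rhom R R' ==>
   ww R' (map (pull X R R' h) xs) = res F R R' h (bp R xs) (ww R xs)"
 using assms unfolding natural_form_def by blast+

lemma is_form_iff: "is_form X p (base_change p F) U n ww \<longleftrightarrow> natural_form F U n ww &
  (ALL R xs. cring R & xs : spx X p U n R & degenerate xs --> ww R xs = \<one>\<^sub>(grp F R (bp R xs)))"
 unfolding is_form_def natural_form_def base_change_simps by blast

lemma is_formD:
 assumes "is_form X p (base_change p F) U n ww"
 shows "natural_form F U n ww"
  and "cring R ==> xs : spx X p U n R ==> degenerate xs ==> ww R xs = \<one>\<^sub>(grp F R (bp R xs))"
 using assms unfolding is_form_iff by blast+

text \<open>The conclusion of \<open>vanishing\<close> as a property of the sheaf of values, so that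
  later statements need not distinguish \<open>G\<close> from its automorphism sheaf.\<close>

definition vanishes :: "('r, 's, 'f) gfunctor => bool" where
 "vanishes F \<longleftrightarrow> (ALL U n ww a l R xs J. stable_open U --> natural_form F U n ww -->
   (ALL R xs i. cring R --> xs : spx X p U n R --> a <= i --> i < a + l --> xs ! i = xs ! Suc i -->
    ww R xs = \<one>\<^sub>(grp F R (bp R xs))) -->
   0 < l --> a + l <= n --> aff_spx U n R xs --> J <= carrier R -->
   (ALL i. a <= i --> i < a + l --> agree_mod X R J (xs ! i) (xs ! Suc i)) --> pw R J l <= {\<zero>\<^sub>R} -->
   ww R xs = \<one>\<^sub>(grp F R (bp R xs)))"

lemma vanishesD:
 assumes "vanishes F" "stable_open U" "natural_form F U n ww"
  and "!!R xs i. cring R ==> xs : spx X p U n R ==> a <= i ==> i < a + l ==> xs ! i = xs ! Suc i ==>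
    ww R xs = \<one>\<^sub>(grp F R (bp R xs))"
  and "0 < l" "a + l <= n" "aff_spx U n R xs" "J <= carrier R"
  and "!!i. a <= i ==> i < a + l ==> agree_mod X R J (xs ! i) (xs ! Suc i)" "pw R J l <= {\<zero>\<^sub>R}"
 shows "ww R xs = \<one>\<^sub>(grp F R (bp R xs))"
 by (rule assms(1)[unfolded vanishes_def, rule_format, of U n ww a l R xs J]) (use assms(2-) in blast)+

lemma vanishes_G: "vanishes G"
 unfolding vanishes_def
proof (intro allI impI)
 fix U n ww a l R xs J
 assume U: "stable_open U" and nat: "natural_form G U n ww"
  and deg: "ALL R xs i. cring R --> xs : spx X p U n R --> a <= i --> i < a + l --> xs ! i = xs ! Suc i -->
    ww R xs = \<one>\<^sub>(grp G R (bp R xs))"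
  and l: "0 < l" "a + l <= n" and xs: "aff_spx U n R xs" and J: "J <= carrier R"
  and ag: "ALL i. a <= i --> i < a + l --> agree_mod X R J (xs ! i) (xs ! Suc i)" and pw: "pw R J l <= {\<zero>\<^sub>R}"
 note xsD = aff_spxD[OF xs]
 interpret H: group "grp G R (bp R xs)" by (rule grp_group[OF xsD(1) good_pts[OF xsD(1,3)]])
 show "ww R xs = \<one>\<^sub>(grp G R (bp R xs))"
 proof (rule vanishing[OF U _ _ l xs H.one_closed J _ pw, where Ph = "%R xs g. ww R xs"])
  show "natural_op U n (%R xs g. ww R xs)" using nat unfolding natural_op_def natural_form_def by blast
 qed (use deg ag in blast)+
qed

text \<open>Automorphisms are not treated as points of a scheme; the vanishing theorem is applied to
  the operation \<open>u(g) g^-1\<close> with values in \<open>G\<close>, after every base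
  change.\<close>

lemma vanishes_Aut: "vanishes (Aut_sheaf S G)"
 unfolding vanishes_def
proof (intro allI impI)
 fix U n u a l R xs J
 assume U: "stable_open U" and nat: "natural_form (Aut_sheaf S G) U n u"
  and deg: "ALL R xs i. cring R --> xs : spx X p U n R --> a <= i --> i < a + l --> xs ! i = xs ! Suc i -->
    u R xs = \<one>\<^sub>(AG R (bp R xs))"
  and l: "0 < l" "a + l <= n" and xs: "aff_spx U n R xs" and J: "J <= carrier R"
  and ag: "ALL i. a <= i --> i < a + l --> agree_mod X R J (xs ! i) (xs ! Suc i)" and pw: "pw R J l <= {\<zero>\<^sub>R}"
 define Ph where "Ph R xs g = aut_app R (u R xs) g **\<^sub>(grp G R (bp R xs)) inv \<^sub>(grp G R (bp R xs)) g" for R xs g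
 note uD = natural_formD[OF nat]
 have natPhi: "natural_op U n Ph"
  unfolding natural_op_def
 proof (intro allI impI, elim conjE, intro conjI allI impI)
  fix R xs g assume R: "cring R" and xs: "xs : spx X p U n R" and g: "g : GC R (bp R xs)"
  note b = spx_base[OF U R xs]
  interpret H: group "grp G R (bp R xs)" by (rule grp_group[OF R b(1)])
  note u = uD(1)[OF R xs] note ug = aut_app_closed[OF R b(1) u g]
  show "Ph R xs g : GC R (bp R xs)" using ug g by (simp add: Ph_def)
  fix R' h assume "cring R' & h : rhom R R'"
  then have R': "cring R'" "h : rhom R R'" by auto
  show "Ph R' (map (pull X R R' h) xs) (res G R R' h (bp R xs) g) = res G R R' h (bp R xs) (Ph R xs g)"
   unfolding Ph_def using ug g u
   by (simp add: res_mult[OF R R' b(1)] res_inv[OF R R' b(1)] uD(2)[OF R xs R'] b(3,4)[OF R'] aut_app_natural[OF R R' b(1)])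
 qed
 have degPhi: "Ph R xs g = \<one>\<^sub>(grp G R (bp R xs))"
  if "cring R" "xs : spx X p U n R" "g : GC R (bp R xs)" "a <= i" "i < a + l" "xs ! i = xs ! Suc i"
  for R xs g i
 proof -
  note b = spx_base[OF U that(1,2)]
  interpret H: group "grp G R (bp R xs)" by (rule grp_group[OF that(1) b(1)])
  have "u R xs = \<one>\<^sub>(AG R (bp R xs))" using deg that by blast
  then show ?thesis using that(3) by (simp add: Ph_def aut_app_one[OF that(1) b(1)])
 qed
 note xsD = aff_spxD[OF xs] note b = spx_base[OF U xsD(1,2)]
 interpret A: group "AG R (bp R xs)" by (rule Aut.grp_group[OF xsD(1) b(1)])
 show "u R xs = \<one>\<^sub>(AG R (bp R xs))"
 proof (rule Aut_eqI_app[OF uD(1)[OF xsD(1,2)] A.one_closed])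
  fix R' h g assume R': "cring R'" "h : rhom R R'" and g: "g : GC R' (pull S R R' h (bp R xs))"
  let ?ys = "map (pull X R R' h) xs"
  have ys: "aff_spx U n R' ?ys" by (rule aff_spx_pull[OF U R' xs])
  note ysD = aff_spxD[OF ys] note b' = spx_base[OF U ysD(1,2)]
  interpret H: group "grp G R' (bp R' ?ys)" by (rule grp_group[OF R'(1) b'(1)])
  have pe: "bp R' ?ys = pull S R R' h (bp R xs)" using b(3,4)[OF R'] by simp
  have g': "g : GC R' (bp R' ?ys)" using g pe by simp
  have "Ph R' ?ys g = \<one>\<^sub>(grp G R' (bp R' ?ys))"
  proof (rule vanishing[where J = "h ` J", OF U natPhi degPhi l ys g'])
   show "h ` J <= carrier R'" using J rhom_closed[OF R'(2)] by blast
   show "pw R' (h ` J) l <= {\<zero>\<^sub>R'}" by (rule pw_image_zero[OF xsD(1) R' J pw])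
   fix i assume i: "a <= i" "i < a + l"
   have len: "length xs = Suc n" by (rule spxD(1)[OF xsD(2)])
   have m: "xs ! i : pts X R" "xs ! Suc i : pts X R"
    using i l spxD(1,2)[OF xsD(2)] stable_openD(1)[OF U xsD(1)] by (auto simp: subset_iff)
   have "agree_mod X R J (xs ! i) (xs ! Suc i)" using ag i by blast
   from X.agree_mod_pull[OF xsD(1) R' J m this]
   show "agree_mod X R' (h ` J) (?ys ! i) (?ys ! Suc i)" using i l len by simp
  qed
  moreover have u': "u R' ?ys : AC R' (bp R' ?ys)" by (rule uD(1)[OF ysD(1,2)])
  ultimately have "aut_app R' (u R' ?ys) g = g"
   using eq_iff_quotient[OF R'(1) b'(1) aut_app_closed[OF R'(1) b'(1) u' g'] g'] by (simp add: Ph_def)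
  then show "aut_app R' (ract R R' h (bp R xs) (u R xs)) g
    = aut_app R' (ract R R' h (bp R xs) \<one>\<^sub>(AG R (bp R xs))) g"
   using uD(2)[OF xsD(1,2) R'] aut_app_one[OF R'(1) S.pull_closed[OF xsD(1) R' b(1)] g]
   by (simp add: Aut.res_one[OF xsD(1) R' b(1)])
 qed
qed

end

locale value_sheaf = form_space S G X p + F: group_over S F
 for S :: "('r, 's) pfunctor" and G :: "('r, 's, 'g) gfunctor"
  and X :: "('r, 'x) pfunctor" and p :: "'r ring => 'x => 's" and F :: "('r, 's, 'f) gfunctor" +
 assumes vanishes: "vanishes F"
begin

text \<open>All \<open>k\<close> pairs of adjacent vertices are used in \<open>vanishes\<close>,
  over every test ring on which products of \<open>k\<close> elements of \<open>J\<close> are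
  zero.\<close>

lemma form_congr:
 assumes U: "stable_open U" and form: "is_form X p (base_change p F) U k ww" and k: "0 < k"
  and ys: "aff_spx U k R ys" and J: "J <= carrier R"
  and ag: "!!x y. x : set ys ==> y : set ys ==> agree_mod X R J x y"
 shows "ww R ys : F.congr R (bp R ys) (pw R J k)"
proof (rule F.congrI)
 note ysD = aff_spxD[OF ys] note b = spx_base[OF U ysD(1,2)] note nf = is_formD(1)[OF form]
 show "ww R ys : carrier (grp F R (bp R ys))" by (rule natural_formD(1)[OF nf ysD(1,2)])
 fix Q q assume Q: "cring Q" "q : rhom R Q" "!!j. j : pw R J k ==> q j = \<zero>\<^sub>Q"
 let ?zs = "map (pull X R Q q) ys"
 have zs: "aff_spx U k Q ?zs" by (rule aff_spx_pull[OF U Q(1,2) ys])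
 have len: "length ys = Suc k" by (rule spxD(1)[OF ysD(2)])
 have "ww Q ?zs = \<one>\<^sub>(grp F Q (bp Q ?zs))"
 proof (rule vanishesD[OF vanishes U nf _ k _ zs, of 0 "q ` J"])
  fix R xs i assume xs: "cring R" "xs : spx X p U k R" "i < 0 + k" "xs ! i = xs ! Suc i"
  then have "degenerate xs" using spxD(1)[OF xs(2)] by (intro degenerateI[of i]) auto
  then show "ww R xs = \<one>\<^sub>(grp F R (bp R xs))" by (rule is_formD(2)[OF form xs(1,2)])
 next
  show "q ` J <= carrier Q" using J rhom_closed[OF Q(2)] by blast
  show "pw Q (q ` J) k <= {\<zero>\<^sub>Q}" using Q(3) by (auto simp: pw_image[OF Q(2) ysD(1) J])
  fix i assume i: "i < 0 + k"
  have m: "ys ! i : set ys" "ys ! Suc i : set ys" using i len by auto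
  have mp: "ys ! i : pts X R" "ys ! Suc i : pts X R"
   using m spxD(2)[OF ysD(2)] stable_openD(1)[OF U ysD(1)] by auto
  show "agree_mod X Q (q ` J) (?zs ! i) (?zs ! Suc i)"
   using X.agree_mod_pull[OF ysD(1) Q(1,2) J mp ag[OF m]] i len by simp
 qed simp_all
 then show "res F R Q q (bp R ys) (ww R ys) = \<one>\<^sub>(grp F Q (pull S R Q q (bp R ys)))"
  using natural_formD(2)[OF nf ysD(1,2) Q(1,2)] b(3,4)[OF Q(1,2)] by simp
qed

text \<open>A form changes sign under a transposition of adjacent vertices: the operation
 \<open>\<omega>(x, y) \<omega>(y, z) \<omega>(x, z)\<^sup>-\<^sup>1\<close> (other vertices being omitted) is trivial for \<open>x = y\<close> and for \<open>y = z\<close>, hence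
 for \<open>x = z\<close>, since the square of the ideal of \<open>(x, y)\<close> is zero.\<close>

lemma form_swap:
 assumes U: "stable_open U" and form: "is_form X p (base_change p F) U n ww"
  and xs: "aff_spx U n R (pre @ x # y # post)"
 shows "ww R (pre @ y # x # post) = inv \<^sub>(grp F R (p R x)) (ww R (pre @ x # y # post))"
proof -
 let ?i = "length pre"
 note nf = is_formD(1)[OF form]
 define f where "f R zs = ww R (omit (Suc (Suc ?i)) zs) **\<^sub>(grp F R (bp R zs)) ww R (omit ?i zs)
   **\<^sub>(grp F R (bp R zs)) inv \<^sub>(grp F R (bp R zs)) (ww R (omit (Suc ?i) zs))" for R zs
 have len: "length pre + length post + 2 = Suc n"
  using spxD(1)[OF aff_spxD(2)[OF xs]] by simp
 have om: "omit k zs : spx X p U n R" "bp R (omit k zs) = bp R zs"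
  if "cring R" "zs : spx X p U (Suc n) R" "k <= Suc (Suc ?i)" for R zs k
 proof -
  have kl: "k < length zs" using that(3) spxD(1)[OF that(2)] len by simp
  show 1: "omit k zs : spx X p U n R"
   by (rule spx_subset[OF that(2)]) (use kl spxD(1)[OF that(2)] in "simp_all add: omit_facts")
  show "bp R (omit k zs) = bp R zs"
   using spxD(6)[OF 1] spxD(3,6)[OF that(2)] omit_facts(2)[OF kl] by blast
 qed
 have om_val: "ww R (omit k zs) : carrier (grp F R (bp R zs))"
  "cring R' ==> h : rhom R R' ==> ww R' (omit k (map (pull X R R' h) zs)) = res F R R' h (bp R zs) (ww R (omit k zs))"
  if "cring R" "zs : spx X p U (Suc n) R" "k <= Suc (Suc ?i)" for R zs k R' h
 proof -
  have kl: "k < length zs" using that(3) spxD(1)[OF that(2)] len by simp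
  show "ww R (omit k zs) : carrier (grp F R (bp R zs))"
   using natural_formD(1)[OF nf that(1) om(1)[OF that]] om(2)[OF that] by simp
  show "cring R' ==> h : rhom R R' ==> ww R' (omit k (map (pull X R R' h) zs)) = res F R R' h (bp R zs) (ww R (omit k zs))"
   using natural_formD(2)[OF nf that(1) om(1)[OF that]] om(2)[OF that] by (simp add: omit_facts(3)[OF kl])
 qed
 have nat: "natural_form F U (Suc n) f"
  unfolding natural_form_def
 proof (intro allI impI, elim conjE, intro conjI allI impI)
  fix R zs assume R: "cring R" and zs: "zs : spx X p U (Suc n) R"
  note b = spx_base[OF U R zs]
  interpret H: group "grp F R (bp R zs)" by (rule F.grp_group[OF R b(1)])
  note v = om_val(1)[OF R zs, of ?i] om_val(1)[OF R zs, of "Suc ?i"] om_val(1)[OF R zs, of "Suc (Suc ?i)"]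
  show "f R zs : carrier (grp F R (bp R zs))" using v by (simp add: f_def)
  fix R' h assume "cring R' & h : rhom R R'"
  then have R': "cring R'" "h : rhom R R'" by auto
  show "f R' (map (pull X R R' h) zs) = res F R R' h (bp R zs) (f R zs)"
   unfolding f_def using v by (simp add: b(3,4)[OF R'] F.res_mult[OF R R' b(1)] F.res_inv[OF R R' b(1)] om_val(2)[OF R zs _ R'])
 qed
 have deg: "f R zs = \<one>\<^sub>(grp F R (bp R zs))"
  if R: "cring R" and zs: "zs : spx X p U (Suc n) R" and i: "?i <= i" "i < ?i + 2" and e: "zs ! i = zs ! Suc i" for R zs i
 proof -
  note b = spx_base[OF U R zs]
  interpret H: group "grp F R (bp R zs)" by (rule F.grp_group[OF R b(1)])
  note v = om_val(1)[OF R zs, of ?i] om_val(1)[OF R zs, of "Suc ?i"] om_val(1)[OF R zs, of "Suc (Suc ?i)"]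
  have zl: "length zs = Suc (Suc n)" by (rule spxD(1)[OF zs])
  have one: "ww R (omit k zs) = \<one>\<^sub>(grp F R (bp R zs))" if "k <= Suc (Suc ?i)" "degenerate (omit k zs)" for k
   using is_formD(2)[OF form R om(1)[OF R zs that(1)] that(2)] om(2)[OF R zs that(1)] by simp
  consider "i = ?i" | "i = Suc ?i" using i by linarith
  then show ?thesis
  proof cases
   case 1
   have "degenerate (omit (Suc (Suc ?i)) zs)"
    by (rule degenerateI[of ?i]) (use 1 e zl len in "simp_all add: omit_facts")
   moreover have "omit ?i zs = omit (Suc ?i) zs" by (rule omit_eq) (use 1 e zl len in simp_all)
   ultimately show ?thesis using v one by (simp add: f_def)
  next
   case 2
   have "degenerate (omit ?i zs)"
    by (rule degenerateI[of ?i]) (use 2 e zl len in "simp_all add: omit_facts")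
   moreover have "omit (Suc ?i) zs = omit (Suc (Suc ?i)) zs" by (rule omit_eq) (use 2 e zl len in simp_all)
   ultimately show ?thesis using v one by (simp add: f_def)
  qed
 qed
 note xsD = aff_spxD[OF xs] note sD = spxD[OF xsD(2)]
 \<comment> \<open>With \<open>x\<close> on both sides of \<open>y\<close>, the face omitting
   \<open>y\<close> is degenerate and the other two faces are the two orders of the pair. Both pairs
   are governed by the same square-zero ideal, which is why \<open>l = 2\<close> suffices.\<close>
 let ?zs = "pre @ x # y # x # post"
 have zs: "aff_spx U (Suc n) R ?zs" by (rule aff_spx_subset[OF xs]) (use len in auto)
 note zsD = aff_spxD[OF zs] note b = spx_base[OF U zsD(1,2)]
 interpret Rc: cring R by (rule xsD(1))
 interpret H: group "grp F R (bp R ?zs)" by (rule F.grp_group[OF zsD(1) b(1)])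
 have xy: "x : pts X R" "y : pts X R" using sD(2) stable_openD(1)[OF U xsD(1)] by auto
 obtain J where J: "J <= carrier R" "!!i j. i : J ==> j : J ==> i **\<^sub>R j = \<zero>\<^sub>R" "agree_mod X R J x y"
  using iffD1[OF close_iff[OF xsD(1) xy] sD(4)[of x y]] by auto
 have "i **\<^sub>R (j **\<^sub>R \<one>\<^sub>R) = \<zero>\<^sub>R" if "i : J" "j : J" for i j
  using J(2)[OF that] Rc.r_one[of j] J(1) that(2) by auto
 then have J2: "pw R J 2 <= {\<zero>\<^sub>R}" by (auto simp: numeral_2_eq_2)
 have f1: "f R ?zs = \<one>\<^sub>(grp F R (bp R ?zs))"
 proof (rule vanishesD[OF vanishes U nat deg _ _ zs J(1) _ J2])
  fix i assume "?i <= i" "i < ?i + 2"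
  then consider "i = ?i" | "i = Suc ?i" by linarith
  then show "agree_mod X R J (?zs ! i) (?zs ! Suc i)"
   using J(3) agree_mod_sym[OF J(3)] by cases (simp_all add: nth_append)
 qed (use len in auto)
 have xx: "ww R (pre @ x # x # post) = \<one>\<^sub>(grp F R (bp R ?zs))"
 proof -
  have 1: "pre @ x # x # post : spx X p U n R"
   by (rule spx_subset[OF zsD(2)]) (use len in auto)
  have "bp R (pre @ x # x # post) = bp R ?zs" by (cases pre) auto
  then show ?thesis
   using is_formD(2)[OF form xsD(1) 1] degenerateI[of ?i "pre @ x # x # post"] by (simp add: nth_append)
 qed
 have oz: "omit ?i ?zs = pre @ y # x # post" "omit (Suc ?i) ?zs = pre @ x # x # post"
  "omit (Suc (Suc ?i)) ?zs = pre @ x # y # post"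
  using omit_append(1)[of pre x "y # x # post"] omit_append(2)[of pre x y "x # post"] omit_append(3)[of pre x y x post]
  by simp_all
 have px: "bp R ?zs = p R x"
  by (rule spxD(3)[OF zsD(2) spxD(6)[OF zsD(2)]]) simp
 have v: "ww R (omit ?i ?zs) : carrier (grp F R (bp R ?zs))" "ww R (omit (Suc (Suc ?i)) ?zs) : carrier (grp F R (bp R ?zs))"
  by (rule om_val(1)[OF zsD(1,2)], simp)+
 have "ww R (pre @ x # y # post) **\<^sub>(grp F R (bp R ?zs)) ww R (pre @ y # x # post) = \<one>\<^sub>(grp F R (bp R ?zs))"
  using f1 v unfolding f_def oz xx by simp
 then have "inv \<^sub>(grp F R (bp R ?zs)) (ww R (pre @ x # y # post)) = ww R (pre @ y # x # post)"
  using v unfolding oz by (intro H.inv_char) (simp_all add: H.inv_comm)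
 then show ?thesis by (simp add: px)
qed

end

section \<open>Calculus in filtered groups\<close>

context group
begin

lemma cancel_left:
 assumes "a : carrier G" "b : carrier G"
 shows "inv a ** (a ** b) = b" "a ** (inv a ** b) = b"
 using assms by (simp_all flip: m_assoc)

text \<open>\<open>monomial [x\<^sub>1, \<dots>, x\<^sub>n] [k\<^sub>1, \<dots>, k\<^sub>n] = x\<^sub>1\<^sup>k\<^sup>1 \<cdots> x\<^sub>n\<^sup>k\<^sup>n\<close>. Identities between products of commuting elements are
 proved by computing exponents.\<close>

primrec monomial :: "'a list => int list => 'a" where
 "monomial [] ks = \<one>"
| "monomial (x # xs) ks = x [^] hd ks ** monomial xs (tl ks)"

definition commuting :: "'a list => bool" where
 "commuting xs \<longleftrightarrow> set xs <= carrier G & (ALL x:set xs. ALL y:set xs. x ** y = y ** x)"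

lemma monomial_closed: "set xs <= carrier G ==> monomial xs ks : carrier G"
 by (induction xs arbitrary: ks) (auto simp: int_pow_closed)

lemma commute_int_pow:
 assumes "x : carrier G" "y : carrier G" "x ** y = y ** x"
 shows "x ** y [^] (k::int) = y [^] k ** x"
proof -
 have nat: "x ** y [^] (n::nat) = y [^] n ** x" for n
 proof (induction n)
  case (Suc n)
  have "x ** y [^] Suc n = x ** y [^] n ** y" using assms by (simp add: m_assoc)
  also have "... = y [^] n ** (x ** y)" using Suc assms by (simp add: m_assoc)
  also have "... = y [^] Suc n ** x" using assms by (simp add: m_assoc)
  finally show ?case .
 qed (use assms in simp)
 have inv: "x ** inv z = inv z ** x" if "z : carrier G" "x ** z = z ** x" for z
 proof -
  have "inv z ** (x ** z) ** inv z = inv z ** x" "inv z ** (z ** x) ** inv z = x ** inv z"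
   using that(1) assms(1) by (simp_all add: m_assoc cancel_left)
  then show ?thesis using that(2) by simp
 qed
 have "x ** inv (y [^] nat (- k)) = inv (y [^] nat (- k)) ** x"
  by (rule inv[OF _ nat]) (use assms in simp)
 then show ?thesis unfolding int_pow_def2 using nat[of "nat k"] by (cases "k < 0") simp_all
qed

lemma commute_monomial:
 assumes "x : carrier G" "set xs <= carrier G" "!!y. y : set xs ==> x ** y = y ** x"
 shows "x ** monomial xs ks = monomial xs ks ** x"
 using assms(2,3)
proof (induction xs arbitrary: ks)
 case (Cons y ys)
 have c: "y : carrier G" "y [^] hd ks : carrier G" "monomial ys (tl ks) : carrier G"
  using Cons.prems by (auto simp: int_pow_closed monomial_closed)
 have 1: "x ** y [^] hd ks = y [^] hd ks ** x" using Cons.prems assms(1) by (intro commute_int_pow) auto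
 have 2: "x ** monomial ys (tl ks) = monomial ys (tl ks) ** x" using Cons by simp
 have "x ** monomial (y # ys) ks = x ** y [^] hd ks ** monomial ys (tl ks)"
  using c assms(1) by (simp add: m_assoc)
 also have "... = y [^] hd ks ** (x ** monomial ys (tl ks))" unfolding 1 using c assms(1) by (simp add: m_assoc)
 also have "... = monomial (y # ys) ks ** x" unfolding 2 using c assms(1) by (simp add: m_assoc)
 finally show ?case .
qed (use assms(1) in simp)

lemma monomial_mult:
 assumes "commuting xs" "length ks = length xs" "length ls = length xs"
 shows "monomial xs ks ** monomial xs ls = monomial xs (map2 (+) ks ls)"
 using assms
proof (induction xs arbitrary: ks ls)
 case (Cons x xs)
 obtain k ks' where k: "ks = k # ks'" using Cons.prems(2) by (cases ks) auto
 obtain l ls' where l: "ls = l # ls'" using Cons.prems(3) by (cases ls) auto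
 have c: "x : carrier G" "set xs <= carrier G" using Cons.prems(1) unfolding commuting_def by simp_all
 have 1: "x [^] l ** monomial xs ks' = monomial xs ks' ** x [^] l"
 proof (rule commute_monomial)
  fix y assume y: "y : set xs"
  have "x : set (x # xs)" "y : set (x # xs)" using y by simp_all
  then have "y ** x = x ** y" using Cons.prems(1) unfolding commuting_def by blast
  then have "y ** x [^] l = x [^] l ** y" using y c by (intro commute_int_pow) auto
  then show "x [^] l ** y = y ** x [^] l" by simp
 qed (use c in "auto simp: int_pow_closed")
 have 2: "monomial xs ks' ** monomial xs ls' = monomial xs (map2 (+) ks' ls')"
 proof (rule Cons.IH)
  have "set xs <= set (x # xs)" by auto
  then show "commuting xs" using Cons.prems(1) unfolding commuting_def by blast
 qed (use Cons.prems(2,3) k l in simp_all)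
 have m: "monomial xs ks' : carrier G" "monomial xs ls' : carrier G" "x [^] k : carrier G" "x [^] l : carrier G"
  using c by (auto simp: int_pow_closed monomial_closed)
 have "monomial (x # xs) ks ** monomial (x # xs) ls = x [^] k ** (monomial xs ks' ** x [^] l) ** monomial xs ls'"
  using m by (simp add: k l m_assoc)
 also have "... = x [^] k ** x [^] l ** (monomial xs ks' ** monomial xs ls')"
  unfolding 1[symmetric] using m by (simp add: m_assoc)
 finally show ?case using 2 by (simp add: k l int_pow_mult[OF c(1)])
qed simp

lemma monomial_zero: "monomial xs (map (%_. 0) xs) = \<one>"
 by (induction xs) simp_all

text \<open>Writes each generator as a monomial with unit exponent vector. The list stays folded as
  \<open>L\<close> on the right, so that these equations can be used as rewrite rules without
  applying to their own results.\<close>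

lemma monomial_units:
 assumes "L = xs" "commuting L"
 shows "list_all2 (%x ks. x = monomial L ks) xs (map (%i. map (%j. if i = j then 1 else 0) [0..<length xs]) [0..<length xs])
  & \<one> = monomial L (map (%_. 0) xs)"
proof -
 have "xs ! i = monomial xs (map (%j. if i = j then 1 else 0) [0..<length xs])" if "set xs <= carrier G" "i < length xs" for i
  using that
 proof (induction xs arbitrary: i)
  case (Cons x xs)
  have "map f [0..<Suc (length xs)] = f 0 # map (f \<circ> Suc) [0..<length xs]" for f :: "nat => int"
   by (simp add: upt_conv_Cons flip: map_Suc_upt del: upt_Suc)
  moreover have "monomial xs (map ((%j. 0) \<circ> Suc) [0..<length xs]) = \<one>"
   using monomial_zero[of xs] by (simp add: map_replicate_const comp_def)
  ultimately show ?case using Cons by (cases i) (simp_all add: comp_def monomial_closed del: upt_Suc)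
 qed simp
 then show ?thesis using assms monomial_zero[of xs] by (auto simp: commuting_def list_all2_conv_all_nth)
qed

lemma monomial_inv:
 assumes "commuting xs" "length ks = length xs"
 shows "inv (monomial xs ks) = monomial xs (map uminus ks)"
proof (rule inv_equality)
 have "map2 (+) (map uminus ks) ks = map (%_. 0) xs"
  by (rule nth_equalityI) (use assms(2) in simp_all)
 then show "monomial xs (map uminus ks) ** monomial xs ks = \<one>"
  using assms by (simp add: monomial_mult monomial_zero)
qed (use assms in "simp_all add: commuting_def monomial_closed")

end

text \<open>Models the groups of points of \<open>G\<close> and of its automorphisms over one
  simplex; \<open>c\<close> is a degree in which both filtrations have become trivial. Additivity of
  degrees is required only in positive degrees, since it comes from nilpotent ideals.\<close>

locale filtered_action = H: group H + A: group A
 for H :: "'h monoid" (structure) and A :: "'u monoid" +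
 fixes act :: "'u => 'h => 'h" and inn :: "'h => 'u"
  and N :: "nat => 'h set" and M :: "nat => 'u set" and c :: nat
 assumes act_closed: "u : carrier A ==> g : carrier H ==> act u g : carrier H"
  and act_mult: "u : carrier A ==> g : carrier H ==> h : carrier H ==> act u (g ** h) = act u g ** act u h"
  and act_comp: "u : carrier A ==> w : carrier A ==> g : carrier H ==> act (u **\<^sub>A w) g = act u (act w g)"
  and act_one: "g : carrier H ==> act \<one>\<^sub>A g = g"
  and inn_closed: "h : carrier H ==> inn h : carrier A"
  and inn_mult: "g : carrier H ==> h : carrier H ==> inn (g ** h) = inn g **\<^sub>A inn h"
  and act_inn: "g : carrier H ==> h : carrier H ==> act (inn h) g = h ** g ** inv h"
  and inn_conj: "u : carrier A ==> h : carrier H ==> u **\<^sub>A inn h = inn (act u h) **\<^sub>A u"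
  and N_normal: "N k \<lhd> H" and M_normal: "M k \<lhd> A"
  and N_Suc: "N (Suc k) <= N k" and M_Suc: "M (Suc k) <= M k"
  and N_c: "N c <= {\<one>}" and M_c: "M c <= {\<one>\<^sub>A}"
  and act_N: "u : carrier A ==> g : N k ==> act u g : N k"
  and act_M_N: "0 < j ==> 0 < k ==> u : M j ==> g : N k ==> act u g ** inv g : N (j + k)"
  and M_commutator: "0 < j ==> 0 < k ==> u : M j ==> w : M k ==>
   u **\<^sub>A w **\<^sub>A inv \<^sub>A u **\<^sub>A inv \<^sub>A w : M (j + k)"
  and inn_M: "h : N k ==> inn h : M k"
begin

lemma N_mem: "g : N k ==> g : carrier H" and M_mem: "u : M k ==> u : carrier A"
 using N_normal M_normal by (meson normal_imp_subgroup subgroup.mem_carrier)+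

lemma N_mult: "g : N k ==> h : N k ==> g ** h : N k" and N_inv: "g : N k ==> inv g : N k"
 using N_normal by (meson normal_imp_subgroup subgroup.m_closed subgroup.m_inv_closed)+

lemma M_mult: "u : M k ==> w : M k ==> u **\<^sub>A w : M k" and M_inv: "u : M k ==> inv \<^sub>A u : M k"
 using M_normal by (meson normal_imp_subgroup subgroup.m_closed subgroup.m_inv_closed)+

lemma N_conj: "h : carrier H ==> g : N k ==> h ** g ** inv h : N k"
 by (rule normal.inv_op_closed2[OF N_normal])

lemma M_conj: "u : carrier A ==> w : M k ==> u **\<^sub>A w **\<^sub>A inv \<^sub>A u : M k"
 by (rule normal.inv_op_closed2[OF M_normal])

lemma N_antimono: "j <= k ==> N k <= N j" and M_antimono: "j <= k ==> M k <= M j"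
proof -
 show "N k <= N j" if "j <= k" using that
  by (induction rule: dec_induct) (use N_Suc in "blast+")
 show "M k <= M j" if "j <= k" using that
  by (induction rule: dec_induct) (use M_Suc in "blast+")
qed

lemma N_trivial: "g : N k ==> c <= k ==> g = \<one>" and M_trivial: "u : M k ==> c <= k ==> u = \<one>\<^sub>A"
 using N_antimono M_antimono N_c M_c by blast+

lemma act_inv: "u : carrier A ==> g : carrier H ==> act u (inv g) = inv (act u g)"
proof -
 assume u: "u : carrier A" and g: "g : carrier H"
 interpret group_hom H H "act u"
  by (simp add: group_hom_def group_hom_axioms_def hom_def H.group_axioms act_closed act_mult u)
 show ?thesis using g by simp
qed

lemma act_hom_one: "u : carrier A ==> act u \<one> = \<one>"
proof -
 assume u: "u : carrier A"
 interpret group_hom H H "act u"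
  by (simp add: group_hom_def group_hom_axioms_def hom_def H.group_axioms act_closed act_mult u)
 show ?thesis by simp
qed

lemma inn_inv: "h : carrier H ==> inn (inv h) = inv \<^sub>A (inn h)"
proof -
 interpret group_hom H A inn
  by (simp add: group_hom_def group_hom_axioms_def hom_def H.group_axioms A.group_axioms inn_closed inn_mult)
 show "h : carrier H ==> inn (inv h) = inv \<^sub>A (inn h)" by simp
qed

lemma act_fix: "u : M j ==> g : N k ==> 0 < j ==> 0 < k ==> c <= j + k ==> act u g = g"
proof -
 assume a: "u : M j" "g : N k" "0 < j" "0 < k" "c <= j + k"
 note cl = N_mem[OF a(2)] act_closed[OF M_mem[OF a(1)] N_mem[OF a(2)]]
 have "act u g ** inv g = \<one>" by (rule N_trivial[OF act_M_N[OF a(3,4,1,2)] a(5)])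
 then have "act u g ** inv g ** g = g" using cl by simp
 then show ?thesis using cl by (simp add: H.m_assoc)
qed

lemma M_commute: "u : M j ==> w : M k ==> 0 < j ==> 0 < k ==> c <= j + k ==> u **\<^sub>A w = w **\<^sub>A u"
proof -
 assume a: "u : M j" "w : M k" "0 < j" "0 < k" "c <= j + k"
 note cl = a(1,2)[THEN M_mem]
 have "u **\<^sub>A w **\<^sub>A inv \<^sub>A u **\<^sub>A inv \<^sub>A w = \<one>\<^sub>A" by (rule M_trivial[OF M_commutator[OF a(3,4,1,2)] a(5)])
 then have "u **\<^sub>A w **\<^sub>A inv \<^sub>A u **\<^sub>A inv \<^sub>A w **\<^sub>A (w **\<^sub>A u) = w **\<^sub>A u" using cl by simp
 then show ?thesis using cl by (simp add: A.m_assoc A.cancel_left)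
qed

lemma N_commutator: "a : N j ==> b : N k ==> 0 < j ==> 0 < k ==> a ** b ** inv a ** inv b : N (j + k)"
 using act_M_N[OF _ _ inn_M] by (simp add: act_inn N_mem)

lemma N_commute: "a : N j ==> b : N k ==> 0 < j ==> 0 < k ==> c <= j + k ==> a ** b = b ** a"
proof -
 assume a: "a : N j" "b : N k" "0 < j" "0 < k" "c <= j + k"
 note cl = a(1,2)[THEN N_mem]
 have "a ** b ** inv a = b" using act_fix[OF inn_M[OF a(1)] a(2-5)] cl by (simp add: act_inn)
 then have "a ** b ** inv a ** a = b ** a" by simp
 then show ?thesis using cl by (simp add: H.m_assoc)
qed

lemma commuting_N: "set xs <= N k ==> 0 < k ==> c <= k + k ==> H.commuting xs"
 unfolding H.commuting_def using N_commute[of _ k _ k] N_mem[of _ k] by blast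

lemma commuting_M: "set us <= M k ==> 0 < k ==> c <= k + k ==> A.commuting us"
 unfolding A.commuting_def using M_commute[of _ k _ k] M_mem[of _ k] by blast

definition com :: "'h => 'h => 'h" where
 "com a b = a ** b ** inv a ** inv b"

lemma com_swap: "a : carrier H ==> b : carrier H ==> com a b ** (b ** a) = a ** b"
 by (simp add: com_def H.m_assoc H.cancel_left)

lemma com_eqI: "a : carrier H ==> b : carrier H ==> k : carrier H ==> k ** (b ** a) = a ** b ==> com a b = k"
 using com_swap[of a b] H.right_cancel[of "b ** a" "com a b" k] by (auto simp: com_def)

lemma com_mem: "a : N j ==> b : N k ==> 0 < j ==> 0 < k ==> com a b : N (j + k)"
 unfolding com_def by (rule N_commutator)

text \<open>The obstruction to multiplicativity is the commutator of \<open>com a b'\<close> with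
  \<open>b\<close>, of degree \<open>j + 2 k\<close>, which is at least \<open>c\<close>.\<close>

lemma com_mult_right:
 assumes "a : N j" "b : N k" "b' : N k" "0 < j" "0 < k" "c <= j + k + 1"
 shows "com a (b ** b') = com a b ** com a b'"
proof -
 note cl = assms(1-3)[THEN N_mem]
 have m: "com a b : N (j + k)" "com a b' : N (j + k)" using assms by (auto intro: com_mem)
 note mc = m(1,2)[THEN N_mem]
 have 1: "com a b' ** b = b ** com a b'"
  by (rule N_commute[OF m(2) assms(2)]) (use assms in auto)
 show ?thesis
 proof (rule com_eqI)
  have "com a b ** com a b' ** (b ** b' ** a) = com a b ** (com a b' ** b) ** (b' ** a)"
   using cl mc by (simp add: H.m_assoc)
  also have "... = com a b ** b ** (com a b' ** (b' ** a))" unfolding 1 using cl mc by (simp add: H.m_assoc)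
  also have "... = com a b ** (b ** a) ** b'" unfolding com_swap[OF cl(1,3)] using cl mc by (simp add: H.m_assoc)
  also have "... = a ** (b ** b')" unfolding com_swap[OF cl(1,2)] using cl by (simp add: H.m_assoc)
  finally show "com a b ** com a b' ** (b ** b' ** a) = a ** (b ** b')" .
 qed (use cl mc in auto)
qed

lemma com_inv_right:
 assumes "a : N j" "b : N k" "0 < j" "0 < k" "c <= j + k + 1"
 shows "com a (inv b) = inv (com a b)"
proof -
 note cl = assms(1,2)[THEN N_mem]
 have "com a b ** com a (inv b) = com a (b ** inv b)"
  by (rule com_mult_right[symmetric, OF assms(1,2) N_inv[OF assms(2)] assms(3-5)])
 also have "... = \<one>" using cl by (simp add: com_def)
 finally have "com a b ** com a (inv b) = \<one>" .
 then have "com a (inv b) ** com a b = \<one>" using cl H.inv_comm[of "com a b" "com a (inv b)"] by (simp add: com_def)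
 then show ?thesis using cl H.inv_equality[of "com a (inv b)" "com a b"] by (simp add: com_def)
qed

lemma com_inv_eq: "a : carrier H ==> b : carrier H ==> inv (com a b) = com b a"
 by (simp add: com_def H.inv_mult_group H.m_assoc)

lemma com_inv_left:
 assumes "a : N j" "b : N k" "0 < j" "0 < k" "c <= j + k + 1"
 shows "com (inv a) b = inv (com a b)"
proof -
 note cl = assms(1,2)[THEN N_mem]
 have "com b (inv a) = inv (com b a)" by (rule com_inv_right[OF assms(2,1)]) (use assms in auto)
 then show ?thesis using com_inv_eq[of b "inv a"] com_inv_eq[of b a] cl by simp
qed

lemma com_trivial: "a : N j ==> b : N k ==> 0 < j ==> 0 < k ==> c <= j + k ==> com a b = \<one>"
 by (rule N_trivial[OF com_mem])

end

section \<open>The identities on one simplex, as statements about filtered groups\<close>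

context filtered_action
begin

abbreviation A_mult (infixl \<open>##\<close> 70) where "u ## w == u **\<^sub>A w"
abbreviation A_inv (\<open>inv\<^sub>A _\<close> [81] 80) where "inv\<^sub>A u == inv \<^sub>A u"

text \<open>The relation \<open>r\<close> is solved for \<open>l0 ## mj\<close>; after that only
  elements of degree 1 remain, and these commute because \<open>c <= 2\<close>.\<close>

lemma gauge_connection:
 assumes c: "c <= 2" and m: "m : M 1" "mj : carrier A" and l: "l0 : carrier A" "l1 : carrier A"
  and l01: "l0 ## inv\<^sub>A l1 : M 1" and a: "a : N 1"
  and r: "m ## l1 = inn a ## (l0 ## mj)"
 shows "l0 ## mj ## inv\<^sub>A l0
  = m ## inv\<^sub>A (l0 ## inv\<^sub>A l1) ## inv\<^sub>A (inn a)"
proof -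
 define w where "w = inv\<^sub>A (l0 ## inv\<^sub>A l1)"
 have w: "w : M 1" unfolding w_def by (rule M_inv[OF l01])
 have wl: "w = l1 ## inv\<^sub>A l0" using l by (simp add: w_def A.inv_mult_group)
 have ia: "inv\<^sub>A (inn a) : M 1" by (rule M_inv[OF inn_M[OF a]])
 note cl = M_mem[OF m(1)] m(2) l M_mem[OF w] inn_closed[OF N_mem[OF a]]
 have "l0 ## mj = inv\<^sub>A (inn a) ## (m ## l1)" unfolding r using cl by (simp add: A.cancel_left)
 then have "l0 ## mj ## inv\<^sub>A l0 = inv\<^sub>A (inn a) ## (m ## w)"
  using cl(1-4,6) by (simp add: wl A.m_assoc)
 also have "... = (m ## w) ## inv\<^sub>A (inn a)"
  by (rule M_commute[OF ia M_mult[OF m(1) w]]) (use c in auto)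
 finally show ?thesis by (simp add: w_def)
qed

text \<open>\<open>g1\<close> differs from \<open>g0\<close> by an element of degree 1, which
  \<open>m\<close>, also of degree 1, fixes when \<open>c <= 2\<close>.\<close>

lemma cocycle_connection:
 assumes c: "c <= 2" and m: "m : M 1" and k: "g1 ** inv g0 : N 1" and g: "g0 : carrier H" "g1 : carrier H"
  and abc: "a : carrier H" "b : carrier H" "e : carrier H"
  and r: "a ** b ** g0 = act m g1 ** e"
 shows "a ** b ** inv (g0 ** e ** inv g0) = g1 ** inv g0 ** (act m g0 ** inv g0)"
proof -
 define k' where "k' = g1 ** inv g0"
 note mA = M_mem[OF m]
 have k': "k' : N 1" "g1 = k' ** g0" using k g by (simp_all add: k'_def H.m_assoc)
 have "act m k' = k'" by (rule act_fix[OF m k'(1)]) (use c in auto)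
 then have mg: "act m g1 = k' ** act m g0" unfolding k'(2) by (simp add: act_mult mA N_mem[OF k'(1)] g)
 have "a ** b ** inv (g0 ** e ** inv g0) = a ** b ** g0 ** inv e ** inv g0"
  using g abc by (simp add: H.inv_mult_group H.m_assoc)
 also have "... = act m g1 ** inv g0" unfolding r using g abc act_closed[OF mA g(2)] by (simp add: H.m_assoc H.cancel_left)
 finally show ?thesis unfolding mg using g act_closed[OF mA g(1)] N_mem[OF k'(1)]
  by (simp add: k'_def[symmetric] H.m_assoc)
qed

text \<open>The three edge relations are substituted around the triangle and the inner automorphisms
  are collected on the left. The only commutation required is that of \<open>mu\<close>, of degree
  2, with \<open>inn a02\<close>, of degree 1.\<close>

lemma gauge_curvature_aux:
 assumes c: "c <= 3"
  and m: "m01 : carrier A" "m12 : carrier A" "m02 : carrier A"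
  and mj: "mj01 : carrier A" "mj12 : carrier A" "mj02 : carrier A"
  and l: "l0 : carrier A" "l1 : carrier A" "l2 : carrier A"
  and a: "a01 : carrier H" "a12 : carrier H" "a02 : N 1"
  and mu: "mu : M 2" "mu = m01 ## m12 ## inv\<^sub>A m02"
  and r01: "m01 ## l1 = inn a01 ## (l0 ## mj01)"
  and r12: "m12 ## l2 = inn a12 ## (l1 ## mj12)"
  and r02: "m02 ## l2 = inn a02 ## (l0 ## mj02)"
 shows "l0 ## (mj01 ## mj12 ## inv\<^sub>A mj02) ## inv\<^sub>A l0
  = inn (inv a01 ** act m01 (inv a12) ** a02) ## mu"
proof -
 note a02 = N_mem[OF a(3)]
 note icl = a(1,2)[THEN inn_closed] inn_closed[OF a02]
 have e01: "l0 ## mj01 = inv\<^sub>A (inn a01) ## (m01 ## l1)" unfolding r01 using l mj icl by (simp add: A.cancel_left)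
 have e12: "l1 ## mj12 = inv\<^sub>A (inn a12) ## (m12 ## l2)" unfolding r12 using l mj icl by (simp add: A.cancel_left)
 have e02: "l0 ## mj02 = inv\<^sub>A (inn a02) ## (m02 ## l2)" unfolding r02 using l mj icl by (simp add: A.cancel_left)
 have "l0 ## (mj01 ## mj12 ## inv\<^sub>A mj02) ## inv\<^sub>A l0
   = (l0 ## mj01) ## mj12 ## inv\<^sub>A (l0 ## mj02)"
  using l mj by (simp add: A.inv_mult_group A.m_assoc)
 also have "... = inv\<^sub>A (inn a01) ## m01 ## (l1 ## mj12) ## inv\<^sub>A (l0 ## mj02)"
  unfolding e01 using l mj m icl by (simp add: A.m_assoc)
 also have "... = inv\<^sub>A (inn a01) ## (m01 ## inn (inv a12)) ## m12 ## inv\<^sub>A m02 ## inn a02"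
  unfolding e12 e02 using l mj m icl a by (simp add: A.inv_mult_group A.m_assoc A.cancel_left inn_inv)
 also have "... = inn (inv a01) ## inn (act m01 (inv a12)) ## (mu ## inn a02)"
  unfolding mu(2) inn_conj[OF m(1) H.inv_closed[OF a(2)]]
  using m icl a act_closed[OF m(1) H.inv_closed[OF a(2)]] inn_closed by (simp add: A.m_assoc inn_inv)
 also have "mu ## inn a02 = inn a02 ## mu"
  by (rule M_commute[OF mu(1) inn_M[OF a(3)]]) (use c in auto)
 also have "inn (inv a01) ## inn (act m01 (inv a12)) ## (inn a02 ## mu)
   = inn (inv a01 ** act m01 (inv a12) ** a02) ## mu"
  using a a02 act_closed[OF m(1) H.inv_closed[OF a(2)]] M_mem[OF mu(1)]
  by (simp add: inn_mult inn_closed A.m_assoc)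
 finally show ?thesis .
qed

text \<open>Conjugation by \<open>l0\<close> turns \<open>inn Bj\<close> into
  \<open>inn (act l0 Bj)\<close>; all remaining factors have degree 2 and commute since
  \<open>c <= 4\<close>.\<close>

lemma gauge_curvature:
 assumes c: "c <= 4" and l: "l0 : carrier A" and mu: "mu : M 2" and muj: "muj : carrier A"
  and d: "d : N 2" and B: "B : N 2" "Bj : N 2"
  and e: "l0 ## muj ## inv\<^sub>A l0 = inn d ## mu"
 shows "l0 ## (muj ## inv\<^sub>A (inn Bj)) ## inv\<^sub>A l0
  = mu ## inv\<^sub>A (inn B) ## inv\<^sub>A (inn (act l0 Bj ** inv B ** inv d))"
proof -
 note lB = act_N[OF l B(2)]
 note cl = N_mem[OF d] B(1,2)[THEN N_mem] N_mem[OF lB]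
 note icl = cl(1-4)[THEN inn_closed] M_mem[OF mu]
 have "l0 ## inv\<^sub>A (inn Bj) = inv\<^sub>A (inn (act l0 Bj)) ## l0"
  using inn_conj[OF l H.inv_closed[OF cl(3)]] cl by (simp add: inn_inv act_inv l)
 note e1 = this
 have "inv\<^sub>A (inn Bj) ## inv\<^sub>A l0 = inv\<^sub>A l0 ## (l0 ## inv\<^sub>A (inn Bj)) ## inv\<^sub>A l0"
  using l icl by (simp add: A.m_assoc A.cancel_left)
 also have "... = inv\<^sub>A l0 ## inv\<^sub>A (inn (act l0 Bj))" unfolding e1 using l icl by (simp add: A.m_assoc)
 finally have "l0 ## (muj ## inv\<^sub>A (inn Bj)) ## inv\<^sub>A l0
   = (l0 ## muj ## inv\<^sub>A l0) ## inv\<^sub>A (inn (act l0 Bj))"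
  using l icl muj by (simp add: A.m_assoc)
 also have "... = inn d ## mu ## inv\<^sub>A (inn (act l0 Bj))" unfolding e ..
 also have "... = mu ## inv\<^sub>A (inn B) ## inv\<^sub>A (inn (act l0 Bj) ## inv\<^sub>A (inn B) ## inv\<^sub>A (inn d))"
 proof -
  define L where "L = [inn d, mu, inn B, inn (act l0 Bj)]"
  have co: "A.commuting L"
   by (rule commuting_M[of _ 2]) (use inn_M[OF d] inn_M[OF B(1)] inn_M[OF lB] mu c in "auto simp: L_def")
  have len: "length L = 4" by (simp add: L_def)
  note E = A.monomial_units[OF L_def co, simplified]
  show ?thesis by (simp add: E A.monomial_mult[OF co] A.monomial_inv[OF co] len)
 qed
 also have "inn (act l0 Bj) ## inv\<^sub>A (inn B) ## inv\<^sub>A (inn d) = inn (act l0 Bj ** inv B ** inv d)"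
  using cl by (simp add: inn_mult inn_inv)
 finally show ?thesis .
qed

lemma N_lcommute: "a : N j ==> b : N k ==> 0 < j ==> 0 < k ==> c <= j + k ==> x : carrier H ==>
  a ** (b ** x) = b ** (a ** x)"
 using N_commute[of a j b k] N_mem by (metis H.m_assoc)

text \<open>\<open>act m01 (act m12 g2)\<close> is computed twice: by the cocycle relations on the
  edges, and as \<open>act mu (act m02 g2)\<close>. Comparison determines the action of the
  curvature on \<open>g0\<close>.\<close>

lemma cocycle_curvature_aux:
 assumes c: "c <= 3"
  and m: "m01 : carrier A" "m12 : carrier A" "m02 : carrier A" and mj: "mj01 : carrier A"
  and l: "l0 : carrier A" "l1 : carrier A" and g: "g0 : carrier H" "g1 : carrier H" "g2 : carrier H"
  and a: "a01 : N 1" "a12 : N 1" "a02 : N 1" and b: "b01 : N 1" "b12 : N 1" "b02 : N 1"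
  and e: "e01 : N 1" "e12 : N 1" "e02 : N 1"
  and mu: "mu : M 2" "mu = m01 ## m12 ## inv\<^sub>A m02"
  and da: "da : N 2" "da = inv a01 ** act m01 (inv a12) ** a02"
  and db: "db : N 2" "db = inv b01 ** act mj01 (inv b12) ** b02"
  and de: "de : N 2" "de = inv e01 ** act m01 (inv e12) ** e02"
  and r: "m01 ## l1 = inn a01 ## (l0 ## mj01)"
  and s01: "a01 ** act l0 b01 ** g0 = act m01 g1 ** e01"
  and s12: "a12 ** act l1 b12 ** g1 = act m12 g2 ** e12"
  and s02: "a02 ** act l0 b02 ** g0 = act m02 g2 ** e02"
 shows "act mu g0 = inv da ** inv (act l0 db) ** (g0 ** de ** inv g0) ** g0"
proof -
 note acl = a(1-3)[THEN N_mem] and bcl = b(1-3)[THEN N_mem]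
  and ecl = e(1-3)[THEN N_mem] and dcl = N_mem[OF da(1)] N_mem[OF db(1)] N_mem[OF de(1)]
 note muA = M_mem[OF mu(1)]
 have sol: "x = y ** inv z" if "y = x ** z" "x : carrier H" "z : carrier H" for x y z
  using that by (simp add: H.m_assoc)
 have g1': "act m01 g1 = a01 ** act l0 b01 ** g0 ** inv e01"
  by (rule sol[OF s01]) (simp_all add: act_closed m g ecl)
 have g2': "act m12 g2 = a12 ** act l1 b12 ** g1 ** inv e12"
  by (rule sol[OF s12]) (simp_all add: act_closed m g ecl)
 have g3': "act m02 g2 = a02 ** act l0 b02 ** g0 ** inv e02"
  by (rule sol[OF s02]) (simp_all add: act_closed m g ecl)
 define x where "x = act mj01 b12"
 have x: "x : carrier H" by (simp add: x_def act_closed mj bcl)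
 \<comment> \<open>The edge relation moves \<open>m01\<close> past \<open>l1\<close>, at the price
   of a conjugation by \<open>a01\<close>.\<close>
 have lb: "act m01 (act l1 b12) = a01 ** act l0 x ** inv a01"
 proof -
  have "act m01 (act l1 b12) = act (inn a01 ## (l0 ## mj01)) b12"
   by (simp add: act_comp[symmetric] m l bcl r)
  then show ?thesis by (simp add: act_comp inn_closed acl l mj bcl act_inn act_closed x_def)
 qed
 have ia: "inv da = inv a02 ** act m01 a12 ** a01" unfolding da(2) using acl m
  by (simp add: H.inv_mult_group act_inv act_closed H.m_assoc)
 have ib: "inv db = inv b02 ** x ** b01" unfolding db(2) x_def using bcl mj
  by (simp add: H.inv_mult_group act_inv act_closed H.m_assoc)
 have "act m01 (act m12 g2) = act m01 a12 ** (a01 ** act l0 x ** inv a01) ** (a01 ** act l0 b01 ** g0 ** inv e01) ** inv (act m01 e12)"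
  unfolding g2' using acl bcl ecl g l m by (simp add: act_mult act_closed act_inv g1' lb)
 also have "... = (act m01 a12 ** a01) ** act l0 (x ** b01) ** g0 ** (inv e01 ** inv (act m01 e12))"
  using acl bcl ecl g l m x by (simp add: act_mult act_closed H.m_assoc H.cancel_left)
 also have "act m01 a12 ** a01 = a02 ** inv da" unfolding ia using acl m by (simp add: act_closed H.m_assoc H.cancel_left)
 also have "x ** b01 = b02 ** inv db" unfolding ib using bcl x by (simp add: H.m_assoc H.cancel_left)
 also have "inv e01 ** inv (act m01 e12) = de ** inv e02" unfolding de(2) using ecl m
  by (simp add: act_closed act_inv H.m_assoc)
 finally have one: "act m01 (act m12 g2) = a02 ** inv da ** act l0 (b02 ** inv db) ** g0 ** (de ** inv e02)" .
 \<comment> \<open>The three contributions of degree 2 are named so that they can be moved to the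
   left through factors of degree 1, which commute with them as \<open>c <= 3\<close>.\<close>
 define P Q X lb02 where "P = inv da" and "Q = inv (act l0 db)" and "X = g0 ** de ** inv g0" and "lb02 = act l0 b02"
 have N2: "P : N 2" "Q : N 2" "X : N 2"
  unfolding P_def Q_def X_def by (auto intro: N_inv act_N N_conj da db de l g)
 have N1: "lb02 : N 1" unfolding lb02_def by (rule act_N[OF l(1) b(3)])
 note pcl = N2(1-3)[THEN N_mem] N_mem[OF N1]
 have lc: "y ** z = z ** y" if "y : N 1" "z : N 2" for y z
  by (rule N_commute[OF that]) (use c in auto)
 have llc: "y ** (z ** w) = z ** (y ** w)" if "y : N 1" "z : N 2" "w : carrier H" for y z w
  by (rule N_lcommute[OF that(1,2) _ _ _ that(3)]) (use c in auto)
 have "act m01 (act m12 g2) = a02 ** (P ** (lb02 ** (Q ** (X ** (g0 ** inv e02)))))"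
  unfolding one P_def Q_def X_def lb02_def using acl bcl dcl ecl g l
  by (simp add: act_mult act_closed act_inv H.m_assoc H.cancel_left)
 also have "... = P ** (Q ** (X ** (a02 ** (lb02 ** (g0 ** inv e02)))))"
  using pcl acl g ecl by (simp add: llc[OF a(3)] llc[OF N1] N2)
 finally have two: "act m01 (act m12 g2) = P ** Q ** X ** act m02 g2"
  using pcl acl g ecl by (simp add: g3' lb02_def[symmetric] H.m_assoc)
 \<comment> \<open>\<open>act m02 g2\<close> is \<open>g0\<close> up to this factor of degree 1,
   which \<open>mu\<close> fixes; it can then be cancelled.\<close>
 define k where "k = a02 ** lb02 ** (g0 ** inv e02 ** inv g0)"
 have k: "k : N 1" unfolding k_def by (intro N_mult a N1 N_conj N_inv g e)
 have h: "act m02 g2 = k ** g0" unfolding g3' k_def lb02_def[symmetric] using pcl acl g ecl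
  by (simp add: H.m_assoc H.cancel_left)
 have "act mu (act m02 g2) = act m01 (act m12 g2)"
 proof -
  have "mu ## m02 = m01 ## m12" unfolding mu(2) using m by (simp add: A.m_assoc)
  then show ?thesis using act_comp[OF muA m(3) g(3)] act_comp[OF m(1,2) g(3)] by simp
 qed
 then have "act mu k ** act mu g0 = P ** Q ** X ** (k ** g0)" unfolding two h using muA N_mem[OF k] g by (simp add: act_mult)
 also have "act mu k = k" by (rule act_fix[OF mu(1) k]) (use c in auto)
 finally have "k ** act mu g0 = k ** (P ** (Q ** (X ** g0)))"
  using pcl g N_mem[OF k] by (simp add: H.m_assoc llc[OF k] N2)
 then have "act mu g0 = P ** (Q ** (X ** g0))"
  using N_mem[OF k] pcl g act_closed[OF muA g(1)] by (simp add: H.Units_eq)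
 then show ?thesis using pcl g by (simp add: P_def Q_def X_def H.m_assoc)
qed

text \<open>The inner part of the fake curvature contributes \<open>inv B\<close> and the conjugate
  of \<open>B\<close> by \<open>g0\<close>, and its other part is given by \<open>mg\<close>. All
  terms then have degree 2 and commute, so exponents decide.\<close>

lemma cocycle_curvature:
 assumes c: "c <= 4" and l: "l0 : carrier A" "l0' : carrier A" "l0'' : carrier A" and g: "g0 : carrier H"
  and ll: "l0 ## l0' = inn g0 ## l0''"
  and B: "B : N 2" "Bj : N 2" "Bk : N 2" and d: "da : N 2" "db : N 2" "de : N 2" and mu: "mu : M 2"
  and mg: "act mu g0 = inv da ** inv (act l0 db) ** (g0 ** de ** inv g0) ** g0"
 shows "(act l0 Bj ** inv B ** inv da) ** act l0 (act l0' Bk ** inv Bj ** inv db)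
   ** inv (act (l0 ## l0' ## inv\<^sub>A l0'') (act l0'' Bk ** inv B ** inv de))
  = act (mu ## inv\<^sub>A (inn B)) g0 ** inv g0"
proof -
 note Bcl = B(1-3)[THEN N_mem] and dcl = d(1-3)[THEN N_mem]
 note muA = M_mem[OF mu]
 define P Q D1 D2 D3 B' where "P = act l0 Bj" and "Q = act l0 (act l0' Bk)" and "D1 = da" and "D2 = act l0 db"
  and "D3 = g0 ** de ** inv g0" and "B' = g0 ** B ** inv g0"
 have N2: "P : N 2" "Q : N 2" "D1 : N 2" "D2 : N 2" "D3 : N 2" "B' : N 2"
  unfolding P_def Q_def D1_def D2_def D3_def B'_def by (auto intro: act_N N_conj B d l g)
 note pcl = N2(1-6)[THEN N_mem]
 \<comment> \<open>This is \<open>ll\<close> applied to \<open>Bk\<close>; it lets the terms in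
   \<open>Bk\<close> cancel.\<close>
 have Q: "g0 ** act l0'' Bk ** inv g0 = Q"
  unfolding Q_def using l g Bcl by (simp add: act_comp[symmetric] ll) (simp add: act_comp inn_closed act_inn act_closed)
 have "l0 ## l0' ## inv\<^sub>A l0'' = inn g0" unfolding ll using l g inn_closed by (simp add: A.m_assoc)
 then have 3: "act (l0 ## l0' ## inv\<^sub>A l0'') (act l0'' Bk ** inv B ** inv de) = Q ** inv B' ** inv D3"
  unfolding Q[symmetric] B'_def D3_def using l g Bcl dcl
  by (simp add: act_inn act_closed H.inv_mult_group H.m_assoc H.cancel_left)
 have 2: "act l0 (act l0' Bk ** inv Bj ** inv db) = Q ** inv P ** inv D2"
  unfolding Q_def P_def D2_def using l Bcl dcl by (simp add: act_mult act_closed act_inv)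
 have "act (mu ## inv\<^sub>A (inn B)) g0 = act mu (inv B ** g0 ** B)"
  using muA Bcl g by (simp add: act_comp inn_closed inn_inv[symmetric] act_inn)
 also have "... = inv (act mu B) ** act mu g0 ** act mu B" using muA Bcl g by (simp add: act_mult act_inv act_closed)
 also have "act mu B = B" by (rule act_fix[OF mu B(1)]) (use c in auto)
 finally have "act (mu ## inv\<^sub>A (inn B)) g0 ** inv g0 = inv B ** (inv D1 ** inv D2 ** D3) ** B'"
  unfolding mg D1_def[symmetric] D2_def[symmetric] D3_def[symmetric] B'_def
  using pcl Bcl g by (simp add: H.m_assoc)
 moreover have "(P ** inv B ** inv D1) ** (Q ** inv P ** inv D2) ** inv (Q ** inv B' ** inv D3)
   = inv B ** (inv D1 ** inv D2 ** D3) ** B'"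
 proof -
  define L where "L = [P, Q, D1, D2, D3, B', B]"
  have co: "H.commuting L"
   by (rule commuting_N[of _ 2]) (use N2 B(1) c in "auto simp: L_def")
  have len: "length L = 7" by (simp add: L_def)
  note E = H.monomial_units[OF L_def co, simplified]
  show ?thesis by (simp add: E H.monomial_mult[OF co] H.monomial_inv[OF co] len)
 qed
 ultimately show ?thesis unfolding 2 3 P_def[symmetric] D1_def[symmetric] by simp
qed

text \<open>The heart is \<open>u012 ## u023 = v ## u013\<close> with \<open>v\<close> the conjugate
  of \<open>u123\<close> by \<open>m01\<close>: both sides are the path
  \<open>m01 ## m12 ## m23\<close> closed by the inverse of \<open>m03\<close>. The rest commutes in
  degree 2.\<close>

lemma bianchi:
 assumes c: "c <= 4"
  and m: "m01 : carrier A" "m02 : carrier A" "m03 : carrier A" "m12 : carrier A" "m13 : carrier A" "m23 : carrier A"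
  and u: "u012 : M 2" "u013 : M 2" "u023 : M 2" "u123 : M 2"
  and u_def: "u012 = m01 ## m12 ## inv\<^sub>A m02" "u013 = m01 ## m13 ## inv\<^sub>A m03"
   "u023 = m02 ## m23 ## inv\<^sub>A m03" "u123 = m12 ## m23 ## inv\<^sub>A m13"
  and B: "B012 : N 2" "B013 : N 2" "B023 : N 2" "B123 : N 2"
  and n_def: "n012 = u012 ## inv\<^sub>A (inn B012)" "n013 = u013 ## inv\<^sub>A (inn B013)"
   "n023 = u023 ## inv\<^sub>A (inn B023)" "n123 = u123 ## inv\<^sub>A (inn B123)"
 shows "n123 ## (inv\<^sub>A n023 ## (n013 ## (inv\<^sub>A n012 ## \<one>\<^sub>A))) ## (m01 ## n123 ## inv\<^sub>A m01 ## inv\<^sub>A n123)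
  ## inn (B123 ** (inv B023 ** (B013 ** (inv B012 ** \<one>))) ** (act m01 B123 ** inv B123)) = \<one>\<^sub>A"
proof -
 define v B' where "v = m01 ## u123 ## inv\<^sub>A m01" and "B' = act m01 B123"
 have v: "v : M 2" unfolding v_def by (rule M_conj[OF m(1) u(4)])
 have B': "B' : N 2" unfolding B'_def by (rule act_N[OF m(1) B(4)])
 note cl = B(1-4)[THEN N_mem] N_mem[OF B']
  u(1-4)[THEN M_mem] M_mem[OF v]
 have icl: "inn B012 : carrier A" "inn B013 : carrier A" "inn B023 : carrier A" "inn B123 : carrier A" "inn B' : carrier A"
  using cl by (simp_all add: inn_closed)
 have "u012 ## u023 = v ## u013" unfolding v_def u_def using m by (simp add: A.m_assoc A.cancel_left)
 then have "v ## u013 ## inv\<^sub>A u023 = u012 ## u023 ## inv\<^sub>A u023" by simp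
 then have u012: "u012 = v ## u013 ## inv\<^sub>A u023" using cl by (simp add: A.m_assoc)
 have "m01 ## inv\<^sub>A (inn B123) = inv\<^sub>A (inn B') ## m01"
  using inn_conj[OF m(1) H.inv_closed[OF cl(4)]] cl m by (simp add: inn_inv act_inv B'_def)
 note e = this
 have "m01 ## n123 ## inv\<^sub>A m01 = v ## (m01 ## inv\<^sub>A (inn B123)) ## inv\<^sub>A m01"
  unfolding n_def v_def using m cl icl by (simp add: A.m_assoc A.cancel_left)
 also have "... = v ## inv\<^sub>A (inn B')" unfolding e using m cl icl by (simp add: A.m_assoc)
 finally have mn: "m01 ## n123 ## inv\<^sub>A m01 = v ## inv\<^sub>A (inn B')" .
 have i: "inn (B123 ** (inv B023 ** (B013 ** (inv B012 ** \<one>))) ** (B' ** inv B123))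
   = inn B123 ## (inv\<^sub>A (inn B023) ## (inn B013 ## inv\<^sub>A (inn B012))) ## (inn B' ## inv\<^sub>A (inn B123))"
  using cl by (simp add: inn_mult inn_inv)
 define L where "L = [u013, u023, u123, v, inn B012, inn B013, inn B023, inn B123, inn B']"
 have co: "A.commuting L"
  by (rule commuting_M[of _ 2]) (use B(1-4)[THEN inn_M] inn_M[OF B'] u v c in "auto simp: L_def")
 have len: "length L = 9" by (simp add: L_def)
 note E = A.monomial_units[OF L_def co, simplified]
 show ?thesis unfolding mn B'_def[symmetric] i unfolding n_def u012 by (simp add: E A.monomial_mult[OF co] A.monomial_inv[OF co] len)
qed

text \<open>The simplicial parts of the two differentials cancel once the faces of \<open>B\<close>
  commute. What survives is the difference between transporting \<open>B234\<close> along
  \<open>m01\<close>, \<open>m12\<close> and along \<open>m02\<close>, that is, the action of the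
  curvature. The terms of degree 3 commute with those of degree 2 because
  \<open>c <= 5\<close>.\<close>

lemma curvature_differential:
 assumes c: "c <= 5"
  and m: "m01 : M 1" "m02 : M 1" "m12 : M 1"
  and u: "u : M 2" "u = m01 ## m12 ## inv\<^sub>A m02"
  and N2: "set Bs <= N 2" and Bs: "Bs = [B012, B013, B014, B023, B024, B034, B123, B124, B134, B234]"
  and BB: "!!b b'. b : set Bs ==> b' : set Bs ==> b ** b' = b' ** b"
  and w_def: "w0123 = B123 ** (inv B023 ** (B013 ** (inv B012 ** \<one>))) ** (act m01 B123 ** inv B123)"
   "w0124 = B124 ** (inv B024 ** (B014 ** (inv B012 ** \<one>))) ** (act m01 B124 ** inv B124)"
   "w0134 = B134 ** (inv B034 ** (B014 ** (inv B013 ** \<one>))) ** (act m01 B134 ** inv B134)"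
   "w0234 = B234 ** (inv B034 ** (B024 ** (inv B023 ** \<one>))) ** (act m02 B234 ** inv B234)"
   "w1234 = B234 ** (inv B134 ** (B124 ** (inv B123 ** \<one>))) ** (act m12 B234 ** inv B234)"
 shows "w1234 ** (inv w0234 ** (w0134 ** (inv w0124 ** (w0123 ** \<one>)))) ** (act m01 w1234 ** inv w1234)
  = act (u ## inv\<^sub>A (inn B012)) B234 ** inv B234"
proof -
 have B: "B012 : N 2" "B013 : N 2" "B014 : N 2" "B023 : N 2" "B024 : N 2" "B034 : N 2" "B123 : N 2"
  "B124 : N 2" "B134 : N 2" "B234 : N 2" using N2 unfolding Bs by auto
 note Bc = B(1-10)[THEN N_mem]
 note mc = m(1-3)[THEN M_mem] M_mem[OF u(1)]
 have x: "act w b ** inv b : N 3" if "w : M 1" "b : N 2" for w b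
  using act_M_N[OF _ _ that] by (simp add: numeral_3_eq_3 numeral_2_eq_2)
 \<comment> \<open>\<open>y\<close> is a generator of its own: it differs from \<open>x12\<close> by
   an element of degree 4, which is not trivial when \<open>c = 5\<close>.\<close>
 define x123 x124 x134 x234 x02 x12 y where "x123 = act m01 B123 ** inv B123" and "x124 = act m01 B124 ** inv B124"
  and "x134 = act m01 B134 ** inv B134" and "x234 = act m01 B234 ** inv B234"
  and "x02 = act m02 B234 ** inv B234" and "x12 = act m12 B234 ** inv B234" and "y = act m01 x12"
 have X: "x123 : N 3" "x124 : N 3" "x134 : N 3" "x234 : N 3" "x02 : N 3" "x12 : N 3"
  unfolding x123_def x124_def x134_def x234_def x02_def x12_def by (rule x, rule m, rule B)+
 have y: "y : N 3" unfolding y_def by (rule act_N[OF mc(1) X(6)])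
 note Xc = X(1-6)[THEN N_mem] N_mem[OF y]
 define L where "L = Bs @ [x123, x124, x134, x234, x02, x12, y]"
 have L3: "z : N 3" if "z : set L" "z \<notin> set Bs" for z using that X y by (auto simp: L_def)
 have LN: "z : N 2" if "z : set L" for z
  using L3[OF that] N2 N_antimono[of 2 3] by (cases "z : set Bs") auto
 have co: "H.commuting L"
  unfolding H.commuting_def
 proof (intro conjI ballI subsetI)
  show "z : carrier H" if "z : set L" for z by (rule N_mem[OF LN[OF that]])
  fix z z' assume z: "z : set L" "z' : set L"
  consider "z : set Bs" "z' : set Bs" | "z : N 2" "z' : N 3" | "z : N 3" "z' : N 2"
   using L3 LN z by blast
  then show "z ** z' = z' ** z"
   by cases (use BB c in "auto intro: N_commute[of _ 2 _ 3] N_commute[of _ 3 _ 2]")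
 qed
 have len: "length L = 17" by (simp add: L_def Bs)
 note E = H.monomial_units[OF L_def[unfolded Bs] co, simplified]
 have sol: "act w b = act w b ** inv b ** b" if "w : carrier A" "b : carrier H" for w b
  using that by (simp add: H.m_assoc act_closed)
 have a: "act m01 B123 = x123 ** B123" "act m01 B124 = x124 ** B124" "act m01 B134 = x134 ** B134"
  "act m01 B234 = x234 ** B234" "act m02 B234 = x02 ** B234" "act m12 B234 = x12 ** B234"
  unfolding x123_def x124_def x134_def x234_def x02_def x12_def using sol mc Bc by blast+
 have mw: "act m01 w1234 = x234 ** B234 ** (inv (x134 ** B134) ** (x124 ** B124 ** inv (x123 ** B123))) ** y"
  unfolding w_def x12_def[symmetric] using mc Bc Xc by (simp add: act_mult act_inv a y_def)
 have "w1234 ** (inv w0234 ** (w0134 ** (inv w0124 ** (w0123 ** \<one>)))) ** (act m01 w1234 ** inv w1234)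
   = (y ** (x234 ** B234)) ** inv (x02 ** B234)"
  unfolding mw unfolding w_def x123_def[symmetric] x124_def[symmetric] x134_def[symmetric] x02_def[symmetric] x12_def[symmetric]
  by (simp add: E H.monomial_mult[OF co] H.monomial_inv[OF co] len)
 also have "y ** (x234 ** B234) = act m01 (act m12 B234)" using mc Bc Xc by (simp add: y_def a act_mult)
 \<comment> \<open>The definition of \<open>u\<close> compares the two routes from the vertex 2 to
   the vertex 0.\<close>
 also have "... = act u (x02 ** B234)"
 proof -
  have "u ## m02 = m01 ## m12" unfolding u(2) using mc by (simp add: A.m_assoc)
  then have "act m01 (act m12 B234) = act u (act m02 B234)" using mc Bc by (simp flip: act_comp)
  then show ?thesis unfolding a .
 qed
 also have "... = x02 ** act u B234"
  using act_fix[OF u(1) X(5)] c mc Bc Xc by (simp add: act_mult)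
 also have "x02 ** act u B234 ** inv (x02 ** B234) = act u B234 ** inv B234"
 proof -
  define z where "z = act u B234 ** inv B234"
  have z: "z : N 4" unfolding z_def using act_M_N[OF _ _ u(1) B(10)] by simp
  have "x02 ** z = z ** x02" by (rule N_commute[OF X(5) z]) (use c in auto)
  then have "x02 ** z ** inv x02 = z" using Xc N_mem[OF z] by (simp add: H.m_assoc)
  then show ?thesis unfolding z_def using mc Bc Xc by (simp add: H.inv_mult_group H.m_assoc act_closed)
 qed
 \<comment> \<open>The fake curvature differs from \<open>u\<close> by conjugation with
   \<open>B012\<close>, which does not move \<open>B234\<close> by the commutation
   hypothesis.\<close>
 also have "act u B234 = act (u ## inv\<^sub>A (inn B012)) B234"
 proof -
  have "B234 ** B012 = B012 ** B234" by (rule BB) (simp_all add: Bs)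
  then have "inv B012 ** B234 ** B012 = B234" using Bc by (simp add: H.m_assoc H.cancel_left)
  then show ?thesis using mc Bc by (simp add: act_comp inn_closed inn_inv[symmetric] act_inn)
 qed
 finally show ?thesis .
qed

text \<open>Apart from values of 2-forms, only four quantities of degree 3 survive: the commutators
  of \<open>inv a01\<close> with \<open>B123\<close>, \<open>b123\<close> and \<open>d123\<close>,
  and the action of the curvature \<open>u\<close> on \<open>a23\<close>. The hypotheses
  \<open>GC\<close> identify the first two with the commutators of \<open>B012\<close> and
  \<open>b012\<close> with \<open>a23\<close> that arise from the fake curvature
  \<open>n\<close>.\<close>

lemma gauge_three_curvature:
 assumes c: "c <= 4"
  and m: "m01 : M 1" "m02 : M 1" "m12 : M 1" and mj: "mj01 : carrier A"
  and l: "l0 : carrier A" "l1 : carrier A"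
  and a: "a01 : N 1" "a02 : N 1" "a03 : N 1" "a12 : N 1" "a13 : N 1" "a23 : N 1"
  and r: "m01 ## l1 = inn a01 ## (l0 ## mj01)"
  and u: "u : M 2" "u = m01 ## m12 ## inv\<^sub>A m02"
  and B: "B012 : N 2" "B013 : N 2" "B023 : N 2" "B123 : N 2"
  and C: "C012 : N 2" "C013 : N 2" "C023 : N 2" "C123 : N 2"
  and d: "d012 : N 2" "d013 : N 2" "d023 : N 2" "d123 : N 2"
  and d_def: "d012 = inv a01 ** act m01 (inv a12) ** a02" "d013 = inv a01 ** act m01 (inv a13) ** a03"
   "d023 = inv a02 ** act m02 (inv a23) ** a03" "d123 = inv a12 ** act m12 (inv a23) ** a13"
  and b_def: "b012 = act l0 C012 ** inv B012 ** inv d012" "b013 = act l0 C013 ** inv B013 ** inv d013"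
   "b023 = act l0 C023 ** inv B023 ** inv d023" "b123 = act l1 C123 ** inv B123 ** inv d123"
  and n: "n = u ## inv\<^sub>A (inn B012) ## inv\<^sub>A (inn b012)"
  and GC: "com B012 a23 ** com a01 B123 = \<one>" "com b012 a23 ** com a01 b123 = \<one>"
 shows "act l0 (C123 ** (inv C023 ** (C013 ** (inv C012 ** \<one>))) ** (act mj01 C123 ** inv C123)) ** (act n a23 ** inv a23)
  = B123 ** (inv B023 ** (B013 ** (inv B012 ** \<one>))) ** (act m01 B123 ** inv B123)
   ** (b123 ** (inv b023 ** (b013 ** (inv b012 ** \<one>))) ** (act m01 b123 ** inv b123))"
proof -
 note ac = a(1-6)[THEN N_mem]
 note Bc = B(1-4)[THEN N_mem]
  C(1-4)[THEN N_mem] d(1-4)[THEN N_mem]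
 note mc = m(1-3)[THEN M_mem] M_mem[OF u(1)]
 define p012 p013 p023 p123 q s be where "p012 = act l0 C012" and "p013 = act l0 C013" and "p023 = act l0 C023"
  and "p123 = act l0 C123" and "q = act l1 C123" and "s = act l0 (act mj01 C123)" and "be = act m01 q"
 have P: "p012 : N 2" "p013 : N 2" "p023 : N 2" "p123 : N 2" "q : N 2" "s : N 2" "be : N 2"
  unfolding p012_def p013_def p023_def p123_def s_def be_def q_def by (auto intro!: act_N C l mj mc)
 define B' d' where "B' = act m01 B123" and "d' = act m01 d123"
 have P': "B' : N 2" "d' : N 2" unfolding B'_def d'_def by (auto intro!: act_N B d mc)
 have b: "b012 : N 2" "b123 : N 2"
  unfolding b_def by (auto intro!: act_N B C d l N_mult N_inv)
 note Pc = P(1-7)[THEN N_mem]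
  P'(1,2)[THEN N_mem] b(1,2)[THEN N_mem]
 have com3: "com x y : N 3" if "x : N 1" "y : N 2" for x y
  using com_mem[OF that] by (simp add: numeral_3_eq_3 numeral_2_eq_2)
 have act3: "act w x ** inv x : N 3" if "w : M 2" "x : N 1" for w x
  using act_M_N[OF _ _ that] by (simp add: numeral_3_eq_3 numeral_2_eq_2)
 define e k where "e = inv a01" and "k = act m02 (inv a23)"
 have e: "e : N 1" and k: "k : N 1" unfolding e_def k_def by (rule N_inv[OF a(1)], rule act_N[OF mc(2) N_inv[OF a(6)]])
 note ec = N_mem[OF e] N_mem[OF k]
 define ka t S where "ka = act u k ** inv k" and "t = com e d'" and "S = com e be"
 have ka: "ka : N 3" unfolding ka_def by (rule act3[OF u(1) k])
 have tS: "t : N 3" "S : N 3"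
  unfolding t_def S_def by (rule com3[OF e P'(2)], rule com3[OF e P(7)])
 note kc = N_mem[OF ka] tS(1,2)[THEN N_mem]
 have c3: "x ** y = y ** x" if "x : N 3" "y : N 1" for x y by (rule N_commute[OF that]) (use c in auto)
 have c3': "x ** y = y ** x" if "x : N 3" "y : N 2" for x y by (rule N_commute[OF that]) (use c in auto)

 \<comment> \<open>Transport of \<open>C123\<close> by \<open>l0\<close>, \<open>mj01\<close> and by
   \<open>m01\<close>, \<open>l1\<close> differs by conjugation with \<open>a01\<close>, hence by
   the commutator \<open>S\<close>.\<close>
 have sS: "s = S ** be"
 proof -
  have "be = act (m01 ## l1) C123" by (simp add: be_def q_def act_comp mc l Bc)
  also have "... = a01 ** s ** inv a01" unfolding r s_def using ac l mj Bc
   by (simp add: act_comp inn_closed act_inn act_closed)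
  finally have "s = inv a01 ** be ** a01" using ac Pc by (simp add: H.m_assoc H.cancel_left)
  then show ?thesis unfolding S_def com_def e_def using ac Pc by (simp add: H.m_assoc)
 qed
 \<comment> \<open>The twisted differential of the 2-form \<open>d\<close>, itself the twisted
   differential of the inverse of \<open>a\<close>: it fails to vanish by the curvature term
   \<open>ka\<close> and the commutator \<open>t\<close>.\<close>
 have dd: "t ** d' ** d013 = ka ** d012 ** d023"
 proof -
  define x y z where "x = act m01 (inv a12)" and "y = act m01 (act m12 (inv a23))" and "z = act m01 (inv a13)"
  have xc: "x : carrier H" "y : carrier H" "z : carrier H" unfolding x_def y_def z_def by (simp_all add: act_closed mc ac)
  have "u ## m02 = m01 ## m12" unfolding u(2) using mc by (simp add: A.m_assoc)
  then have "act u k = y" unfolding k_def y_def using mc ac by (simp flip: act_comp)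
  then have y: "y = ka ** k" using ec xc mc by (simp add: ka_def H.m_assoc)
  have d'x: "d' = x ** y ** inv z" unfolding d'_def d_def x_def y_def z_def using mc ac by (simp add: act_mult act_closed act_inv)
  have dx: "d013 = e ** z ** a03" "d012 = e ** x ** a02" "d023 = inv a02 ** k ** a03"
   unfolding d_def e_def z_def x_def k_def by simp_all
  have kx: "ka : carrier H" by (rule kc(1))
  have ke: "ka ** e = e ** ka" by (rule c3[OF ka e])
  have "x : N 1" unfolding x_def by (rule act_N[OF mc(1) N_inv[OF a(4)]])
  then have kx': "ka ** x = x ** ka" by (rule c3[OF ka])
  have "t ** d' ** d013 = e ** d' ** (inv e ** d013)"
   unfolding t_def com_def using ec Pc Bc by (simp add: H.m_assoc)
  also have "... = e ** (x ** ka) ** k ** a03"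
   unfolding dx d'x y using ec xc ac kx by (simp add: H.m_assoc H.cancel_left)
  also have "... = (e ** ka) ** (x ** k ** a03)" unfolding kx'[symmetric] using ec xc ac kx by (simp add: H.m_assoc)
  also have "... = ka ** d012 ** d023" unfolding ke[symmetric] dx using ec xc ac kx by (simp add: H.m_assoc H.cancel_left)
  finally show ?thesis .
 qed

 \<comment> \<open>The bracket with \<open>a23\<close> is multiplicative on automorphisms of degree
   2, since its values have degree 3 and are fixed by these automorphisms. Hence \<open>f n\<close>
   splits into a curvature part and inner parts.\<close>
 define f where "f w = act w a23 ** inv a23" for w
 have f_mem: "f w : N 3" if "w : M 2" for w
  unfolding f_def by (rule act3[OF that a(6)])
 have f_mult: "f (w ## w') = f w ** f w'" if "w : M 2" "w' : M 2" for w w'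
 proof -
  note wc = that(1,2)[THEN M_mem] N_mem[OF f_mem[OF that(1)]] N_mem[OF f_mem[OF that(2)]]
  have 1: "act w (f w') = f w'" by (rule act_fix[OF that(1) f_mem[OF that(2)]]) (use c in auto)
  have "act w' a23 = f w' ** a23" unfolding f_def using wc ac by (simp add: H.m_assoc act_closed)
  then have "f (w ## w') = act w (f w') ** act w a23 ** inv a23"
   unfolding f_def[of "w ## w'"] using wc ac by (simp add: act_comp act_mult)
  also have "... = f w' ** f w" unfolding 1 f_def[of w] using wc ac by (simp add: H.m_assoc act_closed)
  also have "... = f w ** f w'" by (rule N_commute[OF that(2,1)[THEN f_mem]]) (use c in auto)
  finally show ?thesis .
 qed
 have f_inn: "f (inv\<^sub>A (inn x)) = inv (com x a23)" if "x : N 2" for x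
 proof -
  have "f (inv\<^sub>A (inn x)) = com (inv x) a23"
   unfolding f_def com_def using N_mem[OF that] ac by (simp add: inn_inv[symmetric] act_inn)
  then show ?thesis using com_inv_left[OF that a(6)] c by simp
 qed
 have fn: "f n = f u ** inv (com B012 a23) ** inv (com b012 a23)"
  unfolding n using M_inv[OF inn_M[OF B(1)]] M_inv[OF inn_M[OF b(1)]] u(1)
  by (simp add: f_mult M_mult f_inn B b)
 \<comment> \<open>\<open>k\<close> is \<open>inv a23\<close> up to a factor of degree 2, which
   \<open>u\<close> fixes, so \<open>u\<close> moves \<open>k\<close> as it moves
   \<open>inv a23\<close>.\<close>
 have kaf: "ka = inv (f u)"
 proof -
  define z where "z = act m02 (inv a23) ** inv (inv a23)"
  have z: "z : N 2" unfolding z_def using act_M_N[OF _ _ m(2) N_inv[OF a(6)]] by (simp add: numeral_2_eq_2)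
  have k': "k = z ** inv a23" unfolding k_def z_def using mc ac by (simp add: H.m_assoc act_closed)
  have uz: "act u z = z" by (rule act_fix[OF u(1) z]) (use c in auto)
  have fu: "act u a23 = f u ** a23" unfolding f_def using mc ac by (simp add: H.m_assoc act_closed)
  note fc = N_mem[OF f_mem[OF u(1)]] N_mem[OF z]
  have 1: "inv (f u) ** z = z ** inv (f u)" by (rule c3'[OF N_inv[OF f_mem[OF u(1)]] z])
  have 2: "inv (f u) ** inv a23 = inv a23 ** inv (f u)" by (rule c3[OF N_inv[OF f_mem[OF u(1)]] N_inv[OF a(6)]])
  have "ka = z ** (inv a23 ** inv (f u)) ** inv (z ** inv a23)"
   unfolding ka_def k' using mc ac fc by (simp add: act_mult uz act_inv fu H.inv_mult_group)
  also have "... = (z ** inv (f u)) ** inv a23 ** inv (z ** inv a23)" unfolding 2[symmetric] using ac fc by (simp add: H.m_assoc)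
  also have "... = inv (f u)" unfolding 1[symmetric] using ac fc by (simp add: H.m_assoc H.inv_mult_group H.cancel_left)
  finally show ?thesis .
 qed

 \<comment> \<open>\<open>m01\<close> changes \<open>x\<close> by a factor of degree 3, whose
   commutator with \<open>e\<close> is trivial as \<open>c <= 4\<close>.\<close>
 have e_act: "com e (act m01 x) = com e x" if "x : N 2" for x
 proof -
  define y where "y = act m01 x ** inv x"
  have y: "y : N 3" unfolding y_def using act_M_N[OF _ _ m(1) that] by (simp add: numeral_3_eq_3 numeral_2_eq_2)
  have y2: "y : N 2" using y N_antimono[of 2 3] by auto
  have "act m01 x = y ** x" unfolding y_def using mc N_mem[OF that] by (simp add: H.m_assoc act_closed)
  then have "com e (act m01 x) = com e y ** com e x" using com_mult_right[OF e y2 that] c by simp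
  also have "com e y = \<one>" by (rule com_trivial[OF e y]) (use c in auto)
  finally show ?thesis using ec N_mem[OF that] by (simp add: com_def)
 qed
 have comN: "com e B123 : N 3" "com e d123 : N 3" "com e b123 : N 3"
  by (rule com3[OF e B(4)], rule com3[OF e d(4)], rule com3[OF e b(2)])
 have t: "t = com e d123" unfolding t_def d'_def by (rule e_act[OF d(4)])
 \<comment> \<open>The definition of \<open>b123\<close> is solved for \<open>q\<close> and the
   commutator is expanded multiplicatively.\<close>
 have S: "S = com e b123 ** com e d123 ** com e B123"
 proof -
  have "q = b123 ** (d123 ** B123)" unfolding b_def q_def using Bc l by (simp add: H.m_assoc H.cancel_left act_closed)
  then have "S = com e (b123 ** (d123 ** B123))" unfolding S_def be_def using e_act[OF P(5)] by simp
  then show ?thesis using com_mult_right[OF e b(2) N_mult[OF d(4) B(4)]] com_mult_right[OF e d(4) B(4)] c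
    comN(1-3)[THEN N_mem] by (simp add: H.m_assoc)
 qed
 have gc: "com e x = com y a23" if "com y a23 ** com a01 x = \<one>" "x : N 2" "y : N 2" for x y
 proof -
  have cc: "com a01 x : carrier H" "com y a23 : carrier H"
   using ac that(2,3)[THEN N_mem] by (simp_all add: com_def)
  have "com e x = inv (com a01 x)" unfolding e_def by (rule com_inv_left[OF a(1) that(2)]) (use c in auto)
  also have "... = com y a23" by (rule H.inv_equality[OF that(1) cc])
  finally show ?thesis .
 qed
 note g = gc[OF GC(1) B(4,1)] gc[OF GC(2) b(2,1)]

 define X Y Z W where "X = com e B123" and "Y = com e b123" and "Z = com e d123" and "W = f u"
 note XN = comN(1)[folded X_def] comN(3)[folded Y_def] comN(2)[folded Z_def] f_mem[OF u(1), folded W_def]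
 note XYZ = X_def[symmetric] Y_def[symmetric] Z_def[symmetric] W_def[symmetric]
 note SYZ = S[unfolded XYZ] and tZ = t[unfolded XYZ] and kaW = kaf[unfolded XYZ] and fnW = fn[folded g, unfolded XYZ]
 define L where "L = [p012, p013, p023, p123, q, be, B012, B013, B023, B123, B', d012, d013, d023, d123, X, Y, Z, W]"
 have "X : N 2" "Y : N 2" "Z : N 2" "W : N 2" using XN N_antimono[of 2 3] by auto
 then have co: "H.commuting L"
  by (intro commuting_N[of _ 2]) (use P P' B d c in "auto simp: L_def")
 have len: "length L = 19" by (simp add: L_def)
 note E = H.monomial_units[OF L_def co, simplified]
 \<comment> \<open>\<open>d'\<close> depends on the other generators by \<open>dd\<close>; it is
   eliminated before exponents in \<open>L\<close> are compared.\<close>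
 have "d' = inv t ** (ka ** d012 ** d023) ** inv d013"
  unfolding dd[symmetric] using Bc Pc kc by (simp add: H.m_assoc H.cancel_left)
 then have d': "d' = inv Z ** (inv W ** d012 ** d023) ** inv d013" unfolding tZ kaW .
 have lhs: "act l0 (C123 ** (inv C023 ** (C013 ** (inv C012 ** \<one>))) ** (act mj01 C123 ** inv C123))
   = p123 ** (inv p023 ** (p013 ** inv p012)) ** (S ** be ** inv p123)"
  unfolding sS[symmetric] unfolding p012_def p013_def p023_def p123_def s_def using Bc l mj
  by (simp add: act_mult act_inv act_closed)
 have mb: "act m01 b123 = be ** inv B' ** inv d'"
  unfolding b_def q_def[symmetric] be_def B'_def d'_def using mc Bc Pc by (simp add: act_mult act_inv)
 show ?thesis
  unfolding lhs f_def[symmetric] mb unfolding b_def B'_def[symmetric] p012_def[symmetric] p013_def[symmetric]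
   p023_def[symmetric] q_def[symmetric] unfolding SYZ fnW d'
  by (simp add: E H.monomial_mult[OF co] H.monomial_inv[OF co] len)
qed

end

lemma degenerate_Cons: "degenerate (a # b # xs) \<longleftrightarrow> a = b | degenerate (b # xs)" "\<not> degenerate [a]"
proof -
 show "\<not> degenerate [a]" by (simp add: degenerate_def)
 show "degenerate (a # b # xs) \<longleftrightarrow> a = b | degenerate (b # xs)" (is "?l \<longleftrightarrow> ?r")
 proof
  assume ?l
  then obtain i where i: "Suc i < length (a # b # xs)" "(a # b # xs) ! i = (a # b # xs) ! Suc i"
   unfolding degenerate_def by blast
  show ?r
  proof (cases i)
   case 0 then show ?thesis using i by simp
  next
   case (Suc j) then show ?thesis using i degenerateI[of j "b # xs"] by simp
  qed
 next
  assume ?r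
  then show ?l
  proof
   assume "a = b" then show ?l by (intro degenerateI[of 0]) simp_all
  next
   assume "degenerate (b # xs)"
   then obtain i where "Suc i < length (b # xs)" "(b # xs) ! i = (b # xs) ! Suc i" unfolding degenerate_def by blast
   then show ?l by (intro degenerateI[of "Suc i"]) simp_all
  qed
 qed
qed

text \<open>The two parts share the vertex with index \<open>m\<close>, so no pair of adjacent
  vertices is separated.\<close>

lemma degenerate_split: "degenerate xs ==> degenerate (take (Suc m) xs) | degenerate (drop m xs)"
proof -
 assume "degenerate xs"
 then obtain i where i: "Suc i < length xs" "xs ! i = xs ! Suc i" unfolding degenerate_def by blast
 show ?thesis
 proof (cases "i < m")
  case True
  then show ?thesis using i degenerateI[of i "take (Suc m) xs"] by simp
 next
  case False
  then show ?thesis using i degenerateI[of "i - m" "drop m xs"] by simp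
 qed
qed

lemma length_simps:
 "length xs = Suc (Suc 0) \<longleftrightarrow> (EX a b. xs = [a, b])"
 "length xs = 3 \<longleftrightarrow> (EX a b c. xs = [a, b, c])"
 "length xs = 4 \<longleftrightarrow> (EX a b c d. xs = [a, b, c, d])"
 "length xs = 5 \<longleftrightarrow> (EX a b c d e. xs = [a, b, c, d, e])"
 by (auto simp: length_Suc_conv eval_nat_numeral)

lemma de_rham_simps:
 "de_rham F ww R [a, b, c, d] = ww R [b, c, d] **\<^sub>(grp F R a) (inv \<^sub>(grp F R a) ww R [a, c, d] **\<^sub>(grp F R a)
  (ww R [a, b, d] **\<^sub>(grp F R a) (inv \<^sub>(grp F R a) ww R [a, b, c] **\<^sub>(grp F R a) \<one>\<^sub>(grp F R a))))"
 "de_rham F ww R [a, b, c, d, e] = ww R [b, c, d, e] **\<^sub>(grp F R a) (inv \<^sub>(grp F R a) ww R [a, c, d, e] **\<^sub>(grp F R a)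
  (ww R [a, b, d, e] **\<^sub>(grp F R a) (inv \<^sub>(grp F R a) ww R [a, b, c, e] **\<^sub>(grp F R a)
  (ww R [a, b, c, d] **\<^sub>(grp F R a) \<one>\<^sub>(grp F R a)))))"
 by (simp_all add: de_rham_def alternating_factor_def omit_def upt_rec)

section \<open>Operations on forms\<close>

context form_space
begin

lemma natural_form_mono:
 assumes "natural_form F U n ww" "!!R. cring R ==> V R <= U R"
 shows "natural_form F V n ww"
 using assms spx_mono[of _ X p V n _ U] spxD(2)[of _ X p V n]
 unfolding natural_form_def by (meson subset_trans)

lemma is_form_mono:
 assumes "is_form X p (base_change p F) U n ww" "!!R. cring R ==> V R <= U R"
 shows "is_form X p (base_change p F) V n ww"
 unfolding is_form_iff
proof (intro conjI allI impI; (elim conjE)?)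
 show "natural_form F V n ww" by (rule natural_form_mono[OF is_formD(1)[OF assms(1)] assms(2)])
 fix R xs assume a: "cring R" "xs : spx X p V n R" "degenerate xs"
 have "set xs <= U R" using spxD(2)[OF a(2)] assms(2)[OF a(1)] by blast
 then show "ww R xs = \<one>\<^sub>(grp F R (bp R xs))"
  by (rule is_formD(2)[OF assms(1) a(1) spx_mono[OF a(2)] a(3)])
qed

text \<open>Allows identities between forms to be checked on affine simplices only, for both sheaves
  of values.\<close>

definition local_eq :: "('r, 's, 'f) gfunctor => bool" where
 "local_eq F \<longleftrightarrow> (ALL U n R xs g g'. stable_open U --> cring R --> xs : spx X p U n R -->
   g : carrier (grp F R (bp R xs)) --> g' : carrier (grp F R (bp R xs)) -->
   (ALL R' h. cring R' --> h : rhom R R' --> aff_spx U n R' (map (pull X R R' h) xs) -->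
    res F R R' h (bp R xs) g = res F R R' h (bp R xs) g') --> g = g')"

lemma local_eqD:
 assumes "local_eq F" "stable_open U" "cring R" "xs : spx X p U n R"
  "g : carrier (grp F R (bp R xs))" "g' : carrier (grp F R (bp R xs))"
  "!!R' h. cring R' ==> h : rhom R R' ==> aff_spx U n R' (map (pull X R R' h) xs) ==>
    res F R R' h (bp R xs) g = res F R R' h (bp R xs) g'"
 shows "g = g'"
 using assms unfolding local_eq_def by blast

text \<open>A covering of the base moves the first vertex into an affine open of \<open>X\<close>,
  after which \<open>eq_good\<close> takes care of the base point; the other vertices follow by
  \<open>aff_spxI\<close>.\<close>

lemma local_eq_G: "local_eq G"
 unfolding local_eq_def
proof (intro allI impI)
 fix U n R xs g g'
 assume U: "stable_open U" and R: "cring R" and xs: "xs : spx X p U n R"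
  and g: "g : GC R (bp R xs)" "g' : GC R (bp R xs)"
  and eq: "ALL R' h. cring R' --> h : rhom R R' --> aff_spx U n R' (map (pull X R R' h) xs) -->
    res G R R' h (bp R xs) g = res G R R' h (bp R xs) g'"
 note b = spx_base[OF U R xs]
 obtain C where C: "zariski_cover R C"
  "ALL (R1, h1):C. EX A v. affine_open X A v & pull X R R1 h1 (hd xs) : orbit X A v R1"
  using X R b(2) unfolding scheme_def by blast
 show "g = g'"
 proof (rule eq_local[OF R b(1) g C(1)])
  fix R1 h1 assume m: "(R1, h1) : C"
  have R1: "cring R1" "h1 : rhom R R1" using zariski_coverD[OF C(1) m] by auto
  obtain A v where A: "affine_open X A v" "pull X R R1 h1 (hd xs) : orbit X A v R1" using C(2) m by blast
  interpret aff: affine X A v by unfold_locales (rule A(1))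
  have s1: "pull S R R1 h1 (bp R xs) : pts S R1" by (rule S.pull_closed[OF R R1 b(1)])
  show "res G R R1 h1 (bp R xs) g = res G R R1 h1 (bp R xs) g'"
  proof (rule eq_good[OF R1(1) s1 res_closed[OF R R1 b(1) g(1)] res_closed[OF R R1 b(1) g(2)]])
   fix R' h assume R': "cring R'" "h : rhom R1 R'" and gd: "good R' (pull S R1 R' h (pull S R R1 h1 (bp R xs)))"
   let ?k = "cmps R h h1"
   have k: "?k : rhom R R'" by (rule rhom_comp[OF R R1(2) R'(2)])
   have "aff_spx U n R' (map (pull X R R' ?k) xs)"
   proof (rule aff_spxI[OF U R'(1) simplex_pull[OF U R R'(1) k xs] _ A(1)])
    show "good R' (bp R' (map (pull X R R' ?k) xs))"
     using gd b(3,4)[OF R'(1) k] S.pull_comp[OF R R1(1) R'(1) R1(2) R'(2) b(1)] by simp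
    show "hd (map (pull X R R' ?k) xs) : orbit X A v R'"
     using b(4)[OF R'(1) k] X.pull_comp[OF R R1(1) R'(1) R1(2) R'(2) b(2)] aff.orbit_pull[OF R1(1) R' A(2)] by simp
   qed
   then have "res G R R' ?k (bp R xs) g = res G R R' ?k (bp R xs) g'" using eq R'(1) k by blast
   then show "res G R1 R' h (pull S R R1 h1 (bp R xs)) (res G R R1 h1 (bp R xs) g)
     = res G R1 R' h (pull S R R1 h1 (bp R xs)) (res G R R1 h1 (bp R xs) g')"
    using res_comp[OF R R1(1) R'(1) R1(2) R'(2) b(1)] g by simp
  qed
 qed
qed

text \<open>Automorphisms are compared on sections after base change, which reduces the claim to
  \<open>local_eq_G\<close>.\<close>

lemma local_eq_Aut: "local_eq (Aut_sheaf S G)"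
 unfolding local_eq_def
proof (intro allI impI)
 fix U n R xs u w
 assume U: "stable_open U" and R: "cring R" and xs: "xs : spx X p U n R"
  and u: "u : AC R (bp R xs)" "w : AC R (bp R xs)"
  and eq: "ALL R' h. cring R' --> h : rhom R R' --> aff_spx U n R' (map (pull X R R' h) xs) -->
    ract R R' h (bp R xs) u = ract R R' h (bp R xs) w"
 note b = spx_base[OF U R xs]
 show "u = w"
 proof (rule Aut_eqI_app[OF u])
  fix R' h g assume R': "cring R'" "h : rhom R R'" and g: "g : GC R' (pull S R R' h (bp R xs))"
  let ?ys = "map (pull X R R' h) xs"
  have ys: "?ys : spx X p U n R'" by (rule simplex_pull[OF U R R' xs])
  note b' = spx_base[OF U R'(1) ys]
  have pe: "bp R' ?ys = pull S R R' h (bp R xs)" using b(3,4)[OF R'] by simp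
  note s' = b'(1)[unfolded pe]
  have c: "ract R R' h (bp R xs) v : AC R' (pull S R R' h (bp R xs))"
   if "v : AC R (bp R xs)" for v by (rule Aut.res_closed[OF R R' b(1) that])
  show "aut_app R' (ract R R' h (bp R xs) u) g = aut_app R' (ract R R' h (bp R xs) w) g"
  proof (rule local_eqD[OF local_eq_G U R'(1) ys, unfolded pe])
   fix R'' k assume R'': "cring R''" "k : rhom R' R''" and aff: "aff_spx U n R'' (map (pull X R' R'' k) ?ys)"
   let ?l = "cmps R k h"
   have l: "?l : rhom R R''" by (rule rhom_comp[OF R R'(2) R''(2)])
   have e: "map (pull X R' R'' k) ?ys = map (pull X R R'' ?l) xs"
    using X.pull_comp[OF R R'(1) R''(1) R'(2) R''(2)] spxD(2)[OF xs] stable_openD(1)[OF U R] by auto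
   have "ract R R'' ?l (bp R xs) u = ract R R'' ?l (bp R xs) w" using eq R''(1) l aff[unfolded e] by blast
   then have "ract R' R'' k (pull S R R' h (bp R xs)) (ract R R' h (bp R xs) u)
     = ract R' R'' k (pull S R R' h (bp R xs)) (ract R R' h (bp R xs) w)"
    using Aut.res_comp[OF R R'(1) R''(1) R'(2) R''(2) b(1)] u by simp
   then show "res G R' R'' k (pull S R R' h (bp R xs)) (aut_app R' (ract R R' h (bp R xs) u) g)
     = res G R' R'' k (pull S R R' h (bp R xs)) (aut_app R' (ract R R' h (bp R xs) w) g)"
    using aut_app_natural[OF R'(1) R'' s' c[OF u(1)] g] aut_app_natural[OF R'(1) R'' s' c[OF u(2)] g] by simp
  qed (rule aut_app_closed[OF R'(1) s' c g], rule u)+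
 qed
qed

lemma natural_eq:
 assumes F: "local_eq F" and U: "stable_open U" and nat: "natural_form F U n al" "natural_form F U n be"
  and eq: "!!R xs. aff_spx U n R xs ==> al R xs = be R xs" and R: "cring R" and xs: "xs : spx X p U n R"
 shows "al R xs = be R xs"
proof (rule local_eqD[OF F U R xs natural_formD(1)[OF nat(1) R xs] natural_formD(1)[OF nat(2) R xs]])
 fix R' h assume "cring R'" "h : rhom R R'" "aff_spx U n R' (map (pull X R R' h) xs)"
 then show "res F R R' h (bp R xs) (al R xs) = res F R R' h (bp R xs) (be R xs)"
  using eq natural_formD(2)[OF nat(1) R xs] natural_formD(2)[OF nat(2) R xs] by metis
qed

lemma natural_form_cong:
 assumes "natural_form F U n ww" "!!R xs. length xs = Suc n ==> ww R xs = ww' R xs"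
 shows "natural_form F U n ww'"
 unfolding natural_form_def
proof (intro allI impI, elim conjE, goal_cases)
 case (1 R xs)
 note R = 1(1) and xs = 1(2)
 have "ww R' (map h xs) = ww' R' (map h xs)" for R' and h :: "'x => 'x"
  by (rule assms(2)) (simp add: spxD(1)[OF xs])
 then show ?case
  using natural_formD[OF assms(1) R xs] assms(2)[OF spxD(1)[OF xs]] by metis
qed

lemma natural_face:
 assumes nat: "natural_form F U k ww"
  and f: "!!xs. length xs = Suc n ==> set (f xs) <= set xs & length (f xs) = Suc k"
  and fmap: "!!xs h. length xs = Suc n ==> f (map h xs) = map h (f xs)"
 shows "natural_form F U n (%R xs. ww R (f xs))"
 unfolding natural_form_def
proof (intro allI impI, elim conjE, goal_cases)
 case (1 R xs)
 note R = 1(1) and xs = 1(2)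
 note l = spxD(1)[OF xs]
 have ys: "f xs : spx X p U k R" by (rule spx_subset[OF xs]) (use f[OF l] in auto)
 have "bp R (f xs) = bp R xs"
  using spxD(3,6)[OF xs] spxD(6)[OF ys] f[OF l] by blast
 then show ?case
  using natural_formD[OF nat R ys] by (auto simp: fmap[OF l])
qed

end

context value_sheaf
begin

lemma natural_mult:
 assumes U: "stable_open U" and "natural_form F U n al" "natural_form F U n be"
 shows "natural_form F U n (%R xs. al R xs **\<^sub>(grp F R (bp R xs)) be R xs)"
 unfolding natural_form_def
proof (intro allI impI, elim conjE, goal_cases)
 case (1 R xs)
 note R = 1(1) and xs = 1(2)
 note b = spx_base[OF U R xs]
 interpret H: group "grp F R (bp R xs)" by (rule F.grp_group[OF R b(1)])
 note a = natural_formD[OF assms(2) R xs] natural_formD[OF assms(3) R xs]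
 show ?case
  using a by (simp add: b(3,4) F.res_mult[OF R _ _ b(1)])
qed

lemma natural_inv:
 assumes U: "stable_open U" and "natural_form F U n al"
 shows "natural_form F U n (%R xs. inv \<^sub>(grp F R (bp R xs)) al R xs)"
 unfolding natural_form_def
proof (intro allI impI, elim conjE, goal_cases)
 case (1 R xs)
 note R = 1(1) and xs = 1(2)
 note b = spx_base[OF U R xs]
 interpret H: group "grp F R (bp R xs)" by (rule F.grp_group[OF R b(1)])
 note a = natural_formD[OF assms(2) R xs]
 show ?case
  using a by (simp add: b(3,4) F.res_inv[OF R _ _ b(1)])
qed

lemma natural_one:
 assumes U: "stable_open U"
 shows "natural_form F U n (%R xs. \<one>\<^sub>(grp F R (bp R xs)))"
 unfolding natural_form_def
proof (intro allI impI, elim conjE, goal_cases)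
 case (1 R xs)
 note R = 1(1) and xs = 1(2)
 note b = spx_base[OF U R xs]
 interpret H: group "grp F R (bp R xs)" by (rule F.grp_group[OF R b(1)])
 show ?case
  by (simp add: b(3,4) F.res_one[OF R _ _ b(1)])
qed

abbreviation "FX == base_change p F"
abbreviation "Fform U n w == is_form X p FX U n w"

lemma natural_fzero: "stable_open U ==> natural_form F U n (fzero FX)"
 using natural_one by (simp add: fzero_def[abs_def])

lemma natural_fadd: "stable_open U ==> natural_form F U n al ==> natural_form F U n be ==> natural_form F U n (al \<boxplus>\<^bsub>FX\<^esub> be)"
 using natural_mult by (simp add: fadd_def[abs_def])

lemma natural_fneg: "stable_open U ==> natural_form F U n al ==> natural_form F U n (fneg FX al)"
 using natural_inv by (simp add: fneg_def[abs_def])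

lemma natural_fsub: "stable_open U ==> natural_form F U n al ==> natural_form F U n be ==> natural_form F U n (al \<boxminus>\<^bsub>FX\<^esub> be)"
 unfolding fsub_def by (intro natural_fadd natural_fneg)

lemma natural_conj: "stable_open U ==> natural_form F U n u ==> natural_form F U n al ==> natural_form F U n (conj_form FX u al)"
 unfolding conj_form_def by (intro natural_fsub natural_fadd)

lemma natural_at0: "natural_form F U 0 (at0 s) ==> natural_form F U n (at0 s)"
proof -
 assume s: "natural_form F U 0 (at0 s)"
 have "natural_form F U n (%R xs. at0 s R [hd xs])" by (rule natural_face[OF s]) (auto simp: length_Suc_conv)
 then show ?thesis by (simp add: at0_def[abs_def])
qed

lemma natural_vertex:
 "natural_form F U 0 (at0 s) ==> i <= n ==> natural_form F U n (%R xs. s R (xs ! i))"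
 using natural_face[of F U 0 "at0 s" n "%xs. [xs ! i]"] by (auto simp: at0_def[abs_def])

lemma natural_edge:
 "natural_form F U 1 ww ==> i <= n ==> j <= n ==> natural_form F U n (%R xs. ww R [xs ! i, xs ! j])"
 using natural_face[of F U 1 ww n "%xs. [xs ! i, xs ! j]"] by auto

lemma natural_difference:
 assumes U: "stable_open U" and s: "natural_form F U 0 (at0 s)"
 shows "natural_form F U 1 (dg_ginv FX s)" "natural_form F U 1 (u_duinv FX s)"
 using natural_mult[OF U natural_vertex[OF s, of 1] natural_inv[OF U natural_vertex[OF s, of 0]]]
  natural_mult[OF U natural_vertex[OF s, of 0] natural_inv[OF U natural_vertex[OF s, of 1]]]
 by (simp_all add: dg_ginv_def[abs_def] u_duinv_def[abs_def])

lemma natural_d1_aut: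
 assumes U: "stable_open U" and m: "natural_form F U 1 m"
 shows "natural_form F U 2 (d1_aut FX m)"
 using natural_mult[OF U natural_mult[OF U natural_edge[OF m, of 0 2 1] natural_edge[OF m, of 1 2 2]] natural_edge[OF m, of 2 2 0]]
 by (simp add: d1_aut_def[abs_def] Let_def)

lemma natural_de_rham:
 assumes U: "stable_open U" and w: "natural_form F U n ww"
 shows "natural_form F U (Suc n) (de_rham FX ww)"
proof -
 have face: "natural_form F U (Suc n) (%R xs. alternating_factor FX ww R xs i)" if "i <= Suc n" for i
 proof -
  have 1: "natural_form F U (Suc n) (%R xs. ww R (omit i xs))"
   by (rule natural_face[OF w]) (use that in "simp_all add: omit_facts")
  show ?thesis using 1 natural_inv[OF U 1] by (cases "even i") (simp_all add: alternating_factor_def)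
 qed
 have fold: "natural_form F U (Suc n) (%R xs. foldr (%i acc. alternating_factor FX ww R xs i **\<^sub>(grp F R (bp R xs)) acc)
   is \<one>\<^sub>(grp F R (bp R xs)))" if "set is <= {..Suc n}" for "is"
  using that by (induction "is") (simp_all add: natural_one[OF U] natural_mult[OF U face])
 have "natural_form F U (Suc n) (%R xs. foldr (%i acc. alternating_factor FX ww R xs i **\<^sub>(grp F R (bp R xs)) acc)
   [0..<Suc (Suc n)] \<one>\<^sub>(grp F R (bp R xs)))" by (rule fold) auto
 then show ?thesis by (rule natural_form_cong) (simp add: de_rham_def del: upt_Suc)
qed

lemma natural_bracket:
 assumes U: "stable_open U" and a: "natural_form F U m al" and b: "natural_form F U n be"
 shows "natural_form F U (m + n) (bracket FX m al be)"
proof -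
 have 1: "natural_form F U (m + n) (%R xs. al R (take (Suc m) xs))"
  by (rule natural_face[OF a]) (auto simp: take_map dest: in_set_takeD)
 have 2: "natural_form F U (m + n) (%R xs. be R (drop m xs))"
  by (rule natural_face[OF b]) (auto simp: drop_map dest: in_set_dropD)
 show ?thesis
  using natural_mult[OF U natural_mult[OF U natural_mult[OF U 1 2] natural_inv[OF U 1]] natural_inv[OF U 2]]
  by (simp add: bracket_def[abs_def] Let_def)
qed

end

locale form_sheaf = value_sheaf +
 assumes local_eq: "local_eq F"
begin

lemma is_formI:
 assumes U: "stable_open U" and nat: "natural_form F U n ww"
  and deg: "!!R xs. aff_spx U n R xs ==> degenerate xs ==> ww R xs = \<one>\<^sub>(grp F R (bp R xs))"
 shows "Fform U n ww"
 unfolding is_form_iff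
proof (intro conjI nat allI impI; elim conjE)
 fix R xs assume R: "cring R" and xs: "xs : spx X p U n R" and d: "degenerate xs"
 note b = spx_base[OF U R xs]
 interpret H: group "grp F R (bp R xs)" by (rule F.grp_group[OF R b(1)])
 show "ww R xs = \<one>\<^sub>(grp F R (bp R xs))"
 proof (rule local_eqD[OF local_eq U R xs natural_formD(1)[OF nat R xs] H.one_closed])
  fix R' h assume R': "cring R'" "h : rhom R R'" and aff: "aff_spx U n R' (map (pull X R R' h) xs)"
  show "res F R R' h (bp R xs) (ww R xs) = res F R R' h (bp R xs) \<one>\<^sub>(grp F R (bp R xs))"
   using deg[OF aff degenerate_map[OF d]] natural_formD(2)[OF nat R xs R'] b(3,4)[OF R']
   by (simp add: F.res_one[OF R R' b(1)])
 qed
qed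

text \<open>Triviality on degenerate simplices has to be verified for one side only; the other side
  inherits it from the equality.\<close>

lemma eq_formsI:
 assumes U: "stable_open U" and form: "Fform U n al" and nat: "natural_form F U n be"
  and eq: "!!R xs. aff_spx U n R xs ==> al R xs = be R xs"
 shows "eq_forms X p FX U n al be"
proof -
 have e: "al R xs = be R xs" if "cring R" "xs : spx X p U n R" for R xs
  by (rule natural_eq[OF local_eq U is_formD(1)[OF form] nat eq that])
 have "Fform U n be" using form nat e unfolding is_form_iff by metis
 then show ?thesis using form e unfolding eq_forms_def by blast
qed

lemma eq_forms_sym: "eq_forms X p FX U n al be ==> eq_forms X p FX U n be al"
 by (simp add: eq_forms_def)

lemma edge_swap:
 assumes "stable_open U" "Fform U 1 ww" "aff_spx U 1 R [x, y]"
 shows "ww R [y, x] = inv \<^sub>(grp F R (p R x)) ww R [x, y]"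
 using form_swap[OF assms(1,2), of R "[]" x y "[]"] assms(3) by simp

lemma degenerate_value:
 assumes "Fform U k ww" "aff_spx U n R xs" "set ys <= set xs" "length ys = Suc k" "degenerate ys"
 shows "ww R ys = \<one>\<^sub>(grp F R (bp R xs))"
proof -
 note ysa = aff_spx_subset[OF assms(2-4)]
 note ysD = aff_spxD[OF ysa] note xsD = aff_spxD[OF assms(2)]
 have "bp R ys = bp R xs"
  using spxD(3,6)[OF xsD(2)] spxD(6)[OF ysD(2)] assms(3) by blast
 then show ?thesis using is_formD(2)[OF assms(1) ysD(1,2) assms(5)] by simp
qed

lemma form_fneg:
 assumes U: "stable_open U" and a: "Fform U n al"
 shows "Fform U n (fneg FX al)"
proof (rule is_formI[OF U natural_fneg[OF U is_formD(1)[OF a]]], goal_cases)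
 case (1 R xs)
 note xs = 1
 note xsD = aff_spxD[OF xs(1)]
 interpret H: group "grp F R (bp R xs)" by (rule F.grp_group[OF xsD(1) spx_base(1)[OF U xsD(1,2)]])
 show ?case using is_formD(2)[OF a xsD(1,2) xs(2)] by (simp add: fneg_def)
qed

lemma form_fadd:
 assumes U: "stable_open U" and a: "Fform U n al" "Fform U n be"
 shows "Fform U n (al \<boxplus>\<^bsub>FX\<^esub> be)"
proof (rule is_formI[OF U natural_fadd[OF U is_formD(1)[OF a(1)] is_formD(1)[OF a(2)]]], goal_cases)
 case (1 R xs)
 note xs = 1
 note xsD = aff_spxD[OF xs(1)]
 interpret H: group "grp F R (bp R xs)" by (rule F.grp_group[OF xsD(1) spx_base(1)[OF U xsD(1,2)]])
 show ?case
  using is_formD(2)[OF a(1) xsD(1,2) xs(2)] is_formD(2)[OF a(2) xsD(1,2) xs(2)] by (simp add: fadd_def)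
qed

lemma form_fsub:
 "stable_open U ==> Fform U n al ==> Fform U n be ==> Fform U n (al \<boxminus>\<^bsub>FX\<^esub> be)"
 unfolding fsub_def by (intro form_fadd form_fneg)

lemma form_conj:
 assumes U: "stable_open U" and u: "natural_form F U n u" and a: "Fform U n al"
 shows "Fform U n (conj_form FX u al)"
proof (rule is_formI[OF U natural_conj[OF U u is_formD(1)[OF a]]], goal_cases)
 case (1 R xs)
 note xs = 1
 note xsD = aff_spxD[OF xs(1)]
 interpret H: group "grp F R (bp R xs)" by (rule F.grp_group[OF xsD(1) spx_base(1)[OF U xsD(1,2)]])
 show ?case
  using is_formD(2)[OF a xsD(1,2) xs(2)] natural_formD(1)[OF u xsD(1,2)]
  by (simp add: conj_form_def fsub_def fneg_def fadd_def)
qed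

lemma form_difference:
 assumes U: "stable_open U" and s: "natural_form F U 0 (at0 s)"
 shows "Fform U 1 (dg_ginv FX s)" "Fform U 1 (u_duinv FX s)"
proof -
 have "dg_ginv FX s R xs = \<one>\<^sub>(grp F R (bp R xs)) & u_duinv FX s R xs = \<one>\<^sub>(grp F R (bp R xs))"
  if xs: "aff_spx U 1 R xs" "degenerate xs" for R xs
 proof -
  note xsD = aff_spxD[OF xs(1)]
  interpret H: group "grp F R (bp R xs)" by (rule F.grp_group[OF xsD(1) spx_base(1)[OF U xsD(1,2)]])
  obtain x where x: "xs = [x, x]"
   using spxD(1)[OF xsD(2)] xs(2) by (auto simp: length_simps degenerate_Cons)
  have "s R x : carrier (grp F R (bp R xs))"
   using natural_formD(1)[OF natural_at0[OF s] xsD(1,2)] by (simp add: at0_def x)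
  then show ?thesis using H.r_inv by (simp add: dg_ginv_def u_duinv_def x)
 qed
 note one = this
 show "Fform U 1 (dg_ginv FX s)" "Fform U 1 (u_duinv FX s)"
  by (rule is_formI[OF U natural_difference(1)[OF U s]], use one in blast, rule is_formI[OF U natural_difference(2)[OF U s]], use one in blast)
qed

lemma form_d1_aut:
 assumes U: "stable_open U" and m: "Fform U 1 m"
 shows "Fform U 2 (d1_aut FX m)"
proof (rule is_formI[OF U natural_d1_aut[OF U is_formD(1)[OF m]]], goal_cases)
 case (1 R xs)
 note xs = 1
 note xsD = aff_spxD[OF xs(1)]
 interpret H: group "grp F R (bp R xs)" by (rule F.grp_group[OF xsD(1) spx_base(1)[OF U xsD(1,2)]])
 obtain x y z where x: "xs = [x, y, z]" "x = y | y = z"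
  using spxD(1)[OF xsD(2)] xs(2) by (auto simp: length_simps degenerate_Cons)
 have a: "aff_spx U 1 R [x, z]" by (rule aff_spx_subset[OF xs(1)]) (auto simp: x)
 note aD = aff_spxD[OF a]
 have c: "m R [x, z] : carrier (grp F R (p R x))" using natural_formD(1)[OF is_formD(1)[OF m] aD(1,2)] by simp
 have one: "m R [v, v] = \<one>\<^sub>(grp F R (p R x))" if "v : {x, z}" for v
  using degenerate_value[OF m xs(1), of "[v, v]"] that by (auto simp: x degenerate_Cons)
 \<comment> \<open>In both degenerate cases the two edges between \<open>x\<close> and
   \<open>z\<close> remain, in opposite orientation, and cancel by \<open>edge_swap\<close>.\<close>
 show ?case
  using x(2) c one[of x] one[of z] H.r_inv H.l_one H.r_one edge_swap[OF U m a] by (auto simp: d1_aut_def Let_def x(1))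
qed

lemma form_bracket:
 assumes U: "stable_open U" and a: "Fform U m al" and b: "Fform U n be"
 shows "Fform U (m + n) (bracket FX m al be)"
proof (rule is_formI[OF U natural_bracket[OF U is_formD(1)[OF a] is_formD(1)[OF b]]], goal_cases)
 case (1 R xs)
 note xs = 1
 note xsD = aff_spxD[OF xs(1)] note len = spxD(1)[OF xsD(2)]
 interpret H: group "grp F R (bp R xs)" by (rule F.grp_group[OF xsD(1) spx_base(1)[OF U xsD(1,2)]])
 have "natural_form F U (m + n) (%R xs. al R (take (Suc m) xs))" "natural_form F U (m + n) (%R xs. be R (drop m xs))"
  by (auto intro!: natural_face[OF is_formD(1)[OF a]] natural_face[OF is_formD(1)[OF b]]
    simp: take_map drop_map dest: in_set_takeD in_set_dropD)
 note c = natural_formD(1)[OF this(1) xsD(1,2)] natural_formD(1)[OF this(2) xsD(1,2)]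
 have "al R (take (Suc m) xs) = \<one>\<^sub>(grp F R (bp R xs)) | be R (drop m xs) = \<one>\<^sub>(grp F R (bp R xs))"
  using degenerate_split[OF xs(2), of m] degenerate_value[OF a xs(1) set_take_subset[of "Suc m"]]
   degenerate_value[OF b xs(1) set_drop_subset[of m]] len by auto
 then show ?case
  using c by (auto simp: bracket_def Let_def)
qed

end

context form_space
begin

sublocale VG: form_sheaf S G X p G
 by unfold_locales (rule vanishes_G local_eq_G)+

sublocale VA: form_sheaf S G X p "Aut_sheaf S G"
 by unfold_locales (rule vanishes_Aut local_eq_Aut)+

abbreviation "GX == base_change p G"
abbreviation "AX == base_change p (Aut_sheaf S G)"
abbreviation "Gform U n w == is_form X p GX U n w"
abbreviation "Aform U n w == is_form X p AX U n w"
abbreviation "Anat U n w == natural_form (Aut_sheaf S G) U n w"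

lemma natural_act:
 assumes U: "stable_open U" and u: "Anat U n u" and w: "natural_form G U n ww"
 shows "natural_form G U n (act_form u ww)"
 unfolding natural_form_def
proof (intro allI impI, elim conjE, goal_cases)
 case (1 R xs)
 note R = 1(1) and xs = 1(2)
 note b = spx_base[OF U R xs]
 note a = natural_formD[OF u R xs] natural_formD[OF w R xs]
 show ?case
  using a by (simp add: act_form_def aut_app_closed[OF R b(1)] aut_app_natural[OF R _ _ b(1)])
qed

lemma natural_inner:
 assumes U: "stable_open U" and w: "natural_form G U n ww"
 shows "Anat U n (inner_form S p G ww)"
 unfolding natural_form_def
proof (intro allI impI, elim conjE, goal_cases)
 case (1 R xs)
 note R = 1(1) and xs = 1(2)
 note b = spx_base[OF U R xs]
 note a = natural_formD[OF w R xs]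
 show ?case
  using a by (simp add: inner_form_def inner_closed[OF R b(1)] inner_res[OF R _ _ b(1)] b(3,4))
qed

lemma natural_aut_bracket:
 assumes U: "stable_open U" and u: "Anat U m u" and w: "natural_form G U n ww"
 shows "natural_form G U (m + n) (aut_bracket GX m u ww)"
proof -
 have 1: "Anat U (m + n) (%R xs. u R (take (Suc m) xs))"
  by (rule natural_face[OF u]) (auto simp: take_map dest: in_set_takeD)
 have 2: "natural_form G U (m + n) (%R xs. ww R (drop m xs))"
  by (rule natural_face[OF w]) (auto simp: drop_map dest: in_set_dropD)
 show ?thesis
  using VG.natural_mult[OF U natural_act[OF U 1 2] VG.natural_inv[OF U 2]]
  by (simp add: aut_bracket_def[abs_def] act_form_def[abs_def] Let_def)
qed

lemma natural_d1_twisted: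
 assumes U: "stable_open U" and m: "Anat U 1 m" and w: "natural_form G U 1 ww"
 shows "natural_form G U 2 (d1_twisted GX m ww)"
 using VG.natural_mult[OF U VG.natural_mult[OF U VG.natural_edge[OF w, of 0 2 1]
   natural_act[OF U VA.natural_edge[OF m, of 0 2 1] VG.natural_edge[OF w, of 1 2 2]]] VG.natural_inv[OF U VG.natural_edge[OF w, of 0 2 2]]]
 by (simp add: d1_twisted_def[abs_def] act_form_def[abs_def] Let_def)

lemma natural_d_twisted:
 assumes U: "stable_open U" and m: "Anat U 1 m" and w: "natural_form G U n ww"
 shows "natural_form G U (Suc n) (d_twisted GX m ww)"
 unfolding d_twisted_def
 using VG.natural_fadd[OF U VG.natural_de_rham[OF U w]] natural_aut_bracket[OF U m w] by simp

lemma natural_d2_aut: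
 assumes U: "stable_open U" and m: "Anat U 1 m" and w: "Anat U 2 nu"
 shows "Anat U 3 (d2_aut AX m nu)"
 unfolding d2_aut_def
 using VA.natural_fadd[OF U VA.natural_de_rham[OF U w]] VA.natural_bracket[OF U m w] by (simp add: numeral_3_eq_3 numeral_2_eq_2)

lemma form_act:
 assumes U: "stable_open U" and u: "Anat U n u" and w: "Gform U n ww"
 shows "Gform U n (act_form u ww)"
proof (rule VG.is_formI[OF U natural_act[OF U u is_formD(1)[OF w]]], goal_cases)
 case (1 R xs)
 note xs = 1
 note xsD = aff_spxD[OF xs(1)] note b = spx_base(1)[OF U xsD(1,2)]
 show ?case using is_formD(2)[OF w xsD(1,2) xs(2)] aut_app_hom_one[OF xsD(1) b natural_formD(1)[OF u xsD(1,2)]]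
  by (simp add: act_form_def)
qed

lemma form_inner:
 assumes U: "stable_open U" and w: "Gform U n ww"
 shows "Aform U n (inner_form S p G ww)"
proof (rule VA.is_formI[OF U natural_inner[OF U is_formD(1)[OF w]]], goal_cases)
 case (1 R xs)
 note xs = 1
 note xsD = aff_spxD[OF xs(1)] note b = spx_base(1)[OF U xsD(1,2)]
 show ?case using is_formD(2)[OF w xsD(1,2) xs(2)] by (simp add: inner_form_def inner_one[OF xsD(1) b])
qed

lemma form_aut_bracket:
 assumes U: "stable_open U" and u: "Aform U m u" and w: "Gform U n ww"
 shows "Gform U (m + n) (aut_bracket GX m u ww)"
proof (rule VG.is_formI[OF U natural_aut_bracket[OF U is_formD(1)[OF u] is_formD(1)[OF w]]], goal_cases)
 case (1 R xs)
 note xs = 1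
 note xsD = aff_spxD[OF xs(1)] note len = spxD(1)[OF xsD(2)] note b = spx_base(1)[OF U xsD(1,2)]
 interpret H: group "grp G R (bp R xs)" by (rule grp_group[OF xsD(1) b])
 have "Anat U (m + n) (%R xs. u R (take (Suc m) xs))" "natural_form G U (m + n) (%R xs. ww R (drop m xs))"
  by (auto intro!: natural_face[OF is_formD(1)[OF u]] natural_face[OF is_formD(1)[OF w]]
    simp: take_map drop_map dest: in_set_takeD in_set_dropD)
 note c = natural_formD(1)[OF this(1) xsD(1,2)] natural_formD(1)[OF this(2) xsD(1,2)]
 have "u R (take (Suc m) xs) = \<one>\<^sub>(AG R (bp R xs)) | ww R (drop m xs) = \<one>\<^sub>(grp G R (bp R xs))"
  using degenerate_split[OF xs(2), of m] VA.degenerate_value[OF u xs(1) set_take_subset[of "Suc m"]]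
   VG.degenerate_value[OF w xs(1) set_drop_subset[of m]] len by auto
 then show ?case
  using c aut_app_one[OF xsD(1) b c(2)] aut_app_hom_one[OF xsD(1) b c(1)] by (auto simp: aut_bracket_def Let_def)
qed

end

section \<open>Calculus on affine simplices\<close>

context group_scheme
begin

lemma act_congr_closed:
 assumes R: "cring R" and s: "s : pts S R" and u: "u : AC R s" and g: "g : congr R s K"
 shows "aut_app R u g : congr R s K"
proof (rule congrI)
 show "aut_app R u g : GC R s" by (rule aut_app_closed[OF R s u congrD(1)[OF g]])
 fix Q q assume Q: "cring Q" "q : rhom R Q" "!!k. k : K ==> q k = \<zero>\<^sub>Q"
 have e: "res G R Q q s g = \<one>\<^sub>(grp G Q (pull S R Q q s))" by (rule congrD(2)[OF g Q])
 show "res G R Q q s (aut_app R u g) = \<one>\<^sub>(grp G Q (pull S R Q q s))"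
  unfolding aut_app_natural[OF R Q(1,2) s u congrD(1)[OF g]] e
  by (rule aut_app_hom_one[OF Q(1) S.pull_closed[OF R Q(1,2) s] Aut.res_closed[OF R Q(1,2) s u]])
qed

lemma filtered_action_congr:
 assumes R: "cring R" and s: "good R s" and J: "J <= carrier R" "pw R J c <= {\<zero>\<^sub>R}"
 shows "filtered_action (grp G R s) (AG R s) (aut_app R) (inn R s)
  (%k. congr R s (pw R J k)) (%k. Aut.congr R s (pw R J k)) c"
proof -
 note sp = good_pts[OF R s] and pc = pw_carrier[OF R J(1)]
 interpret Rc: cring R by (rule R)
 have Suc: "q k = \<zero>\<^sub>Q" if "cring Q" "q : rhom R Q" "!!k'. k' : pw R J n ==> q k' = \<zero>\<^sub>Q" "k : pw R J (Suc n)" for Q q k n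
 proof -
  note h = that
  obtain j w where "k = j **\<^sub>R w" "j : J" "w : pw R J n" using h(4) by auto
  then show ?thesis
   using rhom_mult[OF h(2), of j w] rhom_closed[OF h(2), of j] h(3)[of w] J(1) pc[of n] h(1)
   by (auto simp: cring.cring_simprules subset_iff)
 qed
 note nil = pw_pw_zero[OF R J] and add = pw_add[OF R J(1)]
 show ?thesis
 proof (intro filtered_action.intro filtered_action_axioms.intro)
  show "group (grp G R s)" "group (AG R s)" by (rule grp_group[OF R sp], rule Aut.grp_group[OF R sp])
  show "congr R s (pw R J k) \<lhd> grp G R s" "Aut.congr R s (pw R J k) \<lhd> AG R s" for k
   by (rule congr_normal[OF R sp], rule Aut.congr_normal[OF R sp])
  show "congr R s (pw R J (Suc k)) <= congr R s (pw R J k)"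
   "Aut.congr R s (pw R J (Suc k)) <= Aut.congr R s (pw R J k)" for k
   by (rule congr_mono, rule Suc, assumption+, rule Aut.congr_mono, rule Suc, assumption+)
  show "congr R s (pw R J c) <= {\<one>\<^sub>(grp G R s)}" "Aut.congr R s (pw R J c) <= {\<one>\<^sub>(AG R s)}"
   using congr_trivial[OF R sp J(2)] Aut.congr_trivial[OF R sp J(2)] by blast+
  show "aut_app R u g **\<^sub>(grp G R s) inv \<^sub>(grp G R s) g : congr R s (pw R J (j + k))"
   if "0 < j" "0 < k" "u : Aut.congr R s (pw R J j)" "g : congr R s (pw R J k)" for u g j k
   by (rule act_congr[OF R s pc pc nil[OF that(2)] add that(3,4)])
  show "u **\<^sub>(AG R s) w **\<^sub>(AG R s) inv \<^sub>(AG R s) u **\<^sub>(AG R s) inv \<^sub>(AG R s) w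
    : Aut.congr R s (pw R J (j + k))"
   if "0 < j" "0 < k" "u : Aut.congr R s (pw R J j)" "w : Aut.congr R s (pw R J k)" for u w j k
   by (rule Aut_commutator[OF R s pc nil[OF that(1)] pc nil[OF that(2)] add that(3,4)])
 qed (simp_all add: aut_app_closed[OF R sp] aut_app_mult[OF R sp] aut_app_comp[OF R sp] aut_app_one[OF R sp] inner_closed[OF R sp]
   inner_mult[OF R sp] inner_aut_app[OF R sp] inner_conj[OF R sp] act_congr_closed[OF R sp] inner_congr[OF R sp])
qed

end

text \<open>All faces of the simplex have the same base point \<open>s\<close>, so the values of
  forms on them lie in one pair of groups with common filtrations, indexed by powers of the ideal of
  the whole simplex.\<close>

locale simplex_calculus = form_space +
 fixes U n R xs s J
 assumes U: "stable_open U" and xs: "aff_spx U n R xs" and s: "s = p R (hd xs)"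
  and J: "J <= carrier R" "pw R J (Suc n) <= {\<zero>\<^sub>R}"
  and ag: "!!x y. x : set xs ==> y : set xs ==> agree_mod X R J x y"
begin

abbreviation "H == grp G R s"
abbreviation "A == AG R s"
abbreviation "N k == congr R s (pw R J k)"
abbreviation "M k == Aut.congr R s (pw R J k)"

lemma R: "cring R" and simplex: "xs : spx X p U n R" and good: "good R s"
 using aff_spxD[OF xs] by (simp_all add: s)

lemma base: "s : pts S R" by (rule good_pts[OF R good])

sublocale C: filtered_action H A "aut_app R" "inn R s" N M "Suc n"
 by (rule filtered_action_congr[OF R good J])

lemma face: "set ys <= set xs ==> length ys = Suc k ==> aff_spx U k R ys & bp R ys = s"
proof -
 assume a: "set ys <= set xs" "length ys = Suc k"
 have y: "aff_spx U k R ys" by (rule aff_spx_subset[OF xs a])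
 then show ?thesis
  using spxD(3,6)[OF simplex] spxD(6)[OF aff_spxD(2)[OF y]] a(1) unfolding s by blast
qed

lemma natural_value:
 assumes "natural_form F U k ww" "set ys <= set xs" "length ys = Suc k"
 shows "ww R ys : carrier (grp F R s)"
 using natural_formD(1)[OF assms(1) R] face[OF assms(2,3)] aff_spxD(2) by metis

lemma G_value:
 assumes "Gform U k ww" "0 < k" "set ys <= set xs" "length ys = Suc k"
 shows "ww R ys : N k"
proof -
 note f = face[OF assms(3,4)]
 have a: "agree_mod X R J x y" if "x : set ys" "y : set ys" for x y by (rule ag) (use that assms(3) in auto)
 show ?thesis using VG.form_congr[OF U assms(1,2) conjunct1[OF f] J(1) a] f by simp
qed

lemma A_value:
 assumes "Aform U k ww" "0 < k" "set ys <= set xs" "length ys = Suc k"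
 shows "ww R ys : M k"
proof -
 note f = face[OF assms(3,4)]
 have a: "agree_mod X R J x y" if "x : set ys" "y : set ys" for x y by (rule ag) (use that assms(3) in auto)
 show ?thesis using VA.form_congr[OF U assms(1,2) conjunct1[OF f] J(1) a] f by simp
qed

text \<open>The definition closes the triangle by the reversed edge; the sign rule replaces it by an
  inverse, the form used in the group calculus.\<close>

lemma d1_aut_value:
 assumes m: "Aform U 1 m" and v: "{a, b, c} <= set xs"
 shows "d1_aut AX m R [a, b, c] = m R [a, b] **\<^sub>A m R [b, c]
  **\<^sub>A inv \<^sub>A m R [a, c]"
proof -
 have "aff_spx U 1 R [a, c] & p R (hd [a, c]) = s" by (rule face) (use v in auto)
 then have "p R a = s" "m R [c, a] = inv \<^sub>(AG R (p R a)) m R [a, c]"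
  using VA.edge_swap[OF U m] by auto
 then show ?thesis by (simp add: d1_aut_def Let_def)
qed

lemma swap:
 assumes w: "Gform U k ww" and ys: "set (pre @ x # y # post) <= set xs" "length (pre @ x # y # post) = Suc k"
 shows "ww R (pre @ y # x # post) = inv \<^sub>H ww R (pre @ x # y # post)"
  and "ww R (pre @ x # y # post) = inv \<^sub>H ww R (pre @ y # x # post)"
proof -
 have "p R (hd [x]) = s" using face[of "[x]" 0] ys(1) by simp
 then show 1: "ww R (pre @ y # x # post) = inv \<^sub>H ww R (pre @ x # y # post)"
  using VG.form_swap[OF U w] face[OF ys] by simp
 have "ww R (pre @ x # y # post) : carrier H" by (rule natural_value[OF is_formD(1)[OF w] ys])
 then show "ww R (pre @ x # y # post) = inv \<^sub>H ww R (pre @ y # x # post)" unfolding 1 by simp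
qed

text \<open>Reversing 3, 4 or 5 vertices takes 3, 6 or 10 adjacent transpositions, hence the signs.
  Each proof lists such a chain.\<close>

lemma reversal:
 shows "Gform U 2 ww ==> {a, b, c} <= set xs ==> ww R [c, b, a] = inv \<^sub>H ww R [a, b, c]"
  and "Gform U 3 ww ==> {a, b, c, d} <= set xs ==> ww R [d, c, b, a] = ww R [a, b, c, d]"
  and "Gform U 4 ww ==> {a, b, c, d, e} <= set xs ==> ww R [e, d, c, b, a] = ww R [a, b, c, d, e]"
proof -
 {
  assume w: "Gform U 2 ww" and x: "{a, b, c} <= set xs"
  note s = swap[OF w]
  show "ww R [c, b, a] = inv \<^sub>H ww R [a, b, c]"
   using s(1)[of "[]" b c "[a]"] s(2)[of "[b]" a c "[]"] s(1)[of "[]" a b "[c]"] x by simp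
 next
  assume w: "Gform U 3 ww" and x: "{a, b, c, d} <= set xs"
  note s = swap[OF w]
  show "ww R [d, c, b, a] = ww R [a, b, c, d]"
   using s(2)[of "[]" a b "[c, d]"] s(1)[of "[b]" a c "[d]"] s(2)[of "[b, c]" a d "[]"] s(1)[of "[]" b c "[d, a]"]
    s(2)[of "[c]" b d "[a]"] s(1)[of "[]" c d "[b, a]"] x by simp
 next
  assume w: "Gform U 4 ww" and x: "{a, b, c, d, e} <= set xs"
  note s = swap[OF w]
  show "ww R [e, d, c, b, a] = ww R [a, b, c, d, e]"
   using s(2)[of "[]" a b "[c, d, e]"] s(1)[of "[b]" a c "[d, e]"] s(2)[of "[b, c]" a d "[e]"] s(1)[of "[b, c, d]" a e "[]"]
    s(2)[of "[]" b c "[d, e, a]"] s(1)[of "[c]" b d "[e, a]"] s(2)[of "[c, d]" b e "[a]"]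
    s(1)[of "[]" c d "[e, b, a]"] s(2)[of "[d]" c e "[b, a]"] s(1)[of "[]" d e "[c, b, a]"] x by simp
 }
qed

lemma edge_reversal: "Gform U 1 ww ==> {a, b} <= set xs ==> ww R [b, a] = inv \<^sub>H ww R [a, b]"
 using swap(1)[of 1 ww "[]" a b "[]"] by simp

lemma bracket_value:
 assumes "v : set xs" "length (v # ys) = Suc m"
 shows "bracket GX m al be R (v # ys @ zs) = C.com (al R (v # ys)) (be R (last (v # ys) # zs))"
proof -
 have v: "p R v = s" using face[of "[v]" 0] assms(1) by simp
 have "drop m (v # ys @ zs) = last (v # ys) # zs" using assms(2) by (cases "ys" rule: rev_cases) auto
 then show ?thesis using assms(2) by (simp add: bracket_def Let_def C.com_def v)
qed

text \<open>Reversal is even for the bracket on four vertices, but odd for each factor, and it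
  exchanges the positions of the factors. Multiplicativity of the commutator cancels the two
  signs.\<close>

lemma com_reversal:
 assumes n: "n <= 3" and b: "Gform U 2 be" and a: "Gform U 1 al" and x: "{w, x, y, z} <= set xs"
 shows "C.com (be R [w, x, y]) (al R [y, z]) **\<^sub>H C.com (al R [w, x]) (be R [x, y, z])
  = \<one>\<^sub>H"
proof -
 have f: "Gform U 3 (bracket GX 2 be al)" using VG.form_bracket[OF U b a] by (simp add: numeral_3_eq_3 numeral_2_eq_2)
 have av: "al R [w, x] : N 1" by (rule G_value[OF a]) (use x in auto)
 have bv: "be R [x, y, z] : N 2" by (rule G_value[OF b]) (use x in auto)
 have "C.com (be R [w, x, y]) (al R [y, z]) = C.com (be R [z, y, x]) (al R [x, w])"
  using reversal(2)[OF f, of z y x w] bracket_value[of w "[x, y]" 2 be al "[z]"] bracket_value[of z "[y, x]" 2 be al "[w]"] x by auto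
 also have "... = C.com (inv \<^sub>H be R [x, y, z]) (inv \<^sub>H al R [w, x])"
  using reversal(1)[OF b, of x y z] edge_reversal[OF a, of w x] x by auto
 also have "... = inv \<^sub>H C.com (be R [x, y, z]) (inv \<^sub>H al R [w, x])"
  by (rule C.com_inv_left[OF bv C.N_inv[OF av]]) (use n in auto)
 also have "... = C.com (be R [x, y, z]) (al R [w, x])"
  using C.com_inv_right[OF bv av] n C.N_mem[OF av] C.N_mem[OF bv] by (simp add: C.com_def)
 finally show ?thesis
  using C.com_inv_eq[OF C.N_mem[OF bv] C.N_mem[OF av], symmetric] C.N_mem[OF av] C.N_mem[OF bv] by (simp add: C.com_def)
qed

text \<open>Reversal is even on five vertices and odd on each factor, so the bracket equals the
  commutator of the same values in the opposite order, which is its inverse.\<close>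

lemma bracket_square:
 assumes n: "n <= 4" and b: "Gform U 2 be" and x: "{v, w, x, y, z} <= set xs"
 shows "C.com (be R [v, w, x]) (be R [x, y, z]) **\<^sub>H C.com (be R [v, w, x]) (be R [x, y, z])
  = \<one>\<^sub>H"
proof -
 have f: "Gform U 4 (bracket GX 2 be be)" using VG.form_bracket[OF U b b] by simp
 have bv: "be R [v, w, x] : N 2" "be R [x, y, z] : N 2"
  by (rule G_value[OF b]; use x in auto)+
 have "C.com (be R [v, w, x]) (be R [x, y, z]) = C.com (be R [z, y, x]) (be R [x, w, v])"
  using reversal(3)[OF f, of z y x w v] bracket_value[of v "[w, x]" 2 be be "[y, z]"] bracket_value[of z "[y, x]" 2 be be "[w, v]"] x by auto
 also have "... = C.com (inv \<^sub>H be R [x, y, z]) (inv \<^sub>H be R [v, w, x])"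
  using reversal(1)[OF b, of x y z] reversal(1)[OF b, of v w x] x by auto
 also have "... = inv \<^sub>H C.com (be R [x, y, z]) (inv \<^sub>H be R [v, w, x])"
  by (rule C.com_inv_left[OF bv(2) C.N_inv[OF bv(1)]]) (use n in auto)
 also have "... = C.com (be R [x, y, z]) (be R [v, w, x])"
  using C.com_inv_right[OF bv(2,1)] n bv(1,2)[THEN C.N_mem] by (simp add: C.com_def)
 also have "... = inv \<^sub>H C.com (be R [v, w, x]) (be R [x, y, z])"
  by (rule C.com_inv_eq[symmetric, OF bv(1,2)[THEN C.N_mem]])
 finally have e: "C.com (be R [v, w, x]) (be R [x, y, z]) = inv \<^sub>H C.com (be R [v, w, x]) (be R [x, y, z])" .
 have "C.com (be R [v, w, x]) (be R [x, y, z]) : carrier H"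
  using bv(1,2)[THEN C.N_mem] by (simp add: C.com_def)
 then show ?thesis using C.H.r_inv e by metis
qed

end

section \<open>Vanishing of the bracket of a 2-form with itself\<close>

context form_space
begin

lemma simplex_calculus:
 assumes U: "stable_open U" and xs: "aff_spx U n R xs"
 obtains J where "simplex_calculus S G X p U n R xs (bp R xs) J"
proof -
 obtain J where "J <= carrier R" "pw R J (Suc n) <= {\<zero>\<^sub>R}"
  "!!x y. x : set xs ==> y : set xs ==> agree_mod X R J x y"
  using simplex_ideal[OF U aff_spxD(1,2)[OF xs]] by blast
 then show thesis using that form_space_axioms U xs
  unfolding simplex_calculus_def simplex_calculus_axioms_def by blast
qed

text \<open>The bracket of a \<open>2\<close>-form with itself is symmetric, hence killed by \<open>2\<close>.\<close>

lemma curvature_commute: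
 assumes two: "invertible_on 2 S" and U: "stable_open U" and b: "Gform U 2 be"
  and xs: "aff_spx U 4 R [v, w, x, y, z]"
 shows "be R [v, w, x] **\<^sub>(grp G R (p R v)) be R [x, y, z] = be R [x, y, z] **\<^sub>(grp G R (p R v)) be R [v, w, x]"
proof -
 let ?xs = "[v, w, x, y, z]" and ?f = "bracket GX 2 be be"
 note xsD = aff_spxD[OF xs] note sD = spxD[OF xsD(2)] note R = xsD(1)
 note base = spx_base(1)[OF U xsD(1,2)]
 have f: "Gform U 4 ?f" using VG.form_bracket[OF U b b] by simp
 note nf = is_formD(1)[OF f]
 have yz: "y : pts X R" "z : pts X R" using sD(2) stable_openD(1)[OF U R] by auto
 obtain J where J: "J <= carrier R" "!!i j. i : J ==> j : J ==> i **\<^sub>R j = \<zero>\<^sub>R" "agree_mod X R J y z"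
  using iffD1[OF close_iff[OF R yz] sD(4)[of y z]] by auto
 interpret Rc: cring R by (rule R)
 obtain T p1 p2 where sq: "fibre_square R (Idl \<^sub>R J) T p1 p2"
  using ex_fibre_square[OF infinite_universe R Rc.genideal_ideal[OF J(1)]] by blast
 interpret sq: fibre_square R "Idl \<^sub>R J" T p1 p2 by (rule sq)
 \<comment> \<open>Division by 2 is available for points over a fibre square with trivial first
   projection. Doubling the last vertex into the pair \<open>(y, z)\<close> produces such a point:
   its first projection is degenerate and its second is the given value.\<close>
 obtain zs where zs: "aff_spx U 4 T zs" "map (pull X T R p1) zs = ?xs[4 := ?xs ! 3]"
  "map (pull X T R p2) zs = ?xs" "bp T zs = pull S R T sq.diag (bp R ?xs)"
  by (rule vertex_pair[OF U xs J(1) sq, of 3 4]) (use J(3) in simp_all)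
 note zsD = aff_spxD[OF zs(1)] note zb = spx_base[OF U zsD(1,2)]
 have p12: "p1 : rhom T R" "p2 : rhom T R" by (rule sq.p1, rule sq.p2)
 have g: "?f T zs : GC T (bp T zs)" by (rule natural_formD(1)[OF nf zsD(1,2)])
 have "?f T zs **\<^sub>(grp G T (bp T zs)) ?f T zs = \<one>\<^sub>(grp G T (bp T zs))"
 proof -
  obtain K where "simplex_calculus S G X p U 4 T zs (bp T zs) K" by (rule simplex_calculus[OF U zs(1)])
  then interpret sc: simplex_calculus S G X p U 4 T zs "bp T zs" K .
  obtain a b c d e where ab: "zs = [a, b, c, d, e]" using spxD(1)[OF zsD(2)] by (auto simp: length_simps)
  show ?thesis using sc.bracket_square[OF _ assms(3), of a b c d e] sc.bracket_value[of a "[b, c]" 2 be be "[d, e]"] by (simp add: ab)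
 qed
 note sqr = this
 have one: "?f T zs = \<one>\<^sub>(grp G T (bp T zs))"
 proof (rule no_two_torsion[OF sq xsD(3) _ _ zs(4) g _ sqr])
  show "i **\<^sub>R j = \<zero>\<^sub>R" if "i : Idl \<^sub>R J" "j : Idl \<^sub>R J" for i j
   by (rule Idl_square_zero[OF R J(1,2) that])
  have "[(2::nat)] \<cdot>\<^sub>R \<one>\<^sub>R : Units R" using two R base unfolding invertible_on_def by blast
  then show "\<one>\<^sub>R \<oplus>\<^sub>R \<one>\<^sub>R : Units R" by (simp add: numeral_2_eq_2)
  have m: "map (pull X T R p1) zs : spx X p U 4 R" by (rule simplex_pull[OF U zsD(1) R p12(1) zsD(2)])
  have "degenerate (map (pull X T R p1) zs)" unfolding zs(2) by (intro degenerateI[of 3]) simp_all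
  then have "?f R (map (pull X T R p1) zs) = \<one>\<^sub>(grp G R (bp R (map (pull X T R p1) zs)))"
   by (rule is_formD(2)[OF f R m])
  then show "res G T R p1 (bp T zs) (?f T zs) = \<one>\<^sub>(grp G R (bp R ?xs))"
   using natural_formD(2)[OF nf zsD(1,2) R p12(1)] zs(2) by simp
 qed
 have pv: "pull S T R p2 (bp T zs) = p R v" using zb(3,4)[OF R p12(2)] zs(3) by simp
 have "?f R ?xs = res G T R p2 (bp T zs) (?f T zs)"
  using natural_formD(2)[OF nf zsD(1,2) R p12(2)] zs(3) by simp
 then have f1: "?f R ?xs = \<one>\<^sub>(grp G R (p R v))" using res_one[OF zsD(1) R p12(2) zb(1)] one pv by simp
 obtain K where "simplex_calculus S G X p U 4 R ?xs (p R v) K" using simplex_calculus[OF U xs] by auto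
 then interpret sc: simplex_calculus S G X p U 4 R ?xs "p R v" K .
 have bv: "be R [v, w, x] : carrier sc.H" "be R [x, y, z] : carrier sc.H"
  by (rule sc.natural_value[OF is_formD(1)[OF b]]; simp)+
 have "sc.C.com (be R [v, w, x]) (be R [x, y, z]) = \<one>\<^sub>sc.H"
  using f1 sc.bracket_value[of v "[w, x]" 2 be be "[y, z]"] by simp
 then show ?thesis using sc.C.com_swap[OF bv] bv sc.C.H.l_one sc.C.H.m_closed[OF bv(2,1)] by simp
qed

end

text \<open>Permuting the vertices of a face only inverts the value, so the common vertex may be
  made the last one of the first face and the first one of the second, as
  \<open>curvature_commute\<close> requires.\<close>

lemma (in simplex_calculus) faces_commute:
 assumes two: "invertible_on 2 S" and n: "n = 4" and b: "Gform U 2 be"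
  and ys: "set ys <= set xs" "length ys = 3" and zs: "set zs <= set xs" "length zs = 3"
  and meet: "set ys Int set zs ~= {}"
 shows "be R ys **\<^sub>H be R zs = be R zs **\<^sub>H be R ys"
proof -
 let ?H = "H"
 obtain x where x: "x : set ys" "x : set zs" using meet by blast
 have last: "EX a b. {a, b} <= set xs & (be R us = be R [a, b, x] | be R us = inv \<^sub>?H be R [a, b, x])"
  if us: "set us <= set xs" "length us = 3" "x : set us" for us
 proof -
  obtain a b d where u: "us = [a, b, d]" using us(2) by (auto simp: length_simps)
  consider "x = d" | "x = b" | "x = a" using us(3) u by auto
  then show ?thesis
  proof cases
   case 1 then show ?thesis using u us(1) by auto
  next
   case 2 then show ?thesis using u us(1) swap(2)[OF b, of "[a]" b d "[]"] by auto
  next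
   case 3
   have "be R us = be R [b, d, x]"
    using u us(1) 3 reversal(1)[OF b, of d b a] swap(1)[OF b, of "[]" d b "[a]"] by simp
   then show ?thesis using u us(1) by auto
  qed
 qed
 obtain a b where ab: "{a, b} <= set xs" "be R ys = be R [a, b, x] | be R ys = inv \<^sub>?H be R [a, b, x]"
  using last[OF ys x(1)] by blast
 obtain d e where de: "{d, e} <= set xs" "be R zs = be R [d, e, x] | be R zs = inv \<^sub>?H be R [d, e, x]"
  using last[OF zs x(2)] by blast
 have xx: "x : set xs" using x ys by blast
 \<comment> \<open>The vertices are reordered and may repeat; any list of five vertices of the given
   simplex is again a simplex.\<close>
 have f: "aff_spx U 4 R [a, b, x, e, d] & p R (hd [a, b, x, e, d]) = s"
  by (rule face) (use ab de xx in auto)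
 have v: "be R [a, b, x] : carrier ?H" "be R [d, e, x] : carrier ?H" "be R [x, e, d] : carrier ?H"
  by (rule natural_value[OF is_formD(1)[OF b]]; use ab de xx in simp)+
 have c: "be R [a, b, x] **\<^sub>?H be R [x, e, d] = be R [x, e, d] **\<^sub>?H be R [a, b, x]"
  using curvature_commute[OF two U b conjunct1[OF f]] f by simp
 have invc: "g **\<^sub>?H inv \<^sub>?H h = inv \<^sub>?H h **\<^sub>?H g"
  if "g : carrier ?H" "h : carrier ?H" "g **\<^sub>?H h = h **\<^sub>?H g" for g h
 proof -
  have "inv \<^sub>?H h **\<^sub>?H (g **\<^sub>?H h) **\<^sub>?H inv \<^sub>?H h = inv \<^sub>?H h **\<^sub>?H g"
   using that(1,2) by (simp add: C.H.m_assoc)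
  then show ?thesis unfolding that(3) using that(1,2) by (simp add: C.H.m_assoc C.H.cancel_left)
 qed
 have r: "be R [d, e, x] = inv \<^sub>?H be R [x, e, d]" by (rule reversal(1)[OF b]) (use de xx in auto)
 have c1: "be R [a, b, x] **\<^sub>?H be R zs = be R zs **\<^sub>?H be R [a, b, x]"
  using de(2) unfolding r using invc[OF v(1,3) c] c v by auto
 have zc: "be R zs : carrier ?H" using de(2) v by auto
 show ?thesis using ab(2) c1 invc[OF zc v(1) c1[symmetric]] by auto
qed

declare pw.simps [simp del]

context form_space
begin

lemma form_d1_twisted:
 assumes U: "stable_open U" and m: "Aform U 1 m" and w: "Gform U 1 ww"
 shows "Gform U 2 (d1_twisted GX m ww)"
proof (rule VG.is_formI[OF U natural_d1_twisted[OF U is_formD(1)[OF m] is_formD(1)[OF w]]], goal_cases)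
 case (1 R xs)
 note xs = 1
 obtain x y z where x: "xs = [x, y, z]" "x = y | y = z"
  using spxD(1)[OF aff_spxD(2)[OF xs(1)]] xs(2) by (auto simp: length_simps degenerate_Cons)
 obtain J where "simplex_calculus S G X p U 2 R xs (bp R xs) J" by (rule simplex_calculus[OF U xs(1)])
 then interpret sc: simplex_calculus S G X p U 2 R "[x, y, z]" "p R x" J unfolding x(1) list.sel .
 have c: "ww R [x, z] : carrier sc.H" "m R [x, z] : carrier sc.A"
  using sc.natural_value[OF is_formD(1)[OF w], of "[x, z]"] sc.natural_value[OF is_formD(1)[OF m], of "[x, z]"] by simp_all
 have one: "ww R [v, v] = \<one>\<^sub>sc.H" "m R [v, v] = \<one>\<^sub>sc.A" if "v : {x, y, z}" for v
  using VG.degenerate_value[OF w sc.xs, of "[v, v]"] VA.degenerate_value[OF m sc.xs, of "[v, v]"] that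
  by (auto simp: degenerate_Cons)
 consider "y = x" | "z = y" using x(2) by blast
 then show ?case
  by cases (use c one in "simp_all add: d1_twisted_def Let_def x(1) sc.C.act_one sc.C.act_hom_one")
qed

lemma form_d_twisted:
 assumes U: "stable_open U" and m: "Aform U 1 m" and w: "Gform U 2 ww"
 shows "Gform U 3 (d_twisted GX m ww)"
proof -
 have "Gform U 3 (de_rham GX ww)"
 proof (rule VG.is_formI[OF U])
  show "natural_form G U 3 (de_rham GX ww)"
   using VG.natural_de_rham[OF U is_formD(1)[OF w]] by (simp add: numeral_3_eq_3 numeral_2_eq_2)
  fix R xs assume xs: "aff_spx U 3 R xs" "degenerate xs"
  obtain x y z v where x: "xs = [x, y, z, v]" "x = y | y = z | z = v"
   using spxD(1)[OF aff_spxD(2)[OF xs(1)]] xs(2) by (auto simp: length_simps degenerate_Cons)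
  obtain J where "simplex_calculus S G X p U 3 R xs (bp R xs) J" by (rule simplex_calculus[OF U xs(1)])
  then interpret sc: simplex_calculus S G X p U 3 R "[x, y, z, v]" "p R x" J unfolding x(1) list.sel .
  have c: "ww R [a, b, d] : carrier sc.H" if "{a, b, d} <= {x, y, z, v}" for a b d
   using sc.natural_value[OF is_formD(1)[OF w], of "[a, b, d]"] that by simp
  have one: "ww R [a, b, d] = \<one>\<^sub>sc.H" if "{a, b, d} <= {x, y, z, v}" "a = b | b = d" for a b d
   using VG.degenerate_value[OF w sc.xs, of "[a, b, d]"] that by (auto simp: degenerate_Cons)
  interpret H: group "sc.H" using sc.C.H.group_axioms by simp
  show "de_rham GX ww R xs = \<one>\<^sub>(grp G R (bp R xs))"
  proof -
   consider "y = x" | "z = y" | "v = z" using x(2) by blast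
   then show ?thesis
    by cases (use c one in "simp_all add: de_rham_simps x(1)")
  qed
 qed
 then show ?thesis
  unfolding d_twisted_def using VG.form_fadd[OF U] form_aut_bracket[OF U m w] by (simp add: numeral_3_eq_3 numeral_2_eq_2)
qed

end

text \<open>Isolates what comparing two local objects contributes. \<open>m\<close>,
  \<open>mj\<close>, \<open>l\<close> and \<open>a\<close> stand for \<open>m\<^sub>i\<close>,
  \<open>m\<^sub>j\<close>, \<open>\<lambda>\<^sub>i\<^sub>j\<close> and
  \<open>\<gamma>\<^sub>i\<^sub>j\<close>; the gerbe enters only through the relation on
  edges.\<close>

locale gauge = form_space +
 fixes U m mj l a
 assumes U: "stable_open U"
  and m: "Aform U 1 m" and mj: "Aform U 1 mj"
  and l: "Anat U 0 (at0 l)" and a: "Gform U 1 a"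
  and gauge: "[|cring R; [x, y] : spx X p U 1 R|] ==>
   m R [x, y] **\<^sub>(AG R (p R x)) l R y
   = inn R (p R x) (a R [x, y]) **\<^sub>(AG R (p R x)) (l R x **\<^sub>(AG R (p R x)) mj R [x, y])"
begin

lemmas nm = is_formD(1)[OF m] and nmj = is_formD(1)[OF mj] and na = is_formD(1)[OF a] and nl = VA.natural_at0[OF l] and gauge_l = l

lemma connection_eq:
 "eq_forms X p AX U 1 (conj_form AX (at0 l) mj) (m \<boxminus>\<^bsub>AX\<^esub> u_duinv AX l \<boxminus>\<^bsub>AX\<^esub> inner_form S p G a)"
proof (rule VA.eq_formsI[OF U])
 show "Aform U 1 (conj_form AX (at0 l) mj)" by (rule VA.form_conj[OF U nl mj])
 show "Anat U 1 (m \<boxminus>\<^bsub>AX\<^esub> u_duinv AX l \<boxminus>\<^bsub>AX\<^esub> inner_form S p G a)"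
  by (intro VA.natural_fsub[OF U] nm VA.natural_difference(2)[OF U l] natural_inner[OF U na])
 fix R xs assume xs: "aff_spx U 1 R xs"
 obtain x y where xy: "xs = [x, y]" using spxD(1)[OF aff_spxD(2)[OF xs]] by (auto simp: length_simps)
 obtain J where "simplex_calculus S G X p U 1 R xs (bp R xs) J" by (rule simplex_calculus[OF U xs])
 then interpret sc: simplex_calculus S G X p U 1 R "[x, y]" "p R x" J unfolding xy list.sel .
 have v: "l R x : carrier sc.A" "l R y : carrier sc.A"
  "mj R [x, y] : carrier sc.A"
  using sc.natural_value[OF l, of "[x]"] sc.natural_value[OF l, of "[y]"] sc.natural_value[OF nmj, of "[x, y]"]
  by (simp_all add: at0_def)
 have v1: "m R [x, y] : sc.M 1" "a R [x, y] : sc.N 1"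
  "l R x **\<^sub>sc.A inv \<^sub>sc.A l R y : sc.M 1"
  using sc.A_value[OF m, of "[x, y]"] sc.G_value[OF a, of "[x, y]"] sc.A_value[OF VA.form_difference(2)[OF U l], of "[x, y]"]
  by (simp_all add: u_duinv_def)
 show "conj_form AX (at0 l) mj R xs = (m \<boxminus>\<^bsub>AX\<^esub> u_duinv AX l \<boxminus>\<^bsub>AX\<^esub> inner_form S p G a) R xs"
  using sc.C.gauge_connection[OF _ v1(1) v(3,1,2) v1(3,2) gauge[OF sc.R sc.simplex]]
  by (simp add: xy conj_form_def fsub_def fadd_def fneg_def at0_def u_duinv_def inner_form_def)
qed

lemma gauge_face:
 assumes xs: "aff_spx U n R xs" and xy: "x : set xs" "y : set xs"
 shows "m R [x, y] **\<^sub>(AG R (bp R xs)) l R y = inn R (bp R xs) (a R [x, y])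
  **\<^sub>(AG R (bp R xs)) (l R x **\<^sub>(AG R (bp R xs)) mj R [x, y])"
proof -
 note xsD = aff_spxD[OF xs]
 have "p R x = bp R xs" by (rule spxD(3)[OF xsD(2) xy(1) spxD(6)[OF xsD(2)]])
 moreover have "[x, y] : spx X p U 1 R" by (rule spx_subset[OF xsD(2)]) (use xy in auto)
 ultimately show ?thesis using gauge[OF xsD(1)] by metis
qed

end

locale gauge_curving = gauge +
 fixes B Bj d
 assumes B: "Gform U 2 B" and Bj: "Gform U 2 Bj"
  and d: "d = act_form (at0 l) Bj \<boxminus>\<^bsub>GX\<^esub> B \<boxminus>\<^bsub>GX\<^esub> d1_twisted GX m (fneg GX a)"
begin

lemmas nB = is_formD(1)[OF B] and nBj = is_formD(1)[OF Bj]

lemma form_t: "Gform U 2 (d1_twisted GX m (fneg GX a))"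
 by (rule form_d1_twisted[OF U m VG.form_fneg[OF U a]])

lemma form_d: "Gform U 2 d"
 unfolding d by (intro VG.form_fsub[OF U] form_act[OF U nl] Bj B form_t)

lemmas nd = is_formD(1)[OF form_d]

lemma curvature_eq:
 "eq_forms X p AX U 2 (conj_form AX (at0 l) (d1_aut AX mj \<boxminus>\<^bsub>AX\<^esub> inner_form S p G Bj))
  (d1_aut AX m \<boxminus>\<^bsub>AX\<^esub> inner_form S p G B \<boxminus>\<^bsub>AX\<^esub> inner_form S p G d)" (is "eq_forms X p AX U 2 ?l ?r")
proof (rule VA.eq_formsI[OF U])
 show "Aform U 2 ?l"
  by (intro VA.form_conj[OF U nl] VA.form_fsub[OF U] VA.form_d1_aut[OF U mj] form_inner[OF U Bj])
 show "Anat U 2 ?r"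
  by (intro VA.natural_fsub[OF U] VA.natural_d1_aut[OF U nm] natural_inner[OF U nB] natural_inner[OF U nd])
 fix R xs assume xs: "aff_spx U 2 R xs"
 obtain x y z where x: "xs = [x, y, z]" using spxD(1)[OF aff_spxD(2)[OF xs]] by (auto simp: length_simps)
 obtain J where "simplex_calculus S G X p U 2 R xs (bp R xs) J" by (rule simplex_calculus[OF U xs])
 then interpret sc: simplex_calculus S G X p U 2 R "[x, y, z]" "p R x" J unfolding x list.sel .
 note gauge = gauge_face[OF sc.xs, unfolded list.sel]
 have lv: "l R v : carrier sc.A" if "v : {x, y, z}" for v
  using sc.natural_value[OF gauge_l, of "[v]"] that by (auto simp: at0_def)
 have mv: "m R [v, w] : carrier sc.A" "mj R [v, w] : carrier sc.A"
  "a R [v, w] : sc.N 1" if "v : {x, y, z}" "w : {x, y, z}" for v w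
  using sc.natural_value[OF nm, of "[v, w]"] sc.natural_value[OF nmj, of "[v, w]"] sc.G_value[OF a, of "[v, w]"] that by auto
 note ac = sc.C.N_mem[OF mv(3)]
 have mu: "d1_aut AX m R [x, y, z] : sc.M 2" "d1_aut AX mj R [x, y, z] : sc.M 2"
  using sc.A_value[OF VA.form_d1_aut[OF U m], of "[x, y, z]"] sc.A_value[OF VA.form_d1_aut[OF U mj], of "[x, y, z]"] by simp_all
 have Bv: "B R [x, y, z] : sc.N 2" "Bj R [x, y, z] : sc.N 2"
  "d1_twisted GX m (fneg GX a) R [x, y, z] : sc.N 2"
  using sc.G_value[OF B, of "[x, y, z]"] sc.G_value[OF Bj, of "[x, y, z]"] sc.G_value[OF form_t, of "[x, y, z]"] by simp_all
 have pv: "p R v = p R x" if "v : {x, y, z}" for v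
  using spxD(3)[OF sc.simplex, of v x] that by auto
 have t: "d1_twisted GX m (fneg GX a) R [x, y, z] = inv \<^sub>sc.H a R [x, y] **\<^sub>sc.H
   aut_app R (m R [x, y]) (inv \<^sub>sc.H a R [y, z]) **\<^sub>sc.H a R [x, z]"
  using ac[of x z] sc.C.H.inv_inv[of "a R [x, z]"] pv[of y] by (simp add: d1_twisted_def fneg_def Let_def)
 note muv = sc.d1_aut_value[OF m, of x y z] sc.d1_aut_value[OF mj, of x y z]
 have e: "l R x **\<^sub>sc.A d1_aut AX mj R [x, y, z] **\<^sub>sc.A inv \<^sub>sc.A l R x
   = inn R (p R x) (d1_twisted GX m (fneg GX a) R [x, y, z]) **\<^sub>sc.A d1_aut AX m R [x, y, z]"
  unfolding t muv(2)[simplified]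
  by (rule sc.C.gauge_curvature_aux[OF _ mv(1) mv(1) mv(1) mv(2) mv(2) mv(2) lv lv lv ac ac mv(3) mu(1) muv(1)
     gauge gauge gauge]) simp_all
 show "?l R xs = ?r R xs"
  using sc.C.gauge_curvature[OF _ lv mu(1) sc.C.M_mem[OF mu(2)] Bv(3,1,2) e]
  by (simp add: x conj_form_def fsub_def fadd_def fneg_def at0_def inner_form_def d act_form_def)
qed

lemma three_curvature_eq:
 assumes n: "nj = d1_aut AX mj \<boxminus>\<^bsub>AX\<^esub> inner_form S p G Bj"
 shows "eq_forms X p GX U 3
  (act_form (at0 l) (d_twisted GX mj Bj) \<boxplus>\<^bsub>GX\<^esub> aut_bracket GX 2 (conj_form AX (at0 l) nj) a)
  (d_twisted GX m B \<boxplus>\<^bsub>GX\<^esub> d_twisted GX m d)" (is "eq_forms X p GX U 3 ?l ?r")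
proof (rule VG.eq_formsI[OF U])
 have nj: "Aform U 2 nj"
  unfolding n by (intro VA.form_fsub[OF U] VA.form_d1_aut[OF U mj] form_inner[OF U Bj])
 have cn: "Aform U 2 (conj_form AX (at0 l) nj)" by (rule VA.form_conj[OF U nl nj])
 have "Gform U 3 (aut_bracket GX 2 (conj_form AX (at0 l) nj) a)"
  using form_aut_bracket[OF U cn a] by (simp add: numeral_3_eq_3 numeral_2_eq_2)
 then show "Gform U 3 ?l"
  by (intro VG.form_fadd[OF U] form_act[OF U nl] form_d_twisted[OF U mj Bj])
 show "natural_form G U 3 ?r"
  by (intro VG.natural_fadd[OF U] is_formD(1)[OF form_d_twisted[OF U m B]] is_formD(1)[OF form_d_twisted[OF U m form_d]])
 fix R xs assume xs: "aff_spx U 3 R xs"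
 obtain w x y z where x: "xs = [w, x, y, z]" using spxD(1)[OF aff_spxD(2)[OF xs]] by (auto simp: length_simps)
 obtain J where "simplex_calculus S G X p U 3 R xs (bp R xs) J" by (rule simplex_calculus[OF U xs])
 then interpret sc: simplex_calculus S G X p U 3 R "[w, x, y, z]" "p R w" J unfolding x list.sel .
 let ?H = sc.H and ?A = sc.A
 note gauge = gauge_face[OF sc.xs, unfolded list.sel]
 have lv: "l R v : carrier ?A" if "v : {w, x, y, z}" for v
  using sc.natural_value[OF gauge_l, of "[v]"] that by (auto simp: at0_def)
 have mv: "m R [t, v] : sc.M 1" "mj R [t, v] : carrier ?A"
  "a R [t, v] : sc.N 1" if "t : {w, x, y, z}" "v : {w, x, y, z}" for t v
  using sc.A_value[OF m, of "[t, v]"] sc.natural_value[OF nmj, of "[t, v]"] sc.G_value[OF a, of "[t, v]"] that by auto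
 have fv: "B R [t, u, v] : sc.N 2" "Bj R [t, u, v] : sc.N 2"
  "d1_twisted GX m (fneg GX a) R [t, u, v] : sc.N 2"
  "d1_aut AX m R [t, u, v] : sc.M 2"
  if "t : {w, x, y, z}" "u : {w, x, y, z}" "v : {w, x, y, z}" for t u v
  using sc.G_value[OF B, of "[t, u, v]"] sc.G_value[OF Bj, of "[t, u, v]"] sc.G_value[OF form_t, of "[t, u, v]"]
   sc.A_value[OF VA.form_d1_aut[OF U m], of "[t, u, v]"] that by auto
 have pv: "p R v = p R w" if "v : {w, x, y, z}" for v
  using spxD(3)[OF sc.simplex, of v w] that by auto
 have tv: "d1_twisted GX m (fneg GX a) R [t, u, v] = inv \<^sub>?H a R [t, u] **\<^sub>?H
   aut_app R (m R [t, u]) (inv \<^sub>?H a R [u, v]) **\<^sub>?H a R [t, v]"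
  if "t : {w, x, y, z}" "u : {w, x, y, z}" "v : {w, x, y, z}" for t u v
  using sc.C.N_mem[OF mv(3)[OF that(1,3)]] sc.C.H.inv_inv[of "a R [t, v]"] that(1,2)[THEN pv]
  by (simp add: d1_twisted_def fneg_def Let_def)
 have dv: "d R [t, u, v] = aut_app R (l R t) (Bj R [t, u, v]) **\<^sub>?H inv \<^sub>?H B R [t, u, v]
   **\<^sub>?H inv \<^sub>?H d1_twisted GX m (fneg GX a) R [t, u, v]" if "t : {w, x, y, z}" for t u v
  using pv[OF that] by (simp add: d fsub_def fadd_def fneg_def act_form_def at0_def)
 \<comment> \<open>The transformation law of the fake curvature, used on the first face, where the
   bracket evaluates its first factor.\<close>
 have cv: "conj_form AX (at0 l) nj R [w, x, y] = d1_aut AX m R [w, x, y] **\<^sub>?A inv \<^sub>?A inn R (p R w) (B R [w, x, y])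
   **\<^sub>?A inv \<^sub>?A inn R (p R w) (d R [w, x, y])"
 proof -
  have "[w, x, y] : spx X p U 2 R" by (rule spx_subset[OF sc.simplex]) auto
  then show ?thesis
   using curvature_eq sc.R unfolding eq_forms_def n by (simp add: fsub_def fadd_def fneg_def inner_form_def)
 qed
 show "?l R xs = ?r R xs"
  using pv[of x] pv[of y] pv[of z]
  by (simp add: x fadd_def d_twisted_def de_rham_simps act_form_def at0_def aut_bracket_def Let_def)
   (rule sc.C.gauge_three_curvature[OF _ mv(1) mv(1) mv(1) mv(2) lv lv mv(3) mv(3) mv(3) mv(3) mv(3) mv(3)
    gauge fv(4) sc.d1_aut_value[OF m, of w x y] fv(1) fv(1) fv(1) fv(1) fv(2) fv(2) fv(2) fv(2)
    fv(3) fv(3) fv(3) fv(3) tv tv tv tv dv dv dv dv cv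
    sc.com_reversal[OF _ B a, of w x y z] sc.com_reversal[OF _ form_d a, of w x y z]]; simp)
qed

end

section \<open>Bianchi identities\<close>

context form_space
begin

lemma bianchi_eq:
 assumes U: "stable_open U" and m: "Aform U 1 m" and B: "Gform U 2 B"
  and n: "nu = d1_aut AX m \<boxminus>\<^bsub>AX\<^esub> inner_form S p G B"
 shows "eq_forms X p AX U 3 (d2_aut AX m nu \<boxplus>\<^bsub>AX\<^esub> inner_form S p G (d_twisted GX m B)) (fzero AX)" (is "eq_forms X p AX U 3 ?l _")
proof (rule VA.eq_forms_sym[OF VA.eq_formsI[OF U]])
 have nu: "Aform U 2 nu"
  unfolding n by (intro VA.form_fsub[OF U] VA.form_d1_aut[OF U m] form_inner[OF U B])
 show "Anat U 3 ?l"
  by (intro VA.natural_fadd[OF U] natural_d2_aut[OF U is_formD(1)[OF m] is_formD(1)[OF nu]] natural_inner[OF U]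
    is_formD(1)[OF form_d_twisted[OF U m B]])
 show "Aform U 3 (fzero AX)"
  by (rule VA.is_formI[OF U VA.natural_fzero[OF U]]) (simp add: fzero_def)
 fix R xs assume xs: "aff_spx U 3 R xs"
 obtain w x y z where x: "xs = [w, x, y, z]" using spxD(1)[OF aff_spxD(2)[OF xs]] by (auto simp: length_simps)
 obtain J where "simplex_calculus S G X p U 3 R xs (bp R xs) J" by (rule simplex_calculus[OF U xs])
 then interpret sc: simplex_calculus S G X p U 3 R "[w, x, y, z]" "p R w" J unfolding x list.sel .
 let ?A = sc.A
 have mv: "m R [t, v] : carrier ?A" if "t : {w, x, y, z}" "v : {w, x, y, z}" for t v
  using sc.natural_value[OF is_formD(1)[OF m], of "[t, v]"] that by auto
 have fv: "B R [t, u, v] : sc.N 2" "d1_aut AX m R [t, u, v] : sc.M 2"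
  "d1_aut AX m R [t, u, v] = m R [t, u] **\<^sub>?A m R [u, v] **\<^sub>?A inv \<^sub>?A m R [t, v]"
  if "t : {w, x, y, z}" "u : {w, x, y, z}" "v : {w, x, y, z}" for t u v
  using sc.G_value[OF B, of "[t, u, v]"] sc.A_value[OF VA.form_d1_aut[OF U m], of "[t, u, v]"]
   sc.d1_aut_value[OF m, of t u v] that by auto
 have pv: "p R v = p R w" if "v : {w, x, y, z}" for v
  using spxD(3)[OF sc.simplex, of v w] that by auto
 have nv: "nu R [t, u, v] = d1_aut AX m R [t, u, v] **\<^sub>?A inv \<^sub>?A inn R (p R w) (B R [t, u, v])"
  if "t : {w, x, y, z}" for t u v
  using pv[OF that] by (simp add: n fsub_def fadd_def fneg_def inner_form_def)
 show "fzero AX R xs = ?l R xs"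
  using pv[of x] pv[of y] pv[of z]
  by (simp add: x fzero_def fadd_def d2_aut_def d_twisted_def de_rham_simps bracket_def aut_bracket_def inner_form_def Let_def)
   (rule sc.C.bianchi[symmetric, OF _ mv mv mv mv mv mv fv(2) fv(2) fv(2) fv(2) fv(3) fv(3) fv(3) fv(3)
    fv(1) fv(1) fv(1) fv(1) nv nv nv nv]; simp)
qed

lemma curvature_differential_eq:
 assumes two: "invertible_on 2 S"
  and U: "stable_open U" and m: "Aform U 1 m" and B: "Gform U 2 B"
  and n: "nu = d1_aut AX m \<boxminus>\<^bsub>AX\<^esub> inner_form S p G B"
 shows "eq_forms X p GX U 4 (d_twisted GX m (d_twisted GX m B)) (aut_bracket GX 2 nu B)" (is "eq_forms X p GX U 4 ?l ?r")
proof (rule VG.eq_forms_sym[OF VG.eq_formsI[OF U]])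
 have nu: "Aform U 2 nu"
  unfolding n by (intro VA.form_fsub[OF U] VA.form_d1_aut[OF U m] form_inner[OF U B])
 show "Gform U 4 ?r" using form_aut_bracket[OF U nu B] by simp
 show "natural_form G U 4 ?l"
  using natural_d_twisted[OF U is_formD(1)[OF m] is_formD(1)[OF form_d_twisted[OF U m B]]] by simp
 fix R xs assume xs: "aff_spx U 4 R xs"
 obtain x0 x1 x2 x3 x4 where x: "xs = [x0, x1, x2, x3, x4]"
  using spxD(1)[OF aff_spxD(2)[OF xs]] by (auto simp: length_simps)
 obtain J where "simplex_calculus S G X p U 4 R xs (bp R xs) J" by (rule simplex_calculus[OF U xs])
 then interpret sc: simplex_calculus S G X p U 4 R "[x0, x1, x2, x3, x4]" "p R x0" J unfolding x list.sel .
 let ?H = sc.H and ?A = sc.A and ?V = "{x0, x1, x2, x3, x4}"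
 have mv: "m R [t, v] : sc.M 1" if "t : ?V" "v : ?V" for t v
  using sc.A_value[OF m, of "[t, v]"] that by auto
 have u: "d1_aut AX m R [x0, x1, x2] : sc.M 2"
  using sc.A_value[OF VA.form_d1_aut[OF U m], of "[x0, x1, x2]"] by auto
 have pv: "p R v = p R x0" if "v : ?V" for v
  using spxD(3)[OF sc.simplex, of v x0] that by auto
 define Fs where "Fs = [[x0, x1, x2], [x0, x1, x3], [x0, x1, x4], [x0, x2, x3], [x0, x2, x4], [x0, x3, x4],
  [x1, x2, x3], [x1, x2, x4], [x1, x3, x4], [x2, x3, x4]]"
 have Fs: "set ys <= ?V" "length ys = 3" if "ys : set Fs" for ys using that unfolding Fs_def by auto
 \<comment> \<open>Two triangles among five vertices always share a vertex, which is what
   \<open>faces_commute\<close> needs.\<close>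
 have meet: "ALL ys:set Fs. ALL zs:set Fs. set ys Int set zs ~= {}" unfolding Fs_def by simp
 have N2: "set (map (B R) Fs) <= sc.N 2"
  using sc.G_value[OF B] Fs by auto
 have BB: "b **\<^sub>?H b' = b' **\<^sub>?H b" if "b : set (map (B R) Fs)" "b' : set (map (B R) Fs)" for b b'
  using that sc.faces_commute[OF two refl B] Fs meet by auto
 define W where "W t u v w = B R [u, v, w] **\<^sub>?H (inv \<^sub>?H B R [t, v, w] **\<^sub>?H (B R [t, u, w] **\<^sub>?H
   (inv \<^sub>?H B R [t, u, v] **\<^sub>?H \<one>\<^sub>?H))) **\<^sub>?H (aut_app R (m R [t, u]) (B R [u, v, w]) **\<^sub>?H inv \<^sub>?H B R [u, v, w])"
  for t u v w
 have wv: "d_twisted GX m B R [t, u, v, w] = W t u v w" if "t : ?V" for t u v w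
  using pv[OF that] by (simp add: d_twisted_def fadd_def de_rham_simps aut_bracket_def Let_def W_def)
 have nv: "nu R [x0, x1, x2] = d1_aut AX m R [x0, x1, x2] **\<^sub>?A inv \<^sub>?A inn R (p R x0) (B R [x0, x1, x2])"
  by (simp add: n fsub_def fadd_def fneg_def inner_form_def)
 note key = sc.C.curvature_differential[OF _ mv mv mv u
   sc.d1_aut_value[OF m, of x0 x1 x2] N2 Fs_def[THEN arg_cong[where f = "map (B R)"], simplified list.map] BB
   W_def W_def W_def W_def W_def]
 show "?r R xs = ?l R xs"
  using key by (simp add: x nv wv fadd_def d_twisted_def[of GX m "d_twisted GX m B"] de_rham_simps aut_bracket_def Let_def)
qed

end

text \<open>The bracket with a 0-form evaluates it at the last vertex, whereas the cocycle
  computations produce the first one. The values differ by a factor of degree 1, invisible to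
  \<open>u\<close> when \<open>c <= j + 1\<close>.\<close>

lemma (in filtered_action) bracket_section:
 assumes u: "u : M j" and j: "0 < j" "c <= j + 1" and g: "g0 : carrier H" "g1 : carrier H"
  and k: "g1 ** inv g0 : N 1" and n: "act u g0 ** inv g0 : N j"
 shows "act u g1 ** inv g1 = act u g0 ** inv g0"
proof -
 define k' where "k' = g1 ** inv g0"
 have k': "k' : N 1" using k by (simp add: k'_def)
 have g1: "g1 = k' ** g0" using g by (simp add: k'_def H.m_assoc)
 have uk: "act u k' = k'" by (rule act_fix[OF u k']) (use j in auto)
 have "k' ** (act u g0 ** inv g0) = act u g0 ** inv g0 ** k'" by (rule N_commute[OF k' n]) (use j in auto)
 then have "act u g0 ** inv g0 ** k' ** inv k' = k' ** (act u g0 ** inv g0) ** inv k'" by simp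
 then show ?thesis
  using g N_mem[OF k'] act_closed[OF M_mem[OF u] g(1)] M_mem[OF u]
  by (simp add: g1 act_mult uk H.inv_mult_group H.m_assoc)
qed

text \<open>Data on a triple overlap: unprimed, primed and doubly primed letters belong to the index
  pairs ij, jk and ik, and \<open>a\<close>, \<open>b\<close>, \<open>e\<close> are the three
  1-forms \<gamma> for these pairs.\<close>

locale cocycle = gauge_curving +
 fixes l' l'' g b e Bk d' d''
 assumes l': "Anat U 0 (at0 l')" and l'': "Anat U 0 (at0 l'')"
  and g: "natural_form G U 0 (at0 g)"
  and b: "Gform U 1 b" and e: "Gform U 1 e" and Bk: "Gform U 2 Bk"
  and d': "d' = act_form (at0 l') Bk \<boxminus>\<^bsub>GX\<^esub> Bj \<boxminus>\<^bsub>GX\<^esub> d1_twisted GX mj (fneg GX b)"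
  and d'': "d'' = act_form (at0 l'') Bk \<boxminus>\<^bsub>GX\<^esub> B \<boxminus>\<^bsub>GX\<^esub> d1_twisted GX m (fneg GX e)"
  and ll: "[|cring R; [x] : spx X p U 0 R|] ==> l R x **\<^sub>(AG R (p R x)) l' R x
   = inn R (p R x) (g R x) **\<^sub>(AG R (p R x)) l'' R x"
  and cocycle: "[|cring R; [x, y] : spx X p U 1 R|] ==>
   a R [x, y] **\<^sub>(grp G R (p R x)) aut_app R (l R x) (b R [x, y]) **\<^sub>(grp G R (p R x)) g R x
   = aut_app R (m R [x, y]) (g R y) **\<^sub>(grp G R (p R x)) e R [x, y]"
begin

lemmas nl' = VA.natural_at0[OF l'] and nl'' = VA.natural_at0[OF l''] and ng = VG.natural_at0[OF g] and section_g = g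
 and section_l' = l' and section_l'' = l''

lemma natural_lll: "Anat U n (at0 l \<boxplus>\<^bsub>AX\<^esub> at0 l' \<boxminus>\<^bsub>AX\<^esub> at0 l'')"
 by (intro VA.natural_fsub[OF U] VA.natural_fadd[OF U] nl nl' nl'')

lemma cocycle_face:
 assumes xs: "aff_spx U n R xs" and xy: "x : set xs" "y : set xs"
 shows "a R [x, y] **\<^sub>(grp G R (bp R xs)) aut_app R (l R x) (b R [x, y]) **\<^sub>(grp G R (bp R xs)) g R x
   = aut_app R (m R [x, y]) (g R y) **\<^sub>(grp G R (bp R xs)) e R [x, y]"
proof -
 note xsD = aff_spxD[OF xs]
 have "p R x = bp R xs" by (rule spxD(3)[OF xsD(2) xy(1) spxD(6)[OF xsD(2)]])
 moreover have "[x, y] : spx X p U 1 R" by (rule spx_subset[OF xsD(2)]) (use xy in auto)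
 ultimately show ?thesis using cocycle[OF xsD(1)] by metis
qed

lemma section_face:
 assumes xs: "aff_spx U n R xs"
 shows "l R (hd xs) **\<^sub>(AG R (bp R xs)) l' R (hd xs)
   = inn R (bp R xs) (g R (hd xs)) **\<^sub>(AG R (bp R xs)) l'' R (hd xs)"
proof -
 note xsD = aff_spxD[OF xs]
 have "[hd xs] : spx X p U 0 R"
  by (rule spx_subset[OF xsD(2)]) (use spxD(6)[OF xsD(2)] in auto)
 then show ?thesis by (rule ll[OF xsD(1)])
qed

lemma cocycle_eq:
 "eq_forms X p GX U 1 (a \<boxplus>\<^bsub>GX\<^esub> act_form (at0 l) b \<boxminus>\<^bsub>GX\<^esub> act_form (at0 l \<boxplus>\<^bsub>AX\<^esub> at0 l' \<boxminus>\<^bsub>AX\<^esub> at0 l'') e)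
  (dg_ginv GX g \<boxplus>\<^bsub>GX\<^esub> aut_bracket GX 1 m (at0 g))" (is "eq_forms X p GX U 1 ?l ?r")
proof (rule VG.eq_formsI[OF U])
 show "Gform U 1 ?l"
  by (intro VG.form_fsub[OF U] VG.form_fadd[OF U] a form_act[OF U nl b] form_act[OF U natural_lll e])
 show "natural_form G U 1 ?r"
  using VG.natural_fadd[OF U VG.natural_difference(1)[OF U g]] natural_aut_bracket[OF U nm section_g] by simp
 fix R xs assume xs: "aff_spx U 1 R xs"
 obtain x y where x: "xs = [x, y]" using spxD(1)[OF aff_spxD(2)[OF xs]] by (auto simp: length_simps)
 obtain J where "simplex_calculus S G X p U 1 R xs (bp R xs) J" by (rule simplex_calculus[OF U xs])
 then interpret sc: simplex_calculus S G X p U 1 R "[x, y]" "p R x" J unfolding x list.sel .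
 let ?H = sc.H and ?A = sc.A
 have lv: "l R x : carrier ?A" "l' R x : carrier ?A" "l'' R x : carrier ?A" "g R x : carrier ?H" "g R y : carrier ?H"
  using sc.natural_value[OF gauge_l, of "[x]"] sc.natural_value[OF section_l', of "[x]"] sc.natural_value[OF section_l'', of "[x]"]
   sc.natural_value[OF section_g, of "[x]"] sc.natural_value[OF section_g, of "[y]"] by (simp_all add: at0_def)
 have mv: "m R [x, y] : sc.M 1" "g R y **\<^sub>?H inv \<^sub>?H g R x : sc.N 1"
  using sc.A_value[OF m, of "[x, y]"] sc.G_value[OF VG.form_difference(1)[OF U section_g], of "[x, y]"] by (simp_all add: dg_ginv_def)
 have av: "a R [x, y] : carrier ?H" "b R [x, y] : carrier ?H" "e R [x, y] : carrier ?H"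
  using sc.natural_value[OF na, of "[x, y]"] sc.natural_value[OF is_formD(1)[OF b], of "[x, y]"]
   sc.natural_value[OF is_formD(1)[OF e], of "[x, y]"] by simp_all
 \<comment> \<open>So the automorphism acting on the third term is conjugation by \<open>g\<close>
   at the first vertex.\<close>
 have lll: "l R x **\<^sub>?A l' R x **\<^sub>?A inv \<^sub>?A l'' R x = inn R (p R x) (g R x)"
  using section_face[OF sc.xs, unfolded list.sel] lv sc.C.inn_closed[of "g R x"] sc.C.A.inv_solve_right'[of "inn R (p R x) (g R x)" "l R x **\<^sub>?A l' R x" "l'' R x"]
   sc.C.A.m_closed[of "l R x" "l' R x"] by simp
 have gb: "aut_app R (m R [x, y]) (g R y) **\<^sub>?H inv \<^sub>?H g R y = aut_app R (m R [x, y]) (g R x) **\<^sub>?H inv \<^sub>?H g R x"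
  by (rule sc.C.bracket_section[OF mv(1) _ _ lv(4,5) mv(2) act_congr_self[OF sc.R sc.base mv(1) lv(4)]]) simp_all
 have "a R [x, y] **\<^sub>?H aut_app R (l R x) (b R [x, y]) **\<^sub>?H inv \<^sub>?H (g R x **\<^sub>?H e R [x, y] **\<^sub>?H inv \<^sub>?H g R x)
   = g R y **\<^sub>?H inv \<^sub>?H g R x **\<^sub>?H (aut_app R (m R [x, y]) (g R x) **\<^sub>?H inv \<^sub>?H g R x)"
  by (rule sc.C.cocycle_connection[OF _ mv lv(4,5) av(1) _ av(3) cocycle_face[OF sc.xs, unfolded list.sel]])
   (use aut_app_closed[OF sc.R sc.base lv(1) av(2)] in simp_all)
 then show "?l R xs = ?r R xs"
  using lll inner_aut_app[OF sc.R sc.base lv(4) av(3)] gb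
  by (simp add: x fsub_def fadd_def fneg_def act_form_def at0_def dg_ginv_def aut_bracket_def Let_def)
qed

lemma cocycle_curvature_eq:
 assumes n: "nu = d1_aut AX m \<boxminus>\<^bsub>AX\<^esub> inner_form S p G B"
 shows "eq_forms X p GX U 2 (d \<boxplus>\<^bsub>GX\<^esub> act_form (at0 l) d' \<boxminus>\<^bsub>GX\<^esub> act_form (at0 l \<boxplus>\<^bsub>AX\<^esub> at0 l' \<boxminus>\<^bsub>AX\<^esub> at0 l'') d'')
  (aut_bracket GX 2 nu (at0 g))" (is "eq_forms X p GX U 2 ?l ?r")
proof (rule VG.eq_formsI[OF U])
 have td': "Gform U 2 (d1_twisted GX mj (fneg GX b))" and td'': "Gform U 2 (d1_twisted GX m (fneg GX e))"
  by (intro form_d1_twisted[OF U] m mj VG.form_fneg[OF U] b e)+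
 have "Gform U 2 d'" "Gform U 2 d''"
  unfolding d' d'' by (intro VG.form_fsub[OF U] form_act[OF U] nl' nl'' Bk Bj B td' td'')+
 then show "Gform U 2 ?l"
  by (intro VG.form_fsub[OF U] VG.form_fadd[OF U] form_d form_act[OF U nl] form_act[OF U natural_lll])
 have nu: "Aform U 2 nu"
  unfolding n by (intro VA.form_fsub[OF U] VA.form_d1_aut[OF U m] form_inner[OF U B])
 show "natural_form G U 2 ?r" using natural_aut_bracket[OF U is_formD(1)[OF nu] section_g] by simp
 fix R xs assume xs: "aff_spx U 2 R xs"
 obtain x y z where x: "xs = [x, y, z]" using spxD(1)[OF aff_spxD(2)[OF xs]] by (auto simp: length_simps)
 obtain J where "simplex_calculus S G X p U 2 R xs (bp R xs) J" by (rule simplex_calculus[OF U xs])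
 then interpret sc: simplex_calculus S G X p U 2 R "[x, y, z]" "p R x" J unfolding x list.sel .
 let ?H = sc.H and ?A = sc.A and ?V = "{x, y, z}"
 note C = sc.base
 have lv: "l R v : carrier ?A" "l' R v : carrier ?A" "l'' R v : carrier ?A" "g R v : carrier ?H" if "v : ?V" for v
  using sc.natural_value[OF gauge_l, of "[v]"] sc.natural_value[OF section_l', of "[v]"] sc.natural_value[OF section_l'', of "[v]"]
   sc.natural_value[OF section_g, of "[v]"] that by (auto simp: at0_def)
 have mv: "m R [v, w] : carrier ?A" "mj R [v, w] : carrier ?A" "a R [v, w] : sc.N 1"
  "b R [v, w] : sc.N 1" "e R [v, w] : sc.N 1" if "v : ?V" "w : ?V" for v w
  using sc.natural_value[OF nm, of "[v, w]"] sc.natural_value[OF nmj, of "[v, w]"] sc.G_value[OF a, of "[v, w]"]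
   sc.G_value[OF b, of "[v, w]"] sc.G_value[OF e, of "[v, w]"] that by auto
 have fv: "B R [x, y, z] : sc.N 2" "Bj R [x, y, z] : sc.N 2"
  "Bk R [x, y, z] : sc.N 2" "d1_twisted GX m (fneg GX a) R [x, y, z] : sc.N 2"
  "d1_twisted GX mj (fneg GX b) R [x, y, z] : sc.N 2"
  "d1_twisted GX m (fneg GX e) R [x, y, z] : sc.N 2"
  using sc.G_value[OF B, of "[x, y, z]"] sc.G_value[OF Bj, of "[x, y, z]"] sc.G_value[OF Bk, of "[x, y, z]"]
   sc.G_value[OF form_t, of "[x, y, z]"] sc.G_value[OF td', of "[x, y, z]"] sc.G_value[OF td'', of "[x, y, z]"] by simp_all
 have mu: "d1_aut AX m R [x, y, z] : sc.M 2"
  "g R z **\<^sub>?H inv \<^sub>?H g R x : sc.N 1" "nu R [x, y, z] : sc.M 2"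
  using sc.A_value[OF VA.form_d1_aut[OF U m], of "[x, y, z]"] sc.G_value[OF VG.form_difference(1)[OF U section_g], of "[x, z]"]
   sc.A_value[OF nu, of "[x, y, z]"] by (simp_all add: dg_ginv_def)
 have pv: "p R y = p R x" using spxD(3)[OF sc.simplex, of y x] by auto
 have tv: "d1_twisted GX m' (fneg GX c) R [x, y, z] = inv \<^sub>?H c R [x, y] **\<^sub>?H
   aut_app R (m' R [x, y]) (inv \<^sub>?H c R [y, z]) **\<^sub>?H c R [x, z]" if "c R [x, z] : sc.N 1" for m' c
  using sc.C.N_mem[OF that] sc.C.H.inv_inv[of "c R [x, z]"] pv
  by (simp add: d1_twisted_def fneg_def Let_def)
 have gb: "aut_app R (nu R [x, y, z]) (g R z) **\<^sub>?H inv \<^sub>?H g R z = aut_app R (nu R [x, y, z]) (g R x) **\<^sub>?H inv \<^sub>?H g R x"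
  by (rule sc.C.bracket_section[OF mu(3) _ _ lv(4) lv(4) mu(2) act_congr_self[OF sc.R C mu(3) lv(4)]]) simp_all
 have mg: "aut_app R (d1_aut AX m R [x, y, z]) (g R x) = inv \<^sub>?H d1_twisted GX m (fneg GX a) R [x, y, z]
   **\<^sub>?H inv \<^sub>?H aut_app R (l R x) (d1_twisted GX mj (fneg GX b) R [x, y, z])
   **\<^sub>?H (g R x **\<^sub>?H d1_twisted GX m (fneg GX e) R [x, y, z] **\<^sub>?H inv \<^sub>?H g R x) **\<^sub>?H g R x"
  by (rule sc.C.cocycle_curvature_aux[OF _ mv(1) mv(1) mv(1) mv(2) lv(1) lv(1) lv(4) lv(4) lv(4)
     mv(3) mv(3) mv(3) mv(4) mv(4) mv(4) mv(5) mv(5) mv(5) mu(1) sc.d1_aut_value[OF m]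
     fv(4) tv[of a, OF mv(3)] fv(5) tv[of b, OF mv(4)] fv(6) tv[of e, OF mv(5)] gauge_face[OF sc.xs, unfolded list.sel]
     cocycle_face[OF sc.xs, unfolded list.sel] cocycle_face[OF sc.xs, unfolded list.sel]
     cocycle_face[OF sc.xs, unfolded list.sel]]) simp_all
 show "?l R xs = ?r R xs"
  using sc.C.cocycle_curvature[OF _ lv(1) lv(2) lv(3) lv(4) section_face[OF sc.xs, unfolded list.sel]
    fv(1,2,3,4,5,6) mu(1) mg] gb[unfolded n]
  by (simp add: x n fsub_def fadd_def fneg_def act_form_def at0_def inner_form_def aut_bracket_def d d' d'' Let_def)
qed

end

section \<open>Arrows of a gerbe\<close>

context fibred_in_groupoids
begin

abbreviation arr_comp (infixr \<open>$\<close> 75) where "f $ g == fcat.cmp P f g"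

definition arrow where
 "arrow f a b \<longleftrightarrow> f : ars P & src P f = a & tgt P f = b"

lemma arrow_comp: "arrow f b c ==> arrow g a b ==> arrow (f $ g) a c"
 unfolding arrow_def using cmp by auto

lemma arrow_assoc: "arrow f c d ==> arrow g b c ==> arrow e a b ==> (f $ g) $ e = f $ (g $ e)"
 unfolding arrow_def using cmp_assoc by auto

lemma fib_arrow: "f : fib P a b ==> arrow f a b"
 by (simp add: fib_def arrow_def)

lemma fib_obs: "f : fib P a b ==> a : obs P" "f : fib P a b ==> b : obs P"
 using src_tgt by (auto simp: fib_def)

lemma fib_comp: assumes "f : fib P b c" "g : fib P a b" shows "f $ g : fib P a c"
proof -
 have "bhom P (f $ g) = compose (carrier (brg P c)) (rid (brg P b)) (rid (brg P c))"
  using assms cmp[of f g] by (auto simp: fib_def)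
 moreover have "brg P b = brg P c" "cring (brg P c)" using assms(1) fib_obs(2)[OF assms(1)] obj_base by (auto simp: fib_def)
 ultimately show ?thesis
  using assms cmp[of f g] compose_rid(1)[OF rid_rhom] by (auto simp: fib_def)
qed

lemma fib_idn: "a : obs P ==> idn P a : fib P a a"
 using idn by (simp add: fib_def)

lemma idn_left: "arrow f a b ==> idn P b $ f = f" and idn_right: "arrow f a b ==> f $ idn P a = f"
 unfolding arrow_def using cmp_idn by auto

text \<open>\<open>s\<close> need not lie in a fibre: uniqueness in the cartesian property suffices.
  This is what makes naturality provable by composing with transition arrows.\<close>

lemma left_cancel:
 assumes s: "arrow s b c" and e: "e : fib P a b" "e' : fib P a b" and eq: "s $ e = s $ e'"
 shows "e = e'"
proof -
 note sD = s[unfolded arrow_def] and eD = e[unfolded fib_def]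
 have "s $ e : ars P & src P (s $ e) = src P e & tgt P (s $ e) = tgt P s &
   bhom P (s $ e) = compose (carrier (brg P (tgt P s))) (bhom P e) (bhom P s)"
  using cmp[of s e] sD eD by simp
 moreover have "bhom P e : rhom (brg P (src P s)) (brg P (src P e))"
  using arr_base[of e] sD eD by simp
 ultimately have "EX! x. x : ars P & src P x = src P (s $ e) & tgt P x = src P s & bhom P x = bhom P e & s $ x = s $ e"
  using sD by (intro cartesian) simp_all
 moreover have "e : ars P & src P e = src P (s $ e) & tgt P e = src P s & bhom P e = bhom P e & s $ e = s $ e"
  "e' : ars P & src P e' = src P (s $ e) & tgt P e' = src P s & bhom P e' = bhom P e & s $ e' = s $ e"
  using sD eD eq cmp[of s e] by simp_all
 ultimately show ?thesis by blast
qed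

text \<open>Every arrow of a category fibred in groupoids is cartesian, so the identity of the
  target factors through \<open>f\<close>.\<close>

lemma fib_right_inverse:
 assumes f: "f : fib P a b" obtains e where "e : fib P b a" "f $ e = idn P b"
proof -
 note fD = f[unfolded fib_def, simplified] and b = fib_obs(2)[OF f]
 have R: "cring (brg P b)" using obj_base[OF b] by simp
 have "EX! e. e : ars P & src P e = src P (idn P b) & tgt P e = src P f & bhom P e = rid (brg P b) & f $ e = idn P b"
  using fD idn[OF b] rid_rhom[OF R] compose_rid(1)[OF rid_rhom[OF R]] by (intro cartesian) auto
 then obtain e where "e : ars P" "src P e = b" "tgt P e = a" "bhom P e = rid (brg P b)" "f $ e = idn P b"
  using idn[OF b] fD by auto
 then show thesis using that fD by (simp add: fib_def)
qed

lemma fib_inverse: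
 assumes f: "f : fib P a b" obtains e where "e : fib P b a" "f $ e = idn P b" "e $ f = idn P a"
proof -
 obtain e where e: "e : fib P b a" "f $ e = idn P b" by (rule fib_right_inverse[OF f])
 note fa = fib_arrow[OF f] and ea = fib_arrow[OF e(1)]
 have "f $ (e $ f) = f $ idn P a"
  using arrow_assoc[OF fa ea fa] e(2) idn_left[OF fa] idn_right[OF fa] by simp
 then have "e $ f = idn P a"
  by (rule left_cancel[OF fa fib_comp[OF e(1) f] fib_idn[OF fib_obs(1)[OF f]]])
 then show thesis using that e by blast
qed

lemma right_cancel:
 assumes f: "f : fib P a b" and h: "arrow h b c" "arrow h' b c" and eq: "h $ f = h' $ f"
 shows "h = h'"
proof -
 obtain e where e: "e : fib P b a" "f $ e = idn P b" by (rule fib_right_inverse[OF f])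
 have "h = (h $ f) $ e" using arrow_assoc[OF h(1) fib_arrow[OF f] fib_arrow[OF e(1)]] e(2) idn_right[OF h(1)] by simp
 also have "... = h'" unfolding eq using arrow_assoc[OF h(2) fib_arrow[OF f] fib_arrow[OF e(1)]] e(2) idn_right[OF h(2)] by simp
 finally show ?thesis .
qed

lemma fib_quotient:
 assumes f: "f : fib P a b" and f': "f' : fib P a b" obtains h where "h : fib P b b" "f = h $ f'"
proof -
 obtain e where e: "e : fib P b a" "f' $ e = idn P b" "e $ f' = idn P a" by (rule fib_inverse[OF f'])
 have "(f $ e) $ f' = f"
  using arrow_assoc[OF fib_arrow[OF f] fib_arrow[OF e(1)] fib_arrow[OF f']] e(3) idn_right[OF fib_arrow[OF f]] by simp
 then show thesis using that[OF fib_comp[OF f e(1)]] by simp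
qed

end

section \<open>Sections determined by arrows\<close>

locale gerbe_space = form_space S G X p + P: fibred_in_groupoids X P
 for S :: "('r, 's) pfunctor" and G :: "('r, 's, 'g) gfunctor"
  and X :: "('r, 'x) pfunctor" and p :: "'r ring => 'x => 's" and P :: "('r, 'x, 'o, 'a) fcat"

text \<open>Objects and arrows over a functor \<open>Y\<close> above \<open>X\<close>, of which only the image \<open>q\<close> in \<open>S\<close> is used.\<close>

locale gerbe_over = gerbe_space +
 fixes Y q
 assumes Y: "point_functor Y" and q: "functor_morphism Y S q"
begin

sublocale Y: point_functor Y by (rule Y)
sublocale q: functor_morphism Y S q by (rule q)

notation P.arr_comp (infixr \<open>$\<close> 75)

definition section_of where
 "section_of s \<longleftrightarrow> (ALL R R' h y. cring R & cring R' & h : rhom R R' & y : pts Y R -->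
   P.arrow (sar s R R' h y) (sob s R' (pull Y R R' h y)) (sob s R y))"

definition banded where
 "banded s tt \<longleftrightarrow> section_of s &
   (ALL R y. cring R & y : pts Y R --> tt R y : iso (grp G R (q R y)) (aut_group P (sob s R y))) &
   (ALL R R' h y g. cring R & cring R' & h : rhom R R' & y : pts Y R & g : GC R (q R y) -->
    tt R y g $ sar s R R' h y = sar s R R' h y $ tt R' (pull Y R R' h y) (res G R R' h (q R y) g))"

lemma section_ofD: "section_of s ==> cring R ==> cring R' ==> h : rhom R R' ==> y : pts Y R ==>
  P.arrow (sar s R R' h y) (sob s R' (pull Y R R' h y)) (sob s R y)"
 unfolding section_of_def by blast

lemma is_arrowD:
 assumes "is_arrow P Y s t f" "cring R" "y : pts Y R"
 shows "f R y : fib P (sob s R y) (sob t R y)"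
  and "cring R' ==> h : rhom R R' ==> f R y $ sar s R R' h y = sar t R R' h y $ f R' (pull Y R R' h y)"
 using assms unfolding is_arrow_def by blast+

lemma bandedD:
 assumes "banded s tt"
 shows "section_of s"
  and "cring R ==> y : pts Y R ==> g : GC R (q R y) ==> tt R y g : fib P (sob s R y) (sob s R y)"
  and "cring R ==> y : pts Y R ==> g : GC R (q R y) ==> g' : GC R (q R y) ==>
   tt R y (g **\<^sub>(grp G R (q R y)) g') = tt R y g $ tt R y g'"
  and "cring R ==> y : pts Y R ==> g : GC R (q R y) ==> g' : GC R (q R y) ==>
   tt R y g = tt R y g' ==> g = g'"
  and "cring R ==> y : pts Y R ==> f : fib P (sob s R y) (sob s R y) ==> EX g:GC R (q R y). f = tt R y g"
  and "cring R ==> y : pts Y R ==> cring R' ==> h : rhom R R' ==> g : GC R (q R y) ==>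
   tt R y g $ sar s R R' h y = sar s R R' h y $ tt R' (pull Y R R' h y) (res G R R' h (q R y) g)"
proof goal_cases
 have i: "tt R y : iso (grp G R (q R y)) (aut_group P (sob s R y))" if "cring R" "y : pts Y R"
  using assms that unfolding banded_def by blast
 have b: "bij_betw (tt R y) (GC R (q R y)) (fib P (sob s R y) (sob s R y))" if "cring R" "y : pts Y R"
  using i[OF that] by (simp add: iso_def aut_group_def)
 { case 1 show ?case using assms by (simp add: banded_def)
 next case 2 then show ?case using bij_betwE[OF b[OF 2(1,2)]] by blast
 next case 3 then show ?case using i[OF 3(1,2)] by (simp add: iso_def hom_def aut_group_def)
 next case 4 then show ?case using b[OF 4(1,2)] by (auto simp: bij_betw_def inj_on_def)
 next case 5 then show ?case using b[OF 5(1,2)] by (auto simp: bij_betw_def)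
 next case 6 then show ?case using assms unfolding banded_def by blast }
qed

lemma is_arrow_comp:
 assumes s: "section_of s" and t: "section_of t" and u: "section_of u"
  and f: "is_arrow P Y t u f" and g: "is_arrow P Y s t g"
 shows "is_arrow P Y s u (%R y. f R y $ g R y)"
 unfolding is_arrow_def
proof (intro conjI allI impI; (elim conjE)?)
 fix R y assume a: "cring R" "y : pts Y R"
 show "f R y $ g R y : fib P (sob s R y) (sob u R y)" by (rule P.fib_comp[OF is_arrowD(1)[OF f a] is_arrowD(1)[OF g a]])
next
 fix R R' h y assume R: "cring R" "cring R'" "h : rhom R R'" and y: "y : pts Y R"
 let ?y = "pull Y R R' h y"
 have y': "?y : pts Y R'" by (rule Y.pull_closed[OF R y])
 note fa = P.fib_arrow[OF is_arrowD(1)[OF f R(1) y]] P.fib_arrow[OF is_arrowD(1)[OF f R(2) y']]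
  and ga = P.fib_arrow[OF is_arrowD(1)[OF g R(1) y]] P.fib_arrow[OF is_arrowD(1)[OF g R(2) y']]
 note sa = section_ofD[OF s R y] section_ofD[OF t R y] section_ofD[OF u R y]
 have "(f R y $ g R y) $ sar s R R' h y = f R y $ (g R y $ sar s R R' h y)" by (rule P.arrow_assoc[OF fa(1) ga(1) sa(1)])
 also have "... = (f R y $ sar t R R' h y) $ g R' ?y"
  unfolding is_arrowD(2)[OF g R(1) y R(2,3)] by (rule P.arrow_assoc[OF fa(1) sa(2) ga(2), symmetric])
 also have "... = sar u R R' h y $ (f R' ?y $ g R' ?y)"
  unfolding is_arrowD(2)[OF f R(1) y R(2,3)] by (rule P.arrow_assoc[OF sa(3) fa(2) ga(2)])
 finally show "(f R y $ g R y) $ sar s R R' h y = sar u R R' h y $ (f R' ?y $ g R' ?y)" .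
qed

text \<open>The common pattern behind \<open>cocycle_of\<close>, \<open>gamma_of\<close> and
  \<open>B_of\<close>: two parallel arrows differ by an automorphism of the target, which the band
  turns into a unique section of \<open>G\<close>. Uniqueness also gives compatibility with base
  change.\<close>

lemma quotient_section:
 assumes s: "section_of s" and t: "banded t tt" and f: "is_arrow P Y s t f" and f2: "is_arrow P Y s t f2"
  and k: "!!R y. cring R ==> y : pts Y R ==> k R y = (THE g. g : GC R (q R y) & f R y = tt R y g $ f2 R y)"
  and R: "cring R" and y: "y : pts Y R"
 shows "k R y : GC R (q R y)" "f R y = tt R y (k R y) $ f2 R y"
  "g : GC R (q R y) ==> f R y = tt R y g $ f2 R y ==> k R y = g"
  "cring R' ==> h : rhom R R' ==> k R' (pull Y R R' h y) = res G R R' h (q R y) (k R y)"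
proof -
 have uniq: "g = g'" if "cring R" "y : pts Y R" "g : GC R (q R y)" "g' : GC R (q R y)"
  "f R y = tt R y g $ f2 R y" "f R y = tt R y g' $ f2 R y" for R y g g'
  by (rule bandedD(4)[OF t that(1-4)], rule P.right_cancel[OF is_arrowD(1)[OF f2 that(1,2)]
    P.fib_arrow[OF bandedD(2)[OF t that(1-3)]] P.fib_arrow[OF bandedD(2)[OF t that(1,2,4)]]]) (use that in simp)
 have spec: "k R y : GC R (q R y) & f R y = tt R y (k R y) $ f2 R y" if "cring R" "y : pts Y R" for R y
 proof -
  note fs = is_arrowD(1)[OF f that] is_arrowD(1)[OF f2 that]
  obtain e where e: "e : fib P (sob t R y) (sob t R y)" "f R y = e $ f2 R y" by (rule P.fib_quotient[OF fs])
  have "EX g:GC R (q R y). e = tt R y g" by (rule bandedD(5)[OF t that e(1)])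
  then obtain g where g: "g : GC R (q R y)" "e = tt R y g" by blast
  have "EX! g. g : GC R (q R y) & f R y = tt R y g $ f2 R y"
   using g e(2) uniq[OF that] by blast
  then show ?thesis unfolding k[OF that] by (rule theI')
 qed
 show kc: "k R y : GC R (q R y)" and ke: "f R y = tt R y (k R y) $ f2 R y" using spec[OF R y] by auto
 show "k R y = g" if "g : GC R (q R y)" "f R y = tt R y g $ f2 R y"
  by (rule uniq[OF R y kc that(1) ke that(2)])
 assume R': "cring R'" "h : rhom R R'"
 let ?y = "pull Y R R' h y"
 have y': "?y : pts Y R'" by (rule Y.pull_closed[OF R R' y])
 have qy: "q R' ?y = pull S R R' h (q R y)" by (rule q.mor_natural[OF R R' y])
 have rk: "res G R R' h (q R y) (k R y) : GC R' (q R' ?y)"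
  unfolding qy by (rule res_closed[OF R R' q.mor_closed[OF R y] kc])
 note sa = section_ofD[OF s R R' y] section_ofD[OF bandedD(1)[OF t] R R' y]
 note fa = P.fib_arrow[OF is_arrowD(1)[OF f2 R y]] P.fib_arrow[OF is_arrowD(1)[OF f2 R'(1) y']]
 note ta = P.fib_arrow[OF bandedD(2)[OF t R y kc]] P.fib_arrow[OF bandedD(2)[OF t R'(1) y' rk]]
 have "sar t R R' h y $ f R' ?y = (tt R y (k R y) $ f2 R y) $ sar s R R' h y"
  using is_arrowD(2)[OF f R y R'] ke by simp
 also have "... = tt R y (k R y) $ (f2 R y $ sar s R R' h y)" by (rule P.arrow_assoc[OF ta(1) fa(1) sa(1)])
 also have "... = (tt R y (k R y) $ sar t R R' h y) $ f2 R' ?y"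
  unfolding is_arrowD(2)[OF f2 R y R'] by (rule P.arrow_assoc[OF ta(1) sa(2) fa(2), symmetric])
 also have "... = sar t R R' h y $ (tt R' ?y (res G R R' h (q R y) (k R y)) $ f2 R' ?y)"
  unfolding bandedD(6)[OF t R y R' kc] by (rule P.arrow_assoc[OF sa(2) ta(2) fa(2)])
 \<comment> \<open>Cancels the transition arrow of \<open>t\<close>, which lies over
   \<open>h\<close>, so that the remaining equation holds in a fibre.\<close>
 finally have "f R' ?y = tt R' ?y (res G R R' h (q R y) (k R y)) $ f2 R' ?y"
  by (rule P.left_cancel[OF sa(2) is_arrowD(1)[OF f R'(1) y']
    P.fib_comp[OF bandedD(2)[OF t R'(1) y' rk] is_arrowD(1)[OF f2 R'(1) y']]])
 then show "k R' ?y = res G R R' h (q R y) (k R y)"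
  using uniq[OF R'(1) y' _ rk] spec[OF R'(1) y'] by blast
qed

text \<open>The common pattern behind \<open>lambda_of\<close> and \<open>m_of\<close>: moving
  automorphisms across an arrow transports one band to the other. The values \<open>c\<close> are
  bijective, multiplicative and natural, hence form a local automorphism.\<close>

lemma conjugation:
 assumes s: "banded s sg" and t: "banded t tt" and f: "is_arrow P Y s t f"
  and k: "!!R y. cring R ==> y : pts Y R ==> k R y = (THE u. u : Aut_carrier S G R (q R y) & (ALL R' h. cring R' & h : rhom R R' -->
   (ALL g:GC R' (q R' (pull Y R R' h y)).
    f R' (pull Y R R' h y) $ sg R' (pull Y R R' h y) g = tt R' (pull Y R R' h y) (u R' h g) $ f R' (pull Y R R' h y))))" (is "!!R y. _ ==> _ ==> _ = (THE u. ?P R y u)")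
  and R: "cring R" and y: "y : pts Y R"
 shows "k R y : AC R (q R y)"
  "g : GC R (q R y) ==> f R y $ sg R y g = tt R y (aut_app R (k R y) g) $ f R y"
  "cring R' ==> h : rhom R R' ==> k R' (pull Y R R' h y) = ract R R' h (q R y) (k R y)"
proof -
 note fD = is_arrowD(1)[OF f]
 define c where "c R y g = (THE g'. g' : GC R (q R y) & f R y $ sg R y g = tt R y g' $ f R y)" for R y g
 have uniq: "g = g'" if "cring R" "y : pts Y R" "g : GC R (q R y)" "g' : GC R (q R y)"
  "tt R y g $ f R y = tt R y g' $ f R y" for R y g g'
  by (rule bandedD(4)[OF t that(1-4)], rule P.right_cancel[OF fD[OF that(1,2)]
    P.fib_arrow[OF bandedD(2)[OF t that(1-3)]] P.fib_arrow[OF bandedD(2)[OF t that(1,2,4)]]]) (use that in simp)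
 have spec: "c R y g : GC R (q R y) & f R y $ sg R y g = tt R y (c R y g) $ f R y"
  if "cring R" "y : pts Y R" "g : GC R (q R y)" for R y g
 proof -
  note fs = P.fib_comp[OF fD[OF that(1,2)] bandedD(2)[OF s that]] fD[OF that(1,2)]
  obtain e where e: "e : fib P (sob t R y) (sob t R y)" "f R y $ sg R y g = e $ f R y"
   by (rule P.fib_quotient[OF fs])
  have "EX g':GC R (q R y). e = tt R y g'" by (rule bandedD(5)[OF t that(1,2) e(1)])
  then obtain g' where g': "g' : GC R (q R y)" "e = tt R y g'" by blast
  have "EX! g'. g' : GC R (q R y) & f R y $ sg R y g = tt R y g' $ f R y"
   using g' e(2) uniq[OF that(1,2)] by (metis (full_types))
  then show ?thesis unfolding c_def by (rule theI')
 qed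
 note cc = conjunct1[OF spec] and ce = conjunct2[OF spec]
 have c_eq: "c R y g = g'" if "cring R" "y : pts Y R" "g : GC R (q R y)" "g' : GC R (q R y)"
  "f R y $ sg R y g = tt R y g' $ f R y" for R y g g'
  by (rule uniq[OF that(1,2) cc[OF that(1-3)] that(4)]) (use ce[OF that(1-3)] that(5) in simp)
 have c_mult: "c R y (g **\<^sub>(grp G R (q R y)) g') = c R y g **\<^sub>(grp G R (q R y)) c R y g'"
  if a: "cring R" "y : pts Y R" and g: "g : GC R (q R y)" "g' : GC R (q R y)" for R y g g'
 proof -
  interpret H: group "grp G R (q R y)" by (rule grp_group[OF a(1) q.mor_closed[OF a]])
  note fa = P.fib_arrow[OF fD[OF a]] and sa = P.fib_arrow[OF bandedD(2)[OF s a g(1)]] P.fib_arrow[OF bandedD(2)[OF s a g(2)]]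
   and ta = P.fib_arrow[OF bandedD(2)[OF t a cc[OF a g(1)]]] P.fib_arrow[OF bandedD(2)[OF t a cc[OF a g(2)]]]
  have "f R y $ (sg R y g $ sg R y g') = (tt R y (c R y g) $ f R y) $ sg R y g'"
   unfolding ce[OF a g(1), symmetric] by (rule P.arrow_assoc[OF fa sa, symmetric])
  also have "... = tt R y (c R y g) $ (tt R y (c R y g') $ f R y)"
   unfolding ce[OF a g(2), symmetric] by (rule P.arrow_assoc[OF ta(1) fa sa(2)])
  also have "... = (tt R y (c R y g) $ tt R y (c R y g')) $ f R y" by (rule P.arrow_assoc[OF ta fa, symmetric])
  finally show ?thesis
   using cc[OF a g(1)] cc[OF a g(2)] g by (intro c_eq[OF a]) (simp_all add: bandedD(3)[OF s a] bandedD(3)[OF t a])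
 qed
 have c_bij: "bij_betw (c R y) (GC R (q R y)) (GC R (q R y))" if a: "cring R" "y : pts Y R" for R y
  unfolding bij_betw_def
 proof
  show "inj_on (c R y) (GC R (q R y))"
  proof (rule inj_onI)
   fix g g' assume g: "g : GC R (q R y)" "g' : GC R (q R y)" "c R y g = c R y g'"
   have "f R y $ sg R y g = f R y $ sg R y g'" using ce[OF a g(1)] ce[OF a g(2)] g(3) by simp
   then show "g = g'"
    using P.left_cancel[OF P.fib_arrow[OF fD[OF a]] bandedD(2)[OF s a g(1)] bandedD(2)[OF s a g(2)]] bandedD(4)[OF s a g(1,2)] by blast
  qed
  show "c R y ` GC R (q R y) = GC R (q R y)"
  proof
   show "c R y ` GC R (q R y) <= GC R (q R y)" using cc[OF a] by blast
   show "GC R (q R y) <= c R y ` GC R (q R y)"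
   proof
    fix g' assume g': "g' : GC R (q R y)"
    note fa = P.fib_arrow[OF fD[OF a]] and ta = P.fib_arrow[OF bandedD(2)[OF t a g']]
    obtain e where e: "e : fib P (sob t R y) (sob s R y)" "f R y $ e = idn P (sob t R y)" by (rule P.fib_right_inverse[OF fD[OF a]])
    note ea = P.fib_arrow[OF e(1)]
    have m: "e $ (tt R y g' $ f R y) : fib P (sob s R y) (sob s R y)"
     by (rule P.fib_comp[OF e(1) P.fib_comp[OF bandedD(2)[OF t a g'] fD[OF a]]])
    then obtain g where g: "g : GC R (q R y)" "e $ (tt R y g' $ f R y) = sg R y g" using bandedD(5)[OF s a] by blast
    have tf: "P.arrow (tt R y g' $ f R y) (sob s R y) (sob t R y)" by (rule P.arrow_comp[OF ta fa])
    have "f R y $ sg R y g = tt R y g' $ f R y"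
     unfolding g(2)[symmetric] P.arrow_assoc[OF fa ea tf, symmetric] e(2) by (rule P.idn_left[OF tf])
    then have "c R y g = g'" by (rule c_eq[OF a g(1) g'])
    then show "g' : c R y ` GC R (q R y)" using g(1) by blast
   qed
  qed
 qed
 have c_nat: "c R' (pull Y R R' h y) (res G R R' h (q R y) g) = res G R R' h (q R y) (c R y g)"
  if R: "cring R" "cring R'" "h : rhom R R'" and y: "y : pts Y R" and g: "g : GC R (q R y)" for R R' h y g
 proof -
  let ?y = "pull Y R R' h y"
  have y': "?y : pts Y R'" by (rule Y.pull_closed[OF R y])
  have qy: "q R' ?y = pull S R R' h (q R y)" by (rule q.mor_natural[OF R y])
  note qc = q.mor_closed[OF R(1) y]
  have rg: "res G R R' h (q R y) g : GC R' (q R' ?y)" unfolding qy by (rule res_closed[OF R qc g])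
  have rc: "res G R R' h (q R y) (c R y g) : GC R' (q R' ?y)" unfolding qy by (rule res_closed[OF R qc cc[OF R(1) y g]])
  note sa = section_ofD[OF bandedD(1)[OF s] R y] section_ofD[OF bandedD(1)[OF t] R y]
  note fa = P.fib_arrow[OF fD[OF R(1) y]] P.fib_arrow[OF fD[OF R(2) y']]
  note ga = P.fib_arrow[OF bandedD(2)[OF s R(1) y g]] P.fib_arrow[OF bandedD(2)[OF s R(2) y' rg]]
  note ta = P.fib_arrow[OF bandedD(2)[OF t R(1) y cc[OF R(1) y g]]] P.fib_arrow[OF bandedD(2)[OF t R(2) y' rc]]
  note nf = is_arrowD(2)[OF f R(1) y R(2,3)]
  have "sar t R R' h y $ (f R' ?y $ sg R' ?y (res G R R' h (q R y) g)) = (f R y $ sar s R R' h y) $ sg R' ?y (res G R R' h (q R y) g)"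
   unfolding nf by (rule P.arrow_assoc[OF sa(2) fa(2) ga(2), symmetric])
  also have "... = f R y $ (sg R y g $ sar s R R' h y)"
   unfolding bandedD(6)[OF s R(1) y R(2,3) g] by (rule P.arrow_assoc[OF fa(1) sa(1) ga(2)])
  also have "... = (tt R y (c R y g) $ f R y) $ sar s R R' h y"
   unfolding ce[OF R(1) y g, symmetric] by (rule P.arrow_assoc[OF fa(1) ga(1) sa(1), symmetric])
  also have "... = (tt R y (c R y g) $ sar t R R' h y) $ f R' ?y"
   unfolding P.arrow_assoc[OF ta(1) fa(1) sa(1)] nf by (rule P.arrow_assoc[OF ta(1) sa(2) fa(2), symmetric])
  also have "... = sar t R R' h y $ (tt R' ?y (res G R R' h (q R y) (c R y g)) $ f R' ?y)"
   unfolding bandedD(6)[OF t R(1) y R(2,3) cc[OF R(1) y g]] by (rule P.arrow_assoc[OF sa(2) ta(2) fa(2)])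
  finally have "f R' ?y $ sg R' ?y (res G R R' h (q R y) g) = tt R' ?y (res G R R' h (q R y) (c R y g)) $ f R' ?y"
   by (rule P.left_cancel[OF sa(2) P.fib_comp[OF fD[OF R(2) y'] bandedD(2)[OF s R(2) y' rg]]
     P.fib_comp[OF bandedD(2)[OF t R(2) y' rc] fD[OF R(2) y']]])
  then show ?thesis by (rule c_eq[OF R(2) y' rg rc])
 qed

 \<comment> \<open>The candidate for the definite description: the maps \<open>c\<close> at all base
   changes of \<open>y\<close>, extended by \<open>undefined\<close> as local automorphisms must
   be.\<close>
 define w where "w R y = family R (%R' h. restrict (c R' (pull Y R R' h y)) (GC R' (q R' (pull Y R R' h y))))" for R y
 have w_app: "w R y R' h g = c R' (pull Y R R' h y) g"
  if "cring R'" "h : rhom R R'" "g : GC R' (q R' (pull Y R R' h y))" for R y R' h g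
  using that by (simp add: w_def family_app)
 have wA: "w R y : Aut_carrier S G R (q R y)" if R: "cring R" and y: "y : pts Y R" for R y
 proof (rule Aut_carrierI)
  show "family R (w R y) = w R y" by (simp add: w_def family_family)
  fix R' h assume R': "cring R'" "h : rhom R R'"
  let ?y = "pull Y R R' h y"
  have y': "?y : pts Y R'" by (rule Y.pull_closed[OF R R' y])
  have qy: "q R' ?y = pull S R R' h (q R y)" by (rule q.mor_natural[OF R R' y])
  interpret H: group "grp G R' (q R' ?y)" by (rule grp_group[OF R'(1) q.mor_closed[OF R'(1) y']])
  have "restrict (c R' ?y) (GC R' (q R' ?y)) : auto (grp G R' (q R' ?y))"
   using cc[OF R'(1) y'] c_mult[OF R'(1) y'] c_bij[OF R'(1) y']
   by (auto simp: auto_def hom_def Bij_def bij_betw_restrict_eq)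
  then show "w R y R' h : auto (grp G R' (pull S R R' h (q R y)))"
   unfolding w_def family_app[OF R'] qy[symmetric] .
  fix R'' l g assume R'': "cring R''" "l : rhom R' R''" and g: "g : GC R' (pull S R R' h (q R y))"
  have g': "g : GC R' (q R' ?y)" using g qy by simp
  have hl: "cmps R l h : rhom R R''" by (rule rhom_comp[OF R R'(2) R''(2)])
  have pl: "pull Y R R'' (cmps R l h) y = pull Y R' R'' l ?y" by (rule Y.pull_comp[OF R R'(1) R''(1) R'(2) R''(2) y])
  have "res G R' R'' l (q R' ?y) g : GC R'' (q R'' (pull Y R' R'' l ?y))"
   unfolding q.mor_natural[OF R'(1) R'' y'] by (rule res_closed[OF R'(1) R'' q.mor_closed[OF R'(1) y'] g'])
  then show "w R y R'' (cmps R l h) (res G R' R'' l (pull S R R' h (q R y)) g)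
    = res G R' R'' l (pull S R R' h (q R y)) (w R y R' h g)"
   using c_nat[OF R'(1) R'' y' g'] w_app[OF R'(1,2) g'] w_app[OF R''(1) hl, of _ y] pl qy by simp
 qed
 have kw: "k R y = w R y" if R: "cring R" and y: "y : pts Y R" for R y
  unfolding k[OF R y]
 proof (rule the_equality)
  show "?P R y (w R y)"
   using wA[OF R y] w_app ce Y.pull_closed[OF R _ _ y] by simp
  fix u assume u: "?P R y u"
  show "u = w R y"
  proof (rule Aut_eqI[OF conjunct1[OF u] wA[OF R y]])
   fix R' h g assume R': "cring R'" "h : rhom R R'" and g: "g : GC R' (pull S R R' h (q R y))"
   let ?y = "pull Y R R' h y"
   have y': "?y : pts Y R'" by (rule Y.pull_closed[OF R R' y])
   have qy: "q R' ?y = pull S R R' h (q R y)" by (rule q.mor_natural[OF R R' y])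
   have g': "g : GC R' (q R' ?y)" using g qy by simp
   have "c R' ?y g = u R' h g"
    using u R' g' auto_closed[OF conjunct1[OF u] R' g] qy by (intro c_eq[OF R'(1) y' g']) auto
   then show "u R' h g = w R y R' h g" using w_app[OF R' g'] by simp
  qed
 qed
 show "k R y : AC R (q R y)" using kw[OF R y] wA[OF R y] by (simp add: Aut_sheaf_simps)
 have id: "pull Y R R (rid R) y = y" by (rule Y.pull_id[OF R y])
 show "f R y $ sg R y g = tt R y (aut_app R (k R y) g) $ f R y" if g: "g : GC R (q R y)"
  using ce[OF R y g] w_app[OF R rid_rhom[OF R], of g y] g id kw[OF R y] by (simp add: aut_app_def)
 assume R': "cring R'" "h : rhom R R'"
 let ?y = "pull Y R R' h y"
 have y': "?y : pts Y R'" by (rule Y.pull_closed[OF R R' y])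
 have qy: "q R' ?y = pull S R R' h (q R y)" by (rule q.mor_natural[OF R R' y])
 have "w R' ?y = ract R R' h (q R y) (w R y)"
 proof (rule Aut_eqI[OF wA[OF R'(1) y']])
  show "ract R R' h (q R y) (w R y) : Aut_carrier S G R' (q R' ?y)"
   unfolding qy by (rule Aut_res_closed[OF R R' q.mor_closed[OF R y] wA[OF R y]])
  fix R'' l g assume R'': "cring R''" "l : rhom R' R''" and g: "g : GC R'' (pull S R' R'' l (q R' ?y))"
  have g': "g : GC R'' (q R'' (pull Y R' R'' l ?y))" using g q.mor_natural[OF R'(1) R'' y'] by simp
  have hl: "cmps R l h : rhom R R''" by (rule rhom_comp[OF R R'(2) R''(2)])
  have pl: "pull Y R R'' (cmps R l h) y = pull Y R' R'' l ?y" by (rule Y.pull_comp[OF R R'(1) R''(1) R'(2) R''(2) y])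
  show "w R' ?y R'' l g = ract R R' h (q R y) (w R y) R'' l g"
   using w_app[OF R'' g'] w_app[OF R''(1) hl, of g y] g' pl Aut_res_app[OF R''] by simp
 qed
 then show "k R' ?y = ract R R' h (q R y) (k R y)" using kw[OF R y] kw[OF R'(1) y'] by simp
qed

end

section \<open>Images of objects under morphisms of stacks\<close>

text \<open>\<open>image_obj\<close> with a morphism of stacks applied along a face \<open>c\<close>
  of the simplex, as needed for \<epsilon> on the edges of a triangle.\<close>

definition image_section :: "('x, 'o, 'a) fmor => ('x list => 'x list) => ('r, 'x list, 'o, 'a) csect => ('r, 'x list, 'o, 'a) csect" where
 "image_section F c s = \<lparr>sob = %R xs. fob F (c xs) (sob s R xs), sar = %R R' h xs. far F (c xs) (sar s R R' h xs)\<rparr>"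

context gerbe_space
begin

lemma over_open: assumes V: "stable_open V" shows "gerbe_over S G X p P (subfunctor X V) p"
proof -
 have "point_functor (subfunctor X V)"
  by unfold_locales (simp_all add: subfunctor_def stable_openD(1,2)[OF V] X.pull_id X.pull_comp)
 moreover have "functor_morphism (subfunctor X V) S p"
  by unfold_locales (simp_all add: subfunctor_def stable_openD(1)[OF V] p.mor_closed p.mor_natural)
 ultimately show ?thesis
  using gerbe_space_axioms unfolding gerbe_over_def gerbe_over_axioms_def by blast
qed

lemma over_simplices:
 assumes V: "stable_open V" shows "gerbe_over S G X p P (simplices X p V n) (%R xs. bp R xs)"
proof -
 have pX: "x : pts X R" if "cring R" "xs : spx X p V n R" "x : set xs" for R xs x
  using spxD(2)[OF that(2)] stable_openD(1)[OF V that(1)] that(3) by blast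
 have "point_functor (simplices X p V n)"
 proof
  show "pull (simplices X p V n) R R' h xs : spx X p V n R'"
   if "cring R" "cring R'" "h : rhom R R'" "xs : spx X p V n R" for R R' h xs
   unfolding spx_pull by (rule simplex_pull[OF V that])
  show "pull (simplices X p V n) R R (rid R) xs = xs" if "cring R" "xs : spx X p V n R" for R xs
   unfolding spx_pull using X.pull_id[OF that(1) pX[OF that]] by (simp add: map_idI)
  show "pull (simplices X p V n) R R'' (cmps R k h) xs
    = pull (simplices X p V n) R' R'' k (pull (simplices X p V n) R R' h xs)"
   if "cring R" "cring R'" "cring R''" "h : rhom R R'" "k : rhom R' R''" "xs : spx X p V n R" for R R' R'' h k xs
   unfolding spx_pull using X.pull_comp[OF that(1-5) pX[OF that(1,6)]] by simp
 qed
 moreover have "functor_morphism (simplices X p V n) S (%R xs. bp R xs)"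
  by unfold_locales (simp_all add: spx_pull spx_base[OF V])
 ultimately show ?thesis
  using gerbe_space_axioms unfolding gerbe_over_def gerbe_over_axioms_def by blast
qed

lemma far_fib:
 assumes F: "stack_morphism P (simplices X p (pts X) k) b' a' F"
  and ys: "over P (simplices X p (pts X) k) b' ys ob'" and f: "f : fib P ob ob'"
 shows "far F ys f : fib P (fob F ys ob) (fob F ys ob')" "pull_along P (simplices X p (pts X) k) f ys = ys"
  "over P (simplices X p (pts X) k) b' ys ob"
proof -
 interpret F: stack_morphism P "simplices X p (pts X) k" b' a' F by (rule F)
 have fD: "f : ars P" "src P f = ob" "tgt P f = ob'" "brg P ob = brg P ob'" "bhom P f = rid (brg P ob')"
  using f by (simp_all add: fib_def)
 have y: "ys : spx X p (pts X) k (brg P ob')" and R: "cring (brg P ob')"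
  using ys P.obj_base[of ob'] by (simp_all add: over_def)
 have "pull X (brg P ob') (brg P ob') (rid (brg P ob')) x = x" if "x : set ys" for x
  using X.pull_id[OF R] spxD(2)[OF y] that by blast
 then show pa: "pull_along P (simplices X p (pts X) k) f ys = ys" by (simp add: fD spx_pull map_idI)
 have "bpt P ob = bpt P ob'" using P.arr_base[OF fD(1)] fD X.pull_id[OF R] P.obj_base[of ob'] ys by (simp add: over_def)
 then show o: "over P (simplices X p (pts X) k) b' ys ob" using ys fD P.fib_obs(1)[OF f] by (simp add: over_def)
 show "far F ys f : fib P (fob F ys ob) (fob F ys ob')"
  using F.far[OF fD(1), of ys] ys pa F.fob[OF ys] F.fob[OF o] fD by (simp add: fib_def)
qed

end

section \<open>Objects over schemes of simplices\<close>

locale simplex_objects = gerbe_space +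
 fixes V and n :: nat
 assumes V: "stable_open V"
begin

sublocale D: gerbe_over S G X p P "simplices X p V n" "%R xs. bp R xs" by (rule over_simplices[OF V])

notation P.arr_comp (infixr \<open>$\<close> 75)

text \<open>The index records the vertex over which the object lies; \<epsilon> along the edge from
  \<open>a\<close> to \<open>b\<close> moves it from \<open>b\<close> to \<open>a\<close>, and
  composites are typed by these indices.\<close>

definition obj_over where
 "obj_over b s \<longleftrightarrow> (ALL R xs. cring R & xs : spx X p V n R -->
   sob s R xs : obs P & brg P (sob s R xs) = R & bpt P (sob s R xs) = xs ! b) &
  (ALL R R' h xs. cring R & cring R' & h : rhom R R' & xs : spx X p V n R -->
   P.arrow (sar s R R' h xs) (sob s R' (map (pull X R R' h) xs)) (sob s R xs) & bhom P (sar s R R' h xs) = h)"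

lemma obj_overD:
 assumes "obj_over b s" "cring R" "xs : spx X p V n R"
 shows "sob s R xs : obs P" "brg P (sob s R xs) = R" "bpt P (sob s R xs) = xs ! b"
  "cring R' ==> h : rhom R R' ==> P.arrow (sar s R R' h xs) (sob s R' (map (pull X R R' h) xs)) (sob s R xs)"
  "cring R' ==> h : rhom R R' ==> bhom P (sar s R R' h xs) = h"
 using assms unfolding obj_over_def by blast+

lemma obj_section: "obj_over b s ==> D.section_of s"
 unfolding D.section_of_def spx_pull using obj_overD(4) by blast

lemma proj_obj:
 assumes s: "is_object P (subfunctor X W) (%R x. x) s" and W: "!!R. cring R ==> V R <= W R" and b: "b <= n"
 shows "obj_over b (proj_pull b s)"
 unfolding obj_over_def
proof (intro conjI allI impI; elim conjE)
 have v: "xs ! b : W R" "length xs = Suc n" if "cring R" "xs : spx X p V n R" for R xs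
 proof -
  show "length xs = Suc n" by (rule spxD(1)[OF that(2)])
  then have "xs ! b : set xs" using b by simp
  then show "xs ! b : W R" using spxD(2)[OF that(2)] W[OF that(1)] by blast
 qed
 show "sob (proj_pull b s) R xs : obs P" "brg P (sob (proj_pull b s) R xs) = R" "bpt P (sob (proj_pull b s) R xs) = xs ! b"
  if "cring R" "xs : spx X p V n R" for R xs
  using s v(1)[OF that] that(1) by (simp_all add: is_object_def proj_pull_def subfunctor_def)
 show "P.arrow (sar (proj_pull b s) R R' h xs) (sob (proj_pull b s) R' (map (pull X R R' h) xs)) (sob (proj_pull b s) R xs)"
  "bhom P (sar (proj_pull b s) R R' h xs) = h"
  if "cring R" "cring R'" "h : rhom R R'" "xs : spx X p V n R" for R R' h xs
  using s v[OF that(1,4)] that(1-3) b by (simp_all add: is_object_def proj_pull_def subfunctor_def P.arrow_def)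
qed

lemma vertex:
 assumes b: "b <= n" and R: "cring R" and xs: "xs : spx X p V n R"
 shows "xs ! b : V R" "p R (xs ! b) = bp R xs" "map f xs ! b = f (xs ! b)"
proof -
 have l: "b < length xs" using b spxD(1)[OF xs] by simp
 then have m: "xs ! b : set xs" by simp
 show "xs ! b : V R" by (rule subsetD[OF spxD(2)[OF xs] m])
 show "p R (xs ! b) = bp R xs" by (rule spxD(3)[OF xs m spxD(6)[OF xs]])
 show "map f xs ! b = f (xs ! b)" by (rule nth_map[OF l])
qed

lemma proj_arrow:
 assumes f: "is_arrow P (subfunctor X W) s t f" and W: "!!R. cring R ==> V R <= W R" and b: "b <= n"
 shows "is_arrow P (simplices X p V n) (proj_pull b s) (proj_pull b t) (%R xs. f R (xs ! b))"
 unfolding is_arrow_def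
proof (intro conjI allI impI; (elim conjE)?)
 show "f R (xs ! b) : fib P (sob (proj_pull b s) R xs) (sob (proj_pull b t) R xs)"
  if "cring R" "xs : spx X p V n R" for R xs
  using f vertex[OF b that] W[OF that(1)] that(1) by (auto simp: is_arrow_def proj_pull_def subfunctor_def)
 show "f R (xs ! b) $ sar (proj_pull b s) R R' h xs
   = sar (proj_pull b t) R R' h xs $ f R' (pull (simplices X p V n) R R' h xs ! b)"
  if "cring R" "cring R'" "h : rhom R R'" "xs : spx X p V n R" for R R' h xs
  unfolding spx_pull vertex(3)[OF b that(1,4)]
  using f vertex[OF b that(1,4)] W[OF that(1)] that(1-3) by (auto simp: is_arrow_def proj_pull_def subfunctor_def)
qed

lemma proj_banded:
 assumes th: "is_band P GX (subfunctor X W) s tt" and s: "is_object P (subfunctor X W) (%R x. x) s"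
  and W: "!!R. cring R ==> V R <= W R" and b: "b <= n"
 shows "D.banded (proj_pull b s) (%R xs. tt R (xs ! b))"
 unfolding D.banded_def
proof (intro conjI allI impI; (elim conjE)?)
 show "D.section_of (proj_pull b s)" by (rule obj_section[OF proj_obj[OF s W b]])
 show "tt R (xs ! b) : iso (grp G R (bp R xs)) (aut_group P (sob (proj_pull b s) R xs))"
  if "cring R" "xs : spx X p V n R" for R xs
 proof -
  have "xs ! b : W R" using vertex(1)[OF b that] W[OF that(1)] by blast
  then have "tt R (xs ! b) : iso (grp G R (p R (xs ! b))) (aut_group P (sob s R (xs ! b)))"
   using th that(1) by (simp add: is_band_def subfunctor_def)
  then show ?thesis unfolding vertex(2)[OF b that] by (simp add: proj_pull_def)
 qed
 show "tt R (xs ! b) g $ sar (proj_pull b s) R R' h xs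
   = sar (proj_pull b s) R R' h xs $ tt R' (pull (simplices X p V n) R R' h xs ! b) (res G R R' h (bp R xs) g)"
  if "cring R" "cring R'" "h : rhom R R'" "xs : spx X p V n R" "g : GC R (bp R xs)" for R R' h xs g
 proof -
  have "xs ! b : W R" using vertex(1)[OF b that(1,4)] W[OF that(1)] by blast
  then show ?thesis
   unfolding spx_pull vertex(3)[OF b that(1,4)]
   using th that(1-3,5) vertex(2)[OF b that(1,4)] by (simp add: is_band_def subfunctor_def proj_pull_def)
 qed
qed

end

text \<open>A face \<open>c\<close> of an \<open>n\<close>-simplex, whose vertices \<open>a'\<close> and \<open>b'\<close> are the vertices \<open>a\<close> and \<open>b\<close> of the simplex.\<close>

locale face_image = simplex_objects S G X p P V n + stack_morphism P "simplices X p (pts X) k" b' a' F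
 for S :: "('r, 's) pfunctor" and G :: "('r, 's, 'g) gfunctor"
  and X :: "('r, 'x) pfunctor" and p :: "'r ring => 'x => 's" and P :: "('r, 'x, 'o, 'a) fcat"
  and V :: "'r ring => 'x set" and n k b' a' :: nat and F :: "('x, 'o, 'a) fmor" +
 fixes c :: "'x list => 'x list" and a b :: nat
 assumes c: "length xs = Suc n ==> set (c xs) <= set xs & length (c xs) = Suc k & c xs ! b' = xs ! b & c xs ! a' = xs ! a"
  and c_map: "length xs = Suc n ==> c (map f xs) = map f (c xs)"
begin

lemma F: "stack_morphism P (simplices X p (pts X) k) b' a' F"
 by (rule stack_morphism_axioms)

lemma over_face:
 assumes s: "obj_over b s" and R: "cring R" and xs: "xs : spx X p V n R"
 shows "over P (simplices X p (pts X) k) b' (c xs) (sob s R xs)"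
proof -
 note l = spxD(1)[OF xs]
 note cl = c[OF l]
 note sub = conjunct1[OF cl] and len = conjunct1[OF conjunct2[OF cl]] and vb = conjunct1[OF conjunct2[OF conjunct2[OF cl]]]
 have "set (c xs) <= pts X R"
 proof
  fix x assume "x : set (c xs)"
  then show "x : pts X R" by (rule stable_openD(1)[OF V R subsetD[OF spxD(2)[OF xs] subsetD[OF sub]]])
 qed
 then have "c xs : spx X p (pts X) k R"
  by (rule spx_mono[OF spx_subset[OF xs sub len]])
 then show ?thesis unfolding over_def obj_overD(2)[OF s R xs] using obj_overD(1,3)[OF s R xs] vb by metis
qed

lemma pull_face:
 assumes s: "obj_over b s" and R: "cring R" "cring R'" "h : rhom R R'" and xs: "xs : spx X p V n R"
 shows "pull_along P (simplices X p (pts X) k) (sar s R R' h xs) (c xs) = c (map (pull X R R' h) xs)"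
proof -
 have xs': "map (pull X R R' h) xs : spx X p V n R'" by (rule simplex_pull[OF V R xs])
 show ?thesis
  using obj_overD(4,5)[OF s R(1) xs R(2,3)] obj_overD(2)[OF s R(1) xs] obj_overD(2)[OF s R(2) xs'] c_map[OF spxD(1)[OF xs]]
  by (simp add: P.arrow_def spx_pull)
qed

lemma image_obj_over:
 assumes s: "obj_over b s" shows "obj_over a (image_section F c s)"
 unfolding obj_over_def image_section_def
proof (intro conjI allI impI; (elim conjE)?; simp)
 fix R xs assume a: "cring R" "xs : spx X p V n R"
 note f = fob[OF over_face[OF s a]]
 show "fob F (c xs) (sob s R xs) : obs P" "brg P (fob F (c xs) (sob s R xs)) = R" "bpt P (fob F (c xs) (sob s R xs)) = xs ! a"
  using f obj_overD(2)[OF s a] conjunct2[OF conjunct2[OF conjunct2[OF c[OF spxD(1)[OF a(2)]]]]] unfolding over_def by metis+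
next
 fix R R' h xs assume a: "cring R" "cring R'" "h : rhom R R'" "xs : spx X p V n R"
 note d = obj_overD(4,5)[OF s a(1,4,2,3)]
 have "sar s R R' h xs : ars P" "over P (simplices X p (pts X) k) b' (c xs) (tgt P (sar s R R' h xs))"
  using d over_face[OF s a(1,4)] by (simp_all add: P.arrow_def)
 note f = far[OF this]
 show "P.arrow (far F (c xs) (sar s R R' h xs)) (fob F (c (map (pull X R R' h) xs)) (sob s R' (map (pull X R R' h) xs))) (fob F (c xs) (sob s R xs))"
  "bhom P (far F (c xs) (sar s R R' h xs)) = h"
  using f d pull_face[OF s a] by (simp_all add: P.arrow_def)
qed

lemma image_fib:
 assumes t: "obj_over b t" and R: "cring R" and xs: "xs : spx X p V n R" and f: "f : fib P ob (sob t R xs)"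
 shows "far F (c xs) f : fib P (fob F (c xs) ob) (fob F (c xs) (sob t R xs))"
  "P.arrow g ob' ob ==> far F (c xs) (f $ g) = far F (c xs) f $ far F (c xs) g"
proof -
 note o = over_face[OF t R xs] note ff = far_fib[OF F o f]
 show "far F (c xs) f : fib P (fob F (c xs) ob) (fob F (c xs) (sob t R xs))" by (rule ff(1))
 show "far F (c xs) (f $ g) = far F (c xs) f $ far F (c xs) g" if "P.arrow g ob' ob"
  using far_cmp[of f g "c xs"] P.fib_arrow[OF f] that o ff(2) by (simp add: P.arrow_def)
qed

lemma image_arrow:
 assumes s: "obj_over b s" and t: "obj_over b t" and f: "is_arrow P (simplices X p V n) s t f"
 shows "is_arrow P (simplices X p V n) (image_section F c s) (image_section F c t) (%R xs. far F (c xs) (f R xs))"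
 unfolding is_arrow_def
proof (intro conjI allI impI; (elim conjE)?)
 show "far F (c xs) (f R xs) : fib P (sob (image_section F c s) R xs) (sob (image_section F c t) R xs)"
  if "cring R" "xs : spx X p V n R" for R xs
  using image_fib(1)[OF t that D.is_arrowD(1)[OF f that]] by (simp add: image_section_def)
 fix R R' h xs assume a: "cring R" "cring R'" "h : rhom R R'" "xs : spx X p V n R"
 let ?xs = "map (pull X R R' h) xs"
 have xs': "?xs : spx X p V n R'" by (rule simplex_pull[OF V a])
 note n = D.is_arrowD(2)[OF f a(1,4,2,3), unfolded spx_pull]
 note sa = obj_overD(4)[OF s a(1,4,2,3)] and ta = obj_overD(4)[OF t a(1,4,2,3)]
 note f' = P.fib_arrow[OF D.is_arrowD(1)[OF f a(2) xs']]
 have "far F (c xs) (sar t R R' h xs $ f R' ?xs) = far F (c xs) (sar t R R' h xs) $ far F (c ?xs) (f R' ?xs)"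
  using far_cmp[of "sar t R R' h xs" "f R' ?xs" "c xs"] ta f' over_face[OF t a(1,4)] pull_face[OF t a]
  by (simp add: P.arrow_def)
 then show "far F (c xs) (f R xs) $ sar (image_section F c s) R R' h xs
   = sar (image_section F c t) R R' h xs $ far F (c (pull (simplices X p V n) R R' h xs)) (f R' (pull (simplices X p V n) R R' h xs))"
  using image_fib(2)[OF t a(1,4) D.is_arrowD(1)[OF f a(1,4)] sa] n by (simp add: image_section_def spx_pull)
qed

text \<open>A morphism of stacks that is bijective on automorphisms transports the band. For
  \<epsilon> this equips the source of \<open>gm'\<close> with a band, so that conjugation by
  \<open>gm'\<close> makes sense.\<close>

lemma image_banded:
 assumes s: "obj_over b s" and th: "D.banded s tt"
  and bij: "!!R xs. cring R ==> xs : spx X p V n R ==> bij_betw (far F (c xs)) (fib P (sob s R xs) (sob s R xs))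
   (fib P (fob F (c xs) (sob s R xs)) (fob F (c xs) (sob s R xs)))"
 shows "D.banded (image_section F c s) (%R xs g. far F (c xs) (tt R xs g))"
 unfolding D.banded_def
proof (intro conjI allI impI; (elim conjE)?)
 show "D.section_of (image_section F c s)" by (rule obj_section[OF image_obj_over[OF s]])
 fix R xs assume a: "cring R" "xs : spx X p V n R"
 let ?H = "grp G R (bp R xs)"
 have "tt R xs : iso ?H (aut_group P (sob s R xs))" using th a unfolding D.banded_def by blast
 then have th': "bij_betw (tt R xs) (carrier ?H) (fib P (sob s R xs) (sob s R xs))" by (simp add: iso_def aut_group_def)
 have "bij_betw (%g. far F (c xs) (tt R xs g)) (carrier ?H) (fib P (fob F (c xs) (sob s R xs)) (fob F (c xs) (sob s R xs)))"
  using bij_betw_trans[OF th' bij[OF a]] by (simp add: comp_def)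
 moreover have "far F (c xs) (tt R xs (g **\<^sub>?H g')) = far F (c xs) (tt R xs g) $ far F (c xs) (tt R xs g')"
  if "g : carrier ?H" "g' : carrier ?H" for g g'
  unfolding D.bandedD(3)[OF th a that]
  by (rule image_fib(2)[OF s a D.bandedD(2)[OF th a that(1)] P.fib_arrow[OF D.bandedD(2)[OF th a that(2)]]])
 ultimately show "(%g. far F (c xs) (tt R xs g)) : iso ?H (aut_group P (sob (image_section F c s) R xs))"
  by (auto simp: iso_def hom_def aut_group_def image_section_def bij_betw_def)
next
 fix R R' h xs g assume a: "cring R" "cring R'" "h : rhom R R'" "xs : spx X p V n R" and g: "g : GC R (bp R xs)"
 let ?xs = "map (pull X R R' h) xs"
 have xs': "?xs : spx X p V n R'" by (rule simplex_pull[OF V a])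
 note sa = obj_overD(4)[OF s a(1,4,2,3)]
 have rg: "res G R R' h (bp R xs) g : GC R' (bp R' ?xs)"
  using res_closed[OF a(1-3) spx_base(1)[OF V a(1,4)] g] spx_base(3,4)[OF V a(1,4,2,3)] by simp
 note f' = P.fib_arrow[OF D.bandedD(2)[OF th a(2) xs' rg]]
 note n = D.bandedD(6)[OF th a(1,4,2,3) g, unfolded spx_pull]
 have "far F (c xs) (sar s R R' h xs $ tt R' ?xs (res G R R' h (bp R xs) g))
   = far F (c xs) (sar s R R' h xs) $ far F (c ?xs) (tt R' ?xs (res G R R' h (bp R xs) g))"
  using far_cmp[of "sar s R R' h xs" _ "c xs"] sa f' over_face[OF s a(1,4)] pull_face[OF s a] by (simp add: P.arrow_def)
 then show "far F (c xs) (tt R xs g) $ sar (image_section F c s) R R' h xs = sar (image_section F c s) R R' h xs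
   $ far F (c (pull (simplices X p V n) R R' h xs)) (tt R' (pull (simplices X p V n) R R' h xs) (res G R R' h (bp R xs) g))"
  using image_fib(2)[OF s a(1,4) D.bandedD(2)[OF th a(1,4) g] sa] n by (simp add: image_section_def spx_pull)
qed

end

section \<open>The local data\<close>

context gerbe_space
begin

lemma restrict_arrow:
 assumes "is_arrow P Y s t f" "pull Y' = pull Y" "!!R. cring R ==> pts Y' R <= pts Y R"
 shows "is_arrow P Y' s t f"
 using assms(1,3) unfolding is_arrow_def assms(2) by (meson subsetD)

lemma restrict_open_arrow:
 assumes "is_arrow P (subfunctor X W) s t f" "!!R. cring R ==> V R <= W R"
 shows "is_arrow P (subfunctor X V) s t f"
 by (rule restrict_arrow[OF assms(1)]) (use assms(2) in "simp_all add: subfunctor_def")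

lemma restrict_simplex_arrow:
 assumes "is_arrow P (simplices X p W n) s t f" "!!R. cring R ==> V R <= W R"
 shows "is_arrow P (simplices X p V n) s t f"
proof (rule restrict_arrow[OF assms(1)])
 fix R :: "'r ring" assume R: "cring R"
 show "spx X p V n R <= spx X p W n R"
 proof
  fix xs assume xs: "xs : spx X p V n R"
  have "set xs <= W R" using spxD(2)[OF xs] assms(2)[OF R] by blast
  then show "xs : spx X p W n R" by (rule spx_mono[OF xs])
 qed
qed (simp add: simplices_def)

lemma open_banded:
 assumes V: "stable_open V" and s: "is_object P (subfunctor X W) (%R x. x) s" and W: "!!R. cring R ==> V R <= W R"
  and th: "is_band P GX (subfunctor X W) s tt"
 shows "gerbe_over.banded G P (subfunctor X V) p s tt"
proof -
 interpret O: gerbe_over S G X p P "subfunctor X V" p by (rule over_open[OF V])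
 have "O.section_of s"
  unfolding O.section_of_def
 proof (intro allI impI; elim conjE)
  fix R R' h y assume a: "cring R" "cring R'" "h : rhom R R'" "y : pts (subfunctor X V) R"
  then have "y : W R" using W[OF a(1)] by (auto simp: subfunctor_def)
  then show "P.arrow (sar s R R' h y) (sob s R' (pull (subfunctor X V) R R' h y)) (sob s R y)"
   using s a(1-3) by (simp add: is_object_def subfunctor_def P.arrow_def)
 qed
 moreover have "tt R y : iso (grp G R (p R y)) (aut_group P (sob s R y))" if "cring R" "y : V R" for R y
  using th that(1) subsetD[OF W[OF that(1)] that(2)] by (simp add: is_band_def subfunctor_def)
 moreover have "fcat.cmp P (tt R y g) (sar s R R' h y) = fcat.cmp P (sar s R R' h y) (tt R' (pull X R R' h y) (res G R R' h (p R y) g))"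
  if "cring R" "cring R'" "h : rhom R R'" "y : V R" "g : GC R (p R y)" for R R' h y g
  using th that(1-3,5) subsetD[OF W[OF that(1)] that(4)] by (simp add: is_band_def subfunctor_def)
 ultimately show ?thesis unfolding O.banded_def by (simp add: subfunctor_def)
qed

end

section \<open>Connection and curving applied to faces\<close>

locale gerbe_curving = gerbe_space S G X p P + conn: connection X p P ep \<eta> + curv: curving X p P ep \<eta> ka K \<zeta>
 for S :: "('r, 's) pfunctor" and G :: "('r, 's, 'g) gfunctor"
  and X :: "('r, 'x) pfunctor" and p :: "'r ring => 'x => 's" and P :: "('r, 'x, 'o, 'a) fcat"
  and ep ka :: "('x, 'o, 'a) fmor" and \<eta> :: "'o => 'a" and K \<zeta> :: "'x list => 'o => 'a"
begin

abbreviation "im a b == image_section ep (%xs. [xs ! a, xs ! b])"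

lemma ep: "stack_morphism P (simplices X p (pts X) 1) 1 0 ep"
 using conn.equivalence by (simp add: stack_equivalence_def)

lemma ep_bij: "over P (simplices X p (pts X) 1) 1 xs c ==> bij_betw (far ep xs) (fib P c c) (fib P (fob ep xs c) (fob ep xs c))"
 using conn.equivalence by (simp add: stack_equivalence_def)

lemma edge_face:
 assumes V: "stable_open V" and ab: "a <= n" "b <= n"
 shows "face_image S G X p P V n 1 1 0 ep (%xs. [xs ! a, xs ! b]) a b"
proof -
 interpret simplex_objects S G X p P V n by unfold_locales (rule V)
 interpret e: stack_morphism P "simplices X p (pts X) 1" 1 0 ep by (rule ep)
 show ?thesis by unfold_locales (use ab in auto)
qed

lemma edge_identity:
 assumes V: "stable_open V" shows "face_image S G X p P V 1 1 1 0 ep (%xs. xs) 0 1"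
proof -
 interpret simplex_objects S G X p P V 1 by unfold_locales (rule V)
 interpret e: stack_morphism P "simplices X p (pts X) 1" 1 0 ep by (rule ep)
 show ?thesis by unfold_locales auto
qed

lemma triangle_identity:
 assumes V: "stable_open V" shows "face_image S G X p P V 2 2 0 0 ka (%xs. xs) 0 0"
proof -
 interpret simplex_objects S G X p P V 2 by unfold_locales (rule V)
 interpret e: stack_morphism P "simplices X p (pts X) 2" 0 0 ka by (rule curv.fake_curvature)
 show ?thesis by unfold_locales auto
qed

lemma image_section_id: "image_section F (%xs. xs) s = image_obj F s"
 by (simp add: image_section_def image_obj_def)

lemma edge_arrow:
 assumes V: "stable_open V" and ab: "a <= n" "b <= n"
  and f: "is_arrow P (simplices X p V 1) (image_obj ep (proj_pull 1 s)) (proj_pull 0 s) f"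
 shows "is_arrow P (simplices X p V n) (im a b (proj_pull b s)) (proj_pull a s)
  (%R xs. f R [xs ! a, xs ! b])"
 unfolding is_arrow_def
proof (intro conjI allI impI; (elim conjE)?)
 have e: "[xs ! a, xs ! b] : spx X p V 1 R" "map h [xs ! a, xs ! b] = [map h xs ! a, map h xs ! b]"
  if "xs : spx X p V n R" for R xs and h :: "'x => 'x"
 proof -
  have l: "a < length xs" "b < length xs" using ab spxD(1)[OF that] by simp_all
  show "[xs ! a, xs ! b] : spx X p V 1 R" by (rule spx_subset[OF that]) (use l in simp_all)
  show "map h [xs ! a, xs ! b] = [map h xs ! a, map h xs ! b]" using l by simp
 qed
 show "f R [xs ! a, xs ! b] : fib P (sob (im a b (proj_pull b s)) R xs) (sob (proj_pull a s) R xs)"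
  if "cring R" "xs : spx X p V n R" for R xs
 proof -
  have "f R [xs ! a, xs ! b] : fib P (sob (image_obj ep (proj_pull 1 s)) R [xs ! a, xs ! b]) (sob (proj_pull 0 s) R [xs ! a, xs ! b])"
   using f that(1) e(1)[OF that(2)] unfolding is_arrow_def by blast
  then show ?thesis by (simp add: image_section_def image_obj_def proj_pull_def)
 qed
 fix R R' h xs assume r: "cring R" "cring R'" "h : rhom R R'" and xs: "xs : spx X p V n R"
 have "fcat.cmp P (f R [xs ! a, xs ! b]) (sar (image_obj ep (proj_pull 1 s)) R R' h [xs ! a, xs ! b])
   = fcat.cmp P (sar (proj_pull 0 s) R R' h [xs ! a, xs ! b]) (f R' (map (pull X R R' h) [xs ! a, xs ! b]))"
  using f r e(1)[OF xs] unfolding is_arrow_def spx_pull by blast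
 then show "fcat.cmp P (f R [xs ! a, xs ! b]) (sar (im a b (proj_pull b s)) R R' h xs)
   = fcat.cmp P (sar (proj_pull a s) R R' h xs)
     (f R' [pull (simplices X p V n) R R' h xs ! a, pull (simplices X p V n) R R' h xs ! b])"
  unfolding e(2)[OF xs] by (simp add: image_section_def image_obj_def proj_pull_def spx_pull)
qed

lemma curving_arrow:
 assumes V: "stable_open V" and s: "is_object P (subfunctor X W) (%R x. x) s" and W: "!!R. cring R ==> V R <= W R"
 shows "is_arrow P (simplices X p V 2)
  (im 0 1 (im 1 2 (proj_pull 2 s)))
  (image_section ka (%xs. xs) (im 0 2 (proj_pull 2 s)))
  (%R xs. K xs (sob s R (xs ! 2)))"
 unfolding is_arrow_def
proof (intro conjI allI impI; (elim conjE)?)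
 interpret so: simplex_objects S G X p P V 2 by unfold_locales (rule V)
 have ob: "so.obj_over 2 (proj_pull 2 s)" by (rule so.proj_obj[OF s W]) simp_all
 have ov: "over P (simplices X p (pts X) 2) 2 xs (sob s R (xs ! 2))" "EX x y z. xs = [x, y, z]"
  if "cring R" "xs : spx X p V 2 R" for R xs
 proof -
  have "set xs <= pts X R" using spxD(2)[OF that(2)] stable_openD(1)[OF V that(1)] by blast
  then have "xs : spx X p (pts X) 2 R" by (rule spx_mono[OF that(2)])
  then show "over P (simplices X p (pts X) 2) 2 xs (sob s R (xs ! 2))"
   using so.obj_overD(1-3)[OF ob that] by (simp add: over_def proj_pull_def)
  show "EX x y z. xs = [x, y, z]" using spxD(1)[OF that(2)] by (simp add: length_simps)
 qed
 show "K xs (sob s R (xs ! 2)) : fib P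
   (sob (im 0 1 (im 1 2 (proj_pull 2 s))) R xs)
   (sob (image_section ka (%xs. xs) (im 0 2 (proj_pull 2 s))) R xs)"
  if a: "cring R" "xs : spx X p V 2 R" for R xs
 proof -
  obtain x y z where x: "xs = [x, y, z]" using ov(2)[OF a] by blast
  show ?thesis using curv.K_component[of x y z "sob s R z"] ov(1)[OF a] by (simp add: x image_section_def proj_pull_def)
 qed
 fix R R' h xs assume a: "cring R" "cring R'" "h : rhom R R'" "xs : spx X p V 2 R"
 obtain x y z where x: "xs = [x, y, z]" using ov(2)[OF a(1,4)] by blast
 have xs': "map (pull X R R' h) xs : spx X p V 2 R'" by (rule simplex_pull[OF V a])
 note f = so.obj_overD(4,5)[OF ob a(1,4,2,3), unfolded P.arrow_def] so.obj_overD(2)[OF ob a(1,4)] so.obj_overD(2)[OF ob a(2) xs']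
 show "fcat.cmp P (K xs (sob s R (xs ! 2)))
   (sar (im 0 1 (im 1 2 (proj_pull 2 s))) R R' h xs)
  = fcat.cmp P (sar (image_section ka (%xs. xs) (im 0 2 (proj_pull 2 s))) R R' h xs)
   (K (pull (simplices X p V 2) R R' h xs) (sob s R' (pull (simplices X p V 2) R R' h xs ! 2)))"
  using curv.K_natural[of "sar s R R' h z" x y z] f ov(1)[OF a(1,4)]
  by (simp add: x image_section_def proj_pull_def spx_pull)
qed

end

section \<open>Existence, naturality and degeneracy of the local data\<close>

locale local_data = gerbe_curving +
 fixes U x th ph gm' dl' lam g m gm B
 assumes U: "open_sub X (U i)"
  and x: "is_object P (subfunctor X (U i)) (%R x. x) (x i)"
  and th: "is_band P GX (subfunctor X (U i)) (x i) (th i)"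
  and ph: "is_arrow P (subfunctor X (%R. U i R Int U j R)) (x j) (x i) (ph i j)"
  and gm': "is_arrow P (simplices X p (U i) 1) (image_obj ep (proj_pull 1 (x i))) (proj_pull 0 (x i)) (gm' i)"
  and gm'_diagonal: "cring R ==> y : U i R ==> gm' i R [y, y] = \<eta> (sob (x i) R y)"
  and dl': "is_arrow P (simplices X p (U i) 2) (image_obj ka (proj_pull 0 (x i))) (proj_pull 0 (x i)) (dl' i)"
  and dl'_degenerate: "cring R ==> ys : spx X p (U i) 2 R ==>
    degenerate ys ==> dl' i R ys = \<zeta> ys (sob (x i) R (hd ys))"
  and lam: "lam i j = lambda_of X GX AX P (th i) (th j) (ph i j)"
  and g: "g i j k = cocycle_of GX P (th i) (ph i j) (ph j k) (ph i k)"
  and m: "m i = m_of X GX AX P ep (th i) (gm' i)"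
  and gm: "gm i j = gamma_of GX P ep (th i) (ph i j) (gm' i) (gm' j)"
  and B: "B i = B_of GX P ep ka K (th i) (x i) (gm' i) (dl' i)"
begin

notation P.arr_comp (infixr \<open>$\<close> 75)

abbreviation "U2 i j == (%R. U i R Int U j R)"
abbreviation "U3 i j k == (%R. U i R Int U j R Int U k R)"

lemma stable: "stable_open (U i)" "stable_open (U2 i j)" "stable_open (U3 i j k)"
 by (intro stable_open_Int open_sub_stable[OF U])+

lemma
 assumes R: "cring R" and y: "y : U2 i j R"
 shows lam_closed: "lam i j R y : AC R (p R y)"
  and lam_conj: "c : GC R (p R y) ==>
   ph i j R y $ th j R y c = th i R y (aut_app R (lam i j R y) c) $ ph i j R y"
  and lam_natural: "cring R' ==> h : rhom R R' ==> lam i j R' (pull X R R' h y) = ract R R' h (p R y) (lam i j R y)"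
proof goal_cases
 interpret O: gerbe_over S G X p P "subfunctor X (U2 i j)" p by (rule over_open[OF stable(2)])
 have y': "y : pts (subfunctor X (U2 i j)) R" using y by (simp add: subfunctor_def)
 have bi: "O.banded (x i) (th i)" and bj: "O.banded (x j) (th j)"
  by (rule open_banded[OF stable(2) x _ th]; simp)+
 have k: "lam i j R y = (THE u. u : Aut_carrier S G R (p R y) & (ALL R' h. cring R' & h : rhom R R' -->
   (ALL c:carrier (grp G R' (p R' (pull (subfunctor X (U2 i j)) R R' h y))).
    ph i j R' (pull (subfunctor X (U2 i j)) R R' h y) $ th j R' (pull (subfunctor X (U2 i j)) R R' h y) c
    = th i R' (pull (subfunctor X (U2 i j)) R R' h y) (u R' h c) $ ph i j R' (pull (subfunctor X (U2 i j)) R R' h y))))" for R y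
  by (simp add: lam lambda_of_def Let_def Aut_sheaf_simps subfunctor_def)
 note c = O.conjugation[OF bj bi ph k R y']
 { case 1 show ?case by (rule c(1))
 next case 2 then show ?case by (rule c(2))
 next case 3 then show ?case using c(3) by (simp add: subfunctor_def) }
qed

lemma
 assumes R: "cring R" and y: "y : U3 i j k R"
 shows g_closed: "g i j k R y : GC R (p R y)"
  and g_comp: "ph i j R y $ ph j k R y = th i R y (g i j k R y) $ ph i k R y"
  and g_natural: "cring R' ==> h : rhom R R' ==> g i j k R' (pull X R R' h y) = res G R R' h (p R y) (g i j k R y)"
proof goal_cases
 interpret O: gerbe_over S G X p P "subfunctor X (U3 i j k)" p by (rule over_open[OF stable(3)])
 have y': "y : pts (subfunctor X (U3 i j k)) R" using y by (simp add: subfunctor_def)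
 have b: "O.banded (x i) (th i)" "O.banded (x j) (th j)" "O.banded (x k) (th k)"
  by (rule open_banded[OF stable(3) x _ th]; auto)+
 note s = O.bandedD(1)[OF b(1)] O.bandedD(1)[OF b(2)] O.bandedD(1)[OF b(3)]
 have f: "is_arrow P (subfunctor X (U3 i j k)) (x j) (x i) (ph i j)" "is_arrow P (subfunctor X (U3 i j k)) (x k) (x j) (ph j k)"
  "is_arrow P (subfunctor X (U3 i j k)) (x k) (x i) (ph i k)"
  by (rule restrict_open_arrow[OF ph]; auto)+
 have e: "g i j k R y = (THE c. c : GC R (p R y) & ph i j R y $ ph j k R y = th i R y c $ ph i k R y)" for R y
  by (simp add: g cocycle_of_def)
 note c = O.quotient_section[OF s(3) b(1) O.is_arrow_comp[OF s(3,2,1) f(1,2)] f(3) e R y']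
 { case 1 show ?case by (rule c(1))
 next case 2 show ?case by (rule c(2))
 next case 3 then show ?case using c(4) by (simp add: subfunctor_def) }
qed

lemma vertex_simplex: "[y] : spx X p V 0 R ==> y : V R"
 using spxD(2) by fastforce

lemma natural_sectionI:
 assumes "!!R y. cring R ==> y : V R ==> s R y : carrier (grp F R (p R y))"
  and "!!R R' h y. cring R ==> y : V R ==> cring R' ==> h : rhom R R' ==> s R' (pull X R R' h y) = res F R R' h (p R y) (s R y)"
 shows "natural_form F V 0 (at0 s)"
 unfolding natural_form_def
proof (intro allI impI, elim conjE, goal_cases)
 case (1 R xs)
 obtain y where y: "xs = [y]" using spxD(1)[OF 1(2)] by (auto simp: length_Suc_conv)
 have "y : V R" using 1(2) unfolding y by (rule vertex_simplex)
 then show ?case using assms 1(1) by (simp add: at0_def y)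
qed

lemma natural_lam: "Anat (U2 i j) 0 (at0 (lam i j))"
 by (rule natural_sectionI[OF lam_closed lam_natural])

lemma natural_g: "natural_form G (U3 i j k) 0 (at0 (g i j k))"
 by (rule natural_sectionI[OF g_closed g_natural])

lemma pts_U: "cring R ==> y : U i R ==> sob (x i) R y : obs P & brg P (sob (x i) R y) = R & bpt P (sob (x i) R y) = y"
 using x[of i] by (simp add: is_object_def subfunctor_def)

lemma \<eta>_natural_fib:
 assumes R: "cring R" and y: "y : U i R" "y : U j R" and f: "f : fib P (sob (x j) R y) (sob (x i) R y)"
 shows "\<eta> (sob (x i) R y) $ far ep [y, y] f = f $ \<eta> (sob (x j) R y)"
 using conn.\<eta>_natural[of f] pts_U[OF R y(1)] f by (simp add: fib_def)

text \<open>The arrow \<open>gm' i\<close> starts at the image of the object under \<epsilon>, whose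
  band is the image of \<open>th i\<close>; \<epsilon> is an equivalence, hence bijective on
  automorphisms, and \<open>conjugation\<close> applies.\<close>

lemma
 assumes R: "cring R" and xs: "[y, z] : spx X p (U i) 1 R"
 shows m_closed: "m i R [y, z] : AC R (p R y)"
  and m_conj: "c : GC R (p R y) ==>
   gm' i R [y, z] $ far ep [y, z] (th i R z c) = th i R y (aut_app R (m i R [y, z]) c) $ gm' i R [y, z]"
  and m_natural: "cring R' ==> h : rhom R R' ==> m i R' (map (pull X R R' h) [y, z]) = ract R R' h (p R y) (m i R [y, z])"
proof goal_cases
 interpret fi: face_image S G X p P "U i" 1 1 1 0 ep "%xs. xs" 0 1 by (rule edge_identity[OF stable(1)])
 have o: "fi.obj_over 1 (proj_pull 1 (x i))" by (rule fi.proj_obj[OF x]) simp_all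
 have b: "fi.D.banded (proj_pull 1 (x i)) (%R xs. th i R (xs ! 1))" "fi.D.banded (proj_pull 0 (x i)) (%R xs. th i R (xs ! 0))"
  by (rule fi.proj_banded[OF th x]; simp)+
 have ib: "fi.D.banded (image_section ep (%xs. xs) (proj_pull 1 (x i))) (%R xs c. far ep xs (th i R (xs ! 1) c))"
  by (rule fi.image_banded[OF o b(1)]) (rule ep_bij[OF fi.over_face[OF o]])
 have k: "m i R xs = (THE u. u : Aut_carrier S G R (bp R xs) & (ALL R' h. cring R' & h : rhom R R' -->
   (ALL c:carrier (grp G R' (p R' (hd (pull (simplices X p (U i) 1) R R' h xs)))).
    gm' i R' (pull (simplices X p (U i) 1) R R' h xs) $ far ep (pull (simplices X p (U i) 1) R R' h xs)
     (th i R' (pull (simplices X p (U i) 1) R R' h xs ! 1) c)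
    = th i R' (pull (simplices X p (U i) 1) R R' h xs ! 0) (u R' h c) $ gm' i R' (pull (simplices X p (U i) 1) R R' h xs))))"
  if "cring R" "xs : spx X p (U i) 1 R" for R xs
 proof -
  have "p R' (map (pull X R R' h) xs ! 1) = bp R' (map (pull X R R' h) xs)" if "cring R'" "h : rhom R R'" for R' h
   by (rule fi.vertex(2)[OF order_refl that(1) simplex_pull[OF stable(1) \<open>cring R\<close> that \<open>xs : _\<close>]])
  then show ?thesis
   unfolding m m_of_def Let_def spx_pull base_change_simps Aut_sheaf_simps
   by (intro arg_cong[where f = The] ext conj_cong refl) (metis (no_types, lifting))
 qed
 note c = fi.D.conjugation[OF ib b(2) gm'[of i, folded image_section_id] k R xs]
 { case 1 show ?case using c(1) by simp
 next case 2 then show ?case using c(2) by simp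
 next case 3 then show ?case using c(3) by (simp add: spx_pull) }
qed

text \<open>Both composites run from \<epsilon> applied to \<open>x j\<close> at the second vertex
  to \<open>x i\<close> at the first, so \<open>quotient_section\<close> applies.\<close>

lemma
 assumes R: "cring R" and xs: "[y, z] : spx X p (U2 i j) 1 R"
 shows gm_closed: "gm i j R [y, z] : GC R (p R y)"
  and gm_eq: "gm' i R [y, z] $ far ep [y, z] (ph i j R z) = th i R y (gm i j R [y, z]) $ (ph i j R y $ gm' j R [y, z])"
  and gm_unique: "c : GC R (p R y) ==>
   gm' i R [y, z] $ far ep [y, z] (ph i j R z) = th i R y c $ (ph i j R y $ gm' j R [y, z]) ==> gm i j R [y, z] = c"
  and gm_natural: "cring R' ==> h : rhom R R' ==> gm i j R' (map (pull X R R' h) [y, z]) = res G R R' h (p R y) (gm i j R [y, z])"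
proof goal_cases
 interpret fi: face_image S G X p P "U2 i j" 1 1 1 0 ep "%xs. xs" 0 1 by (rule edge_identity[OF stable(2)])
 have o: "fi.obj_over 1 (proj_pull 1 (x i))" "fi.obj_over 1 (proj_pull 1 (x j))"
  "fi.obj_over 0 (proj_pull 0 (x i))" "fi.obj_over 0 (proj_pull 0 (x j))"
  by (rule fi.proj_obj[OF x]; simp)+
 have b: "fi.D.banded (proj_pull 0 (x i)) (%R xs. th i R (xs ! 0))" by (rule fi.proj_banded[OF th x]) simp_all
 have gg: "is_arrow P (simplices X p (U2 i j) 1) (image_section ep (%xs. xs) (proj_pull 1 (x i))) (proj_pull 0 (x i)) (gm' i)"
  "is_arrow P (simplices X p (U2 i j) 1) (image_section ep (%xs. xs) (proj_pull 1 (x j))) (proj_pull 0 (x j)) (gm' j)"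
  unfolding image_section_id by (rule restrict_simplex_arrow[OF gm']; simp)+
 note pa = fi.proj_arrow[OF ph[of i j]]
 have f0: "is_arrow P (simplices X p (U2 i j) 1) (proj_pull 0 (x j)) (proj_pull 0 (x i)) (%R xs. ph i j R (xs ! 0))"
  "is_arrow P (simplices X p (U2 i j) 1) (proj_pull 1 (x j)) (proj_pull 1 (x i)) (%R xs. ph i j R (xs ! 1))"
  by (rule pa; simp)+
 note e1 = fi.image_arrow[OF o(2,1) f0(2)]
 note s = fi.obj_section[OF fi.image_obj_over[OF o(2)]] fi.obj_section[OF fi.image_obj_over[OF o(1)]] o(3,4)[THEN fi.obj_section]
 have k: "gm i j R xs = (THE c. c : GC R (bp R xs) &
   gm' i R xs $ far ep xs (ph i j R (xs ! 1)) = th i R (xs ! 0) c $ (ph i j R (xs ! 0) $ gm' j R xs))" for R xs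
  by (simp add: gm gamma_of_def)
 note c = fi.D.quotient_section[OF s(1) b fi.D.is_arrow_comp[OF s(1,2,3) gg(1) e1] fi.D.is_arrow_comp[OF s(1,4,3) f0(1) gg(2)] k R xs]
 { case 1 show ?case using c(1) by simp
 next case 2 show ?case using c(2) by simp
 next case 3 then show ?case using c(3) by simp
 next case 4 then show ?case using c(4) by (simp add: spx_pull) }
qed

text \<open>Both composites start at
  \<open>\<epsilon>\<^sub>0\<^sub>1 \<epsilon>\<^sub>1\<^sub>2\<close> applied to \<open>x i\<close>
  at the last vertex: the curving \<open>K\<close> is an arrow of cartesian sections from there, by
  \<open>curving_arrow\<close>.\<close>

lemma
 assumes R: "cring R" and xs: "[y, z, w] : spx X p (U i) 2 R"
 defines "f == gm' i R [y, z] $ far ep [y, z] (gm' i R [z, w])"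
  and "f' == dl' i R [y, z, w] $ (far ka [y, z, w] (gm' i R [y, w]) $ K [y, z, w] (sob (x i) R w))"
 shows B_closed: "B i R [y, z, w] : GC R (p R y)"
  and B_unique: "c : GC R (p R y) ==> f = th i R y c $ f' ==> B i R [y, z, w] = c"
  and B_natural: "cring R' ==> h : rhom R R' ==> B i R' (map (pull X R R' h) [y, z, w]) = res G R R' h (p R y) (B i R [y, z, w])"
  and B_fib: "f' : fib P (fob ep [y, z] (fob ep [z, w] (sob (x i) R w))) (sob (x i) R y)"
proof goal_cases
 interpret e01: face_image S G X p P "U i" 2 1 1 0 ep "%xs. [xs ! 0, xs ! 1]" 0 1 by (rule edge_face[OF stable(1)]) simp_all
 interpret e12: face_image S G X p P "U i" 2 1 1 0 ep "%xs. [xs ! 1, xs ! 2]" 1 2 by (rule edge_face[OF stable(1)]) simp_all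
 interpret e02: face_image S G X p P "U i" 2 1 1 0 ep "%xs. [xs ! 0, xs ! 2]" 0 2 by (rule edge_face[OF stable(1)]) simp_all
 interpret k: face_image S G X p P "U i" 2 2 0 0 ka "%xs. xs" 0 0 by (rule triangle_identity[OF stable(1)])
 have o: "e01.obj_over 0 (proj_pull 0 (x i))" "e01.obj_over 1 (proj_pull 1 (x i))" "e01.obj_over 2 (proj_pull 2 (x i))"
  by (rule e01.proj_obj[OF x]; simp)+
 note oi = e01.image_obj_over[OF e12.image_obj_over[OF o(3)]] e01.image_obj_over[OF o(2)]
  k.image_obj_over[OF e02.image_obj_over[OF o(3)]] k.image_obj_over[OF o(1)]
 note s = oi(1-4)[THEN e01.obj_section]
  e01.obj_section[OF o(1)]
 have b: "e01.D.banded (proj_pull 0 (x i)) (%R xs. th i R (xs ! 0))" by (rule e01.proj_banded[OF th x]) simp_all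
 have ga: "is_arrow P (simplices X p (U i) 2) (im 0 1 (proj_pull 1 (x i))) (proj_pull 0 (x i))
   (%R xs. gm' i R [xs ! 0, xs ! 1])"
  "is_arrow P (simplices X p (U i) 2) (im 1 2 (proj_pull 2 (x i))) (proj_pull 1 (x i))
   (%R xs. gm' i R [xs ! 1, xs ! 2])"
  "is_arrow P (simplices X p (U i) 2) (im 0 2 (proj_pull 2 (x i))) (proj_pull 0 (x i))
   (%R xs. gm' i R [xs ! 0, xs ! 2])"
  by (rule edge_arrow[OF stable(1) _ _ gm']; simp)+
 note f1 = e01.D.is_arrow_comp[OF s(1,2,5) ga(1) e01.image_arrow[OF e12.image_obj_over[OF o(3)] o(2) ga(2)]]
 have ca: "is_arrow P (simplices X p (U i) 2)
  (im 0 1 (im 1 2 (proj_pull 2 (x i))))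
  (image_section ka (%xs. xs) (im 0 2 (proj_pull 2 (x i))))
  (%R xs. K xs (sob (x i) R (xs ! 2)))" by (rule curving_arrow[OF stable(1) x]) simp
 note f2 = e01.D.is_arrow_comp[OF s(1,4,5) dl'[of i, folded image_section_id]
   e01.D.is_arrow_comp[OF s(1,3,4) k.image_arrow[OF e02.image_obj_over[OF o(3)] o(1) ga(3)] ca]]
 have kk: "B i R xs = (THE c. c : GC R (bp R xs) &
   gm' i R [xs ! 0, xs ! 1] $ far ep [xs ! 0, xs ! 1] (gm' i R [xs ! 1, xs ! 2])
   = th i R (xs ! 0) c $ (dl' i R xs $ (far ka xs (gm' i R [xs ! 0, xs ! 2]) $ K xs (sob (x i) R (xs ! 2)))))"
  if "cring R" "xs : spx X p (U i) 2 R" for R xs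
 proof -
  have "hd xs = xs ! 0" using spxD(5)[OF that(2)] by (simp add: hd_conv_nth)
  then show ?thesis by (simp add: B B_of_def Let_def)
 qed
 note c = e01.D.quotient_section[OF s(1) b f1 f2 kk R xs]
 { case 1 show ?case using c(1) by simp
 next case 2 then show ?case using c(3) by (simp add: f_def f'_def)
 next case 3 then show ?case using c(4) by (simp add: spx_pull)
 next case 4 show ?case using e01.D.is_arrowD(1)[OF f2 R xs] by (simp add: f'_def image_section_def proj_pull_def) }
qed

lemma
 assumes R: "cring R" and y: "y : U i R"
 shows th_fib: "c : GC R (p R y) ==> th i R y c : fib P (sob (x i) R y) (sob (x i) R y)"
  and th_mult: "c : GC R (p R y) ==> c' : GC R (p R y) ==>
   th i R y (c **\<^sub>(grp G R (p R y)) c') = th i R y c $ th i R y c'"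
  and th_inj: "c : GC R (p R y) ==> c' : GC R (p R y) ==> th i R y c = th i R y c' ==> c = c'"
  and th_one: "th i R y \<one>\<^sub>(grp G R (p R y)) = idn P (sob (x i) R y)"
proof goal_cases
 interpret O: gerbe_over S G X p P "subfunctor X (U i)" p by (rule over_open[OF stable(1)])
 have y': "y : pts (subfunctor X (U i)) R" using y by (simp add: subfunctor_def)
 have b: "O.banded (x i) (th i)" by (rule open_banded[OF stable(1) x _ th]) simp
 note D = O.bandedD(2-4)[OF b R y']
 have ys: "p R y : pts S R" by (rule p.mor_closed[OF R stable_openD(1)[OF stable(1) R y]])
 interpret H: group "grp G R (p R y)" by (rule grp_group[OF R ys])
 let ?t = "th i R y \<one>\<^sub>(grp G R (p R y))"
 have t: "?t : fib P (sob (x i) R y) (sob (x i) R y)" by (rule D(1)[OF H.one_closed])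
 have "?t $ ?t = ?t $ idn P (sob (x i) R y)"
  using D(2)[OF H.one_closed H.one_closed] P.idn_right[OF P.fib_arrow[OF t]] by simp
 then have "?t = idn P (sob (x i) R y)"
  by (rule P.left_cancel[OF P.fib_arrow[OF t] t P.fib_idn[OF P.fib_obs(1)[OF t]]])
 note one = this
 { case 1 then show ?case by (rule D(1))
 next case 2 then show ?case by (rule D(2))
 next case 3 then show ?case by (rule D(3))
 next case 4 show ?case by (rule one) }
qed

lemma ph_fib: "cring R ==> y : U2 i j R ==> ph i j R y : fib P (sob (x j) R y) (sob (x i) R y)"
 using ph[of i j] by (simp add: is_arrow_def subfunctor_def)

lemma gm'_fib: "cring R ==> [y, z] : spx X p (U i) 1 R ==>
  gm' i R [y, z] : fib P (fob ep [y, z] (sob (x i) R z)) (sob (x i) R y)"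
 using gm'[of i] unfolding is_arrow_def by (fastforce simp: image_obj_def proj_pull_def)

lemma simplex_mem:
 assumes R: "cring R" and xs: "xs : spx X p V n R" and V: "V R <= U i R" and z: "z : set xs"
 shows "z : U i R"
 using spxD(2)[OF xs] V z by blast

lemma simplex_over:
 assumes R: "cring R" and xs: "xs : spx X p (U i) n R" and b: "b <= n"
 shows "over P (simplices X p (pts X) n) b xs (sob (x i) R (xs ! b))"
proof -
 have m: "xs ! b : U i R" by (rule simplex_mem[OF R xs order_refl]) (use spxD(1)[OF xs] b in simp)
 have "set xs <= pts X R" using spxD(2)[OF xs] stable_openD(1)[OF stable(1) R] by blast
 then have "xs : spx X p (pts X) n R" by (rule spx_mono[OF xs])
 then show ?thesis using pts_U[OF R m] by (simp add: over_def)
qed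

lemma
 assumes R: "cring R" and xs: "[y, z] : spx X p (U i) 1 R"
 shows ep_fib: "f : fib P a (sob (x i) R z) ==> far ep [y, z] f : fib P (fob ep [y, z] a) (fob ep [y, z] (sob (x i) R z))"
  and ep_comp: "f : fib P a (sob (x i) R z) ==> f' : fib P b a ==> far ep [y, z] (f $ f') = far ep [y, z] f $ far ep [y, z] f'"
proof -
 interpret e: stack_morphism P "simplices X p (pts X) 1" 1 0 ep by (rule ep)
 have o: "over P (simplices X p (pts X) 1) 1 [y, z] (sob (x i) R z)" using simplex_over[OF R xs, of 1] by simp
 show "far ep [y, z] f : fib P (fob ep [y, z] a) (fob ep [y, z] (sob (x i) R z))" if "f : fib P a (sob (x i) R z)"
  by (rule far_fib(1)[OF ep o that])
 show "far ep [y, z] (f $ f') = far ep [y, z] f $ far ep [y, z] f'" if "f : fib P a (sob (x i) R z)" "f' : fib P b a"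
  using e.far_cmp[of f f' "[y, z]"] P.fib_arrow[OF that(1)] P.fib_arrow[OF that(2)] o far_fib(2)[OF ep o that(1)]
  by (simp add: P.arrow_def)
qed

text \<open>On the diagonal \<open>gm' i\<close> is \<eta>, whose naturality says that conjugation
  by it is trivial.\<close>

lemma m_diagonal:
 assumes R: "cring R" and xs: "[y, y] : spx X p (U i) 1 R" and c: "c : GC R (p R y)"
 shows "aut_app R (m i R [y, y]) c = c"
proof -
 have y: "y : U i R" by (rule simplex_mem[OF R xs order_refl]) simp
 have ys: "p R y : pts S R" by (rule p.mor_closed[OF R stable_openD(1)[OF stable(1) R y]])
 have mc: "aut_app R (m i R [y, y]) c : GC R (p R y)" by (rule aut_app_closed[OF R ys m_closed[OF R xs] c])
 have "th i R y (aut_app R (m i R [y, y]) c) $ gm' i R [y, y] = th i R y c $ gm' i R [y, y]"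
  using m_conj[OF R xs c] \<eta>_natural_fib[OF R y y th_fib[OF R y c]] gm'_diagonal[OF R y] by simp
 then have "th i R y (aut_app R (m i R [y, y]) c) = th i R y c"
  by (rule P.right_cancel[OF gm'_fib[OF R xs] P.fib_arrow[OF th_fib[OF R y mc]] P.fib_arrow[OF th_fib[OF R y c]]])
 then show ?thesis by (rule th_inj[OF R y mc c])
qed

lemma form_m: "Aform (U i) 1 (m i)"
 unfolding is_form_iff natural_form_def
proof (intro conjI allI impI; (elim conjE)?)
 fix R xs assume R: "cring R" and xs: "xs : spx X p (U i) 1 R"
 obtain y z where y: "xs = [y, z]" using spxD(1)[OF xs] by (auto simp: length_simps)
 note xs' = xs[unfolded y]
 show "m i R xs : AC R (bp R xs)" using m_closed[OF R xs'] by (simp add: y)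
 show "m i R' (map (pull X R R' h) xs) = ract R R' h (bp R xs) (m i R xs)" if "cring R'" "h : rhom R R'" for R' h
  using m_natural[OF R xs' that] by (simp add: y)
 assume "degenerate xs"
 then have z: "z = y" by (simp add: y degenerate_Cons)
 note xy = xs'[unfolded z] and b = spx_base[OF stable(1) R xs'[unfolded z]]
 note ys = b(1)[unfolded list.sel(1)]
 interpret A: group "AG R (p R y)" by (rule Aut.grp_group[OF R ys])
 have "m i R [y, y] = \<one>\<^sub>(AG R (p R y))"
 proof (rule Aut_eqI_app[OF m_closed[OF R xy] A.one_closed])
  fix R' h c assume R': "cring R'" "h : rhom R R'" and c: "c : GC R' (pull S R R' h (p R y))"
  have "p R' (pull X R R' h y) = pull S R R' h (p R y)" using b(3)[OF R'] by simp
  then show "aut_app R' (ract R R' h (p R y) (m i R [y, y])) c = aut_app R' (ract R R' h (p R y) \<one>\<^sub>(AG R (p R y))) c"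
   using m_natural[OF R xy R', symmetric] m_diagonal[OF R'(1), of "pull X R R' h y" i c] simplex_pull[OF stable(1) R R' xy] c
    Aut.res_one[OF R R' ys] aut_app_one[OF R'(1) S.pull_closed[OF R R' ys] c] by simp
 qed
 then show "m i R xs = \<one>\<^sub>(AG R (bp R xs))" by (simp add: y z)
qed

text \<open>On the diagonal both \<open>gm' i\<close> and \<open>gm' j\<close> are \<eta>, and
  naturality of \<eta> with respect to \<open>ph i j\<close> makes the two defining composites
  equal.\<close>

lemma form_\<gamma>: "Gform (U2 i j) 1 (gm i j)"
 unfolding is_form_iff natural_form_def
proof (intro conjI allI impI; (elim conjE)?)
 fix R xs assume R: "cring R" and xs: "xs : spx X p (U2 i j) 1 R"
 obtain y z where y: "xs = [y, z]" using spxD(1)[OF xs] by (auto simp: length_simps)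
 note xs' = xs[unfolded y]
 show "gm i j R xs : GC R (bp R xs)" using gm_closed[OF R xs'] by (simp add: y)
 show "gm i j R' (map (pull X R R' h) xs) = res G R R' h (bp R xs) (gm i j R xs)" if "cring R'" "h : rhom R R'" for R' h
  using gm_natural[OF R xs' that] by (simp add: y)
 assume "degenerate xs"
 then have z: "z = y" by (simp add: y degenerate_Cons)
 note xy = xs'[unfolded z] and b = spx_base[OF stable(2) R xs'[unfolded z]]
 interpret H: group "grp G R (p R y)" using grp_group[OF R b(1)] by simp
 have yi: "y : U i R" and yj: "y : U j R" using spxD(2)[OF xy] by simp_all
 have xj: "[y, y] : spx X p (U j) 1 R" using spx_mono[OF xy, of "U j"] yj by simp
 have f: "ph i j R y : fib P (sob (x j) R y) (sob (x i) R y)" by (rule ph_fib[OF R]) (use yi yj in simp)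
 have fg: "ph i j R y $ gm' j R [y, y] : fib P (fob ep [y, y] (sob (x j) R y)) (sob (x i) R y)"
  by (rule P.fib_comp[OF f gm'_fib[OF R xj]])
 have "gm i j R [y, y] = \<one>\<^sub>(grp G R (p R y))"
  by (rule gm_unique[OF R xy H.one_closed])
   (use \<eta>_natural_fib[OF R yi yj f] gm'_diagonal[OF R yi] gm'_diagonal[OF R yj] th_one[OF R yi] P.idn_left[OF P.fib_arrow[OF fg]] in simp)
 then show "gm i j R xs = \<one>\<^sub>(grp G R (bp R xs))" by (simp add: y z)
qed

text \<open>On degenerate triangles \<open>dl' i\<close> is \<zeta>, whose naturality moves it past
  the edge arrow to meet \<open>K\<close>. The composite is then \<eta> or its image under
  \<epsilon>, which is what \<open>gm' i\<close> gives on the degenerate edge.\<close>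

lemma form_B: "Gform (U i) 2 (B i)"
 unfolding is_form_iff natural_form_def
proof (intro conjI allI impI; (elim conjE)?)
 fix R xs assume R: "cring R" and xs: "xs : spx X p (U i) 2 R"
 obtain y z w where y: "xs = [y, z, w]" using spxD(1)[OF xs] by (auto simp: length_simps)
 note xs' = xs[unfolded y]
 show "B i R xs : GC R (bp R xs)" using B_closed[OF R xs'] by (simp add: y)
 show "B i R' (map (pull X R R' h) xs) = res G R R' h (bp R xs) (B i R xs)" if "cring R'" "h : rhom R R'" for R' h
  using B_natural[OF R xs' that] by (simp add: y)
 assume deg: "degenerate xs"
 then have yz: "y = z | z = w" by (auto simp: y degenerate_Cons)
 let ?D = "simplices X p (pts X) 2" and ?ob = "sob (x i) R w"
 have mem: "y : U i R" "z : U i R" "w : U i R" using spxD(2)[OF xs'] by simp_all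
 interpret H: group "grp G R (p R y)" using grp_group[OF R spx_base(1)[OF stable(1) R xs']] by simp
 have e: "[y, w] : spx X p (U i) 1 R" by (rule spx_subset[OF xs']) auto
 define a where "a = gm' i R [y, w]"
 have a: "a : fib P (fob ep [y, w] ?ob) (sob (x i) R y)" unfolding a_def by (rule gm'_fib[OF R e])
 have o0: "over P ?D 0 xs (sob (x i) R y)" using simplex_over[OF R xs, of 0] by (simp add: y)
 have o2: "over P ?D 2 xs ?ob" using simplex_over[OF R xs, of 2] by (simp add: y)
 note fa = far_fib[OF curv.fake_curvature o0 a]
 \<comment> \<open>Naturality of \<zeta> with respect to the long edge; afterwards \<zeta> stands
   next to \<open>K\<close>, as in the degeneracy axioms of the curving.\<close>
 have ze: "\<zeta> xs (sob (x i) R y) $ far ka xs a = a $ \<zeta> xs (fob ep [y, w] ?ob)"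
  using curv.\<zeta>_natural[of a xs] a o0 deg fa(2) by (simp add: fib_def)
 note zc = curv.\<zeta>_component[OF o0 deg] curv.\<zeta>_component[OF fa(3) deg]
 have Ka: "K xs ?ob : fib P (fob ep [y, z] (fob ep [z, w] ?ob)) (fob ka xs (fob ep [y, w] ?ob))"
  using curv.K_component[of y z w ?ob] o2 by (simp add: y)
 define f' where "f' = dl' i R [y, z, w] $ (far ka [y, z, w] (gm' i R [y, w]) $ K [y, z, w] ?ob)"
 note f'fib = B_fib[OF R xs', folded f'_def]
 have "f' = \<zeta> xs (sob (x i) R y) $ (far ka xs a $ K xs ?ob)"
  unfolding f'_def using dl'_degenerate[OF R xs deg] by (simp add: y a_def)
 also have "... = (a $ \<zeta> xs (fob ep [y, w] ?ob)) $ K xs ?ob"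
  unfolding ze[symmetric] by (rule P.arrow_assoc[OF P.fib_arrow[OF zc(1)] P.fib_arrow[OF fa(1)] P.fib_arrow[OF Ka], symmetric])
 also have "... = a $ (\<zeta> xs (fob ep [y, w] ?ob) $ K xs ?ob)"
  by (rule P.arrow_assoc[OF P.fib_arrow[OF a] P.fib_arrow[OF zc(2)] P.fib_arrow[OF Ka]])
 also have "... = gm' i R [y, z] $ far ep [y, z] (gm' i R [z, w])"
  using yz
 proof
  assume z: "y = z"
  have "\<zeta> xs (fob ep [y, w] ?ob) $ K xs ?ob = \<eta> (fob ep [y, w] ?ob)"
   using curv.K_degenerate_01[of z w ?ob] o2 by (simp add: y z)
  moreover have "\<eta> (sob (x i) R y) $ far ep [y, y] a = a $ \<eta> (fob ep [y, w] ?ob)"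
   using conn.\<eta>_natural[of a] a pts_U[OF R mem(1)] by (simp add: fib_def)
  ultimately show ?thesis using gm'_diagonal[OF R mem(1)] by (simp add: z a_def)
 next
  assume z: "z = w"
  have "\<zeta> xs (fob ep [y, w] ?ob) $ K xs ?ob = far ep [y, w] (\<eta> ?ob)"
   using curv.K_degenerate_12[of y w ?ob] o2 by (simp add: y z)
  then show ?thesis using gm'_diagonal[OF R mem(3)] by (simp add: z a_def)
 qed
 finally have "gm' i R [y, z] $ far ep [y, z] (gm' i R [z, w]) = th i R y \<one>\<^sub>(grp G R (p R y)) $ f'"
  using th_one[OF R mem(1)] P.idn_left[OF P.fib_arrow[OF f'fib]] by simp
 then have "B i R [y, z, w] = \<one>\<^sub>(grp G R (p R y))"
  unfolding f'_def by (rule B_unique[OF R xs' H.one_closed])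
 then show "B i R xs = \<one>\<^sub>(grp G R (bp R xs))" by (simp add: y)
qed

end

text \<open>Naturality replaces a test after base change by a test on the base-changed simplex, so
  comparing values on sections over all simplices suffices.\<close>

lemma (in form_space) aut_form_eq:
 assumes V: "stable_open V" and nat: "Anat V n al" "Anat V n be"
  and eq: "!!R xs c. cring R ==> xs : spx X p V n R ==> c : GC R (bp R xs) ==>
   aut_app R (al R xs) c = aut_app R (be R xs) c"
  and R: "cring R" and xs: "xs : spx X p V n R"
 shows "al R xs = be R xs"
proof (rule Aut_eqI_app[OF natural_formD(1)[OF nat(1) R xs] natural_formD(1)[OF nat(2) R xs]])
 fix R' h c assume R': "cring R'" "h : rhom R R'" and c: "c : GC R' (pull S R R' h (bp R xs))"
 note b = spx_base[OF V R xs]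
 have "c : carrier (grp G R' (bp R' (map (pull X R R' h) xs)))" using c b(3,4)[OF R'] by simp
 then show "aut_app R' (ract R R' h (bp R xs) (al R xs)) c = aut_app R' (ract R R' h (bp R xs) (be R xs)) c"
  using eq[OF R'(1) simplex_pull[OF V R R' xs]] natural_formD(2)[OF nat(1) R xs R'] natural_formD(2)[OF nat(2) R xs R'] by simp
qed

lemma (in fibred_in_groupoids) fib_simps:
 "f : fib P a b ==> f : ars P" "f : fib P a b ==> src P f = a" "f : fib P a b ==> tgt P f = b"
 by (simp_all add: fib_def)

lemma (in fibred_in_groupoids) comp_simps:
 "f : ars P ==> g : ars P ==> src P f = tgt P g ==> fcat.cmp P f g : ars P"
 "f : ars P ==> g : ars P ==> src P f = tgt P g ==> src P (fcat.cmp P f g) = src P g"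
 "f : ars P ==> g : ars P ==> src P f = tgt P g ==> tgt P (fcat.cmp P f g) = tgt P f"
 using cmp by blast+

section \<open>Relations between the local data\<close>

context local_data
begin

text \<open>Together with sources and targets of the arrows at hand (collected as \<open>A\<close>
  below), these rules bracket composites to the right, so that each step of an arrow chase is one
  use of a defining equation.\<close>

lemmas asc = P.cmp_assoc P.comp_simps

lemma base_point:
 assumes "cring R" "y : U i R" shows "p R y : pts S R"
 by (rule p.mor_closed[OF assms(1) stable_openD(1)[OF stable(1) assms]])

text \<open>An automorphism of \<open>x k\<close> is moved to the left through
  \<open>ph i j $ ph j k\<close>, either one arrow at a time or after replacing the composite by
  \<open>g i j k\<close> and \<open>ph i k\<close>.\<close>

lemma lam_cocycle_app:
 assumes R: "cring R" and y: "y : U3 i j k R" and c: "c : GC R (p R y)"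
 shows "aut_app R (lam i j R y) (aut_app R (lam j k R y) c) **\<^sub>(grp G R (p R y)) g i j k R y
  = g i j k R y **\<^sub>(grp G R (p R y)) aut_app R (lam i k R y) c"
proof -
 let ?H = "grp G R (p R y)"
  and ?l = "aut_app R (lam i j R y) (aut_app R (lam j k R y) c)"
  and ?t = "th i R y"
  and ?f = "ph i k R y"
 have yi: "y : U i R" "y : U j R" "y : U k R" and y2: "y : U2 i j R" "y : U2 j k R" "y : U2 i k R" using y by auto
 note ps = base_point[OF R yi(1)]
 interpret H: group ?H by (rule grp_group[OF R ps])
 note ac = aut_app_closed[OF R ps]
 note jk = ac[OF lam_closed[OF R y2(2)] c] and ik = ac[OF lam_closed[OF R y2(3)] c] and gc = g_closed[OF R y]
 note ijk = ac[OF lam_closed[OF R y2(1)] jk]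
 note fs = ph_fib[OF R y2(1)] ph_fib[OF R y2(2)] ph_fib[OF R y2(3)] th_fib[OF R yi(1) gc] th_fib[OF R yi(1) ik] th_fib[OF R yi(1) ijk] th_fib[OF R yi(2) jk] th_fib[OF R yi(3) c]
 note A = fs[THEN P.fib_simps(1)] fs[THEN P.fib_simps(2)] fs[THEN P.fib_simps(3)]
 have "?t (?l **\<^sub>?H g i j k R y) $ ?f
   = ?t ?l $ (ph i j R y $ ph j k R y)"
  unfolding th_mult[OF R yi(1) ijk gc] g_comp[OF R y] by (simp add: A asc)
 also have "... = (ph i j R y $ th j R y (aut_app R (lam j k R y) c)) $ ph j k R y"
  unfolding lam_conj[OF R y2(1) jk] by (simp add: A asc)
 also have "... = ph i j R y $ (ph j k R y $ th k R y c)"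
  unfolding lam_conj[OF R y2(2) c] by (simp add: A asc)
 also have "... = (?t (g i j k R y) $ ?f) $ th k R y c"
  unfolding g_comp[OF R y, symmetric] by (simp add: A asc)
 also have "... = ?t (g i j k R y) $ (?f $ th k R y c)" by (simp add: A asc)
 also have "... = ?t (g i j k R y **\<^sub>?H aut_app R (lam i k R y) c) $ ?f"
  unfolding th_mult[OF R yi(1) gc ik] lam_conj[OF R y2(3) c] by (simp add: A asc)
 finally have "?t (?l **\<^sub>?H g i j k R y)
   = ?t (g i j k R y **\<^sub>?H aut_app R (lam i k R y) c)"
  using P.right_cancel[OF ph_fib[OF R y2(3)] P.fib_arrow[OF th_fib[OF R yi(1) H.m_closed[OF ijk gc]]]
    P.fib_arrow[OF th_fib[OF R yi(1) H.m_closed[OF gc ik]]]] by blast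
 then show ?thesis by (rule th_inj[OF R yi(1) H.m_closed[OF ijk gc] H.m_closed[OF gc ik]])
qed

text \<open>The relation on sections holds over every base, so it lifts to local automorphisms by
  \<open>aut_form_eq\<close>.\<close>

lemma lam_cocycle:
 assumes R: "cring R" and xs: "[y] : spx X p (U3 i j k) 0 R"
 shows "lam i j R y **\<^sub>(AG R (p R y)) lam j k R y
  = inn R (p R y) (g i j k R y) **\<^sub>(AG R (p R y)) lam i k R y"
proof -
 have nl: "Anat (U3 i j k) 0 (at0 (lam i j))" "Anat (U3 i j k) 0 (at0 (lam j k))"
  "Anat (U3 i j k) 0 (at0 (lam i k))"
  by (rule natural_form_mono[OF natural_lam]; auto)+
 have "(at0 (lam i j) \<boxplus>\<^bsub>AX\<^esub> at0 (lam j k)) R [y] = (inner_form S p G (at0 (g i j k)) \<boxplus>\<^bsub>AX\<^esub> at0 (lam i k)) R [y]" (is "?a R _ = ?b R _")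
 proof (rule aut_form_eq[OF stable(3) VA.natural_fadd[OF stable(3) nl(1,2)]
    VA.natural_fadd[OF stable(3) natural_inner[OF stable(3) natural_g] nl(3)] _ R xs])
  fix R xs c assume R: "cring R" and xs: "xs : spx X p (U3 i j k) 0 R" and c: "c : GC R (bp R xs)"
  obtain y where y: "xs = [y]" using spxD(1)[OF xs] by (auto simp: length_Suc_conv)
  have y3: "y : U3 i j k R" using xs unfolding y by (rule vertex_simplex)
  then have yi: "y : U i R" "y : U2 i j R" "y : U2 j k R" "y : U2 i k R" by auto
  note ps = base_point[OF R yi(1)] and c' = c[unfolded y list.sel(1)]
  interpret H: group "grp G R (p R y)" by (rule grp_group[OF R ps])
  note ac = aut_app_closed[OF R ps]
  have "aut_app R (lam i j R y) (aut_app R (lam j k R y) c)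
    = g i j k R y **\<^sub>(grp G R (p R y)) aut_app R (lam i k R y) c **\<^sub>(grp G R (p R y)) inv \<^sub>(grp G R (p R y)) g i j k R y"
   using lam_cocycle_app[OF R y3 c'] H.inv_solve_right[OF ac[OF lam_closed[OF R yi(2)] ac[OF lam_closed[OF R yi(3)] c']]
     H.m_closed[OF g_closed[OF R y3] ac[OF lam_closed[OF R yi(4)] c']] g_closed[OF R y3]] by simp
  then show "aut_app R (?a R xs) c
    = aut_app R (?b R xs) c"
   using c' inner_aut_app[OF R ps g_closed[OF R y3] ac[OF lam_closed[OF R yi(4)] c']]
   by (simp add: y fadd_def at0_def inner_form_def aut_app_comp[OF R ps])
 qed
 then show ?thesis by (simp add: fadd_def at0_def inner_form_def)
qed

lemma edge_mem:
 assumes xs: "[y, z] : spx X p (%R. V R Int W R) 1 R"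
 shows "[y, z] : spx X p V 1 R" "[y, z] : spx X p W 1 R" "y : V R" "y : W R" "z : V R" "z : W R" "p R z = p R y"
proof -
 show m: "y : V R" "y : W R" "z : V R" "z : W R" using spxD(2)[OF xs] by auto
 show "[y, z] : spx X p V 1 R" "[y, z] : spx X p W 1 R"
  by (rule spx_mono[OF xs]; use m in simp)+
 show "p R z = p R y" by (rule spxD(3)[OF xs]) simp_all
qed

text \<open>Two evaluations of \<open>gm' i\<close> composed with the image under \<epsilon> of
  \<open>ph i j\<close> and an automorphism of \<open>x j\<close>: the automorphism is carried
  across \<open>ph i j\<close> before or after the connection.\<close>

lemma gauge_app:
 assumes R: "cring R" and xs: "[y, z] : spx X p (U2 i j) 1 R" and c: "c : GC R (p R y)"
 shows "aut_app R (m i R [y, z]) (aut_app R (lam i j R z) c) **\<^sub>(grp G R (p R y)) gm i j R [y, z]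
  = gm i j R [y, z] **\<^sub>(grp G R (p R y)) aut_app R (lam i j R y) (aut_app R (m j R [y, z]) c)"
proof -
 let ?H = "grp G R (p R y)"
  and ?l = "aut_app R (lam i j R z) c"
  and ?E = "far ep [y, z]"
  and ?a = "gm' i R [y, z]"
  and ?g = "gm i j R [y, z]"
  and ?t = "th i R y"
  and ?m = "aut_app R (m i R [y, z])"
  and ?n = "aut_app R (lam i j R y) (aut_app R (m j R [y, z]) c)"
  and ?f = "(ph i j R y $ gm' j R [y, z])"
 note M = edge_mem[OF xs]
 have y2: "y : U2 i j R" "z : U2 i j R" using M by simp_all
 note ps = base_point[OF R M(3)]
 interpret H: group ?H by (rule grp_group[OF R ps])
 note ac = aut_app_closed[OF R ps]
 have c': "c : GC R (p R z)" using c M(7) by simp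
 have lz: "?l : GC R (p R y)"
  using ac[OF _ c, of "lam i j R z"] lam_closed[OF R y2(2)] M(7) by simp
 have lz': "?l : GC R (p R z)" using lz M(7) by simp
 note mlz = ac[OF m_closed[OF R M(1)] lz] and mc = ac[OF m_closed[OF R M(2)] c]
 note lmc = ac[OF lam_closed[OF R y2(1)] mc] and gc = gm_closed[OF R xs]
 note e1 = ep_fib[OF R M(1) ph_fib[OF R y2(2)]] and e2 = ep_fib[OF R M(1) th_fib[OF R M(5) lz']]
  and e3 = ep_fib[OF R M(2) th_fib[OF R M(6) c']]
 note fs = ph_fib[OF R y2(1)] gm'_fib[OF R M(1)] gm'_fib[OF R M(2)] th_fib[OF R M(3) mlz] th_fib[OF R M(3) lmc] th_fib[OF R M(3) gc] th_fib[OF R M(4) mc] e1 e2 e3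
 note A = fs[THEN P.fib_simps(1)] fs[THEN P.fib_simps(2)] fs[THEN P.fib_simps(3)]
 have ff: "ph i j R y $ gm' j R [y, z] : fib P (fob ep [y, z] (sob (x j) R z)) (sob (x i) R y)"
  by (rule P.fib_comp[OF ph_fib[OF R y2(1)] gm'_fib[OF R M(2)]])
 have "?t (?m ?l **\<^sub>?H ?g) $ ?f
   = ?t (?m ?l) $ (?a $ ?E (ph i j R z))"
  unfolding th_mult[OF R M(3) mlz gc] gm_eq[OF R xs] by (simp add: A asc)
 also have "... = (?a $ ?E (th i R z ?l)) $ ?E (ph i j R z)"
  unfolding m_conj[OF R M(1) lz] by (simp add: A asc)
 also have "... = ?a $ (?E (th i R z ?l) $ ?E (ph i j R z))"
  by (simp add: A asc)
 also have "?E (th i R z ?l) $ ?E (ph i j R z)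
   = ?E (ph i j R z) $ ?E (th j R z c)"
  using ep_comp[OF R M(1) th_fib[OF R M(5) lz'] ph_fib[OF R y2(2)]] ep_comp[OF R M(1) ph_fib[OF R y2(2)] th_fib[OF R M(6) c']]
   lam_conj[OF R y2(2) c'] by simp
 also have "?a $ (?E (ph i j R z) $ ?E (th j R z c))
   = (?a $ ?E (ph i j R z)) $ ?E (th j R z c)" by (simp add: A asc)
 also have "... = ?t ?g $ (ph i j R y $ (gm' j R [y, z] $ ?E (th j R z c)))"
  unfolding gm_eq[OF R xs] by (simp add: A asc)
 also have "... = ?t ?g $ ((ph i j R y $ th j R y (aut_app R (m j R [y, z]) c)) $ gm' j R [y, z])"
  unfolding m_conj[OF R M(2) c] by (simp add: A asc)
 also have "... = ?t (?g **\<^sub>?H ?n) $ ?f"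
  unfolding th_mult[OF R M(3) gc lmc] lam_conj[OF R y2(1) mc] by (simp add: A asc)
 finally have "?t (?m ?l **\<^sub>?H ?g)
   = ?t (?g **\<^sub>?H ?n)"
  using P.right_cancel[OF ff P.fib_arrow[OF th_fib[OF R M(3) H.m_closed[OF mlz gc]]]
    P.fib_arrow[OF th_fib[OF R M(3) H.m_closed[OF gc lmc]]]] by blast
 then show ?thesis by (rule th_inj[OF R M(3) H.m_closed[OF mlz gc] H.m_closed[OF gc lmc]])
qed

lemma gauge:
 assumes R: "cring R" and xs: "[y, z] : spx X p (U2 i j) 1 R"
 shows "m i R [y, z] **\<^sub>(AG R (p R y)) lam i j R z
  = inn R (p R y) (gm i j R [y, z]) **\<^sub>(AG R (p R y)) (lam i j R y **\<^sub>(AG R (p R y)) m j R [y, z])"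
proof -
 note V = stable(2)[of i j]
 have nm: "Anat (U2 i j) 1 (m i)" "Anat (U2 i j) 1 (m j)"
  by (rule natural_form_mono[OF is_formD(1)[OF form_m]]; simp)+
 note nz = VA.natural_vertex[OF natural_lam[of i j], of 1 1, OF order_refl]
 note nl = VA.natural_at0[OF natural_lam[of i j], of 1] and ng = is_formD(1)[OF form_\<gamma>[of i j]]
 have "(m i \<boxplus>\<^bsub>AX\<^esub> (%R xs. lam i j R (xs ! 1))) R [y, z] = (inner_form S p G (gm i j) \<boxplus>\<^bsub>AX\<^esub> (at0 (lam i j) \<boxplus>\<^bsub>AX\<^esub> m j)) R [y, z]" (is "?a R _ = ?b R _")
 proof (rule aut_form_eq[OF V VA.natural_fadd[OF V nm(1) nz]
    VA.natural_fadd[OF V natural_inner[OF V ng] VA.natural_fadd[OF V nl nm(2)]] _ R xs])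
  fix R xs c assume R: "cring R" and xs: "xs : spx X p (U2 i j) 1 R" and c: "c : GC R (bp R xs)"
  obtain y z where y: "xs = [y, z]" using spxD(1)[OF xs] by (auto simp: length_simps)
  note xs' = xs[unfolded y] note M = edge_mem[OF xs'] and c' = c[unfolded y list.sel(1)]
  have y2: "y : U2 i j R" "z : U2 i j R" using M by simp_all
  note ps = base_point[OF R M(3)]
  interpret H: group "grp G R (p R y)" by (rule grp_group[OF R ps])
  note ac = aut_app_closed[OF R ps]
  have lz: "lam i j R z : AC R (p R y)" using lam_closed[OF R y2(2)] M(7) by simp
  note mlc = ac[OF m_closed[OF R M(1)] ac[OF lz c']] and lmc = ac[OF lam_closed[OF R y2(1)] ac[OF m_closed[OF R M(2)] c']]
  note gc = gm_closed[OF R xs']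
  have "aut_app R (m i R [y, z]) (aut_app R (lam i j R z) c) = gm i j R [y, z] **\<^sub>(grp G R (p R y))
    aut_app R (lam i j R y) (aut_app R (m j R [y, z]) c) **\<^sub>(grp G R (p R y)) inv \<^sub>(grp G R (p R y)) gm i j R [y, z]"
   using gauge_app[OF R xs' c'] H.inv_solve_right[OF mlc H.m_closed[OF gc lmc] gc] by simp
  then show "aut_app R (?a R xs) c
    = aut_app R (?b R xs) c"
   using c' inner_aut_app[OF R ps gc lmc] by (simp add: y fadd_def at0_def inner_form_def aut_app_comp[OF R ps] lmc)
 qed
 then show ?thesis by (simp add: fadd_def at0_def inner_form_def)
qed

text \<open>\<open>gm' i\<close> is composed with the image under \<epsilon> of
  \<open>ph i j $ ph j k\<close>. One evaluation replaces this composite by \<open>g i j k\<close>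
  and \<open>ph i k\<close>, the other carries the connection past the two arrows in turn.\<close>

lemma cocycle:
 assumes R: "cring R" and xs: "[y, z] : spx X p (U3 i j k) 1 R"
 shows "gm i j R [y, z] **\<^sub>(grp G R (p R y)) aut_app R (lam i j R y) (gm j k R [y, z]) **\<^sub>(grp G R (p R y)) g i j k R y
   = aut_app R (m i R [y, z]) (g i j k R z) **\<^sub>(grp G R (p R y)) gm i k R [y, z]"
proof -
 let ?H = "grp G R (p R y)"
  and ?E = "far ep [y, z]"
  and ?a = "gm' i R [y, z]"
  and ?g = "gm i j R [y, z]"
  and ?t = "th i R y"
  and ?m = "aut_app R (m i R [y, z]) (g i j k R z)"
  and ?n = "aut_app R (lam i j R y) (gm j k R [y, z])"
  and ?f = "(ph i k R y $ gm' k R [y, z])"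
 have pz: "p R z = p R y" and set: "y : U3 i j k R" "z : U3 i j k R"
  using spxD(2)[OF xs] spxD(3)[OF xs, of z y] by auto
 have E: "[y, z] : spx X p (U2 i j) 1 R" "[y, z] : spx X p (U2 j k) 1 R" "[y, z] : spx X p (U2 i k) 1 R"
  "[y, z] : spx X p (U i) 1 R" "[y, z] : spx X p (U j) 1 R" "[y, z] : spx X p (U k) 1 R"
  by (rule spx_mono[OF xs]; use set in auto)+
 have y: "y : U i R" "y : U j R" "y : U k R" "y : U2 i j R" "y : U2 j k R" "y : U2 i k R"
  and z: "z : U i R" "z : U2 i j R" "z : U2 j k R" "z : U2 i k R" using set by auto
 note ps = base_point[OF R y(1)]
 interpret H: group ?H by (rule grp_group[OF R ps])
 note ac = aut_app_closed[OF R ps]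
 note c1 = gm_closed[OF R E(1)] and c2 = gm_closed[OF R E(2)] and c3 = gm_closed[OF R E(3)] and g0 = g_closed[OF R set(1)]
 note g1' = g_closed[OF R set(2)]
 have g1: "g i j k R z : GC R (p R y)" using g1' pz by simp
 note lc2 = ac[OF lam_closed[OF R y(4)] c2] and mg = ac[OF m_closed[OF R E(4)] g1]
 note e = ep_fib[OF R E(4) ph_fib[OF R z(2)]] ep_fib[OF R E(5) ph_fib[OF R z(3)]] ep_fib[OF R E(4) ph_fib[OF R z(4)]]
  ep_fib[OF R E(4) th_fib[OF R z(1) g1']]
 note fs = e(1) e(2) e(3) e(4) ph_fib[OF R y(4)] ph_fib[OF R y(5)] ph_fib[OF R y(6)] gm'_fib[OF R E(4)] gm'_fib[OF R E(5)] gm'_fib[OF R E(6)] th_fib[OF R y(1) c1] th_fib[OF R y(1) c3] th_fib[OF R y(1) g0] th_fib[OF R y(1) lc2] th_fib[OF R y(1) mg] th_fib[OF R y(2) c2]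
 note A = fs[THEN P.fib_simps(1)] fs[THEN P.fib_simps(2)] fs[THEN P.fib_simps(3)]
 note t1 = H.m_closed[OF H.m_closed[OF c1 lc2] g0] and t2 = H.m_closed[OF mg c3]
 have ff: "ph i k R y $ gm' k R [y, z] : fib P (fob ep [y, z] (sob (x k) R z)) (sob (x i) R y)"
  by (rule P.fib_comp[OF ph_fib[OF R y(6)] gm'_fib[OF R E(6)]])
 have "?t (?m **\<^sub>?H gm i k R [y, z]) $ ?f
   = ?t ?m $ (?a $ ?E (ph i k R z))"
  unfolding th_mult[OF R y(1) mg c3] gm_eq[OF R E(3)] by (simp add: A asc)
 also have "... = (?a $ ?E (th i R z (g i j k R z))) $ ?E (ph i k R z)"
  unfolding m_conj[OF R E(4) g1] by (simp add: A asc)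
 also have "... = ?a $ (?E (th i R z (g i j k R z)) $ ?E (ph i k R z))" by (simp add: A asc)
 also have "?E (th i R z (g i j k R z)) $ ?E (ph i k R z) = ?E (ph i j R z) $ ?E (ph j k R z)"
  using ep_comp[OF R E(4) th_fib[OF R z(1) g1'] ph_fib[OF R z(4)]] ep_comp[OF R E(4) ph_fib[OF R z(2)] ph_fib[OF R z(3)]]
   g_comp[OF R set(2)] by simp
 also have "?a $ (?E (ph i j R z) $ ?E (ph j k R z))
   = (?a $ ?E (ph i j R z)) $ ?E (ph j k R z)" by (simp add: A asc)
 also have "... = ?t ?g $ (ph i j R y $ (gm' j R [y, z] $ ?E (ph j k R z)))"
  unfolding gm_eq[OF R E(1)] by (simp add: A asc)
 also have "... = ?t ?g $ ((ph i j R y $ th j R y (gm j k R [y, z])) $ (ph j k R y $ gm' k R [y, z]))"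
  unfolding gm_eq[OF R E(2)] by (simp add: A asc)
 also have "... = ?t ?g $ (?t ?n $ ((ph i j R y $ ph j k R y) $ gm' k R [y, z]))"
  unfolding lam_conj[OF R y(4) c2] by (simp add: A asc)
 also have "... = ?t (?g **\<^sub>?H ?n **\<^sub>?H g i j k R y)
   $ ?f"
  unfolding th_mult[OF R y(1) H.m_closed[OF c1 lc2] g0] th_mult[OF R y(1) c1 lc2] g_comp[OF R set(1)] by (simp add: A asc)
 finally have "?t (?m **\<^sub>?H gm i k R [y, z])
   = ?t (?g **\<^sub>?H ?n **\<^sub>?H g i j k R y)"
  using P.right_cancel[OF ff P.fib_arrow[OF th_fib[OF R y(1) t2]] P.fib_arrow[OF th_fib[OF R y(1) t1]]] by blast
 then show ?thesis by (rule th_inj[OF R y(1) t2 t1, symmetric])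
qed

text \<open>\<open>V\<close> is left free because the same data are used on double overlaps and,
  restricted, on triple overlaps.\<close>

lemma gauge_curving_data:
 assumes V: "stable_open V" "!!R. cring R ==> V R <= U2 i j R"
  and d: "d = act_form (at0 (lam i j)) (B j) \<boxminus>\<^bsub>GX\<^esub> B i \<boxminus>\<^bsub>GX\<^esub> d1_twisted GX (m i) (fneg GX (gm i j))"
 shows "gauge_curving S G X p V (m i) (m j) (lam i j) (gm i j) (B i) (B j) d"
proof unfold_locales
 have Vi: "V R <= U i R" "V R <= U j R" if "cring R" for R using V(2)[OF that] by auto
 show "stable_open V" by (rule V(1))
 show "Aform V 1 (m i)" "Aform V 1 (m j)" by (rule is_form_mono[OF form_m]; use Vi in simp)+
 show "Anat V 0 (at0 (lam i j))" by (rule natural_form_mono[OF natural_lam V(2)])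
 show "Gform V 1 (gm i j)" by (rule is_form_mono[OF form_\<gamma> V(2)])
 show "Gform V 2 (B i)" "Gform V 2 (B j)" by (rule is_form_mono[OF form_B]; use Vi in simp)+
 show "m i R [y, z] **\<^sub>(AG R (p R y)) lam i j R z
  = inn R (p R y) (gm i j R [y, z]) **\<^sub>(AG R (p R y)) (lam i j R y **\<^sub>(AG R (p R y)) m j R [y, z])"
  if "cring R" "[y, z] : spx X p V 1 R" for R y z
  by (rule gauge[OF that(1) spx_mono[OF that(2)]]) (use spxD(2)[OF that(2)] V(2)[OF that(1)] in blast)
qed (rule d)

lemma cocycle_data:
 assumes d: "!!i j. d i j = act_form (at0 (lam i j)) (B j) \<boxminus>\<^bsub>GX\<^esub> B i \<boxminus>\<^bsub>GX\<^esub> d1_twisted GX (m i) (fneg GX (gm i j))"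
 shows "cocycle S G X p (U3 i j k) (m i) (m j) (lam i j) (gm i j) (B i) (B j) (d i j) (lam j k) (lam i k) (g i j k)
  (gm j k) (gm i k) (B k) (d j k) (d i k)"
proof -
 interpret gc: gauge_curving S G X p "U3 i j k" "m i" "m j" "lam i j" "gm i j" "B i" "B j" "d i j"
  by (rule gauge_curving_data[OF stable(3) _ d]) auto
 show ?thesis
 proof unfold_locales
  show "Anat (U3 i j k) 0 (at0 (lam j k))" "Anat (U3 i j k) 0 (at0 (lam i k))"
   by (rule natural_form_mono[OF natural_lam]; auto)+
  show "natural_form G (U3 i j k) 0 (at0 (g i j k))" by (rule natural_g)
  show "Gform (U3 i j k) 1 (gm j k)" "Gform (U3 i j k) 1 (gm i k)" by (rule is_form_mono[OF form_\<gamma>]; auto)+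
  show "Gform (U3 i j k) 2 (B k)" by (rule is_form_mono[OF form_B]) auto
 qed (rule d lam_cocycle cocycle; assumption)+
qed

end

theorem mainTheorem1:
  fixes S :: "('r, 's) pfunctor" and X :: "('r, 'x) pfunctor" and p :: "'r ring \<Rightarrow> 'x \<Rightarrow> 's"
    and G :: "('r, 's, 'g) gfunctor"
    and GX :: "('r, 'x, 'g) gfunctor" and A :: "('r, 'x, ('r, 'g) local_aut) gfunctor"
    and P :: "('r, 'x, 'o, 'a) fcat"
    and \<theta> :: "('r ring \<Rightarrow> 'x set) \<Rightarrow> ('r, 'x, 'o, 'a) csect \<Rightarrow> 'r ring \<Rightarrow> 'x \<Rightarrow> 'g \<Rightarrow> 'a"
    and \<epsilon> \<kappa> :: "('x, 'o, 'a) fmor" and \<eta> :: "'o \<Rightarrow> 'a" and K \<zeta> :: "'x list \<Rightarrow> 'o \<Rightarrow> 'a"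
    and U :: "'i \<Rightarrow> 'r ring \<Rightarrow> 'x set"
    and x :: "'i \<Rightarrow> ('r, 'x, 'o, 'a) csect" and \<phi> :: "'i \<Rightarrow> 'i \<Rightarrow> 'r ring \<Rightarrow> 'x \<Rightarrow> 'a"
    and \<gamma>' \<delta>' :: "'i \<Rightarrow> 'r ring \<Rightarrow> 'x list \<Rightarrow> 'a"
    and lam :: "'i \<Rightarrow> 'i \<Rightarrow> 'r ring \<Rightarrow> 'x \<Rightarrow> ('r, 'g) local_aut"
    and g :: "'i \<Rightarrow> 'i \<Rightarrow> 'i \<Rightarrow> 'r ring \<Rightarrow> 'x \<Rightarrow> 'g"
    and m \<nu> :: "'i \<Rightarrow> ('r, 'x, ('r, 'g) local_aut) fm"
    and \<gamma> \<delta> :: "'i \<Rightarrow> 'i \<Rightarrow> ('r, 'x, 'g) fm" and B \<omega> :: "'i \<Rightarrow> ('r, 'x, 'g) fm"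
  assumes universe: "infinite (UNIV :: 'r set)"
    and S: "scheme S" "invertible_on 2 S" "invertible_on 3 S"
    and X: "scheme X" "smooth_morphism X S p"
    and G: "flat_group_scheme S G"
    and GX: "GX = base_change p G" and A: "A = base_change p (Aut_sheaf S G)"
    and P: "G_gerbe X GX P \<theta>" "connected_gerbe X P"
    and conn: "connection X p P \<epsilon> \<eta>"
    and curv: "curving X p P \<epsilon> \<eta> \<kappa> K \<zeta>"
    and cover: "open_cover X U"
    and x: "\<And>i. is_object P (subfunctor X (U i)) (\<lambda>R x. x) (x i)"
    and \<phi>: "\<And>i j. is_arrow P (subfunctor X (\<lambda>R. U i R \<inter> U j R)) (x j) (x i) (\<phi> i j)"
    and \<gamma>': "\<And>i. is_arrow P (simplices X p (U i) 1)
        (image_obj \<epsilon> (proj_pull 1 (x i))) (proj_pull 0 (x i)) (\<gamma>' i)"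
    and \<gamma>'_diagonal: "\<And>i R y. cring R \<Longrightarrow> y \<in> U i R \<Longrightarrow> \<gamma>' i R [y, y] = \<eta> (sob (x i) R y)"
    and \<delta>': "\<And>i. is_arrow P (simplices X p (U i) 2)
        (image_obj \<kappa> (proj_pull 0 (x i))) (proj_pull 0 (x i)) (\<delta>' i)"
    and \<delta>'_degenerate: "\<And>i R ys. cring R \<Longrightarrow> ys \<in> pts (simplices X p (U i) 2) R \<Longrightarrow>
        degenerate ys \<Longrightarrow> \<delta>' i R ys = \<zeta> ys (sob (x i) R (hd ys))"
    and lam: "\<And>i j. lam i j = lambda_of X GX A P (\<theta> (U i) (x i)) (\<theta> (U j) (x j)) (\<phi> i j)"
    and g: "\<And>i j k. g i j k = cocycle_of GX P (\<theta> (U i) (x i)) (\<phi> i j) (\<phi> j k) (\<phi> i k)"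
    and m: "\<And>i. m i = m_of X GX A P \<epsilon> (\<theta> (U i) (x i)) (\<gamma>' i)"
    and \<gamma>: "\<And>i j. \<gamma> i j = gamma_of GX P \<epsilon> (\<theta> (U i) (x i)) (\<phi> i j) (\<gamma>' i) (\<gamma>' j)"
    and B: "\<And>i. B i = B_of GX P \<epsilon> \<kappa> K (\<theta> (U i) (x i)) (x i) (\<gamma>' i) (\<delta>' i)"
    and \<nu>: "\<And>i. \<nu> i = d1_aut A (m i) \<boxminus>\<^bsub>A\<^esub> inner_form S p G (B i)"
    and \<delta>: "\<And>i j. \<delta> i j = act_form (at0 (lam i j)) (B j) \<boxminus>\<^bsub>GX\<^esub> B i
        \<boxminus>\<^bsub>GX\<^esub> d1_twisted GX (m i) (fneg GX (\<gamma> i j))"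
    and \<omega>: "\<And>i. \<omega> i = d_twisted GX (m i) (B i)"
  shows
    "(\<forall>i j. eq_forms X p A (\<lambda>R. U i R \<inter> U j R) 1
       (conj_form A (at0 (lam i j)) (m j))
       (m i \<boxminus>\<^bsub>A\<^esub> u_duinv A (lam i j) \<boxminus>\<^bsub>A\<^esub> inner_form S p G (\<gamma> i j)))
    \<and> (\<forall>i j k. eq_forms X p GX (\<lambda>R. U i R \<inter> U j R \<inter> U k R) 1
       (\<gamma> i j \<boxplus>\<^bsub>GX\<^esub> act_form (at0 (lam i j)) (\<gamma> j k)
          \<boxminus>\<^bsub>GX\<^esub> act_form (at0 (lam i j) \<boxplus>\<^bsub>A\<^esub> at0 (lam j k) \<boxminus>\<^bsub>A\<^esub> at0 (lam i k)) (\<gamma> i k))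
       (dg_ginv GX (g i j k) \<boxplus>\<^bsub>GX\<^esub> aut_bracket GX 1 (m i) (at0 (g i j k))))
    \<and> (\<forall>i j. eq_forms X p A (\<lambda>R. U i R \<inter> U j R) 2
       (conj_form A (at0 (lam i j)) (\<nu> j))
       (\<nu> i \<boxminus>\<^bsub>A\<^esub> inner_form S p G (\<delta> i j)))
    \<and> (\<forall>i j k. eq_forms X p GX (\<lambda>R. U i R \<inter> U j R \<inter> U k R) 2
       (\<delta> i j \<boxplus>\<^bsub>GX\<^esub> act_form (at0 (lam i j)) (\<delta> j k)
          \<boxminus>\<^bsub>GX\<^esub> act_form (at0 (lam i j) \<boxplus>\<^bsub>A\<^esub> at0 (lam j k) \<boxminus>\<^bsub>A\<^esub> at0 (lam i k)) (\<delta> i k))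
       (aut_bracket GX 2 (\<nu> i) (at0 (g i j k))))
    \<and> (\<forall>i. eq_forms X p GX (U i) 4
       (d_twisted GX (m i) (\<omega> i))
       (aut_bracket GX 2 (\<nu> i) (B i)))
    \<and> (\<forall>i. eq_forms X p A (U i) 3
       (d2_aut A (m i) (\<nu> i) \<boxplus>\<^bsub>A\<^esub> inner_form S p G (\<omega> i))
       (fzero A))
    \<and> (\<forall>i j. eq_forms X p GX (\<lambda>R. U i R \<inter> U j R) 3
       (act_form (at0 (lam i j)) (\<omega> j)
          \<boxplus>\<^bsub>GX\<^esub> aut_bracket GX 2 (conj_form A (at0 (lam i j)) (\<nu> j)) (\<gamma> i j))
       (\<omega> i \<boxplus>\<^bsub>GX\<^esub> d_twisted GX (m i) (\<delta> i j)))"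
proof -
 have mor: "functor_morphism X S p" and gf: "group_functor S G" and tot: "scheme (total S G)"
  using X(2) G by (simp_all add: smooth_morphism_def flat_group_scheme_def)
 have pS: "point_functor S" using S(1) by (simp add: scheme_def)
 have go: "group_over S G" using gf pS by (simp add: group_over_def)
 have fs: "form_space S G X p"
  using go universe S(1) tot X(1) mor
  by (simp add: form_space_def form_space_axioms_def group_scheme_def group_scheme_axioms_def aut_over_def)
 have gs: "gerbe_space S G X p P"
  using fs P(1) by (simp add: gerbe_space_def G_gerbe_def gerbe_def stack_def)
 have gc: "gerbe_curving S G X p P \<epsilon> \<kappa> \<eta> K \<zeta>"
  using gs conn curv by (simp add: gerbe_curving_def)
 have op: "open_sub X (U i)" for i using cover by (simp add: open_cover_def)
 interpret L: local_data S G X p P \<epsilon> \<kappa> \<eta> K \<zeta> U x "%i. \<theta> (U i) (x i)" \<phi> \<gamma>' \<delta>' lam g m \<gamma> B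
 proof (rule local_data.intro[OF gc], unfold_locales)
  show "is_band P (base_change p G) (subfunctor X (U i)) (x i) (\<theta> (U i) (x i))" for i
   using P(1) op x unfolding G_gerbe_def GX by blast
 qed (rule op x \<phi> \<gamma>' \<gamma>'_diagonal \<delta>' \<delta>'_degenerate lam[unfolded GX A] g[unfolded GX] m[unfolded GX A] \<gamma>[unfolded GX] B[unfolded GX];
   assumption)+
 note nu = \<nu>[unfolded A] and dd = \<delta>[unfolded GX]
 have GC: "gauge_curving S G X p (%R. U i R Int U j R) (m i) (m j) (lam i j) (\<gamma> i j) (B i) (B j) (\<delta> i j)" for i j
  by (rule L.gauge_curving_data[OF L.stable(2) _ dd]) simp
 note CO = L.cocycle_data[OF dd]
 show ?thesis
  unfolding GX A
 proof (intro conjI allI)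
  show "eq_forms X p L.AX (%R. U i R Int U j R) 1
    (conj_form L.AX (at0 (lam i j)) (m j))
    (m i \<boxminus>\<^bsub>L.AX\<^esub> u_duinv L.AX (lam i j)
     \<boxminus>\<^bsub>L.AX\<^esub> inner_form S p G (\<gamma> i j))" for i j
   by (rule gauge.connection_eq[OF gauge_curving.axioms(1)[OF GC]])
 qed (unfold \<omega> GX, (rule cocycle.cocycle_eq[OF CO] gauge_curving.curvature_eq[OF GC, folded nu]
   cocycle.cocycle_curvature_eq[OF CO nu] L.curvature_differential_eq[OF S(2) L.stable(1) L.form_m L.form_B nu]
   L.bianchi_eq[OF L.stable(1) L.form_m L.form_B nu] gauge_curving.three_curvature_eq[OF GC nu])+)
qed

end
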